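(* Let $p\in[1,+\infty)$, $T>0$, and let $V:[0,T]\times\mathcal{P}_p(\mathbb{R}^d)\rightrightarrows C^0(\mathbb{R}^d,\mathbb{R}^d)$ be a set-valued map satisfying the following hypotheses. (i) $V$ is Carathéodory, with nonempty closed and convex images. (ii) There exists $m(\cdot)\in L^1([0,T],\mathbb{R}_+)$ such that for $\mathcal{L}^1$-almost every $t\in[0,T]$, any $\mu\in\mathcal{P}_p(\mathbb{R}^d)$ and each $v\in V(t,\mu)$, there holds $|v(x)|\le m(t)\big(1+|x|+\mathcal{M}_p(\mu)\big)$ for all $x\in\mathbb{R}^d$. (iii) For all compact sets $\mathcal{K}\subset\mathcal{P}_p(\mathbb{R}^d)$ and $K\subset\mathbb{R}^d$, there exist a map $l(\cdot)\in L^1([0,T],\mathbb{R}_+)$ and a continuous modulus of continuity $\omega:\mathbb{R}_+\to\mathbb{R}_+$ such that for $\mathcal{L}^1$-almost every $t\in[0,T]$, any $\mu\in\mathcal{K}$ and each $v\in V(t,\mu)$, there holds $|v(x)-v(y)|\le l(t)\,\omega(|x-y|)$ for all $x,y\in K$. (iv) For every compact set $\mathcal{K}\subset\mathcal{P}_p(\mathbb{R}^d)$, there exist a map $L(\cdot)\in L^1([0,T],\mathbb{R}_+)$ and a continuous modulus of continuity $\omega:\mathbb{R}_+\to\mathbb{R}_+$ such that for $\mathcal{L}^1$-almost every $t\in[0,T]$, any $\mu,\nu\in\mathcal{K}$ and each $v\in V(t,\mu)$, there exists $w\in V(t,\nu)$ such that $\mathsf{d}_{\mathrm{cc}}(v,w)\le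 L(t)\,\omega(W_p(\mu,\nu))$. Then for every $\mu^0\in\mathcal{P}_p(\mathbb{R}^d)$, the Cauchy problem $$\partial_t\mu(t)\in-\mathrm{div}_x\big(V(t,\mu(t))\,\mu(t)\big),\qquad \mu(0)=\mu^0,$$ admits at least one solution $\mu(\cdot)\in\mathrm{AC}([0,T],\mathcal{P}_p(\mathbb{R}^d))$.
   Context: $\mathcal{P}_p(\mathbb{R}^d)$ is the set of Borel probability measures on $\mathbb{R}^d$ with finite $p$-th moment, endowed with the Wasserstein distance $W_p$; $\mathcal{M}_p(\mu):=\big(\int_{\mathbb{R}^d}|x|^p\,d\mu(x)\big)^{1/p}$. $\mathrm{AC}([0,T],\mathcal{P}_p(\mathbb{R}^d))$ is the set of curves that are absolutely continuous with respect to $W_p$. $\mathcal{L}^1$ is the one-dimensional Lebesgue measure. A continuous modulus of continuity is a continuous function $\omega:\mathbb{R}_+\to\mathbb{R}_+$ with $\omega(0)=0$. $C^0(\mathbb{R}^d,\mathbb{R}^d)$ is endowed with the topology of uniform convergence on compact sets, metrised by the complete separable translation-invariant metric $\mathsf{d}_{\mathrm{cc}}(v,w):=\sum_{k=1}^{+\infty}2^{-k}\min\{1,\sup_{x\in B(0,k)}|v(x)-w(x)|\}$, where $B(0,k)$ is the closed ball; closedness of images and measurability refer to this topology. A multifunction $F:[0,T]\rightrightarrows Y$ into a complete separable metric space is $\mathcal{L}^1$-measurable if $\{t: F(t)\cap O\neq\emptyset\}$ is Lebesgue measurable for every open $O\subset Y$. A multifunction $F:X\rightrightarrows Y$ between metric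 spaces is continuous at $x$ if (a) for every $\varepsilon>0$ there is $\delta>0$ such that $F(x')\subset\{y: d_Y(y,y')\le\varepsilon \text{ for some } y'\in F(x)\}$ whenever $d_X(x,x')\le\delta$, and (b) for every $\varepsilon>0$ and $y\in F(x)$ there is $\delta>0$ such that $F(x')\cap\{z:d_Y(z,y)\le\varepsilon\}\neq\emptyset$ whenever $d_X(x,x')\le\delta$. A set-valued map $G:[0,T]\times X\rightrightarrows Y$ is Carathéodory if $t\mapsto G(t,x)$ is $\mathcal{L}^1$-measurable for all $x\in X$ and $x\mapsto G(t,x)$ is continuous for $\mathcal{L}^1$-almost every $t$. A curve $\mu(\cdot)\in\mathrm{AC}([0,T],\mathcal{P}_p(\mathbb{R}^d))$ solves the continuity inclusion $\partial_t\mu(t)\in-\mathrm{div}_x(V(t,\mu(t))\mu(t))$ if there exists an $\mathcal{L}^1$-measurable map $t\in[0,T]\mapsto v(t)\in C^0(\mathbb{R}^d,\mathbb{R}^d)$ with $v(t)\in V(t,\mu(t))$ for $\mathcal{L}^1$-almost every $t$, such that $\partial_t\mu(t)+\mathrm{div}_x(v(t)\mu(t))=0$ in the sense of distributions, i.e. $\int_0^T\int_{\mathbb{R}^d}\big(\partial_t\phi(t,x)+\langle\nabla_x\phi(t,x),v(t,x)\rangle\big)\,d\mu(t)(x)\,dt=0$ for every $\phi\in C^\infty_c((0,T)\times\mathbb{R}^d,\mathbb{R})$. *)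

theory Defs
  imports "HOL-Probability.Probability"
begin

section \<open>Wasserstein spaces\<close>

definition Pp :: "real \<Rightarrow> 'a::euclidean_space measure set" where
  "Pp p = {\<mu>. sets \<mu> = sets borel \<and> prob_space \<mu> \<and> integrable \<mu> (\<lambda>x. norm x powr p)}"

definition moment :: "real \<Rightarrow> 'a::euclidean_space measure \<Rightarrow> real" where
  "moment p \<mu> = (\<integral>x. norm x powr p \<partial>\<mu>) powr (1 / p)"

definition couplings ::
    "'a::euclidean_space measure \<Rightarrow> 'a measure \<Rightarrow> ('a \<times> 'a) measure set" where
  "couplings \<mu> \<nu> =
    {\<gamma>. sets \<gamma> = sets borel \<and> distr \<gamma> borel fst = \<mu> \<and> distr \<gamma> borel snd = \<nu>}"

text \<open>On \<^term>\<open>Pp p\<close> the infimum is finite, so \<^const>\<open>enn2real\<close> loses nothing there.\<close>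

definition Wp :: "real \<Rightarrow> 'a::euclidean_space measure \<Rightarrow> 'a measure \<Rightarrow> real" where
  "Wp p \<mu> \<nu> =
    enn2real (INF \<gamma>\<in>couplings \<mu> \<nu>. \<integral>\<^sup>+ z. ennreal (norm (fst z - snd z) powr p) \<partial>\<gamma>) powr (1 / p)"

abbreviation Pp_topology :: "real \<Rightarrow> 'a::euclidean_space measure topology" where
  "Pp_topology p \<equiv> Metric_space.mtopology (Pp p) (Wp p)"


section \<open>Continuous vector fields with locally uniform convergence\<close>

definition C0 :: "('a::euclidean_space \<Rightarrow> 'a) set" where
  "C0 = {v. continuous_on UNIV v}"

text \<open>
  The supremum is taken in the extended nonnegative reals because \<^locale>\<open>Metric_space\<close> asks for
  nonnegativity on all functions, including those that are unbounded on a ball.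
\<close>

definition dcc :: "('a::euclidean_space \<Rightarrow> 'a) \<Rightarrow> ('a \<Rightarrow> 'a) \<Rightarrow> real" where
  "dcc v w = (\<Sum>k. (1/2) ^ Suc k *
     enn2real (min 1 (SUP x\<in>cball 0 (real (Suc k)). ennreal (norm (v x - w x)))))"

abbreviation C0_topology :: "('a::euclidean_space \<Rightarrow> 'a) topology" where
  "C0_topology \<equiv> Metric_space.mtopology C0 dcc"

lemma Metric_space_C0_dcc: "Metric_space (C0 :: ('a::euclidean_space \<Rightarrow> 'a) set) dcc"
proof -
  define s :: "nat \<Rightarrow> ('a \<Rightarrow> 'a) \<Rightarrow> ('a \<Rightarrow> 'a) \<Rightarrow> ennreal" where
    "s k v w = (SUP x\<in>cball 0 (real (Suc k)). ennreal (norm (v x - w x)))" for k v w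
  define g where "g k v w = (1/2) ^ Suc k * enn2real (min 1 (s k v w))" for k v w
  have dcc: "dcc v w = (\<Sum>k. g k v w)" for v w :: "'a \<Rightarrow> 'a"
    by (simp add: dcc_def g_def s_def)
  have fin: "min 1 (s k v w) < \<top>" for k v w
    by (simp add: min_less_iff_disj)
  have le1: "enn2real (min 1 (s k v w)) \<le> 1" for k v w
    by (rule enn2real_leI) auto
  have g0: "0 \<le> g k v w" for k v w by (simp add: g_def)
  have gle: "g k v w \<le> (1/2) ^ Suc k" for k v w
    unfolding g_def using mult_left_mono[OF le1, of "(1/2) ^ Suc k" k v w] by simp
  have summ: "summable (\<lambda>k. g k v w)" for v w
  proof (rule summable_comparison_test'[where N = 0])
    show "summable (\<lambda>k. (1/2::real) ^ Suc k)"
      by (intro summable_Suc_iff[THEN iffD2] summable_geometric) simp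
  qed (use g0 gle in auto)
  have sym: "s k v w = s k w v" for k v w
    by (simp add: s_def norm_minus_commute)
  have tri: "s k v w \<le> s k v u + s k u w" for k v w u
    unfolding s_def
  proof (rule SUP_least)
    fix x :: 'a assume x: "x \<in> cball 0 (real (Suc k))"
    have "norm (v x - w x) \<le> norm (v x - u x) + norm (u x - w x)"
      using norm_triangle_ineq[of "v x - u x" "u x - w x"] by simp
    then have "ennreal (norm (v x - w x)) \<le> ennreal (norm (v x - u x)) + ennreal (norm (u x - w x))"
      by (simp flip: ennreal_plus)
    also have "\<dots> \<le> (SUP x\<in>cball 0 (real (Suc k)). ennreal (norm (v x - u x)))
        + (SUP x\<in>cball 0 (real (Suc k)). ennreal (norm (u x - w x)))"
      using x by (intro add_mono SUP_upper)
    finally show "ennreal (norm (v x - w x)) \<le> \<dots>" .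
  qed
  have gtri: "g k v w \<le> g k v u + g k u w" for k v w u
  proof -
    have "min 1 (s k v w) \<le> min 1 (s k v u) + min 1 (s k u w)"
    proof (cases "s k v u \<le> 1 \<and> s k u w \<le> 1")
      case True
      then show ?thesis using tri[of k v w u] by (simp add: min_absorb2 min.coboundedI2)
    next
      case False
      then have "1 \<le> min 1 (s k v u) + min 1 (s k u w)"
        by (auto simp: min_def intro: add_increasing add_increasing2)
      then show ?thesis by (meson min.cobounded1 order_trans)
    qed
    then have "enn2real (min 1 (s k v w)) \<le> enn2real (min 1 (s k v u) + min 1 (s k u w))"
      using fin by (intro enn2real_mono) auto
    also have "\<dots> = enn2real (min 1 (s k v u)) + enn2real (min 1 (s k u w))"
      using fin by (simp add: enn2real_plus)
    finally show ?thesis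
      unfolding g_def by (simp flip: distrib_left)
  qed
  have eq0: "v = w" if "dcc v w = 0" for v w :: "'a \<Rightarrow> 'a"
  proof
    fix x :: 'a
    obtain k where k: "norm x \<le> real (Suc k)"
      by (metis less_imp_le of_nat_Suc reals_Archimedean2 add_increasing zero_le_one)
    have "g k v w = 0"
      using that suminf_eq_zero_iff[OF summ, of v w] g0 by (auto simp: dcc)
    then have "min 1 (s k v w) = 0"
      using fin[of k v w] by (auto simp: g_def enn2real_eq_0_iff)
    then have "s k v w = 0" by (auto simp: min_def split: if_splits)
    moreover have "ennreal (norm (v x - w x)) \<le> s k v w"
      unfolding s_def using k by (intro SUP_upper) auto
    ultimately show "v x = w x" by simp
  qed
  show ?thesis
  proof
    show "0 \<le> dcc v w" for v w :: "'a \<Rightarrow> 'a"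
      unfolding dcc using summ g0 by (rule suminf_nonneg)
    show "dcc v w = dcc w v" for v w :: "'a \<Rightarrow> 'a"
      by (simp add: dcc g_def sym)
    show "dcc v w = 0 \<longleftrightarrow> v = w" for v w :: "'a \<Rightarrow> 'a"
      using eq0 by (auto simp: dcc_def)
    show "dcc v w \<le> dcc v u + dcc u w" for v w u :: "'a \<Rightarrow> 'a"
      unfolding dcc suminf_add[OF summ summ]
      by (intro suminf_le gtri summ summable_add)
  qed
qed

text \<open>Convexity for the pointwise vector space structure on functions.\<close>

definition convex_fields :: "('a::euclidean_space \<Rightarrow> 'a) set \<Rightarrow> bool" where
  "convex_fields A \<longleftrightarrow> (\<forall>v\<in>A. \<forall>w\<in>A. \<forall>a\<ge>0. \<forall>b\<ge>0. a + b = 1 \<longrightarrow>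
     (\<lambda>x. a *\<^sub>R v x + b *\<^sub>R w x) \<in> A)"


section \<open>Multifunctions\<close>

text \<open>Metric spaces are given by a carrier and a distance function.\<close>

definition mf_measurable ::
    "real \<Rightarrow> 'y set \<Rightarrow> ('y \<Rightarrow> 'y \<Rightarrow> real) \<Rightarrow> (real \<Rightarrow> 'y set) \<Rightarrow> bool" where
  "mf_measurable T Y dY F \<longleftrightarrow>
    (\<forall>U. openin (Metric_space.mtopology Y dY) U \<longrightarrow> {t\<in>{0..T}. F t \<inter> U \<noteq> {}} \<in> sets lebesgue)"

definition mf_continuous_at ::
    "'x set \<Rightarrow> ('x \<Rightarrow> 'x \<Rightarrow> real) \<Rightarrow> ('y \<Rightarrow> 'y \<Rightarrow> real) \<Rightarrow> ('x \<Rightarrow> 'y set) \<Rightarrow> 'x \<Rightarrow> bool" where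
  "mf_continuous_at X dX dY F x \<longleftrightarrow>
    (\<forall>\<epsilon>>0. \<exists>\<delta>>0. \<forall>x'\<in>X. dX x x' \<le> \<delta> \<longrightarrow> (\<forall>y\<in>F x'. \<exists>y'\<in>F x. dY y y' \<le> \<epsilon>)) \<and>
    (\<forall>\<epsilon>>0. \<forall>y\<in>F x. \<exists>\<delta>>0. \<forall>x'\<in>X. dX x x' \<le> \<delta> \<longrightarrow> (\<exists>z\<in>F x'. dY z y \<le> \<epsilon>))"

definition Caratheodory ::
    "real \<Rightarrow> 'x set \<Rightarrow> ('x \<Rightarrow> 'x \<Rightarrow> real) \<Rightarrow> 'y set \<Rightarrow> ('y \<Rightarrow> 'y \<Rightarrow> real) \<Rightarrow>
     (real \<Rightarrow> 'x \<Rightarrow> 'y set) \<Rightarrow> bool" where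
  "Caratheodory T X dX Y dY G \<longleftrightarrow>
    (\<forall>x\<in>X. mf_measurable T Y dY (\<lambda>t. G t x)) \<and>
    (AE t in lebesgue_on {0..T}. \<forall>x\<in>X. mf_continuous_at X dX dY (G t) x)"


section \<open>Integrable functions, moduli of continuity, absolutely continuous curves\<close>

definition L1_nonneg :: "real \<Rightarrow> (real \<Rightarrow> real) \<Rightarrow> bool" where
  "L1_nonneg T m \<longleftrightarrow> integrable (lebesgue_on {0..T}) m \<and> (\<forall>t\<in>{0..T}. 0 \<le> m t)"

definition modulus :: "(real \<Rightarrow> real) \<Rightarrow> bool" where
  "modulus \<omega> \<longleftrightarrow> continuous_on {0..} \<omega> \<and> (\<forall>r\<ge>0. 0 \<le> \<omega> r) \<and> \<omega> 0 = 0"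

definition AC_curves :: "real \<Rightarrow> real \<Rightarrow> (real \<Rightarrow> 'a::euclidean_space measure) set" where
  "AC_curves T p = {\<mu>. (\<forall>t\<in>{0..T}. \<mu> t \<in> Pp p) \<and>
     (\<exists>m. L1_nonneg T m \<and>
       (\<forall>s t. 0 \<le> s \<and> s \<le> t \<and> t \<le> T \<longrightarrow> Wp p (\<mu> s) (\<mu> t) \<le> (\<integral>r. m r \<partial>lebesgue_on {s..t})))}"


section \<open>The continuity inclusion\<close>

text \<open>
  On a finite-dimensional domain the recursion gives the usual classes: \<open>f\<close> is of class
  \<open>C\<close>-\<open>(k+1)\<close> iff it is differentiable and all its directional derivatives are of class \<open>C\<close>-\<open>k\<close>.
\<close>

primrec Ck :: "nat \<Rightarrow> ('a::euclidean_space \<Rightarrow> real) \<Rightarrow> bool" where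
  "Ck 0 f \<longleftrightarrow> continuous_on UNIV f"
| "Ck (Suc k) f \<longleftrightarrow> (\<forall>x. f differentiable (at x)) \<and>
     (\<forall>h. Ck k (\<lambda>x. frechet_derivative f (at x) h))"

text \<open>
  Elements of \<open>C\<^sub>c\<^sup>\<infinity>((0,T) \<times> \<real>\<^sup>d)\<close> are identified with their extension by zero to all times.
\<close>

definition test_functions :: "real \<Rightarrow> (real \<times> 'a::euclidean_space \<Rightarrow> real) set" where
  "test_functions T = {\<phi>. (\<forall>k. Ck k \<phi>) \<and> compact (closure {z. \<phi> z \<noteq> 0}) \<and>
     closure {z. \<phi> z \<noteq> 0} \<subseteq> {0<..<T} \<times> UNIV}"

definition gradient :: "('a::euclidean_space \<Rightarrow> real) \<Rightarrow> 'a \<Rightarrow> 'a" where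
  "gradient f x = (THE g. GDERIV f x :> g)"

text \<open>
  \<^const>\<open>has_bochner_integral\<close> requires the time integrand to be integrable, so that the identity does
  not hold by the convention that non-integrable functions have integral zero. The space integrand
  is continuous with compact support whenever \<open>v t\<close> is continuous.
\<close>

definition solves_continuity_eq ::
    "real \<Rightarrow> (real \<Rightarrow> 'a::euclidean_space \<Rightarrow> 'a) \<Rightarrow> (real \<Rightarrow> 'a measure) \<Rightarrow> bool" where
  "solves_continuity_eq T v \<mu> \<longleftrightarrow>
    (\<forall>\<phi>\<in>test_functions T. has_bochner_integral (lebesgue_on {0..T})
      (\<lambda>t. \<integral>x. deriv (\<lambda>s. \<phi> (s, x)) t + gradient (\<lambda>y. \<phi> (t, y)) x \<bullet> v t x \<partial>\<mu> t) 0)"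

definition solves_continuity_inclusion ::
    "real \<Rightarrow> (real \<Rightarrow> 'a::euclidean_space measure \<Rightarrow> ('a \<Rightarrow> 'a) set) \<Rightarrow>
     (real \<Rightarrow> 'a measure) \<Rightarrow> bool" where
  "solves_continuity_inclusion T V \<mu> \<longleftrightarrow>
    (\<exists>v. v \<in> measurable (lebesgue_on {0..T}) (sigma C0 {U. openin C0_topology U}) \<and>
      (AE t in lebesgue_on {0..T}. v t \<in> V t (\<mu> t)) \<and>
      solves_continuity_eq T v \<mu>)"

end

theory Submission
  imports Defs
begin

text \<open>
  Solutions are limits of explicit Euler schemes in Lagrangian form. On the \<open>k\<close>-th cell of a uniform
  grid, the velocity \<open>v\<^sub>n(s)\<close> is a measurable selection of \<open>V(s, law\<^sub>k)\<close>, where \<open>law\<^sub>k\<close> is the image of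
  \<open>\<mu>\<^sup>0\<close> under the current position map \<open>X\<^sub>k\<close>, and \<open>X\<^sub>k\<^sub>+\<^sub>1 = X\<^sub>k + \<integral>v\<^sub>n(s, X\<^sub>k) ds\<close> over the cell. The sublinear
  growth of \<open>V\<close> bounds \<open>X\<^sub>k\<close> and its increments by fixed multiples of \<open>1 + |x|\<close>. The positions at all
  grid times thus form a tight family of random sequences, and by Skorokhod representation a
  subsequence has copies that converge almost surely on one probability space. The limits define
  the curve \<open>\<mu>\<close> together with couplings that control \<open>W\<^sub>p\<close>, both between the times of \<open>\<mu>\<close> and between
  the schemes and \<open>\<mu>\<close>.

  For the velocities, suitable convex combinations of tails of \<open>v\<^sub>n(s)(y)\<close>
  converge for almost every \<open>s\<close> and all \<open>y\<close> in a countable dense set. Since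
  \<open>v\<^sub>n(s)\<close> is close to the closed convex set \<open>V(s, \<mu>(s))\<close>, whose elements are equicontinuous on compact
  sets, the convergence is locally uniform and the limit \<open>v(s)\<close> belongs to \<open>V(s, \<mu>(s))\<close>. The same
  combinations pass to the limit in the weak formulation, because in it the velocities are tested against
  quantities that converge strongly along the scheme.
\<close>

section \<open>The Wasserstein distance\<close>

text \<open>The selected velocities are only measurable in time, so they converge at best weakly,
  while they are evaluated at moving positions. Convexity of the images of V permits convex
  combinations, but combining velocities of different schemes makes sense only when all are tested
  against one curve. The positions are therefore made to converge strongly before the velocities are
  combined. The Lagrangian form serves this: every position map is dominated by a multiple of 1 +
  |x| under the fixed measure \<mu>0, which gives tightness and also the uniform integrability of
  p-th moments behind convergence in W_p. Since \<open>m\<close> is only integrable, no Lipschitz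
  bound in time can be expected, and displacements are measured in the clock \<open>Mi\<close>, the
  primitive of \<open>m\<close>. For the same reason the velocities are normalised pointwise in time
  before a Hilbert space argument is applied to them. The triangle inequality for W_p rests on an
  approximate gluing of couplings, with a countable partition in place of a disintegration.\<close>

lemma measure_eqI_lipschitz:
  fixes M N :: "'a::metric_space measure"
  assumes "finite_measure M" "finite_measure N"
    and sets: "sets M = sets borel" "sets N = sets borel"
    and eq: "\<And>f::'a \<Rightarrow> real. (\<exists>L. L-lipschitz_on UNIV f) \<Longrightarrow> (\<And>x. 0 \<le> f x \<and> f x \<le> 1) \<Longrightarrow>
      (\<integral>x. f x \<partial>M) = (\<integral>x. f x \<partial>N)"
  shows "M = N"
proof (rule measure_eqI_generator_eq[where E = "Collect closed" and \<Omega> = UNIV and A = "\<lambda>_. UNIV"])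
  interpret M: finite_measure M by fact
  interpret N: finite_measure N by fact
  have [measurable_cong]: "sets M = sets borel" "sets N = sets borel" by (fact sets)+
  have space: "space M = UNIV" "space N = UNIV"
    using sets_eq_imp_space_eq[OF sets(1)] sets_eq_imp_space_eq[OF sets(2)] by auto
  show "Int_stable (Collect closed)" by (auto simp: Int_stable_def)
  show "sets M = sigma_sets UNIV (Collect closed)" "sets N = sigma_sets UNIV (Collect closed)"
    by (simp_all add: sets borel_eq_closed)
  show "emeasure M X = emeasure N X" if "X \<in> Collect closed" for X
  proof (cases "X = {}")
    case False
    from that have X: "closed X" by simp
    \<comment> \<open>Lipschitz cutoffs that tend to the indicator of the closed set
      \<open>X\<close>; closed sets form an intersection-stable generator.\<close>
    define f :: "nat \<Rightarrow> 'a \<Rightarrow> real" where "f n x = max 0 (1 - real n * infdist x X)" for n x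
    have f01: "0 \<le> f n x \<and> f n x \<le> 1" for n x
      by (simp add: f_def infdist_nonneg)
    have "(real n)-lipschitz_on UNIV (f n)" for n
    proof (rule lipschitz_onI)
      fix x y
      have "\<bar>f n x - f n y\<bar> \<le> \<bar>real n * infdist x X - real n * infdist y X\<bar>"
        by (auto simp: f_def max_def)
      also have "\<dots> = real n * \<bar>infdist x X - infdist y X\<bar>"
        by (metis abs_mult abs_of_nat right_diff_distrib)
      also have "\<dots> \<le> real n * dist x y"
        by (intro mult_left_mono infdist_triangle_abs) auto
      finally show "dist (f n x) (f n y) \<le> real n * dist x y"
        by (simp add: dist_real_def)
    qed auto
    then have int_eq: "(\<integral>x. f n x \<partial>M) = (\<integral>x. f n x \<partial>N)" for n
      using f01 by (intro eq) blast+
    have [measurable]: "f n \<in> borel_measurable borel" for n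
      unfolding f_def by (intro borel_measurable_continuous_onI continuous_intros)
    have lim: "(\<lambda>n. f n x) \<longlonglongrightarrow> indicator X x" for x
    proof (cases "x \<in> X")
      case True
      then show ?thesis by (simp add: f_def)
    next
      case False
      then have pos: "0 < infdist x X"
        using X \<open>X \<noteq> {}\<close> by (intro infdist_pos_not_in_closed)
      obtain n0 where n0: "1 < real n0 * infdist x X"
        using reals_Archimedean3[OF pos] by blast
      have "\<forall>\<^sub>F n in sequentially. f n x = 0"
        using eventually_ge_at_top[of n0]
      proof eventually_elim
        case (elim n)
        then have "real n0 * infdist x X \<le> real n * infdist x X"
          using pos by (intro mult_right_mono) auto
        with n0 show ?case by (simp add: f_def)
      qed
      then show ?thesis using False by (simp add: tendsto_eventually)
    qed
    have Xm[measurable]: "X \<in> sets borel" using X by simp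
    have "(\<lambda>n. \<integral>x. f n x \<partial>M) \<longlonglongrightarrow> (\<integral>x. indicator X x \<partial>M)"
      by (rule integral_dominated_convergence[where w = "\<lambda>_. 1"]) (use lim f01 in auto)
    moreover have "(\<lambda>n. \<integral>x. f n x \<partial>N) \<longlonglongrightarrow> (\<integral>x. indicator X x \<partial>N)"
      by (rule integral_dominated_convergence[where w = "\<lambda>_. 1"]) (use lim f01 in auto)
    ultimately have "measure M X = measure N X"
      using LIMSEQ_unique by (fastforce simp: int_eq space)
    then show ?thesis by (simp add: M.emeasure_eq_measure N.emeasure_eq_measure)
  qed simp
qed (use \<open>finite_measure M\<close> in \<open>auto simp: finite_measure.emeasure_finite\<close>)

lemma norm_integral_le:
  fixes f :: "'a \<Rightarrow> 'b::{banach,second_countable_topology}"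
  assumes "integrable M f" "integrable M g" "AE x in M. norm (f x) \<le> g x"
  shows "norm (\<integral>x. f x \<partial>M) \<le> (\<integral>x. g x \<partial>M)"
proof -
  have "norm (\<integral>x. f x \<partial>M) \<le> (\<integral>x. norm (f x) \<partial>M)" by (rule integral_norm_bound)
  also have "\<dots> \<le> (\<integral>x. g x \<partial>M)" using assms by (intro integral_mono_AE) auto
  finally show ?thesis .
qed

section \<open>Minkowski's inequality for p-th powers\<close>

text \<open>On the open half-line this is convexity of \<open>powr\<close>; if \<open>x\<close> or
  \<open>y\<close> is 0, it reduces to c^p <= c for c in [0,1].\<close>

lemma powr_convex_nonneg:
  fixes a b x y p :: real
  assumes "1 \<le> p" "0 \<le> a" "0 \<le> b" "a + b = 1" "0 \<le> x" "0 \<le> y"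
  shows "(a * x + b * y) powr p \<le> a * x powr p + b * y powr p"
proof -
  have scale: "c powr p \<le> c" if "0 \<le> c" "c \<le> 1" for c :: real
    using that assms(1) powr_mono'[of 1 p c] by (cases "c = 0") auto
  show ?thesis
  proof (cases "x = 0 \<or> y = 0")
    case True
    then show ?thesis
      using assms scale[of a] scale[of b]
      by (auto simp: powr_mult mult_right_mono)
  next
    case False
    then have "convex_on {0<..} (\<lambda>x. x powr p)" "x \<in> {0<..}" "y \<in> {0<..}"
      using assms powr_convex by auto
    from convex_onD[OF this(1), of b x y] this(2,3) show ?thesis
      using assms by (simp add: eq_diff_eq[symmetric])
  qed
qed

text \<open>Convexity suffices: f + g is a + b times the combination of f/a and g/b with weights
  a/(a+b) and b/(a+b). Upper bounds \<open>a\<close>, \<open>b\<close> take the place of norms, and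
  their positivity makes these quotients meaningful.\<close>

lemma nn_integral_powr_Minkowski:
  fixes f g :: "'a \<Rightarrow> real"
  assumes p: "1 \<le> p" and a: "0 < a" and b: "0 < b"
    and [measurable]: "f \<in> borel_measurable M" "g \<in> borel_measurable M"
    and nonneg: "\<And>x. 0 \<le> f x" "\<And>x. 0 \<le> g x"
    and fa: "(\<integral>\<^sup>+x. ennreal (f x powr p) \<partial>M) \<le> ennreal (a powr p)"
    and gb: "(\<integral>\<^sup>+x. ennreal (g x powr p) \<partial>M) \<le> ennreal (b powr p)"
  shows "(\<integral>\<^sup>+x. ennreal ((f x + g x) powr p) \<partial>M) \<le> ennreal ((a + b) powr p)"
proof -
  define c d where "c = (a + b) powr p * (a / (a + b)) / a powr p"
    and "d = (a + b) powr p * (b / (a + b)) / b powr p"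
  have cd: "0 \<le> c" "0 \<le> d" using a b by (auto simp: c_def d_def)
  have pw: "(f x + g x) powr p \<le> c * f x powr p + d * g x powr p" for x
  proof -
    have "f x + g x = (a + b) * (a / (a + b) * (f x / a) + b / (a + b) * (g x / b))"
      using a b by (simp add: add_divide_distrib[symmetric])
    then have "(f x + g x) powr p
        = (a + b) powr p * (a / (a + b) * (f x / a) + b / (a + b) * (g x / b)) powr p"
      using a b nonneg[of x] by (metis powr_mult)
    also have "\<dots> \<le> (a + b) powr p * (a / (a + b) * (f x / a) powr p + b / (a + b) * (g x / b) powr p)"
      using a b nonneg[of x] p
      by (intro mult_left_mono powr_convex_nonneg) (auto simp: add_divide_distrib[symmetric])
    also have "\<dots> = c * f x powr p + d * g x powr p"
      using a b nonneg[of x] by (simp add: c_def d_def powr_divide algebra_simps)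
    finally show ?thesis .
  qed
  have "(\<integral>\<^sup>+x. ennreal ((f x + g x) powr p) \<partial>M)
      \<le> (\<integral>\<^sup>+x. ennreal c * ennreal (f x powr p) + ennreal d * ennreal (g x powr p) \<partial>M)"
    using pw cd by (intro nn_integral_mono) (simp flip: ennreal_mult ennreal_plus add: ennreal_leI)
  also have "\<dots> = ennreal c * (\<integral>\<^sup>+x. ennreal (f x powr p) \<partial>M) + ennreal d * (\<integral>\<^sup>+x. ennreal (g x powr p) \<partial>M)"
    by (simp add: nn_integral_add nn_integral_cmult)
  also have "\<dots> \<le> ennreal c * ennreal (a powr p) + ennreal d * ennreal (b powr p)"
    by (intro add_mono mult_left_mono fa gb) auto
  also have "\<dots> = ennreal (c * a powr p + d * b powr p)"
    using cd by (simp add: ennreal_mult)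
  also have "c * a powr p + d * b powr p = (a + b) powr p"
  proof -
    have "c * a powr p = (a + b) powr p * (a / (a + b))" "d * b powr p = (a + b) powr p * (b / (a + b))"
      using a b by (simp_all add: c_def d_def)
    then have "c * a powr p + d * b powr p = (a + b) powr p * ((a + b) / (a + b))"
      by (metis add_divide_distrib distrib_left)
    then show ?thesis using a b by simp
  qed
  finally show ?thesis .
qed

section \<open>Couplings and transport cost\<close>

lemma PpD:
  assumes "\<mu> \<in> Pp p"
  shows "sets \<mu> = sets borel" "prob_space \<mu>" "integrable \<mu> (\<lambda>x. norm x powr p)" "space \<mu> = UNIV"
  using assms sets_eq_imp_space_eq[of \<mu> borel] by (auto simp: Pp_def)

lemma Wp_nonneg: "0 \<le> Wp p \<mu> \<nu>"
  by (simp add: Wp_def)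

lemma Wp_le:
  assumes "0 < p" "0 \<le> r" "\<gamma> \<in> couplings \<mu> \<nu>"
    and "(\<integral>\<^sup>+ z. ennreal (norm (fst z - snd z) powr p) \<partial>\<gamma>) \<le> ennreal (r powr p)"
  shows "Wp p \<mu> \<nu> \<le> r"
proof -
  have "(INF \<gamma>\<in>couplings \<mu> \<nu>. \<integral>\<^sup>+ z. ennreal (norm (fst z - snd z) powr p) \<partial>\<gamma>) \<le> ennreal (r powr p)"
    using assms(3,4) by (meson INF_lower2)
  then have "Wp p \<mu> \<nu> \<le> (r powr p) powr (1 / p)"
    unfolding Wp_def using assms(1) by (intro powr_mono2 enn2real_leI) auto
  also have "\<dots> = r" using assms by (simp add: powr_powr)
  finally show ?thesis .
qed

lemma borel_measurable_cost [measurable]: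
  "(\<lambda>z::'a::euclidean_space \<times> 'a. norm (fst z - snd z) powr p) \<in> borel_measurable borel"
  unfolding borel_prod[symmetric] by measurable

text \<open>Two maps on one probability space couple their image measures. The estimates of
  \<open>Wp\<close> along the scheme and its limit start from such a pair.\<close>

lemma Wp_distr_le:
  fixes f g :: "'b \<Rightarrow> 'a::euclidean_space"
  assumes "prob_space M" "1 \<le> p" and [measurable]: "f \<in> borel_measurable M" "g \<in> borel_measurable M"
    and "0 \<le> r"
    and "(\<integral>\<^sup>+ \<omega>. ennreal (norm (f \<omega> - g \<omega>) powr p) \<partial>M) \<le> ennreal (r powr p)"
  shows "Wp p (distr M borel f) (distr M borel g) \<le> r"
proof (rule Wp_le)
  show "distr M borel (\<lambda>\<omega>. (f \<omega>, g \<omega>)) \<in> couplings (distr M borel f) (distr M borel g)"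
    unfolding couplings_def borel_prod[symmetric]
    by (simp add: distr_distr o_def)
  show "(\<integral>\<^sup>+ z. ennreal (norm (fst z - snd z) powr p) \<partial>distr M borel (\<lambda>\<omega>. (f \<omega>, g \<omega>)))
      \<le> ennreal (r powr p)"
    using assms(6) by (subst nn_integral_distr) auto
qed (use assms in auto)

lemma couplings_measurable:
  fixes \<mu> :: "'a::euclidean_space measure"
  assumes "\<gamma> \<in> couplings \<mu> \<nu>"
  shows "fst \<in> measurable \<gamma> borel" "snd \<in> measurable \<gamma> borel" "sets \<gamma> = sets borel" "space \<gamma> = UNIV"
proof -
  show s: "sets \<gamma> = sets borel" using assms by (simp add: couplings_def)
  then show "space \<gamma> = UNIV" using sets_eq_imp_space_eq by fastforce
  have "(fst :: 'a \<times> 'a \<Rightarrow> 'a) \<in> borel_measurable borel" "(snd :: 'a \<times> 'a \<Rightarrow> 'a) \<in> borel_measurable borel"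
    by (intro borel_measurable_continuous_onI continuous_intros)+
  then show "fst \<in> measurable \<gamma> borel" "snd \<in> measurable \<gamma> borel"
    using measurable_cong_sets[OF s refl] by blast+
qed

lemma prob_space_distrD2:
  assumes "prob_space (distr M N f)" "f \<in> measurable M N"
  shows "prob_space M"
  using assms prob_space_distrD by blast

lemma couplings_prob:
  assumes "\<gamma> \<in> couplings \<mu> \<nu>" "prob_space \<mu>"
  shows "prob_space \<gamma>"
proof (rule prob_space_distrD2)
  show "prob_space (distr \<gamma> borel fst)" using assms by (simp add: couplings_def)
qed (rule couplings_measurable[OF assms(1)])

text \<open>\<open>Wp\<close> applies \<open>enn2real\<close>, which sends infinity to 0, so a small
  value of \<open>Wp\<close> says something about couplings only once the infimum is known to be
  finite. The product coupling shows this.\<close>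

lemma Pp_coupling_cost_finite:
  fixes \<mu> \<nu> :: "'a::euclidean_space measure"
  assumes "1 \<le> p" "\<mu> \<in> Pp p" "\<nu> \<in> Pp p"
  shows "\<exists>\<gamma>\<in>couplings \<mu> \<nu>. (\<integral>\<^sup>+ z. ennreal (norm (fst z - snd z) powr p) \<partial>\<gamma>) < \<infinity>"
proof -
  interpret \<mu>: prob_space \<mu> using assms(2) by (rule PpD)
  interpret \<nu>: prob_space \<nu> using assms(3) by (rule PpD)
  interpret P: pair_prob_space \<mu> \<nu> ..
  note [measurable_cong] = PpD(1)[OF assms(2)] PpD(1)[OF assms(3)]
  have sets: "sets (\<mu> \<Otimes>\<^sub>M \<nu>) = sets borel"
    using PpD(1)[OF assms(2)] PpD(1)[OF assms(3)] by (metis borel_prod sets_pair_measure_cong)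
  have fin: "(\<integral>\<^sup>+x. ennreal (norm x powr p) \<partial>\<mu>) < \<infinity>" "(\<integral>\<^sup>+x. ennreal (norm x powr p) \<partial>\<nu>) < \<infinity>"
    using PpD(3)[OF assms(2)] PpD(3)[OF assms(3)] by (auto simp: integrable_iff_bounded)
  \<comment> \<open>The summand 1 keeps \<open>A\<close> and \<open>B\<close> positive, as
    \<open>nn_integral_powr_Minkowski\<close> requires of its bounds.\<close>
  define A where "A = enn2real (\<integral>\<^sup>+x. ennreal (norm x powr p) \<partial>\<mu>) + 1"
  define B where "B = enn2real (\<integral>\<^sup>+x. ennreal (norm x powr p) \<partial>\<nu>) + 1"
  have AB: "1 \<le> A" "1 \<le> B" by (auto simp: A_def B_def)
  have \<mu>A: "(\<integral>\<^sup>+x. ennreal (norm x powr p) \<partial>\<mu>) \<le> ennreal ((A powr (1/p)) powr p)"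
    using fin assms(1) by (auto simp: powr_powr A_def ennreal_enn2real intro!: order_trans[OF _ ennreal_leI[of "enn2real _"]])
  have \<nu>B: "(\<integral>\<^sup>+x. ennreal (norm x powr p) \<partial>\<nu>) \<le> ennreal ((B powr (1/p)) powr p)"
    using fin assms(1) by (auto simp: powr_powr B_def ennreal_enn2real intro!: order_trans[OF _ ennreal_leI[of "enn2real _"]])
  show ?thesis
  proof
    show "\<mu> \<Otimes>\<^sub>M \<nu> \<in> couplings \<mu> \<nu>"
      unfolding couplings_def mem_Collect_eq
    proof (intro conjI sets)
      show "distr (\<mu> \<Otimes>\<^sub>M \<nu>) borel fst = \<mu>"
      proof (rule measure_eqI)
        fix X assume "X \<in> sets (distr (\<mu> \<Otimes>\<^sub>M \<nu>) borel fst)"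
        then have [measurable]: "X \<in> sets borel" by simp
        then have "X \<in> sets \<mu>" by (simp add: PpD(1)[OF assms(2)])
        moreover have "fst -` X \<inter> space (\<mu> \<Otimes>\<^sub>M \<nu>) = X \<times> UNIV"
          by (auto simp: space_pair_measure PpD(4)[OF assms(2)] PpD(4)[OF assms(3)])
        ultimately show "emeasure (distr (\<mu> \<Otimes>\<^sub>M \<nu>) borel fst) X = emeasure \<mu> X"
          using \<nu>.emeasure_space_1
          by (subst emeasure_distr)
             (auto simp: \<nu>.emeasure_pair_measure_Times PpD(4)[OF assms(3)] sets PpD(1)[OF assms(3)])
      qed (simp add: PpD(1)[OF assms(2)])
      show "distr (\<mu> \<Otimes>\<^sub>M \<nu>) borel snd = \<nu>"
      proof (rule measure_eqI)
        fix X assume "X \<in> sets (distr (\<mu> \<Otimes>\<^sub>M \<nu>) borel snd)"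
        then have [measurable]: "X \<in> sets borel" by simp
        then have "X \<in> sets \<nu>" by (simp add: PpD(1)[OF assms(3)])
        moreover have "snd -` X \<inter> space (\<mu> \<Otimes>\<^sub>M \<nu>) = UNIV \<times> X"
          by (auto simp: space_pair_measure PpD(4)[OF assms(2)] PpD(4)[OF assms(3)])
        ultimately show "emeasure (distr (\<mu> \<Otimes>\<^sub>M \<nu>) borel snd) X = emeasure \<nu> X"
          using \<mu>.emeasure_space_1
          by (subst emeasure_distr)
             (auto simp: \<nu>.emeasure_pair_measure_Times PpD(4)[OF assms(2)] sets PpD(1)[OF assms(2)])
      qed (simp add: PpD(1)[OF assms(3)])
    qed
    have "(\<integral>\<^sup>+ z. ennreal (norm (fst z - snd z) powr p) \<partial>(\<mu> \<Otimes>\<^sub>M \<nu>))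
       \<le> (\<integral>\<^sup>+ z. ennreal ((norm (fst z) + norm (snd z)) powr p) \<partial>(\<mu> \<Otimes>\<^sub>M \<nu>))"
      using assms(1) by (intro nn_integral_mono ennreal_leI powr_mono2 norm_triangle_ineq4) auto
    also have "\<dots> \<le> ennreal ((A powr (1/p) + B powr (1/p)) powr p)"
    proof (rule nn_integral_powr_Minkowski)
      have "(\<integral>\<^sup>+ z. ennreal (norm (fst z) powr p) \<partial>(\<mu> \<Otimes>\<^sub>M \<nu>)) = (\<integral>\<^sup>+x. ennreal (norm x powr p) \<partial>\<mu>)"
        by (subst \<nu>.nn_integral_fst[symmetric]) (auto simp: \<nu>.emeasure_space_1)
      with \<mu>A show "(\<integral>\<^sup>+ z. ennreal (norm (fst z) powr p) \<partial>(\<mu> \<Otimes>\<^sub>M \<nu>)) \<le> ennreal ((A powr (1/p)) powr p)"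
        by simp
      have "(\<integral>\<^sup>+ z. ennreal (norm (snd z) powr p) \<partial>(\<mu> \<Otimes>\<^sub>M \<nu>)) = (\<integral>\<^sup>+x. ennreal (norm x powr p) \<partial>\<nu>)"
        by (subst \<nu>.nn_integral_fst[symmetric]) (auto simp: \<mu>.emeasure_space_1)
      with \<nu>B show "(\<integral>\<^sup>+ z. ennreal (norm (snd z) powr p) \<partial>(\<mu> \<Otimes>\<^sub>M \<nu>)) \<le> ennreal ((B powr (1/p)) powr p)"
        by simp
    qed (use assms(1) AB in auto)
    finally show "(\<integral>\<^sup>+ z. ennreal (norm (fst z - snd z) powr p) \<partial>(\<mu> \<Otimes>\<^sub>M \<nu>)) < \<infinity>"
      using le_less_trans[OF _ ennreal_less_top] by (simp add: infinity_ennreal_def)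
  qed
qed

text \<open>The strict inequality avoids any appeal to optimal couplings: a finite infimum below r^p
  is undercut by some coupling.\<close>

lemma Wp_lessE:
  fixes \<mu> \<nu> :: "'a::euclidean_space measure"
  assumes "1 \<le> p" "\<mu> \<in> Pp p" "\<nu> \<in> Pp p" "Wp p \<mu> \<nu> < r"
  obtains \<gamma> where "\<gamma> \<in> couplings \<mu> \<nu>"
    "(\<integral>\<^sup>+ z. ennreal (norm (fst z - snd z) powr p) \<partial>\<gamma>) \<le> ennreal (r powr p)"
proof -
  define I where "I = (INF \<gamma>\<in>couplings \<mu> \<nu>. \<integral>\<^sup>+ z. ennreal (norm (fst z - snd z) powr p) \<partial>\<gamma>)"
  have "I < \<infinity>"
    unfolding I_def using Pp_coupling_cost_finite[OF assms(1-3)] by (auto simp: INF_less_iff)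
  then have I: "I = ennreal (enn2real I)" by (simp add: less_top)
  have r: "0 < r" using Wp_nonneg[of p \<mu> \<nu>] assms(4) by linarith
  have "enn2real I powr (1/p) < r" using assms(4) by (simp add: Wp_def I_def)
  then have "(enn2real I powr (1/p)) powr p < r powr p"
    using assms(1) by (intro powr_less_mono2) auto
  then have "enn2real I < r powr p" using assms(1) by (simp add: powr_powr)
  then have "I < ennreal (r powr p)" using I by (metis ennreal_less_iff enn2real_nonneg)
  then show ?thesis using that unfolding I_def INF_less_iff by (meson less_imp_le)
qed


section \<open>Approximate gluing and the metric axioms\<close>

text \<open>A measurable discretisation: \<open>h y\<close> is the least index of a point of a dense
  sequence within \<epsilon> of \<open>y\<close>. It partitions the space into small cells for
  gluing couplings, and later gives step approximations of Caratheodory functions.\<close>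

lemma ex_countable_approx:
  fixes \<epsilon> :: real
  assumes "0 < \<epsilon>"
  obtains u :: "nat \<Rightarrow> 'a::euclidean_space" and h :: "'a \<Rightarrow> nat"
  where "h \<in> measurable borel (count_space UNIV)" "\<And>y. dist (u (h y)) y < \<epsilon>"
proof -
  obtain D :: "'a set" where D: "countable D" "\<And>X. open X \<Longrightarrow> X \<noteq> {} \<Longrightarrow> \<exists>d\<in>D. d \<in> X"
    using countable_dense_setE by blast
  then have ne: "D \<noteq> {}" by (metis empty_iff open_UNIV UNIV_not_empty)
  define u where "u = from_nat_into D"
  define h where "h y = (LEAST i. dist (u i) y < \<epsilon>)" for y
  have ex: "\<exists>i. dist (u i) y < \<epsilon>" for y
  proof -
    obtain d where "d \<in> D" "d \<in> ball y \<epsilon>"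
      using D(2)[of "ball y \<epsilon>"] assms by auto
    then show ?thesis
      unfolding u_def using D(1) ne
      by (metis dist_commute from_nat_into_surj mem_ball)
  qed
  show ?thesis
  proof
    show "h \<in> measurable borel (count_space UNIV)"
      unfolding h_def by measurable
    show "dist (u (h y)) y < \<epsilon>" for y
      unfolding h_def using ex[of y] by (rule LeastI_ex)
  qed
qed

text \<open>The integrand is the density used for gluing. For h x = i its integral is N{k = i} / M{h
  = i}, which is 1 by assumption unless the cell has mass 0; the points of such cells form a null
  set.\<close>

lemma glue_nn_integral:
  fixes h :: "'a \<Rightarrow> nat" and k :: "'b \<Rightarrow> nat"
  assumes "prob_space M" "prob_space N"
    and [measurable]: "h \<in> measurable M (count_space UNIV)" "k \<in> measurable N (count_space UNIV)"
    and eq: "\<And>i. measure M {x\<in>space M. h x = i} = measure N {x\<in>space N. k x = i}"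
  shows "AE x in M. (\<integral>\<^sup>+y. ennreal (of_bool (h x = k y) / measure M {x\<in>space M. h x = k y}) \<partial>N) = 1"
proof -
  interpret M: prob_space M by fact
  interpret N: prob_space N by fact
  have "AE x in M. \<forall>i. h x = i \<longrightarrow> measure M {x\<in>space M. h x = i} \<noteq> 0"
    unfolding AE_all_countable
  proof
    fix i
    show "AE x in M. h x = i \<longrightarrow> measure M {x\<in>space M. h x = i} \<noteq> 0"
    proof (cases "measure M {x\<in>space M. h x = i} = 0")
      case True
      then have "emeasure M {x\<in>space M. h x = i} = 0"
        by (simp add: M.emeasure_eq_measure)
      then have "{x\<in>space M. h x = i} \<in> null_sets M" by (intro null_setsI) measurable
      from AE_not_in[OF this] AE_space show ?thesis by eventually_elim auto
    qed simp
  qed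
  then show ?thesis
  proof eventually_elim
    case (elim x)
    define i where "i = h x"
    have i: "measure M {x\<in>space M. h x = i} \<noteq> 0" using elim by (simp add: i_def)
    have "(\<integral>\<^sup>+y. ennreal (of_bool (h x = k y) / measure M {x\<in>space M. h x = k y}) \<partial>N)
       = (\<integral>\<^sup>+y. ennreal (1 / measure M {x\<in>space M. h x = i}) * indicator {y\<in>space N. k y = i} y \<partial>N)"
      by (intro nn_integral_cong) (auto simp: i_def indicator_def)
    also have "\<dots> = ennreal (1 / measure M {x\<in>space M. h x = i}) * emeasure N {y\<in>space N. k y = i}"
      by (subst nn_integral_cmult_indicator) auto
    also have "\<dots> = ennreal (1 / measure M {x\<in>space M. h x = i} * measure N {y\<in>space N. k y = i})"
      by (subst ennreal_mult) (auto simp: N.emeasure_eq_measure)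
    also have "\<dots> = 1" using i eq[of i] by simp
    finally show ?case .
  qed
qed

text \<open>\<open>M\<close> and \<open>N\<close> are made conditionally independent given a common
  cell index: the product measure gets density 1 / q(i) where both indices equal i, and 0 elsewhere.
  The marginals survive because both index laws agree. The glued points share a cell but need not
  coincide.\<close>

lemma glue_measure:
  fixes h :: "'a \<Rightarrow> nat" and k :: "'b \<Rightarrow> nat"
  assumes "prob_space M" "prob_space N"
    and h[measurable]: "h \<in> measurable M (count_space UNIV)" and k[measurable]: "k \<in> measurable N (count_space UNIV)"
    and eq: "\<And>i. measure M {x\<in>space M. h x = i} = measure N {x\<in>space N. k x = i}"
  obtains \<eta> where "sets \<eta> = sets (M \<Otimes>\<^sub>M N)" "distr \<eta> M fst = M" "distr \<eta> N snd = N"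
    "AE z in \<eta>. h (fst z) = k (snd z)"
proof -
  interpret M: prob_space M by fact
  interpret N: prob_space N by fact
  interpret P: pair_prob_space M N ..
  define q where "q i = measure M {x\<in>space M. h x = i}" for i
  define w where "w z = ennreal (of_bool (h (fst z) = k (snd z)) / q (k (snd z)))" for z
  have qm[measurable]: "(\<lambda>z. q (k (snd z))) \<in> borel_measurable (M \<Otimes>\<^sub>M N)"
  proof (rule measurable_compose[of "\<lambda>z. k (snd z)" _ "count_space UNIV" q])
    show "(\<lambda>z. k (snd z)) \<in> M \<Otimes>\<^sub>M N \<rightarrow>\<^sub>M count_space UNIV" by measurable
  qed simp
  have wm[measurable]: "w \<in> borel_measurable (M \<Otimes>\<^sub>M N)"
  proof -
    have "Measurable.pred (M \<Otimes>\<^sub>M N) (\<lambda>z. \<exists>i. h (fst z) = i \<and> k (snd z) = i)" by measurable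
    then have [measurable]: "Measurable.pred (M \<Otimes>\<^sub>M N) (\<lambda>z. h (fst z) = k (snd z))" by (simp add: eq_commute)
    show ?thesis
    unfolding w_def of_bool_def by (intro measurable_compose[OF _ measurable_ennreal] borel_measurable_divide qm) measurable
  qed
  define \<eta> where "\<eta> = density (M \<Otimes>\<^sub>M N) w"
  show ?thesis
  proof
    show sets: "sets \<eta> = sets (M \<Otimes>\<^sub>M N)" by (simp add: \<eta>_def)
    have fst_m: "fst \<in> measurable \<eta> M" and snd_m: "snd \<in> measurable \<eta> N"
      using measurable_fst[of M N] measurable_snd[of M N] measurable_cong_sets[OF sets refl] by blast+
    show "distr \<eta> M fst = M"
    proof (rule measure_eqI)
      fix X assume "X \<in> sets (distr \<eta> M fst)"
      then have [measurable]: "X \<in> sets M" by simp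
      have "emeasure (distr \<eta> M fst) X = (\<integral>\<^sup>+z. indicator X z \<partial>distr \<eta> M fst)"
        by simp
      also have "\<dots> = (\<integral>\<^sup>+z. indicator X (fst z) \<partial>\<eta>)"
        by (rule nn_integral_distr[OF fst_m]) simp
      also have "\<dots> = (\<integral>\<^sup>+z. w z * indicator X (fst z) \<partial>(M \<Otimes>\<^sub>M N))"
        unfolding \<eta>_def by (rule nn_integral_density) measurable
      also have "\<dots> = (\<integral>\<^sup>+x. (\<integral>\<^sup>+y. w (x, y) * indicator X x \<partial>N) \<partial>M)"
        by (subst N.nn_integral_fst[symmetric]) auto
      also have "\<dots> = (\<integral>\<^sup>+x. (\<integral>\<^sup>+y. w (x, y) \<partial>N) * indicator X x \<partial>M)"
        by (intro nn_integral_cong nn_integral_multc measurable_compose[OF measurable_Pair1' wm])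
      also have "\<dots> = (\<integral>\<^sup>+x. indicator X x \<partial>M)"
        using glue_nn_integral[OF assms]
        by (intro nn_integral_cong_AE) (auto simp: w_def q_def)
      finally show "emeasure (distr \<eta> M fst) X = emeasure M X" by simp
    qed simp
    show "distr \<eta> N snd = N"
    proof (rule measure_eqI)
      fix X assume "X \<in> sets (distr \<eta> N snd)"
      then have [measurable]: "X \<in> sets N" by simp
      have "emeasure (distr \<eta> N snd) X = (\<integral>\<^sup>+z. indicator X z \<partial>distr \<eta> N snd)"
        by simp
      also have "\<dots> = (\<integral>\<^sup>+z. indicator X (snd z) \<partial>\<eta>)"
        by (rule nn_integral_distr[OF snd_m]) simp
      also have "\<dots> = (\<integral>\<^sup>+z. w z * indicator X (snd z) \<partial>(M \<Otimes>\<^sub>M N))"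
        unfolding \<eta>_def by (rule nn_integral_density) measurable
      also have "\<dots> = (\<integral>\<^sup>+y. (\<integral>\<^sup>+x. w (x, y) * indicator X y \<partial>M) \<partial>N)"
        by (subst P.nn_integral_snd[symmetric]) auto
      also have "\<dots> = (\<integral>\<^sup>+y. (\<integral>\<^sup>+x. w (x, y) \<partial>M) * indicator X y \<partial>N)"
        by (intro nn_integral_cong nn_integral_multc measurable_compose[OF measurable_Pair2' wm])
      also have "\<dots> = (\<integral>\<^sup>+y. indicator X y \<partial>N)"
      proof (rule nn_integral_cong_AE)
        show "AE y in N. (\<integral>\<^sup>+x. w (x, y) \<partial>M) * indicator X y = indicator X y"
          using glue_nn_integral[OF assms(2,1) k h eq[symmetric]]
        proof eventually_elim
          case (elim y)
          have "(\<integral>\<^sup>+x. w (x, y) \<partial>M)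
            = (\<integral>\<^sup>+x. ennreal (of_bool (k y = h x) / measure N {x'\<in>space N. k x' = h x}) \<partial>M)"
            by (intro nn_integral_cong) (auto simp: w_def q_def eq)
          then show ?case using elim by simp
        qed
      qed
      finally show "emeasure (distr \<eta> N snd) X = emeasure N X" by simp
    qed simp
    show "AE z in \<eta>. h (fst z) = k (snd z)"
      unfolding \<eta>_def by (subst AE_density) (auto simp: w_def)
  qed
qed

text \<open>The slack \<open>c\<close> pays for the approximate gluing. The two middle points share
  a cell of radius c/2, hence are within \<open>c\<close>, and Minkowski is applied to the three
  pieces of the path.\<close>

lemma Wp_triangle_aux:
  fixes \<mu> \<nu> \<kappa> :: "'a::euclidean_space measure"
  assumes p: "1 \<le> p" and P: "\<mu> \<in> Pp p" "\<nu> \<in> Pp p" "\<kappa> \<in> Pp p"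
    and a: "Wp p \<mu> \<nu> < a" and b: "Wp p \<nu> \<kappa> < b" and c: "0 < c"
  shows "Wp p \<mu> \<kappa> \<le> a + b + c"
proof -
  have ab: "0 < a" "0 < b" using a b Wp_nonneg by (metis order_le_less_trans)+
  obtain \<gamma> where \<gamma>: "\<gamma> \<in> couplings \<mu> \<nu>"
    and \<gamma>_cost: "(\<integral>\<^sup>+ z. ennreal (norm (fst z - snd z) powr p) \<partial>\<gamma>) \<le> ennreal (a powr p)"
    using Wp_lessE[OF p P(1,2) a] .
  obtain \<gamma>' where \<gamma>': "\<gamma>' \<in> couplings \<nu> \<kappa>"
    and \<gamma>'_cost: "(\<integral>\<^sup>+ z. ennreal (norm (fst z - snd z) powr p) \<partial>\<gamma>') \<le> ennreal (b powr p)"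
    using Wp_lessE[OF p P(2,3) b] .
  obtain u :: "nat \<Rightarrow> 'a" and h where h[measurable]: "h \<in> measurable borel (count_space UNIV)"
    and u: "\<And>y. dist (u (h y)) y < c / 2"
    using ex_countable_approx[of "c/2"] c by (metis half_gt_zero)
  note m[measurable] = couplings_measurable(1,2)[OF \<gamma>] couplings_measurable(1,2)[OF \<gamma>']
  have pr: "prob_space \<gamma>" "prob_space \<gamma>'" using couplings_prob \<gamma> \<gamma>' P PpD(2) by blast+
  interpret \<gamma>: prob_space \<gamma> by (rule pr)
  have eq: "measure \<gamma> {x\<in>space \<gamma>. h (snd x) = i} = measure \<gamma>' {x\<in>space \<gamma>'. h (fst x) = i}" for i
  proof -
    have B: "{y. h y = i} \<in> sets borel" using measurable_sets[OF h, of "{i}"] by (simp add: vimage_def)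
    have "measure \<gamma> {x\<in>space \<gamma>. h (snd x) = i} = measure \<nu> {y. h y = i}"
      using measure_distr[OF m(2) B] \<gamma> by (simp add: couplings_def vimage_def Int_def conj_commute)
    moreover have "measure \<gamma>' {x\<in>space \<gamma>'. h (fst x) = i} = measure \<nu> {y. h y = i}"
      using measure_distr[OF m(3) B] \<gamma>' by (simp add: couplings_def vimage_def Int_def conj_commute)
    ultimately show ?thesis by simp
  qed
  obtain \<eta> where \<eta>s: "sets \<eta> = sets (\<gamma> \<Otimes>\<^sub>M \<gamma>')" and \<eta>1: "distr \<eta> \<gamma> fst = \<gamma>" and \<eta>2: "distr \<eta> \<gamma>' snd = \<gamma>'"
    and \<eta>h: "AE z in \<eta>. h (snd (fst z)) = h (fst (snd z))"
    using glue_measure[OF pr _ _ eq] by force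
  note [measurable_cong] = \<eta>s
  have "prob_space (distr \<eta> \<gamma> fst)" using \<eta>1 pr by simp
  then have \<eta>p: "prob_space \<eta>" by (rule prob_space_distrD2) measurable
  interpret \<eta>: prob_space \<eta> by (rule \<eta>p)
  have \<mu>: "distr \<eta> borel (\<lambda>z. fst (fst z)) = \<mu>"
  proof -
    have "distr \<eta> borel (\<lambda>z. fst (fst z)) = distr (distr \<eta> \<gamma> fst) borel fst"
      by (subst distr_distr) (auto simp: o_def)
    then show ?thesis using \<gamma> by (simp add: \<eta>1 couplings_def)
  qed
  have \<kappa>: "distr \<eta> borel (\<lambda>z. snd (snd z)) = \<kappa>"
  proof -
    have "distr \<eta> borel (\<lambda>z. snd (snd z)) = distr (distr \<eta> \<gamma>' snd) borel snd"
      by (subst distr_distr) (auto simp: o_def)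
    then show ?thesis using \<gamma>' by (simp add: \<eta>2 couplings_def)
  qed
  have close: "norm (snd (fst z) - fst (snd z)) \<le> c" if "h (snd (fst z)) = h (fst (snd z))" for z :: "('a\<times>'a)\<times>('a\<times>'a)"
    using u[of "snd (fst z)"] u[of "fst (snd z)"] that
      dist_triangle_half_r[of "u (h (fst (snd z)))" "snd (fst z)" c "fst (snd z)"]
    by (simp add: dist_norm)
  let ?f = "\<lambda>z. norm (fst (fst z) - snd (fst z))" and ?g = "\<lambda>z. norm (fst (snd z) - snd (snd z))"
  have cm: "(\<lambda>z. ennreal (norm (fst z - snd z) powr p)) \<in> borel_measurable \<gamma>"
     "(\<lambda>z. ennreal (norm (fst z - snd z) powr p)) \<in> borel_measurable \<gamma>'" by measurable
  have f: "(\<integral>\<^sup>+z. ennreal (?f z powr p) \<partial>\<eta>) \<le> ennreal (a powr p)"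
    using \<gamma>_cost by (subst (asm) \<eta>1[symmetric], subst (asm) nn_integral_distr) auto
  have g: "(\<integral>\<^sup>+z. ennreal (?g z powr p) \<partial>\<eta>) \<le> ennreal (b powr p)"
    using \<gamma>'_cost by (subst (asm) \<eta>2[symmetric], subst (asm) nn_integral_distr) auto
  have "(\<integral>\<^sup>+z. ennreal (norm (fst (fst z) - snd (snd z)) powr p) \<partial>\<eta>)
      \<le> (\<integral>\<^sup>+z. ennreal ((?f z + ?g z + c) powr p) \<partial>\<eta>)"
  proof (intro nn_integral_mono_AE)
    show "AE z in \<eta>. ennreal (norm (fst (fst z) - snd (snd z)) powr p) \<le> ennreal ((?f z + ?g z + c) powr p)"
      using \<eta>h
    proof eventually_elim
      case (elim z)
      have "norm (fst (fst z) - snd (snd z)) \<le> ?f z + norm (snd (fst z) - fst (snd z)) + ?g z"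
        by (smt (verit) norm_triangle_ineq norm_minus_commute diff_add_cancel add_diff_eq)
      then show ?case using close[OF elim] p by (intro ennreal_leI powr_mono2) auto
    qed
  qed
  also have "\<dots> \<le> ennreal ((a + b + c) powr p)"
    using ab c p
    by (intro nn_integral_powr_Minkowski f g) (auto simp: \<eta>.emeasure_space_1)
  finally have "Wp p (distr \<eta> borel (\<lambda>z. fst (fst z))) (distr \<eta> borel (\<lambda>z. snd (snd z))) \<le> a + b + c"
    using ab c p by (intro Wp_distr_le \<eta>p) auto
  then show ?thesis by (simp add: \<mu> \<kappa>)
qed

lemma Wp_sym: "Wp p \<mu> \<nu> = Wp p \<nu> (\<mu> :: 'a::euclidean_space measure)"
proof -
  have le: "(INF \<gamma>\<in>couplings \<mu> \<nu>. \<integral>\<^sup>+ z. ennreal (norm (fst z - snd z) powr p) \<partial>\<gamma>)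
     \<le> (INF \<gamma>\<in>couplings \<nu> \<mu>. \<integral>\<^sup>+ z. ennreal (norm (fst z - snd z) powr p) \<partial>\<gamma>)" for \<mu> \<nu> :: "'a measure"
  proof (rule INF_greatest)
    fix \<gamma> assume \<gamma>: "\<gamma> \<in> couplings \<nu> \<mu>"
    note m = couplings_measurable(1,2)[OF \<gamma>]
    define \<gamma>' where "\<gamma>' = distr \<gamma> borel (\<lambda>z. (snd z, fst z))"
    have g: "(\<lambda>z. (snd z, fst z)) \<in> borel_measurable \<gamma>"
      by (intro borel_measurable_Pair m)
    have "(fst :: 'a \<times> 'a \<Rightarrow> 'a) \<in> borel_measurable borel" "(snd :: 'a \<times> 'a \<Rightarrow> 'a) \<in> borel_measurable borel"
      by (intro borel_measurable_continuous_onI continuous_intros)+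
    then have "distr \<gamma>' borel fst = distr \<gamma> borel snd" "distr \<gamma>' borel snd = distr \<gamma> borel fst"
      unfolding \<gamma>'_def using g by (simp_all add: distr_distr o_def)
    then have "\<gamma>' \<in> couplings \<mu> \<nu>"
      using \<gamma> by (simp add: couplings_def \<gamma>'_def)
    then have "(INF \<gamma>\<in>couplings \<mu> \<nu>. \<integral>\<^sup>+ z. ennreal (norm (fst z - snd z) powr p) \<partial>\<gamma>)
      \<le> (\<integral>\<^sup>+ z. ennreal (norm (fst z - snd z) powr p) \<partial>\<gamma>')"
      by (rule INF_lower)
    also have "\<dots> = (\<integral>\<^sup>+ z. ennreal (norm (snd z - fst z) powr p) \<partial>\<gamma>)"
      unfolding \<gamma>'_def by (subst nn_integral_distr[OF g]) simp_all
    also have "\<dots> = (\<integral>\<^sup>+ z. ennreal (norm (fst z - snd z) powr p) \<partial>\<gamma>)"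
      by (simp only: norm_minus_commute[of "snd _" "fst _"])
    finally show "(INF \<gamma>\<in>couplings \<mu> \<nu>. \<integral>\<^sup>+ z. ennreal (norm (fst z - snd z) powr p) \<partial>\<gamma>)
      \<le> (\<integral>\<^sup>+ z. ennreal (norm (fst z - snd z) powr p) \<partial>\<gamma>)" .
  qed
  show ?thesis
    unfolding Wp_def by (rule arg_cong[OF antisym[OF le le], where f = "\<lambda>x. enn2real x powr (1 / p)"])
qed

lemma Wp_eq_0D:
  fixes \<mu> \<nu> :: "'a::euclidean_space measure"
  assumes p: "1 \<le> p" and P: "\<mu> \<in> Pp p" "\<nu> \<in> Pp p" and 0: "Wp p \<mu> \<nu> = 0"
  shows "\<mu> = \<nu>"
proof (rule measure_eqI_lipschitz)
  show "finite_measure \<mu>" "finite_measure \<nu>" "sets \<mu> = sets borel" "sets \<nu> = sets borel"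
    using PpD[OF P(1)] PpD[OF P(2)] by (auto simp: prob_space_def)
  fix f :: "'a \<Rightarrow> real" assume "\<exists>L. L-lipschitz_on UNIV f" and f01: "\<And>x. 0 \<le> f x \<and> f x \<le> 1"
  then obtain L where L: "L-lipschitz_on UNIV f" by blast
  have L0: "0 \<le> L" using lipschitz_on_nonneg[OF L] .
  have [measurable]: "f \<in> borel_measurable borel"
    using lipschitz_on_continuous_on[OF L] by (rule borel_measurable_continuous_onI)
  have "\<bar>(\<integral>x. f x \<partial>\<mu>) - (\<integral>x. f x \<partial>\<nu>)\<bar> \<le> 2 * L * \<delta>" if \<delta>: "0 < \<delta>" for \<delta>
  proof -
    obtain \<gamma> where \<gamma>: "\<gamma> \<in> couplings \<mu> \<nu>"
      and cost: "(\<integral>\<^sup>+ z. ennreal (norm (fst z - snd z) powr p) \<partial>\<gamma>) \<le> ennreal (\<delta> powr p)"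
      using Wp_lessE[OF p P, of \<delta>] 0 \<delta> by auto
    note m[measurable] = couplings_measurable(1,2)[OF \<gamma>]
    interpret \<gamma>: prob_space \<gamma> using couplings_prob[OF \<gamma> PpD(2)[OF P(1)]] .
    have int: "integrable \<gamma> (\<lambda>z. norm (fst z - snd z) powr p)"
      using le_less_trans[OF cost ennreal_less_top] by (intro integrableI_bounded) auto
    have cost': "(\<integral>z. norm (fst z - snd z) powr p \<partial>\<gamma>) \<le> \<delta> powr p"
      using cost nn_integral_eq_integral[OF int] by simp
    have i1: "integrable \<gamma> (\<lambda>z. f (fst z))" "integrable \<gamma> (\<lambda>z. f (snd z))"
      using f01 by (auto intro!: \<gamma>.integrable_const_bound[where B = 1])
    \<comment> \<open>Splits at distance \<delta>. Beyond it, r = r^(1-p) r^p <= \<delta>^(1-p) r^p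
      because p >= 1, so the p-cost controls the first-order difference without Hoelder's
      inequality.\<close>
    have pw: "\<bar>f (fst z) - f (snd z)\<bar> \<le> L * (\<delta> + \<delta> powr (1 - p) * norm (fst z - snd z) powr p)" for z
    proof -
      have "\<bar>f (fst z) - f (snd z)\<bar> \<le> L * norm (fst z - snd z)"
        using lipschitz_onD[OF L, of "fst z" "snd z"] by (simp add: dist_norm)
      also have "norm (fst z - snd z) \<le> \<delta> + \<delta> powr (1 - p) * norm (fst z - snd z) powr p"
      proof (cases "norm (fst z - snd z) \<le> \<delta>")
        case True
        moreover have "0 \<le> \<delta> powr (1 - p) * norm (fst z - snd z) powr p" by simp
        ultimately show ?thesis by linarith
      next
        case False
        then have n: "\<delta> < norm (fst z - snd z)" by simp
        then have "norm (fst z - snd z) = norm (fst z - snd z) powr (1 - p) * norm (fst z - snd z) powr p"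
          using \<delta> by (simp flip: powr_add)
        also have "\<dots> \<le> \<delta> powr (1 - p) * norm (fst z - snd z) powr p"
          using n \<delta> p by (intro mult_right_mono powr_mono2') auto
        finally show ?thesis using \<delta> by linarith
      qed
      finally show ?thesis using L0 by (simp add: mult_left_mono)
    qed
    have "(\<integral>x. f x \<partial>\<mu>) = (\<integral>z. f (fst z) \<partial>\<gamma>)" "(\<integral>x. f x \<partial>\<nu>) = (\<integral>z. f (snd z) \<partial>\<gamma>)"
      using integral_distr[OF m(1), of f] integral_distr[OF m(2), of f] \<gamma> by (auto simp: couplings_def)
    then have "\<bar>(\<integral>x. f x \<partial>\<mu>) - (\<integral>x. f x \<partial>\<nu>)\<bar> = \<bar>(\<integral>z. f (fst z) - f (snd z) \<partial>\<gamma>)\<bar>"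
      using i1 by simp
    also have "\<dots> \<le> (\<integral>z. L * (\<delta> + \<delta> powr (1 - p) * norm (fst z - snd z) powr p) \<partial>\<gamma>)"
    proof -
      have "norm (\<integral>z. f (fst z) - f (snd z) \<partial>\<gamma>)
        \<le> (\<integral>z. L * (\<delta> + \<delta> powr (1 - p) * norm (fst z - snd z) powr p) \<partial>\<gamma>)"
      proof (rule norm_integral_le)
        show "integrable \<gamma> (\<lambda>z. L * (\<delta> + \<delta> powr (1 - p) * norm (fst z - snd z) powr p))"
          by (intro integrable_mult_right Bochner_Integration.integrable_add int \<gamma>.integrable_const)
      qed (use i1 pw in simp_all)
      then show ?thesis by simp
    qed
    also have "\<dots> = L * (\<delta> + \<delta> powr (1 - p) * (\<integral>z. norm (fst z - snd z) powr p \<partial>\<gamma>))"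
    proof -
      have "(\<integral>z. \<delta> + \<delta> powr (1 - p) * norm (fst z - snd z) powr p \<partial>\<gamma>)
        = (\<integral>z. \<delta> \<partial>\<gamma>) + (\<integral>z. \<delta> powr (1 - p) * norm (fst z - snd z) powr p \<partial>\<gamma>)"
        by (intro Bochner_Integration.integral_add integrable_mult_right int \<gamma>.integrable_const)
      then show ?thesis by (simp add: \<gamma>.prob_space)
    qed
    also have "\<dots> \<le> L * (\<delta> + \<delta> powr (1 - p) * \<delta> powr p)"
      using L0 cost' by (intro mult_left_mono add_left_mono) auto
    also have "\<delta> powr (1 - p) * \<delta> powr p = \<delta>" using \<delta> by (simp flip: powr_add)
    finally show ?thesis by simp
  qed
  note bd = this
  show "(\<integral>x. f x \<partial>\<mu>) = (\<integral>x. f x \<partial>\<nu>)"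
  proof (rule ccontr)
    define d where "d = \<bar>(\<integral>x. f x \<partial>\<mu>) - (\<integral>x. f x \<partial>\<nu>)\<bar>"
    assume "(\<integral>x. f x \<partial>\<mu>) \<noteq> (\<integral>x. f x \<partial>\<nu>)"
    then have d: "0 < d" by (simp add: d_def)
    \<comment> \<open>This \<delta> makes 2 L \<delta> smaller than \<open>d\<close>; the summand 1
      covers the case L = 0.\<close>
    have "d \<le> 2 * L * (d / (4 * (L + 1)))"
      unfolding d_def using L0 d by (intro bd) (auto simp: d_def)
    also have "\<dots> = d * (L / (2 * (L + 1)))" using L0 by (simp add: field_simps)
    also have "\<dots> < d * 1" using L0 d by (intro mult_strict_left_mono) (auto simp: field_simps)
    finally show False by simp
  qed
qed

lemma Metric_space_Pp_Wp:
  assumes p: "1 \<le> p"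
  shows "Metric_space (Pp p :: 'a::euclidean_space measure set) (Wp p)"
proof
  show "0 \<le> Wp p \<mu> \<nu>" for \<mu> \<nu> :: "'a measure" by (rule Wp_nonneg)
  show "Wp p \<mu> \<nu> = Wp p \<nu> \<mu>" for \<mu> \<nu> :: "'a measure" by (rule Wp_sym)
  show "Wp p \<mu> \<nu> = 0 \<longleftrightarrow> \<mu> = \<nu>" if P: "\<mu> \<in> Pp p" "\<nu> \<in> Pp p" for \<mu> \<nu> :: "'a measure"
  proof
    assume "\<mu> = \<nu>"
    have id: "(\<lambda>x. x) \<in> borel_measurable \<mu>"
      using PpD(1)[OF P(1)] measurable_ident_sets by blast
    have "Wp p (distr \<mu> borel (\<lambda>x. x)) (distr \<mu> borel (\<lambda>x. x)) \<le> 0"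
      using PpD(2)[OF P(1)] p by (intro Wp_distr_le id) auto
    moreover have "distr \<mu> borel (\<lambda>x. x) = \<mu>" by (rule distr_id2) (simp add: PpD(1)[OF P(1)])
    ultimately have "Wp p \<mu> \<mu> \<le> 0" by metis
    then have "Wp p \<mu> \<mu> = 0" using Wp_nonneg by (rule antisym)
    then show "Wp p \<mu> \<nu> = 0" unfolding \<open>\<mu> = \<nu>\<close> .
  qed (rule Wp_eq_0D[OF p P])
  show "Wp p \<mu> \<kappa> \<le> Wp p \<mu> \<nu> + Wp p \<nu> \<kappa>"
    if P: "\<mu> \<in> Pp p" "\<nu> \<in> Pp p" "\<kappa> \<in> Pp p" for \<mu> \<nu> \<kappa> :: "'a measure"
  proof (rule field_le_epsilon)
    fix e :: real assume "0 < e"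
    then show "Wp p \<mu> \<kappa> \<le> Wp p \<mu> \<nu> + Wp p \<nu> \<kappa> + e"
      using Wp_triangle_aux[OF p P, of "Wp p \<mu> \<nu> + e / 3" "Wp p \<nu> \<kappa> + e / 3" "e / 3"] by simp
  qed
qed

section \<open>Continuous vector fields and measurable selections\<close>

lemma dcc_term_le:
  "enn2real (min 1 (SUP x\<in>A. ennreal (f x))) \<le> 1"
  by (rule enn2real_leI) auto

lemma dcc_summable:
  "summable (\<lambda>k. (1/2::real) ^ Suc k * enn2real (min 1 (SUP x\<in>cball 0 (real (Suc k)). ennreal (norm (v x - w x)))))"
proof (rule summable_comparison_test'[where N = 0])
  show "summable (\<lambda>k. (1/2::real) ^ Suc k)"
    using power_half_series by (rule sums_summable)
  show "norm ((1/2::real) ^ Suc k * enn2real (min 1 (SUP x\<in>cball 0 (real (Suc k)). ennreal (norm (v x - w x)))))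
    \<le> (1/2) ^ Suc k" for k
    using mult_left_mono[OF dcc_term_le[of "\<lambda>x. norm (v x - w x)" "cball 0 (real (Suc k))"], of "(1/2) ^ Suc k"]
    by (simp add: abs_mult)
qed

text \<open>Only the term with index \<open>k\<close>, whose ball has radius \<open>Suc k\<close>,
  is kept. The condition e <= 1 ensures that the truncation at 1 is not what makes this term
  small.\<close>

lemma dcc_ball_le:
  assumes d: "dcc v w < (1/2) ^ Suc k * e" and e: "e \<le> 1" and x: "norm x \<le> real (Suc k)"
  shows "norm (v x - w x) \<le> e"
proof -
  define S where "S = (SUP x\<in>cball 0 (real (Suc k)). ennreal (norm (v x - w x)))"
  have "(1/2) ^ Suc k * enn2real (min 1 S) \<le> dcc v w"
    unfolding dcc_def S_def
    using sum_le_suminf[OF dcc_summable[of v w], of "{k}"] by simp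
  then have "(1/2) ^ Suc k * enn2real (min 1 S) < (1/2) ^ Suc k * e" using d by linarith
  then have lt: "enn2real (min 1 S) < e" by simp
  have fin: "min 1 S < \<top>" by (simp add: min_less_iff_disj)
  have e0: "0 \<le> e" using lt enn2real_nonneg[of "min 1 S"] by linarith
  have "min 1 S = ennreal (enn2real (min 1 S))" using fin by simp
  also have "\<dots> < ennreal e" using lt by (simp add: ennreal_lessI enn2real_nonneg order_le_less_trans[OF enn2real_nonneg lt])
  finally have "min 1 S < ennreal e" .
  moreover have "ennreal e \<le> 1" using e by (simp add: ennreal_le_1)
  ultimately have "S < ennreal e" by (auto simp: min_def split: if_splits)
  moreover have "ennreal (norm (v x - w x)) \<le> S"
    unfolding S_def using x by (intro SUP_upper) auto
  ultimately have "ennreal (norm (v x - w x)) \<le> ennreal e" by (meson dual_order.trans less_imp_le)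
  then show ?thesis using e0 by simp
qed

text \<open>The terms with index below \<open>k\<close> live on balls of radius at most
  \<open>k\<close> and contribute at most \<open>e\<close> together; the geometric tail sums to
  (1/2)^k.\<close>

lemma dcc_le:
  assumes b: "\<And>x. norm x \<le> real k \<Longrightarrow> norm (v x - w x) \<le> e" and e: "0 \<le> e"
  shows "dcc v w \<le> e + (1/2) ^ k"
proof -
  define g where "g j = (1/2::real) ^ Suc j * enn2real (min 1 (SUP x\<in>cball 0 (real (Suc j)). ennreal (norm (v x - w x))))" for j
  have gs: "summable g" unfolding g_def by (rule dcc_summable)
  have hs: "summable (\<lambda>j. (1/2::real) ^ Suc j)" using power_half_series by (rule sums_summable)
  have g1: "g j \<le> (1/2) ^ Suc j" for j
    unfolding g_def
    using mult_left_mono[OF dcc_term_le[of "\<lambda>x. norm (v x - w x)" "cball 0 (real (Suc j))"], of "(1/2) ^ Suc j"] by simp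
  have g2: "g j \<le> (1/2) ^ Suc j * e" if "j < k" for j
  proof -
    have "(SUP x\<in>cball 0 (real (Suc j)). ennreal (norm (v x - w x))) \<le> ennreal e"
      using that b by (intro SUP_least ennreal_leI) (auto simp: dist_norm)
    then have "enn2real (min 1 (SUP x\<in>cball 0 (real (Suc j)). ennreal (norm (v x - w x)))) \<le> e"
      using e by (intro enn2real_leI) (auto simp: min.coboundedI2)
    then show ?thesis unfolding g_def by (intro mult_left_mono) auto
  qed
  have "dcc v w = (\<Sum>j. g (j + k)) + (\<Sum>j<k. g j)"
    unfolding dcc_def g_def[symmetric] using gs by (rule suminf_split_initial_segment)
  also have "(\<Sum>j. g (j + k)) \<le> (\<Sum>j. (1/2) ^ k * (1/2::real) ^ Suc j)"
  proof (rule suminf_le)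
    show "g (j + k) \<le> (1/2) ^ k * (1/2) ^ Suc j" for j
      using g1[of "j + k"] by (simp add: power_add mult_ac)
    show "summable (\<lambda>j. g (j + k))" using gs by (simp add: summable_iff_shift)
    show "summable (\<lambda>j. (1/2) ^ k * (1/2::real) ^ Suc j)" by (intro summable_mult hs)
  qed
  also have "\<dots> = (1/2) ^ k"
    using suminf_mult[OF hs, of "(1/2) ^ k"] sums_unique[OF power_half_series] by simp
  also have "(\<Sum>j<k. g j) \<le> (\<Sum>j<k. (1/2) ^ Suc j * e)"
    using g2 by (intro sum_mono) auto
  also have "\<dots> = (\<Sum>j<k. (1/2) ^ Suc j) * e" by (simp add: sum_distrib_right)
  also have "\<dots> \<le> 1 * e"
    using sum_le_suminf[OF hs, of "{..<k}"] sums_unique[OF power_half_series] e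
    by (intro mult_right_mono) auto
  finally show ?thesis by simp
qed

lemma ex_half_power_less: "0 < (e::real) \<Longrightarrow> \<exists>k. (1/2) ^ k < e"
  using real_arch_pow_inv[of e "1/2"] by auto

lemma dcc_LIMSEQ_0_D:
  fixes f :: "nat \<Rightarrow> 'a::euclidean_space \<Rightarrow> 'a"
  assumes lim: "(\<lambda>n. dcc (f n) g) \<longlonglongrightarrow> 0"
  shows "uniform_limit (cball 0 (real k)) f g sequentially"
proof (rule uniform_limitI)
  fix e :: real assume "0 < e"
  define e' where "e' = min 1 (e / 2)"
  have e': "0 < e'" "e' \<le> 1" "e' < e" using \<open>0 < e\<close> by (auto simp: e'_def min_def)
  then have "0 < (1/2) ^ Suc k * e'" by simp
  from order_tendstoD(2)[OF lim this]
  show "\<forall>\<^sub>F n in sequentially. \<forall>x\<in>cball 0 (real k). dist (f n x) (g x) < e"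
  proof eventually_elim
    case (elim n)
    show ?case
    proof
      fix x :: 'a assume "x \<in> cball 0 (real k)"
      then show "dist (f n x) (g x) < e"
        using dcc_ball_le[OF elim e'(2), of x] e'(3) by (simp add: dist_norm)
    qed
  qed
qed

lemma dcc_LIMSEQ_0_I:
  fixes f :: "nat \<Rightarrow> 'a::euclidean_space \<Rightarrow> 'a"
  assumes lim: "\<And>k. uniform_limit (cball 0 (real k)) f g sequentially"
  shows "(\<lambda>n. dcc (f n) g) \<longlonglongrightarrow> 0"
proof (rule LIMSEQ_I)
  fix r :: real assume "0 < r"
  then obtain k where k: "(1/2) ^ k < r / 2" using ex_half_power_less[of "r/2"] by auto
  from uniform_limitD[OF lim[of k], of "r/2"] \<open>0 < r\<close>
  obtain N where "\<forall>n\<ge>N. \<forall>x\<in>cball 0 (real k). dist (f n x) (g x) < r / 2"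
    unfolding eventually_sequentially by auto
  then have N: "norm (f n x - g x) < r / 2" if "n \<ge> N" "norm x \<le> real k" for n x
    using that by (simp add: dist_norm)
  have "norm (dcc (f n) g - 0) < r" if "n \<ge> N" for n
  proof -
    have "dcc (f n) g \<le> r / 2 + (1/2) ^ k"
      using N[OF that] \<open>0 < r\<close> by (intro dcc_le) (auto intro: less_imp_le)
    moreover have "0 \<le> dcc (f n) g" using Metric_space.nonneg[OF Metric_space_C0_dcc] .
    ultimately show ?thesis using k by simp
  qed
  then show "\<exists>no. \<forall>n\<ge>no. norm (dcc (f n) g - 0) < r" by blast
qed

lemma C0_uniform_limit:
  fixes f :: "nat \<Rightarrow> 'a::euclidean_space \<Rightarrow> 'a"
  assumes f: "\<And>n. f n \<in> C0" and lim: "\<And>k. uniform_limit (cball 0 (real k)) f g sequentially"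
  shows "g \<in> C0"
proof -
  have "isCont g x" for x
  proof -
    obtain k where k: "norm x < real k" using reals_Archimedean2 by blast
    have "continuous_on (cball 0 (real k)) g"
      by (rule uniform_limit_theorem[OF _ lim])
         (use f in \<open>auto simp: C0_def intro!: always_eventually intro: continuous_on_subset\<close>)
    moreover have "x \<in> interior (cball 0 (real k))"
      using k by (simp add: dist_norm)
    ultimately show ?thesis by (rule continuous_on_interior)
  qed
  then show ?thesis by (simp add: C0_def continuous_at_imp_continuous_on)
qed

lemma C0_dcc_complete:
  fixes f :: "nat \<Rightarrow> 'a::euclidean_space \<Rightarrow> 'a"
  assumes f: "\<And>n. f n \<in> C0"
    and Cauchy: "\<And>e. 0 < e \<Longrightarrow> \<exists>N. \<forall>m\<ge>N. \<forall>n\<ge>N. dcc (f m) (f n) < e"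
  obtains g where "g \<in> C0" "(\<lambda>n. dcc (f n) g) \<longlonglongrightarrow> 0"
proof -
  define g where "g x = lim (\<lambda>n. f n x)" for x
  have lim: "uniform_limit (cball 0 (real k)) f g sequentially" for k
  proof -
    have "uniformly_Cauchy_on (cball 0 (real k)) f"
      unfolding uniformly_Cauchy_on_def
    proof (intro allI impI)
      fix e :: real assume "0 < e"
      define e' where "e' = min 1 (e / 2)"
      have e': "0 < e'" "e' \<le> 1" "e' < e" using \<open>0 < e\<close> by (auto simp: e'_def min_def)
      then obtain N where N: "\<And>m n. m \<ge> N \<Longrightarrow> n \<ge> N \<Longrightarrow> dcc (f m) (f n) < (1/2) ^ Suc k * e'"
        using Cauchy[of "(1/2) ^ Suc k * e'"] by auto
      show "\<exists>M. \<forall>x\<in>cball 0 (real k). \<forall>m\<ge>M. \<forall>n\<ge>M. dist (f m x) (f n x) < e"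
      proof (intro exI[of _ N] ballI allI impI)
        fix x m n assume "x \<in> cball (0::'a) (real k)" "N \<le> m" "N \<le> n"
        then show "dist (f m x) (f n x) < e"
          using dcc_ball_le[OF N e'(2), of m n x] e'(3) by (simp add: dist_norm)
      qed
    qed
    then have "uniformly_convergent_on (cball 0 (real k)) f"
      by (rule Cauchy_uniformly_convergent)
    then show ?thesis
      unfolding g_def by (simp add: uniformly_convergent_uniform_limit_iff)
  qed
  show ?thesis
    by (rule that[OF C0_uniform_limit[OF f lim] dcc_LIMSEQ_0_I[OF lim]])
qed

lemma ex_dense_sequence:
  obtains y :: "nat \<Rightarrow> 'a::euclidean_space" where "\<And>X. open X \<Longrightarrow> X \<noteq> {} \<Longrightarrow> \<exists>i. y i \<in> X"
proof -
  obtain D :: "'a set" where D: "countable D" "\<And>X. open X \<Longrightarrow> X \<noteq> {} \<Longrightarrow> \<exists>d\<in>D. d \<in> X"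
    using countable_dense_setE by blast
  then have "D \<noteq> {}" by (metis empty_iff open_UNIV UNIV_not_empty)
  then show ?thesis
    using that[of "from_nat_into D"] D by (metis from_nat_into_surj)
qed

text \<open>No explicit dense family is written down. A code (k, m, n, L) records a ball, a mesh, a
  tolerance and, for each mesh ball, an approximate value, and \<open>u\<close> chooses any field
  that fits the code. Two fields with one code differ by at most 2/(n+1) on the ball of radius
  \<open>k\<close>, and every continuous field fits codes of arbitrary precision.\<close>

lemma C0_dcc_separable:
  obtains u :: "nat \<Rightarrow> 'a::euclidean_space \<Rightarrow> 'a"
  where "\<And>i. u i \<in> C0" "\<And>v e. v \<in> C0 \<Longrightarrow> 0 < e \<Longrightarrow> \<exists>i. dcc v (u i) < e"
proof -
  obtain y :: "nat \<Rightarrow> 'a" where y: "\<And>X. open X \<Longrightarrow> X \<noteq> {} \<Longrightarrow> \<exists>i. y i \<in> X"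
    using ex_dense_sequence by blast
  define P :: "nat \<times> nat \<times> nat \<times> (nat \<times> nat) list \<Rightarrow> ('a \<Rightarrow> 'a) \<Rightarrow> bool" where
    "P c v = (case c of (k, m, n, L) \<Rightarrow> v \<in> C0 \<and>
       (\<forall>x\<in>cball 0 (real k). \<exists>(i, j)\<in>set L. x \<in> ball (y i) (1 / real (Suc m))) \<and>
       (\<forall>(i, j)\<in>set L. \<forall>x\<in>ball (y i) (1 / real (Suc m)) \<inter> cball 0 (real k).
          norm (v x - y j) < 1 / real (Suc n)))" for c v
  define u where "u c = (if \<exists>v. P (from_nat c) v then SOME v. P (from_nat c) v else (\<lambda>_. 0))" for c
  have uP: "P c (u (to_nat c))" if "P c v" for c v
    using that someI_ex[of "P c"] by (auto simp: u_def)
  show ?thesis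
  proof
    show "u i \<in> C0" for i
    proof (cases "\<exists>v. P (from_nat i) v")
      case True
      then have "P (from_nat i) (u i)" using someI_ex[of "P (from_nat i)"] by (auto simp: u_def)
      then show ?thesis by (auto simp: P_def split: prod.splits)
    next
      case False
      then show ?thesis by (simp add: u_def C0_def)
    qed
    fix v :: "'a \<Rightarrow> 'a" and e :: real assume v: "v \<in> C0" and e: "0 < e"
    obtain k where k: "(1/2) ^ k < e / 2" using ex_half_power_less[of "e/2"] e by auto
    obtain n where n: "1 / real (Suc n) < e / 4"
      using reals_Archimedean[of "e/4"] e by (auto simp: inverse_eq_divide)
    have "uniformly_continuous_on (cball 0 (real k)) v"
      using v by (intro compact_uniformly_continuous) (auto simp: C0_def intro: continuous_on_subset)
    then obtain \<delta> where \<delta>: "0 < \<delta>"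
      "\<And>x x'. x \<in> cball 0 (real k) \<Longrightarrow> x' \<in> cball 0 (real k) \<Longrightarrow> dist x' x < \<delta> \<Longrightarrow> dist (v x') (v x) < 1 / real (Suc n) / 2"
      unfolding uniformly_continuous_on_def by (metis half_gt_zero zero_less_divide_1_iff of_nat_0_less_iff zero_less_Suc)
    obtain m where m: "1 / real (Suc m) < \<delta> / 2"
      using reals_Archimedean[of "\<delta>/2"] \<delta>(1) by (auto simp: inverse_eq_divide)
    have "cball 0 (real k) \<subseteq> (\<Union>i. ball (y i) (1 / real (Suc m)))"
    proof
      fix x :: 'a
      obtain i where "y i \<in> ball x (1 / real (Suc m))" using y[of "ball x (1 / real (Suc m))"] by auto
      then show "x \<in> (\<Union>i. ball (y i) (1 / real (Suc m)))" by (auto simp: dist_commute)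
    qed
    then obtain I where I: "finite I" "cball 0 (real k) \<subseteq> (\<Union>i\<in>I. ball (y i) (1 / real (Suc m)))"
      using compactE_image[of "cball 0 (real k)" UNIV "\<lambda>i. ball (y i) (1 / real (Suc m))"] by auto
    have "\<exists>j. \<forall>x\<in>ball (y i) (1 / real (Suc m)) \<inter> cball 0 (real k). norm (v x - y j) < 1 / real (Suc n)" for i
    proof (cases "ball (y i) (1 / real (Suc m)) \<inter> cball 0 (real k) = {}")
      case False
      then obtain x0 where x0: "x0 \<in> ball (y i) (1 / real (Suc m))" "x0 \<in> cball 0 (real k)" by blast
      obtain j where j: "y j \<in> ball (v x0) (1 / real (Suc n) / 2)"
        using y[of "ball (v x0) (1 / real (Suc n) / 2)"] by auto
      show ?thesis
      proof (intro exI[of _ j] ballI)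
        fix x assume x: "x \<in> ball (y i) (1 / real (Suc m)) \<inter> cball 0 (real k)"
        have "dist x x0 < \<delta>"
          using x x0(1) m dist_triangle[of x x0 "y i"] by (simp add: dist_commute)
        then have "dist (v x) (v x0) < 1 / real (Suc n) / 2" using x x0 by (intro \<delta>(2)) auto
        moreover have "dist (v x0) (y j) < 1 / real (Suc n) / 2" using j by simp
        ultimately have "dist (v x) (y j) < 1 / real (Suc n)"
          using dist_triangle[of "v x" "y j" "v x0"] by linarith
        then show "norm (v x - y j) < 1 / real (Suc n)" by (simp add: dist_norm)
      qed
    qed auto
    then obtain J where J: "\<And>i x. x \<in> ball (y i) (1 / real (Suc m)) \<inter> cball 0 (real k) \<Longrightarrow> norm (v x - y (J i)) < 1 / real (Suc n)"
      by metis
    obtain Il where Il: "set Il = I" using I(1) finite_list by blast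
    define c where "c = (k, m, n, map (\<lambda>i. (i, J i)) Il)"
    have "P c v" using v I(2) J by (fastforce simp: P_def c_def Il)
    then have w: "P c (u (to_nat c))" by (rule uP)
    define w where "w = u (to_nat c)"
    have "norm (v x - w x) \<le> 2 * (1 / real (Suc n))" if x: "norm x \<le> real k" for x
    proof -
      obtain i where i: "i \<in> I" "x \<in> ball (y i) (1 / real (Suc m))" using I(2) x by force
      have "norm (w x - y (J i)) < 1 / real (Suc n)"
        using w i x by (auto simp: P_def c_def Il w_def)
      moreover have "norm (v x - y (J i)) < 1 / real (Suc n)" using J[of x i] i x by simp
      ultimately show ?thesis
        using norm_triangle_ineq4[of "v x - y (J i)" "w x - y (J i)"] by simp
    qed
    then have "dcc v w \<le> 2 * (1 / real (Suc n)) + (1/2) ^ k" by (intro dcc_le) auto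
    also have "\<dots> < e" using n k by simp
    finally show "\<exists>i. dcc v (u i) < e" unfolding w_def by blast
  qed
qed

section \<open>Measurable maps into the space of fields, and selections\<close>

text \<open>Every open set of fields is a countable union of sets \<open>G c\<close>, each described
  by conditions at countably many points, so pointwise measurability suffices.\<close>

lemma measurable_into_C0:
  fixes v :: "'t \<Rightarrow> 'a::euclidean_space \<Rightarrow> 'a"
  assumes C0: "\<And>t. t \<in> space S \<Longrightarrow> v t \<in> C0"
    and m: "\<And>x. (\<lambda>t. v t x) \<in> borel_measurable S"
  shows "v \<in> measurable S (sigma C0 {U. openin C0_topology U})"
proof (rule measurable_measure_of)
  interpret C: Metric_space "C0 :: ('a \<Rightarrow> 'a) set" dcc by (rule Metric_space_C0_dcc)
  show "{U. openin C0_topology U} \<subseteq> Pow (C0 :: ('a \<Rightarrow> 'a) set)"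
    using openin_subset by (fastforce simp: C.topspace_mtopology)
  show "v \<in> space S \<rightarrow> C0" using C0 by auto
  fix U :: "('a \<Rightarrow> 'a) set" assume "U \<in> {U. openin C0_topology U}"
  then have U: "openin C0_topology U" by simp
  obtain u :: "nat \<Rightarrow> 'a \<Rightarrow> 'a" where u: "\<And>i. u i \<in> C0" "\<And>v e. v \<in> C0 \<Longrightarrow> 0 < e \<Longrightarrow> \<exists>i. dcc v (u i) < e"
    using C0_dcc_separable by blast
  obtain y :: "nat \<Rightarrow> 'a" where y: "\<And>X. open X \<Longrightarrow> X \<noteq> {} \<Longrightarrow> \<exists>i. y i \<in> X"
    using ex_dense_sequence by blast
  \<comment> \<open>By continuity, bounds at the dense points \<open>y j\<close> bound the whole
    ball. They are imposed on the open ball of radius \<open>Suc k\<close>, which contains the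
    closed ball of radius \<open>k\<close> needed for \<open>dcc_le\<close>, so that a violation on
    the latter spreads to an open set containing some \<open>y j\<close>.\<close>
  define G where "G c = (case c of (i, k, n) \<Rightarrow> {w\<in>C0. \<forall>j. norm (y j) < real (Suc k) \<longrightarrow>
     norm (w (y j) - u i (y j)) \<le> 1 / real (Suc n)})" for c :: "nat \<times> nat \<times> nat"
  have cover: "\<exists>c. w \<in> G c \<and> G c \<subseteq> U" if w: "w \<in> U" for w
  proof -
    have wC: "w \<in> C0" using U w openin_subset by (fastforce simp: C.topspace_mtopology)
    obtain r where r: "0 < r" "C.mball w r \<subseteq> U" using U w by (auto simp: C.openin_mtopology)
    obtain k where k: "(1/2) ^ k < r / 2" using ex_half_power_less[of "r/2"] r by auto
    obtain n where n: "1 / real (Suc n) < r / 4"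
      using reals_Archimedean[of "r/4"] r by (auto simp: inverse_eq_divide)
    obtain i where i: "dcc w (u i) < (1/2) ^ Suc k * (1 / real (Suc n))"
      using u(2)[OF wC, of "(1/2) ^ Suc k * (1 / real (Suc n))"] by auto
    have wu: "norm (w x - u i x) \<le> 1 / real (Suc n)" if "norm x \<le> real (Suc k)" for x
      using i that by (intro dcc_ball_le) auto
    have "w \<in> G (i, k, n)" using wC wu by (auto simp: G_def)
    moreover have "G (i, k, n) \<subseteq> U"
    proof
      fix z assume z: "z \<in> G (i, k, n)"
      then have zC: "z \<in> C0" by (simp add: G_def)
      have "norm (w x - z x) \<le> 2 * (1 / real (Suc n))" if x: "norm x \<le> real k" for x
      proof (rule ccontr)
        assume neg: "\<not> norm (w x - z x) \<le> 2 * (1 / real (Suc n))"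
        define X where "X = {x. 2 * (1 / real (Suc n)) < norm (w x - z x)} \<inter> ball 0 (real (Suc k))"
        have "x \<in> X" using neg x by (simp add: X_def)
        moreover have "open X"
          using wC zC unfolding X_def C0_def
          by (intro open_Int open_ball open_Collect_less continuous_intros) auto
        ultimately obtain j where j: "y j \<in> X" using y by blast
        then have "norm (z (y j) - u i (y j)) \<le> 1 / real (Suc n)" "norm (w (y j) - u i (y j)) \<le> 1 / real (Suc n)"
          using z wu[of "y j"] by (auto simp: X_def G_def)
        then have "norm (w (y j) - z (y j)) \<le> 2 * (1 / real (Suc n))"
          using norm_triangle_ineq4[of "w (y j) - u i (y j)" "z (y j) - u i (y j)"] by simp
        then show False using j by (simp add: X_def)
      qed
      then have "dcc w z \<le> 2 * (1 / real (Suc n)) + (1/2) ^ k" by (intro dcc_le) auto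
      also have "\<dots> < r" using n k by simp
      finally show "z \<in> U" using r(2) wC zC by (auto simp: C.mball_def)
    qed
    ultimately show ?thesis by blast
  qed
  have "v -` U \<inter> space S = (\<Union>c\<in>{c. G c \<subseteq> U}. v -` G c \<inter> space S)"
    using cover by blast
  also have "\<dots> \<in> sets S"
  proof (rule sets.countable_UN'')
    fix c :: "nat \<times> nat \<times> nat" assume "c \<in> {c. G c \<subseteq> U}"
    obtain i k n where c: "c = (i, k, n)" by (cases c) auto
    have "v -` G c \<inter> space S = {t\<in>space S. \<forall>j. norm (y j) < real (Suc k) \<longrightarrow>
       norm (v t (y j) - u i (y j)) \<le> 1 / real (Suc n)}"
      using C0 by (auto simp: c G_def)
    also have "\<dots> \<in> sets S" using m by measurable
    finally show "v -` G c \<inter> space S \<in> sets S" .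
  qed auto
  finally show "v -` U \<inter> space S \<in> sets S" .
qed

text \<open>Successive approximation by a countable dense sequence of fields: taking the least
  suitable index keeps every approximant measurable, completeness of \<open>dcc\<close> gives a
  limit, and closedness puts it into \<open>F t\<close>.\<close>

theorem Kuratowski_Ryll_Nardzewski_C0:
  fixes F :: "real \<Rightarrow> ('a::euclidean_space \<Rightarrow> 'a) set"
  assumes meas: "mf_measurable T C0 dcc F"
    and F: "\<And>t. t \<in> {0..T} \<Longrightarrow> F t \<noteq> {}" "\<And>t. t \<in> {0..T} \<Longrightarrow> closedin C0_topology (F t)"
  obtains v where "\<And>t. t \<in> {0..T} \<Longrightarrow> v t \<in> F t"
    "\<And>x. (\<lambda>t. v t x) \<in> borel_measurable (lebesgue_on {0..T})"
proof -
  interpret C: Metric_space "C0 :: ('a \<Rightarrow> 'a) set" dcc by (rule Metric_space_C0_dcc)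
  define S where "S = lebesgue_on {0..T}"
  have space: "space S = {0..T}" by (simp add: S_def)
  have FC: "F t \<subseteq> C0" if "t \<in> {0..T}" for t
    using closedin_subset[OF F(2)[OF that]] by (simp add: C.topspace_mtopology)
  have meas': "Measurable.pred S (\<lambda>t. F t \<inter> U \<noteq> {})" if "openin C0_topology U" for U
  proof -
    have "{t\<in>{0..T}. F t \<inter> U \<noteq> {}} \<in> sets lebesgue" using meas that by (simp add: mf_measurable_def)
    then have "{t\<in>{0..T}. F t \<inter> U \<noteq> {}} \<in> sets S"
      unfolding S_def by (subst sets_restrict_space_iff) auto
    then show ?thesis by (simp add: pred_def space)
  qed
  obtain u :: "nat \<Rightarrow> 'a \<Rightarrow> 'a" where u: "\<And>i. u i \<in> C0" "\<And>v e. v \<in> C0 \<Longrightarrow> 0 < e \<Longrightarrow> \<exists>i. dcc v (u i) < e"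
    using C0_dcc_separable by blast
  define B where "B i r = C.mball (u i) r" for i r
  have Bo: "openin C0_topology (B i r)" for i r by (simp add: B_def C.openin_mball)
  \<comment> \<open>\<open>F t\<close> has to meet the intersection of the new ball with the
    previous one: this forces consecutive centres to be close, so the centres form a Cauchy
    sequence.\<close>
  define idx where "idx = rec_nat (\<lambda>t. LEAST i. F t \<inter> B i 1 \<noteq> {})
     (\<lambda>n f t. LEAST i. F t \<inter> (B i ((1/2) ^ Suc n) \<inter> B (f t) ((1/2) ^ n)) \<noteq> {})"
  have idx0: "idx 0 t = (LEAST i. F t \<inter> B i 1 \<noteq> {})" for t by (simp add: idx_def)
  have idxS: "idx (Suc n) t = (LEAST i. F t \<inter> (B i ((1/2) ^ Suc n) \<inter> B (idx n t) ((1/2) ^ n)) \<noteq> {})" for n t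
    by (simp add: idx_def)
  have idx_m[measurable]: "idx n \<in> measurable S (count_space UNIV)" for n
  proof (induction n)
    case 0
    have [measurable]: "Measurable.pred S (\<lambda>t. F t \<inter> B i 1 \<noteq> {})" for i by (intro meas' Bo)
    show ?case unfolding idx0[abs_def] by measurable
  next
    case (Suc n)
    note [measurable] = Suc
    have [measurable]: "Measurable.pred S (\<lambda>t. F t \<inter> (B i ((1/2) ^ Suc n) \<inter> B j ((1/2) ^ n)) \<noteq> {})" for i j
      by (intro meas' openin_Int Bo)
    have "Measurable.pred S (\<lambda>t. \<exists>j. idx n t = j \<and> F t \<inter> (B i ((1/2) ^ Suc n) \<inter> B j ((1/2) ^ n)) \<noteq> {})" for i
      by measurable
    then have [measurable]: "Measurable.pred S (\<lambda>t. F t \<inter> (B i ((1/2) ^ Suc n) \<inter> B (idx n t) ((1/2) ^ n)) \<noteq> {})" for i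
      by simp
    show ?case unfolding idxS[abs_def] by measurable
  qed
  have near: "\<exists>i. z \<in> B i e" if "z \<in> C0" "0 < e" for z e
    using u(2)[OF that] u(1) that(1) by (auto simp: B_def C.mball_def C.commute)
  have ne0: "F t \<inter> B (idx n t) ((1/2) ^ n) \<noteq> {}" if t: "t \<in> {0..T}" for n t
  proof (induction n)
    case 0
    obtain z where z: "z \<in> F t" using F(1)[OF t] by blast
    then obtain i where "z \<in> B i 1" using near[of z 1] FC[OF t] by auto
    then have "F t \<inter> B i 1 \<noteq> {}" using z by blast
    then have "F t \<inter> B (idx 0 t) 1 \<noteq> {}" unfolding idx0 by (rule LeastI)
    then show ?case by simp
  next
    case (Suc n)
    then obtain z where z: "z \<in> F t" "z \<in> B (idx n t) ((1/2) ^ n)" by blast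
    obtain i where "z \<in> B i ((1/2) ^ Suc n)" using near[of z "(1/2) ^ Suc n"] FC[OF t] z by auto
    then have "F t \<inter> (B i ((1/2) ^ Suc n) \<inter> B (idx n t) ((1/2) ^ n)) \<noteq> {}" using z by blast
    then have "F t \<inter> (B (idx (Suc n) t) ((1/2) ^ Suc n) \<inter> B (idx n t) ((1/2) ^ n)) \<noteq> {}"
      unfolding idxS by (rule LeastI)
    then show ?case by blast
  qed
  have step: "dcc (u (idx n t)) (u (idx (Suc n) t)) \<le> 2 * (1/2) ^ n" if t: "t \<in> {0..T}" for n t
  proof -
    obtain z where z: "z \<in> F t" "z \<in> B (idx n t) ((1/2) ^ n)" using ne0[OF t] by blast
    obtain i where "z \<in> B i ((1/2) ^ Suc n)" using near[of z "(1/2) ^ Suc n"] FC[OF t] z by auto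
    then have "F t \<inter> (B i ((1/2) ^ Suc n) \<inter> B (idx n t) ((1/2) ^ n)) \<noteq> {}" using z by blast
    then have "F t \<inter> (B (idx (Suc n) t) ((1/2) ^ Suc n) \<inter> B (idx n t) ((1/2) ^ n)) \<noteq> {}"
      unfolding idxS by (rule LeastI)
    then obtain z' where z': "z' \<in> C0" "dcc (u (idx n t)) z' < (1/2) ^ n" "dcc (u (idx (Suc n) t)) z' < (1/2) ^ Suc n"
      by (auto simp: B_def C.mball_def)
    have "dcc (u (idx n t)) (u (idx (Suc n) t)) \<le> dcc (u (idx n t)) z' + dcc z' (u (idx (Suc n) t))"
      using u(1) z'(1) by (intro C.triangle)
    also have "\<dots> \<le> (1/2) ^ n + (1/2) ^ Suc n" using z' by (intro add_mono) (auto simp: C.commute)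
    also have "\<dots> \<le> 2 * (1/2) ^ n" by simp
    finally show ?thesis .
  qed
  have dist_tail: "dcc (u (idx n t)) (u (idx (n + m) t)) \<le> 4 * (1/2) ^ n" if t: "t \<in> {0..T}" for n m t
  proof -
    \<comment> \<open>The subtracted term makes the induction close: passing from m to m + 1 frees
      exactly 2 (1/2)^(n+m), the bound of \<open>step\<close>.\<close>
    have "dcc (u (idx n t)) (u (idx (n + m) t)) \<le> 4 * (1/2) ^ n - 4 * (1/2) ^ (n + m)"
    proof (induction m)
      case 0
      then show ?case using u(1) C.mdist_zero by simp
    next
      case (Suc m)
      have "dcc (u (idx n t)) (u (idx (n + Suc m) t))
        \<le> dcc (u (idx n t)) (u (idx (n + m) t)) + dcc (u (idx (n + m) t)) (u (idx (n + Suc m) t))"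
        using u(1) by (intro C.triangle)
      then show ?case using Suc step[OF t, of "n + m"] by simp
    qed
    also have "\<dots> \<le> 4 * (1/2) ^ n" by simp
    finally show ?thesis .
  qed
  have "\<exists>g. g \<in> C0 \<and> (\<lambda>n. dcc (u (idx n t)) g) \<longlonglongrightarrow> 0" if t: "t \<in> {0..T}" for t
  proof -
    have "\<exists>N. \<forall>m\<ge>N. \<forall>n\<ge>N. dcc (u (idx m t)) (u (idx n t)) < e" if e: "0 < e" for e
    proof -
      obtain N where N: "(1/2) ^ N < e / 8" using ex_half_power_less[of "e/8"] e by auto
      have "dcc (u (idx m t)) (u (idx n t)) < e" if mn: "N \<le> m" "N \<le> n" for m n
      proof -
        have "dcc (u (idx m t)) (u (idx n t)) \<le> dcc (u (idx m t)) (u (idx N t)) + dcc (u (idx N t)) (u (idx n t))"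
          using u(1) by (intro C.triangle)
        also have "\<dots> \<le> 4 * (1/2) ^ N + 4 * (1/2) ^ N"
          using dist_tail[OF t, of N "m - N"] dist_tail[OF t, of N "n - N"] mn
          by (intro add_mono) (auto simp: C.commute)
        also have "\<dots> < e" using N by simp
        finally show ?thesis .
      qed
      then show ?thesis by blast
    qed
    then show ?thesis using C0_dcc_complete[of "\<lambda>n. u (idx n t)"] u(1) by metis
  qed
  then obtain v where v: "\<And>t. t \<in> {0..T} \<Longrightarrow> v t \<in> C0" "\<And>t. t \<in> {0..T} \<Longrightarrow> (\<lambda>n. dcc (u (idx n t)) (v t)) \<longlonglongrightarrow> 0"
    by metis
  show ?thesis
  proof
    fix t assume t: "t \<in> {0..T}"
    show "v t \<in> F t"
    proof (rule ccontr)
      assume "v t \<notin> F t"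
      then have "v t \<in> C0 - F t" using v(1)[OF t] by simp
      moreover have "openin C0_topology (C0 - F t)"
        using F(2)[OF t] by (simp add: closedin_def C.topspace_mtopology)
      ultimately obtain r where r: "0 < r" "C.mball (v t) r \<subseteq> C0 - F t"
        by (auto simp: C.openin_mtopology)
      have "\<forall>\<^sub>F n in sequentially. dcc (u (idx n t)) (v t) < r / 2"
        using order_tendstoD(2)[OF v(2)[OF t], of "r / 2"] r by simp
      moreover obtain N where N: "(1/2) ^ N < r / 2" using ex_half_power_less[of "r/2"] r by auto
      ultimately obtain n where n: "dcc (u (idx n t)) (v t) < r / 2" "N \<le> n"
        unfolding eventually_sequentially by (meson nle_le)
      obtain z where z: "z \<in> F t" "z \<in> C0" "dcc (u (idx n t)) z < (1/2) ^ n"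
        using ne0[OF t, of n] by (auto simp: B_def C.mball_def)
      have "dcc (v t) z \<le> dcc (v t) (u (idx n t)) + dcc (u (idx n t)) z"
        using u(1) v(1)[OF t] z by (intro C.triangle)
      also have "\<dots> < r"
      proof -
        have "(1/2::real) ^ n \<le> (1/2) ^ N" by (rule power_decreasing[OF n(2)]) auto
        then show ?thesis using n(1) z(3) N C.commute[of "v t" "u (idx n t)"] by linarith
      qed
      finally have "z \<in> C.mball (v t) r" using z v(1)[OF t] by (simp add: C.mball_def)
      then show False using r z by auto
    qed
  next
    fix x
    show "(\<lambda>t. v t x) \<in> borel_measurable (lebesgue_on {0..T})"
      unfolding S_def[symmetric]
    proof (rule borel_measurable_LIMSEQ_metric)
      show "(\<lambda>t. u (idx n t) x) \<in> borel_measurable S" for n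
        by (rule measurable_compose[OF idx_m]) simp
      fix t assume "t \<in> space S"
      then have t: "t \<in> {0..T}" by (simp add: space)
      obtain k where k: "norm x \<le> real k" using real_arch_simple by blast
      show "(\<lambda>n. u (idx n t) x) \<longlonglongrightarrow> v t x"
        using tendsto_uniform_limitI[OF dcc_LIMSEQ_0_D[OF v(2)[OF t], of k], of x] k by simp
    qed
  qed
qed

section \<open>Skorokhod representation of random sequences\<close>

text \<open>Base 4 with digits 0 and 1 only: the codes form a Cantor set, whose gaps separate
  different digits, while binary expansions are ambiguous at dyadic numbers. On codes,
  \<open>bit_shift\<close> deletes the first digit and \<open>bit_of\<close> reads a digit;
  \<open>binval\<close> is the ordinary binary value.\<close>

definition enc :: "(nat \<Rightarrow> bool) \<Rightarrow> real" where
  "enc b = (\<Sum>i. of_bool (b i) / 4 ^ Suc i)"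

definition bit_shift :: "real \<Rightarrow> real" where
  "bit_shift x = 4 * x - of_bool (1 \<le> 4 * x)"

definition bit_of :: "nat \<Rightarrow> real \<Rightarrow> bool" where
  "bit_of i x \<longleftrightarrow> 1 \<le> 4 * (bit_shift ^^ i) x"

definition binval :: "(nat \<Rightarrow> bool) \<Rightarrow> real" where
  "binval b = (\<Sum>i. of_bool (b i) / 2 ^ Suc i)"

lemma quarter_sums: "(\<lambda>i. 1 / 4 ^ Suc i) sums (1/3 :: real)"
  using sums_mult[OF geometric_sums[of "1/4::real"], of "1/4"] by (simp add: power_one_over)

lemma enc_summable: "summable (\<lambda>i. of_bool (b i) / (4::real) ^ Suc i)"
  by (rule summable_comparison_test'[OF sums_summable[OF quarter_sums], where N = 0]) (auto simp: divide_right_mono)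

lemma enc_bounds: "0 \<le> enc b" "enc b \<le> 1/3"
proof -
  show "0 \<le> enc b" unfolding enc_def by (intro suminf_nonneg enc_summable) auto
  have "enc b \<le> (\<Sum>i. 1 / 4 ^ Suc i)"
    unfolding enc_def by (intro suminf_le enc_summable sums_summable[OF quarter_sums]) (auto simp: divide_right_mono)
  then show "enc b \<le> 1/3" using sums_unique[OF quarter_sums] by simp
qed

lemma enc_Suc: "4 * enc b = of_bool (b 0) + enc (\<lambda>i. b (Suc i))"
proof -
  have "enc b = (\<Sum>i. of_bool (b (Suc i)) / 4 ^ Suc (Suc i)) + of_bool (b 0) / 4"
    unfolding enc_def using suminf_split_head[OF enc_summable[of b]] by simp
  also have "(\<Sum>i. of_bool (b (Suc i)) / (4::real) ^ Suc (Suc i)) = (\<Sum>i. 1/4 * (of_bool (b (Suc i)) / 4 ^ Suc i))"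
    by simp
  also have "\<dots> = 1/4 * enc (\<lambda>i. b (Suc i))"
    unfolding enc_def by (rule suminf_mult[OF enc_summable])
  finally show ?thesis by simp
qed

lemma one_le_enc: "1 \<le> 4 * enc b \<longleftrightarrow> b 0"
proof (cases "b 0")
  case True
  then have "4 * enc b = 1 + enc (\<lambda>i. b (Suc i))" using enc_Suc[of b] by simp
  then show ?thesis using True enc_bounds(1)[of "\<lambda>i. b (Suc i)"] by linarith
next
  case False
  then have "4 * enc b = enc (\<lambda>i. b (Suc i))" using enc_Suc[of b] by simp
  then show ?thesis using False enc_bounds(2)[of "\<lambda>i. b (Suc i)"] by linarith
qed

lemma bit_shift_enc: "bit_shift (enc b) = enc (\<lambda>i. b (Suc i))"
  by (simp only: bit_shift_def one_le_enc) (simp add: enc_Suc)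

lemma bit_shift_funpow_enc: "(bit_shift ^^ i) (enc b) = enc (\<lambda>j. b (i + j))"
  by (induction i) (simp_all add: bit_shift_enc)

lemma bit_of_enc [simp]: "bit_of i (enc b) = b i"
  by (simp add: bit_of_def bit_shift_funpow_enc one_le_enc)

text \<open>A first bit 0 puts the code into [0, 1/12], a first bit 1 into [1/4, 1/3]; the gap
  between them has length 1/6.\<close>

lemma enc_close_head:
  assumes "\<bar>enc b - enc c\<bar> < 1/6"
  shows "b 0 = c 0"
proof -
  have *: "\<not> c 0" if "b 0 = False" "\<bar>enc b - enc c\<bar> < 1/6" for b c
  proof
    assume "c 0"
    then have "4 * enc c = 1 + enc (\<lambda>i. c (Suc i))" using enc_Suc[of c] by simp
    moreover have "4 * enc b = enc (\<lambda>i. b (Suc i))" using that(1) enc_Suc[of b] by simp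
    ultimately show False
      using that(2) enc_bounds[of "\<lambda>i. c (Suc i)"] enc_bounds[of "\<lambda>i. b (Suc i)"] by linarith
  qed
  have "\<bar>enc c - enc b\<bar> < 1/6" using assms by linarith
  from *[OF _ this] *[OF _ assms] show ?thesis by blast
qed

text \<open>The first bit stabilises because of the gap. Once it is constant, 4 times the code minus
  this bit is the code of the shifted sequence and still converges, so induction reaches every
  bit.\<close>

lemma convergent_enc_bit:
  assumes "convergent (\<lambda>n. enc (b n))"
  shows "\<exists>c. \<forall>\<^sub>F n in sequentially. b n i = c"
  using assms
proof (induction i arbitrary: b)
  case 0
  have "Cauchy (\<lambda>n. enc (b n))" using 0 by (rule convergent_Cauchy)
  from metric_CauchyD[OF this, of "1/6"]
  obtain N where N: "\<forall>m\<ge>N. \<forall>n\<ge>N. dist (enc (b m)) (enc (b n)) < 1/6" by auto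
  have "b n 0 = b N 0" if "n \<ge> N" for n
    using N that by (intro enc_close_head) (simp add: dist_real_def[symmetric])
  then show ?case unfolding eventually_sequentially by blast
next
  case (Suc i)
  have "Cauchy (\<lambda>n. enc (b n))" using Suc.prems by (rule convergent_Cauchy)
  from metric_CauchyD[OF this, of "1/6"]
  obtain N where N: "\<forall>m\<ge>N. \<forall>n\<ge>N. dist (enc (b m)) (enc (b n)) < 1/6" by auto
  have b0: "b n 0 = b N 0" if "n \<ge> N" for n
    using N that by (intro enc_close_head) (simp add: dist_real_def[symmetric])
  obtain L where L: "(\<lambda>n. enc (b n)) \<longlonglongrightarrow> L" using Suc.prems by (auto simp: convergent_def)
  have "(\<lambda>n. 4 * enc (b n) - of_bool (b N 0)) \<longlonglongrightarrow> 4 * L - of_bool (b N 0)"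
    by (intro tendsto_intros L)
  moreover have "\<forall>\<^sub>F n in sequentially. 4 * enc (b n) - of_bool (b N 0) = enc (\<lambda>i. b n (Suc i))"
    using eventually_ge_at_top[of N]
  proof eventually_elim
    case (elim n)
    then show ?case using b0[OF elim] enc_Suc[of "b n"] by simp
  qed
  ultimately have "(\<lambda>n. enc (\<lambda>i. b n (Suc i))) \<longlonglongrightarrow> 4 * L - of_bool (b N 0)"
    by (rule Lim_transform_eventually)
  then show ?case using Suc.IH[of "\<lambda>n i. b n (Suc i)"] by (auto simp: convergent_def)
qed

lemma binval_summable: "summable (\<lambda>i. of_bool (b i) / (2::real) ^ Suc i)"
  by (rule summable_comparison_test'[OF sums_summable[OF power_half_series], where N = 0])
     (auto simp: power_one_over divide_right_mono)

lemma binval_diff_le: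
  assumes "\<And>i. i < N \<Longrightarrow> b i = c i"
  shows "\<bar>binval b - binval c\<bar> \<le> (1/2) ^ N"
proof -
  have tail: "0 \<le> (\<Sum>i. of_bool (b (i + N)) / (2::real) ^ Suc (i + N)) \<and>
    (\<Sum>i. of_bool (b (i + N)) / (2::real) ^ Suc (i + N)) \<le> (1/2) ^ N" for b
  proof
    have s: "summable (\<lambda>i. of_bool (b (i + N)) / (2::real) ^ Suc (i + N))"
      using binval_summable[of b] summable_iff_shift[of "\<lambda>i. of_bool (b i) / (2::real) ^ Suc i" N] by simp
    show "0 \<le> (\<Sum>i. of_bool (b (i + N)) / (2::real) ^ Suc (i + N))" by (intro suminf_nonneg s) auto
    have "(\<Sum>i. of_bool (b (i + N)) / (2::real) ^ Suc (i + N)) \<le> (\<Sum>i. (1/2) ^ N * (1/2::real) ^ Suc i)"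
      by (intro suminf_le s summable_mult sums_summable[OF power_half_series])
         (auto simp: power_add power_one_over divide_simps)
    also have "\<dots> = (1/2) ^ N"
      using suminf_mult[OF sums_summable[OF power_half_series], of "(1/2) ^ N"] sums_unique[OF power_half_series] by simp
    finally show "(\<Sum>i. of_bool (b (i + N)) / (2::real) ^ Suc (i + N)) \<le> (1/2) ^ N" .
  qed
  have split: "binval b = (\<Sum>i. of_bool (b (i + N)) / (2::real) ^ Suc (i + N)) + (\<Sum>i<N. of_bool (b i) / 2 ^ Suc i)" for b
    unfolding binval_def by (rule suminf_split_initial_segment[OF binval_summable])
  have "(\<Sum>i<N. of_bool (b i) / 2 ^ Suc i) = (\<Sum>i<N. of_bool (c i) / (2::real) ^ Suc i)"
    using assms by (intro sum.cong) auto
  then show ?thesis using split[of b] split[of c] tail[of b] tail[of c] by linarith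
qed

lemma binval_tendsto:
  assumes "\<And>i. \<forall>\<^sub>F n in sequentially. b n i = c i"
  shows "(\<lambda>n. binval (b n)) \<longlonglongrightarrow> binval c"
proof (rule LIMSEQ_I)
  fix r :: real assume "0 < r"
  then obtain N where N: "(1/2) ^ N < r" using real_arch_pow_inv[of r "1/2"] by auto
  have "\<forall>\<^sub>F n in sequentially. \<forall>i\<in>{..<N}. b n i = c i"
    using assms by (intro eventually_ball_finite) auto
  then obtain n0 where "\<And>n. n \<ge> n0 \<Longrightarrow> \<forall>i<N. b n i = c i"
    unfolding eventually_sequentially by auto
  then have "norm (binval (b n) - binval c) < r" if "n \<ge> n0" for n
    using binval_diff_le[of N "b n" c] N that by (simp add: order_le_less_trans)
  then show "\<exists>n0. \<forall>n\<ge>n0. norm (binval (b n) - binval c) < r" by blast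
qed

text \<open>The n-th partial sum is floor(2^n z) / 2^n.\<close>

lemma binval_binary_digits:
  assumes "0 \<le> z" "z < 1"
  shows "binval (\<lambda>i. odd \<lfloor>2 ^ Suc i * z\<rfloor>) = z"
proof -
  have parity: "real_of_int x = 2 * of_int (x div 2) + of_bool (odd x)" for x
    by (cases "odd x") (auto elim!: evenE oddE)
  have part: "(\<Sum>i<n. of_bool (odd \<lfloor>2 ^ Suc i * z\<rfloor>) / 2 ^ Suc i) = (of_int \<lfloor>2 ^ n * z\<rfloor> / 2 ^ n :: real)" for n
  proof (induction n)
    case 0
    have "\<lfloor>z\<rfloor> = 0" using assms by (simp add: floor_eq_iff)
    then show ?case by simp
  next
    case (Suc n)
    have "\<lfloor>2 ^ Suc n * z\<rfloor> div 2 = \<lfloor>2 ^ n * z\<rfloor>"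
      using floor_divide_real_eq_div[of 2 "2 ^ Suc n * z"] by simp
    then have "real_of_int \<lfloor>2 ^ Suc n * z\<rfloor> = 2 * of_int \<lfloor>2 ^ n * z\<rfloor> + of_bool (odd \<lfloor>2 ^ Suc n * z\<rfloor>)"
      using parity[of "\<lfloor>2 ^ Suc n * z\<rfloor>"] by (simp only:)
    then have "real_of_int \<lfloor>2 ^ Suc n * z\<rfloor> / 2 ^ Suc n
      = (2 * of_int \<lfloor>2 ^ n * z\<rfloor> + of_bool (odd \<lfloor>2 ^ Suc n * z\<rfloor>)) / 2 ^ Suc n" by (rule arg_cong)
    also have "\<dots> = of_int \<lfloor>2 ^ n * z\<rfloor> / 2 ^ n + of_bool (odd \<lfloor>2 ^ Suc n * z\<rfloor>) / 2 ^ Suc n"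
      unfolding add_divide_distrib by simp
    finally show ?case unfolding sum.lessThan_Suc Suc by (rule sym)
  qed
  have "(\<lambda>n. of_int \<lfloor>2 ^ n * z\<rfloor> / 2 ^ n) \<longlonglongrightarrow> z"
  proof (rule LIMSEQ_I)
    fix r :: real assume "0 < r"
    then obtain N where N: "(1/2) ^ N < r" using real_arch_pow_inv[of r "1/2"] by auto
    have "norm (of_int \<lfloor>2 ^ n * z\<rfloor> / 2 ^ n - z) < r" if "n \<ge> N" for n
    proof -
      have f: "of_int \<lfloor>2 ^ n * z\<rfloor> \<le> 2 ^ n * z" "2 ^ n * z < of_int \<lfloor>2 ^ n * z\<rfloor> + 1" by linarith+
      have "of_int \<lfloor>2 ^ n * z\<rfloor> / 2 ^ n - z = (of_int \<lfloor>2 ^ n * z\<rfloor> - 2 ^ n * z) / 2 ^ n"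
        by (simp add: diff_divide_distrib)
      then have "norm (of_int \<lfloor>2 ^ n * z\<rfloor> / 2 ^ n - z) = \<bar>of_int \<lfloor>2 ^ n * z\<rfloor> - 2 ^ n * z\<bar> / 2 ^ n"
        by simp
      also have "\<dots> \<le> 1 / 2 ^ n"
      proof (rule divide_right_mono)
        show "\<bar>of_int \<lfloor>2 ^ n * z\<rfloor> - 2 ^ n * z\<bar> \<le> 1" using f by linarith
      qed simp
      also have "\<dots> \<le> (1/2) ^ N" using power_decreasing[OF that, of "1/2::real"] by (simp add: power_one_over)
      finally show ?thesis using N by simp
    qed
    then show "\<exists>N. \<forall>n\<ge>N. norm (of_int \<lfloor>2 ^ n * z\<rfloor> / 2 ^ n - z) < r" by blast
  qed
  moreover have "(\<lambda>n. \<Sum>i<n. of_bool (odd \<lfloor>2 ^ Suc i * z\<rfloor>) / 2 ^ Suc i) \<longlonglongrightarrow> binval (\<lambda>i. odd \<lfloor>2 ^ Suc i * z\<rfloor>)"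
    unfolding binval_def by (rule summable_LIMSEQ[OF binval_summable])
  ultimately show ?thesis unfolding part using LIMSEQ_unique by blast
qed

section \<open>Bounded coordinates and the representation of real sequences\<close>

text \<open>A homeomorphism of the real line onto (0,1), where binary digits are available;
  \<open>unsquash\<close> is its inverse.\<close>

definition squash :: "real \<Rightarrow> real" where "squash r = (1 + r / (1 + \<bar>r\<bar>)) / 2"
definition unsquash :: "real \<Rightarrow> real" where "unsquash s = (2 * s - 1) / (1 - \<bar>2 * s - 1\<bar>)"

lemma squash_bounds: "0 < squash r" "squash r < 1"
proof -
  have "\<bar>r / (1 + \<bar>r\<bar>)\<bar> < 1" by (simp add: divide_simps)
  then show "0 < squash r" "squash r < 1" by (auto simp: squash_def abs_if split: if_splits)
qed

lemma two_squash: "2 * squash r - 1 = r / (1 + \<bar>r\<bar>)"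
proof -
  define q where "q = r / (1 + \<bar>r\<bar>)"
  have "2 * squash r - 1 = q" unfolding squash_def q_def[symmetric] by (simp add: field_simps)
  then show ?thesis by (simp add: q_def)
qed

lemma unsquash_squash: "unsquash (squash r) = r"
proof -
  note two_squash[of r]
  moreover have "1 - \<bar>r / (1 + \<bar>r\<bar>)\<bar> = 1 / (1 + \<bar>r\<bar>)"
    by (simp add: abs_divide field_simps)
  ultimately show ?thesis unfolding unsquash_def by (simp only:) (simp add: divide_simps)
qed

lemma squash_unsquash:
  assumes "0 < s" "s < 1"
  shows "squash (unsquash s) = s"
proof -
  define t where "t = 2 * s - 1"
  have t: "\<bar>t\<bar> < 1" using assms by (auto simp: t_def abs_if)
  have "\<bar>t / (1 - \<bar>t\<bar>)\<bar> = \<bar>t\<bar> / (1 - \<bar>t\<bar>)" using t by (simp add: abs_divide)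
  then have "1 + \<bar>t / (1 - \<bar>t\<bar>)\<bar> = 1 / (1 - \<bar>t\<bar>)" using t by (simp add: field_simps)
  then have "t / (1 - \<bar>t\<bar>) / (1 + \<bar>t / (1 - \<bar>t\<bar>)\<bar>) = t" using t by simp
  then have "squash (unsquash s) = (1 + t) / 2" unfolding squash_def unsquash_def t_def by simp
  then show ?thesis by (simp add: t_def)
qed

lemma squash_measurable [measurable]: "squash \<in> borel_measurable borel"
  unfolding squash_def[abs_def] by measurable

lemma unsquash_measurable [measurable]: "unsquash \<in> borel_measurable borel"
  unfolding unsquash_def[abs_def] by measurable

lemma bit_shift_measurable [measurable]: "bit_shift \<in> borel_measurable borel"
  unfolding bit_shift_def[abs_def] of_bool_def by measurable

lemma bit_of_measurable [measurable]: "Measurable.pred borel (bit_of i)"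
proof -
  have "(bit_shift ^^ i) \<in> borel_measurable borel"
    by (induction i) (auto simp: o_def intro: measurable_compose[OF _ bit_shift_measurable])
  then show ?thesis unfolding bit_of_def[abs_def] by measurable
qed

lemma binval_measurable:
  assumes [measurable]: "\<And>i. Measurable.pred M (\<lambda>x. b x i)"
  shows "(\<lambda>x. binval (b x)) \<in> borel_measurable M"
  unfolding binval_def of_bool_def by measurable

lemma enc_measurable:
  assumes [measurable]: "\<And>i. Measurable.pred M (\<lambda>x. b x i)"
  shows "(\<lambda>x. enc (b x)) \<in> borel_measurable M"
  unfolding enc_def of_bool_def by measurable

text \<open>Coding countably many reals by a point of a Cantor set reduces the Skorokhod representation
  for random sequences to the one for real random variables.\<close>

theorem Skorokhod_random_sequences:
  fixes Z :: "nat \<Rightarrow> nat \<Rightarrow> 'a \<Rightarrow> real"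
  assumes "prob_space M" and Z: "\<And>n j. Z n j \<in> borel_measurable M"
  obtains r :: "nat \<Rightarrow> nat" and \<Omega> :: "real measure" and Y :: "nat \<Rightarrow> nat \<Rightarrow> real \<Rightarrow> real"
  where "strict_mono r" "prob_space \<Omega>" "\<And>n j. Y n j \<in> borel_measurable \<Omega>"
    "\<And>n. distr \<Omega> (Pi\<^sub>M UNIV (\<lambda>_. borel)) (\<lambda>\<omega> j. Y n j \<omega>) = distr M (Pi\<^sub>M UNIV (\<lambda>_. borel)) (\<lambda>\<omega> j. Z (r n) j \<omega>)"
    "AE \<omega> in \<Omega>. \<forall>j. convergent (\<lambda>n. Y n j \<omega> / (1 + \<bar>Y n j \<omega>\<bar>))"
proof -
  interpret M: prob_space M by fact
  \<comment> \<open>All binary digits of all squashed coordinates, interleaved by the pairing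
    function, become one point of the Cantor set; \<open>val j\<close> decodes the j-th squashed
    coordinate.\<close>
  define E where "E z = enc (\<lambda>k. case prod_decode k of (j, i) \<Rightarrow> odd \<lfloor>2 ^ Suc i * squash (z j)\<rfloor>)" for z :: "nat \<Rightarrow> real"
  define val where "val j x = binval (\<lambda>i. bit_of (prod_encode (j, i)) x)" for j x
  have val_E: "val j (E z) = squash (z j)" for j z
    using squash_bounds[of "z j"] binval_binary_digits[of "squash (z j)"] by (simp add: val_def E_def)
  have val_m[measurable]: "val j \<in> borel_measurable borel" for j
    unfolding val_def[abs_def] by (rule binval_measurable) simp
  have Em[measurable]: "(\<lambda>\<omega>. E (\<lambda>j. Z n j \<omega>)) \<in> borel_measurable M" for n
    unfolding E_def
  proof (rule enc_measurable)
    fix k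
    obtain j i where "prod_decode k = (j, i)" by (cases "prod_decode k")
    then show "Measurable.pred M (\<lambda>x. case prod_decode k of (j, i) \<Rightarrow> odd \<lfloor>2 ^ Suc i * squash (Z n j x)\<rfloor>)"
      using Z[of n j, measurable] by simp
  qed
  define \<mu> where "\<mu> n = distr M borel (\<lambda>\<omega>. E (\<lambda>j. Z n j \<omega>))" for n
  have \<mu>: "real_distribution (\<mu> n)" for n
    unfolding \<mu>_def by (rule M.real_distribution_distr) simp
  \<comment> \<open>Tightness is automatic, since all codes lie in [0, 1/3].\<close>
  have "tight \<mu>"
    unfolding tight_def
  proof (intro conjI allI impI \<mu>)
    fix \<epsilon> :: real assume "0 < \<epsilon>"
    have "measure (\<mu> n) {-1<..1} = 1" for n
    proof -
      have "(\<lambda>\<omega>. E (\<lambda>j. Z n j \<omega>)) -` {-1<..1} \<inter> space M = space M"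
      proof -
        have "-1 < E z" "E z \<le> 1" for z
          unfolding E_def by (rule less_le_trans[OF _ enc_bounds(1)], simp) (rule order_trans[OF enc_bounds(2)], simp)
        then show ?thesis by auto
      qed
      then show ?thesis unfolding \<mu>_def by (subst measure_distr) (auto simp: M.prob_space)
    qed
    then show "\<exists>a b. a < b \<and> (\<forall>n. 1 - \<epsilon> < measure (\<mu> n) {a<..b})"
      using \<open>0 < \<epsilon>\<close> by (intro exI[of _ "-1"] exI[of _ 1]) simp
  qed
  then obtain r \<nu> where r: "strict_mono r" and \<nu>: "real_distribution \<nu>" "weak_conv_m (\<mu> \<circ> id \<circ> r) \<nu>"
    using tight_imp_convergent_subsubsequence[of \<mu> id] strict_mono_id by blast
  have "\<exists>\<Omega> S Y. prob_space \<Omega> \<and> (\<forall>n. S n \<in> borel_measurable \<Omega>) \<and>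
      (\<forall>n. distr \<Omega> borel (S n) = \<mu> (r n)) \<and> Y \<in> \<Omega> \<rightarrow>\<^sub>M lborel \<and> distr \<Omega> borel Y = \<nu> \<and>
      (\<forall>x\<in>space (\<Omega> :: real measure). (\<lambda>n. S n x) \<longlonglongrightarrow> (Y x :: real))"
    using Skorohod[of "\<mu> \<circ> id \<circ> r" \<nu>] \<mu> \<nu> by simp
  then obtain \<Omega> :: "real measure" and S Y0 where \<Omega>: "prob_space \<Omega>" and S[measurable]: "\<And>n. S n \<in> borel_measurable \<Omega>"
    and dS: "\<And>n. distr \<Omega> borel (S n) = \<mu> (r n)" and lim: "\<And>x. x \<in> space \<Omega> \<Longrightarrow> (\<lambda>n. S n x) \<longlonglongrightarrow> (Y0 x :: real)"
    by blast
  define Y where "Y n j \<omega> = unsquash (val j (S n \<omega>))" for n j \<omega>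
  \<comment> \<open>The codes whose decoded coordinates stay inside (0,1). The laws are carried by
    this set, so almost every value of \<open>S n\<close> is a genuine code and
    \<open>unsquash\<close> can be inverted on its coordinates.\<close>
  define G where "G = {x. enc (\<lambda>i. bit_of i x) = x \<and> (\<forall>j. 0 < val j x \<and> val j x < 1)}"
  have Gm: "Measurable.pred borel (\<lambda>x. x \<in> G)"
  proof -
    have [measurable]: "(\<lambda>x. enc (\<lambda>i. bit_of i x)) \<in> borel_measurable borel"
      by (rule enc_measurable) simp
    show ?thesis unfolding G_def mem_Collect_eq by measurable
  qed
  have EG: "E z \<in> G" for z
    using squash_bounds by (simp add: G_def val_E) (simp add: E_def)
  have SG: "AE \<omega> in \<Omega>. \<forall>n. S n \<omega> \<in> G"
    unfolding AE_all_countable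
  proof
    fix n
    have "AE x in distr \<Omega> borel (S n). x \<in> G"
      unfolding dS \<mu>_def using Gm EG by (subst AE_distr_iff) (auto simp: pred_def)
    then show "AE \<omega> in \<Omega>. S n \<omega> \<in> G"
      using Gm by (subst (asm) AE_distr_iff) (auto simp: pred_def)
  qed
  show ?thesis
  proof
    show "strict_mono r" by fact
    show "prob_space \<Omega>" by fact
    show Ym: "Y n j \<in> borel_measurable \<Omega>" for n j
      unfolding Y_def[abs_def] by measurable
    show "distr \<Omega> (Pi\<^sub>M UNIV (\<lambda>_. borel)) (\<lambda>\<omega> j. Y n j \<omega>) = distr M (Pi\<^sub>M UNIV (\<lambda>_. borel)) (\<lambda>\<omega> j. Z (r n) j \<omega>)" for n
    proof -
      have D: "(\<lambda>x j. unsquash (val j x)) \<in> measurable borel (Pi\<^sub>M UNIV (\<lambda>_. borel))"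
        by (rule measurable_PiM_single') auto
      have "distr \<Omega> (Pi\<^sub>M UNIV (\<lambda>_. borel)) (\<lambda>\<omega> j. Y n j \<omega>) = distr (distr \<Omega> borel (S n)) (Pi\<^sub>M UNIV (\<lambda>_. borel)) (\<lambda>x j. unsquash (val j x))"
        by (subst distr_distr[OF D S]) (simp add: o_def Y_def)
      also have "\<dots> = distr M (Pi\<^sub>M UNIV (\<lambda>_. borel)) (\<lambda>\<omega> j. Z (r n) j \<omega>)"
        unfolding dS \<mu>_def by (subst distr_distr[OF D Em]) (simp add: o_def val_E unsquash_squash)
      finally show ?thesis .
    qed
    \<comment> \<open>Only the squashed coordinates converge: the limit of \<open>val j\<close> may
      be 0 or 1, that is, a coordinate may escape to infinity. A moment bound excludes this in
      \<open>Skorokhod_random_vectors\<close>.\<close>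
    show "AE \<omega> in \<Omega>. \<forall>j. convergent (\<lambda>n. Y n j \<omega> / (1 + \<bar>Y n j \<omega>\<bar>))"
      using SG AE_space
    proof eventually_elim
      case (elim \<omega>)
      have "convergent (\<lambda>n. enc (\<lambda>i. bit_of i (S n \<omega>)))"
        using lim[OF elim(2)] elim(1) by (auto simp: G_def convergent_def)
      from convergent_enc_bit[OF this]
      obtain c where c: "\<And>i. \<forall>\<^sub>F n in sequentially. bit_of i (S n \<omega>) = c i" by metis
      show ?case
      proof
        fix j
        have "(\<lambda>n. val j (S n \<omega>)) \<longlonglongrightarrow> binval (\<lambda>i. c (prod_encode (j, i)))"
          unfolding val_def by (rule binval_tendsto) (rule c)
        moreover have "squash (Y n j \<omega>) = val j (S n \<omega>)" for n
          unfolding Y_def using elim(1) by (intro squash_unsquash) (auto simp: G_def)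
        ultimately have "(\<lambda>n. 2 * squash (Y n j \<omega>) - 1) \<longlonglongrightarrow> 2 * binval (\<lambda>i. c (prod_encode (j, i))) - 1"
          by (intro tendsto_intros) simp
        then show "convergent (\<lambda>n. Y n j \<omega> / (1 + \<bar>Y n j \<omega>\<bar>))"
          unfolding two_squash by (auto simp: convergent_def)
      qed
    qed
  qed
qed

section \<open>Almost everywhere convergence of convex combinations\<close>

text \<open>Supports in [n, N) move to infinity with \<open>n\<close>, so combinations of a
  convergent sequence inherit its limit; this is what keeps the weak equation valid for the combined
  velocities.\<close>

definition tail_weights :: "nat \<Rightarrow> nat \<Rightarrow> (nat \<Rightarrow> real) \<Rightarrow> bool" where
  "tail_weights n N c \<longleftrightarrow> (\<forall>k. 0 \<le> c k) \<and> (\<forall>k<n. c k = 0) \<and> (\<forall>k\<ge>N. c k = 0) \<and> (\<Sum>k<N. c k) = 1"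

lemma tail_weights_mono: "tail_weights n N c \<Longrightarrow> m \<le> n \<Longrightarrow> tail_weights m N c"
  by (auto simp: tail_weights_def)

lemma sum_extend_zero:
  fixes g :: "nat \<Rightarrow> 'b::comm_monoid_add"
  assumes "N \<le> N'" "\<And>k. N \<le> k \<Longrightarrow> g k = 0"
  shows "(\<Sum>k<N'. g k) = (\<Sum>k<N. g k)"
  using assms by (intro sum.mono_neutral_right) auto

lemma tail_weights_extend: "tail_weights n N c \<Longrightarrow> N \<le> N' \<Longrightarrow> tail_weights n N' c"
  using sum_extend_zero[of N N' c] by (auto simp: tail_weights_def)

lemma norm_weighted_sum_le:
  fixes f :: "nat \<Rightarrow> 'b::real_normed_vector"
  assumes "tail_weights n N c" "\<And>k. n \<le> k \<Longrightarrow> norm (f k) \<le> B"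
  shows "norm (\<Sum>k<N. c k *\<^sub>R f k) \<le> B"
proof -
  have "norm (\<Sum>k<N. c k *\<^sub>R f k) \<le> (\<Sum>k<N. norm (c k *\<^sub>R f k))" by (rule norm_sum)
  also have "\<dots> \<le> (\<Sum>k<N. c k * B)"
  proof (rule sum_mono)
    fix k
    show "norm (c k *\<^sub>R f k) \<le> c k * B"
      using assms by (cases "k < n") (auto simp: tail_weights_def mult_left_mono)
  qed
  also have "\<dots> = B" using assms(1) by (simp add: tail_weights_def flip: sum_distrib_right)
  finally show ?thesis .
qed

text \<open>Almost minimal tail combinations in \<open>L\<^sup>2\<close> are Cauchy by the parallelogram identity.\<close>

theorem tail_combinations_converge_AE:
  fixes f :: "nat \<Rightarrow> 'x \<Rightarrow> 'b::euclidean_space"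
  assumes "finite_measure M" and [measurable]: "\<And>n. f n \<in> borel_measurable M"
    and B: "\<And>n x. norm (f n x) \<le> B"
  obtains c :: "nat \<Rightarrow> nat \<Rightarrow> real" and N :: "nat \<Rightarrow> nat"
  where "\<And>n. tail_weights n (N n) (c n)"
    "AE x in M. convergent (\<lambda>n. \<Sum>k<N n. c n k *\<^sub>R f k x)"
proof -
  interpret M: finite_measure M by fact
  define comb where "comb N c x = (\<Sum>k<N. c k *\<^sub>R f k x)" for N :: nat and c x
  define Q where "Q N c = (\<integral>x. (norm (comb N c x))\<^sup>2 \<partial>M)" for N c
  \<comment> \<open>Smallest energy of combinations from the tail at \<open>n\<close>; it increases
    with \<open>n\<close> to a finite limit \<open>L\<close>.\<close>
  define d where "d n = Inf {Q N c |N c. tail_weights n N c}" for n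
  have [measurable]: "comb N c \<in> borel_measurable M" for N c
    unfolding comb_def[abs_def] by measurable
  have bd: "norm (comb N c x) \<le> B" if "tail_weights n N c" for n N c x
    unfolding comb_def using that B by (rule norm_weighted_sum_le)
  have int: "integrable M (\<lambda>x. (norm (comb N c x))\<^sup>2)" if "tail_weights n N c" for n N c
  proof (rule M.integrable_const_bound[where B = "B\<^sup>2"])
    show "AE x in M. norm ((norm (comb N c x))\<^sup>2) \<le> B\<^sup>2"
      using bd[OF that] by (auto intro!: power_mono)
  qed measurable
  have Q0: "0 \<le> Q N c" for N c unfolding Q_def by simp
  have Qle: "Q N c \<le> B\<^sup>2 * measure M (space M)" if "tail_weights n N c" for n N c
  proof -
    have "Q N c \<le> (\<integral>x. B\<^sup>2 \<partial>M)"
      unfolding Q_def using int[OF that] bd[OF that] by (intro integral_mono) (auto intro!: power_mono)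
    then show ?thesis by (simp add: mult.commute)
  qed
  have ex: "tail_weights n (Suc n) (\<lambda>k. of_bool (k = n))" for n
    by (auto simp: tail_weights_def of_bool_def)
  have bb: "bdd_below {Q N c |N c. tail_weights n N c}" for n
    using Q0 by (auto intro!: bdd_belowI[of _ 0])
  have d_le: "d n \<le> Q N c" if "tail_weights n N c" for n N c
    unfolding d_def using that by (intro cInf_lower bb) auto
  have d_mono: "d m \<le> d n" if "m \<le> n" for m n
    unfolding d_def
  proof (rule cInf_superset_mono[OF _ bb])
    show "{Q N c |N c. tail_weights n N c} \<noteq> {}" using ex by blast
    show "{Q N c |N c. tail_weights n N c} \<subseteq> {Q N c |N c. tail_weights m N c}"
      using tail_weights_mono[OF _ that] by blast
  qed
  have "bdd_above (range d)"
    using d_le[OF ex] Qle[OF ex] by (intro bdd_aboveI[of _ "B\<^sup>2 * measure M (space M)"]) (auto intro: order_trans)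
  define L where "L = (SUP n. d n)"
  have dL: "d n \<le> L" for n unfolding L_def by (intro cSUP_upper \<open>bdd_above (range d)\<close>) simp
  \<comment> \<open>The combination is almost minimal in a tail so late that its infimum is almost
    \<open>L\<close>. The rate 4^(-n) leads to squared distances of order 4^(-n), hence to summable
    L^2 distances.\<close>
  have "\<exists>k N c. n \<le> k \<and> L - (1/4) ^ n < d k \<and> tail_weights k N c \<and> Q N c < L + (1/4) ^ n" for n
  proof -
    obtain k' where "L - (1/4) ^ n < d k'"
      using less_cSUP_iff[of UNIV d "L - (1/4) ^ n"] \<open>bdd_above (range d)\<close> unfolding L_def by auto
    then have k: "L - (1/4) ^ n < d (max k' n)" using d_mono[of k' "max k' n"] by simp
    have "d (max k' n) < L + (1/4) ^ n" using dL[of "max k' n"] by (simp add: add_strict_increasing2 order_le_less_trans)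
    then obtain q where "q \<in> {Q N c |N c. tail_weights (max k' n) N c}" "q < L + (1/4) ^ n"
      unfolding d_def using ex by (subst (asm) cInf_less_iff[OF _ bb]) blast+
    then obtain N c where "q = Q N c" "tail_weights (max k' n) N c" by blast
    then show ?thesis
      using k \<open>q < L + (1/4) ^ n\<close> by (intro exI[of _ "max k' n"] exI[of _ N] exI[of _ c]) auto
  qed
  then obtain K N c where K: "\<And>n. n \<le> K n" "\<And>n. L - (1/4) ^ n < d (K n)"
    and c: "\<And>n. tail_weights (K n) (N n) (c n)" and Qc: "\<And>n. Q (N n) (c n) < L + (1/4) ^ n"
    by metis
  define \<Delta> where "\<Delta> n x = comb (N (Suc n)) (c (Suc n)) x - comb (N n) (c n) x" for n x
  have [measurable]: "\<Delta> n \<in> borel_measurable M" for n unfolding \<Delta>_def[abs_def] by measurable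
  have \<Delta>2: "integrable M (\<lambda>x. (norm (\<Delta> n x))\<^sup>2) \<and> (\<integral>x. (norm (\<Delta> n x))\<^sup>2 \<partial>M) \<le> 8 * (1/4) ^ n" for n
  proof -
    define N' where "N' = max (N n) (N (Suc n))"
    \<comment> \<open>The midpoint of two consecutive combinations is again a tail combination, so
      its energy is at least L - 4^(-n). In the parallelogram identity the terms in \<open>L\<close>
      cancel and (2 + 2 + 4) 4^(-n) remains.\<close>
    define h where "h k = (c n k + c (Suc n) k) / 2" for k
    define m where "m = min (K n) (K (Suc n))"
    have c1: "tail_weights m N' (c n)" and c2: "tail_weights m N' (c (Suc n))"
      using tail_weights_extend[OF tail_weights_mono[OF c[of n]]] tail_weights_extend[OF tail_weights_mono[OF c[of "Suc n"]]]
      by (auto simp: m_def N'_def)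
    have h: "tail_weights m N' h"
      using c1 c2 by (auto simp: tail_weights_def h_def sum.distrib simp flip: sum_divide_distrib)
    have e1: "comb N' (c n) = comb (N n) (c n)" and e2: "comb N' (c (Suc n)) = comb (N (Suc n)) (c (Suc n))"
      unfolding comb_def using c[of n] c[of "Suc n"]
      by (auto intro!: ext sum_extend_zero simp: N'_def tail_weights_def)
    have hc: "comb N' h x = (1/2) *\<^sub>R (comb (N n) (c n) x + comb (N (Suc n)) (c (Suc n)) x)" for x
      unfolding e1[symmetric] e2[symmetric] comb_def h_def
      by (simp add: scaleR_sum_right scaleR_right_distrib sum.distrib scaleR_add_left add_divide_distrib)
    have par: "(norm (\<Delta> n x))\<^sup>2 = 2 * (norm (comb (N n) (c n) x))\<^sup>2 + 2 * (norm (comb (N (Suc n)) (c (Suc n)) x))\<^sup>2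
        - 4 * (norm (comb N' h x))\<^sup>2" for x
      unfolding hc \<Delta>_def by (simp add: power2_norm_eq_inner inner_simps inner_commute algebra_simps)
    note i = int[OF c[of n]] int[OF c[of "Suc n"]] int[OF h]
    have "(\<integral>x. (norm (\<Delta> n x))\<^sup>2 \<partial>M) = 2 * Q (N n) (c n) + 2 * Q (N (Suc n)) (c (Suc n)) - 4 * Q N' h"
      unfolding par Q_def using i by simp
    also have "\<dots> \<le> 2 * (L + (1/4) ^ n) + 2 * (L + (1/4) ^ n) - 4 * (L - (1/4) ^ n)"
    proof -
      have 4: "(1/4::real) ^ Suc n \<le> (1/4) ^ n" by simp
      have "L - (1/4) ^ n < d (K (Suc n))" using K(2)[of "Suc n"] 4 by linarith
      then have "L - (1/4) ^ n \<le> d m"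
        using K(2)[of n] by (simp add: m_def min_def)
      have gen: "2 * a + 2 * b - 4 * q \<le> 2 * (L + e) + 2 * (L + e) - 4 * (L - e)"
        if "a < L + e" "b < L + e'" "e' \<le> e" "L - e \<le> d'" "d' \<le> q" for a b q d' e e' :: real
      proof (intro diff_mono add_mono mult_left_mono)
        show "a \<le> L + e" using that by linarith
        show "b \<le> L + e" using that by linarith
        show "L - e \<le> q" using that by linarith
      qed auto
      show ?thesis
        by (rule gen[OF Qc[of n] Qc[of "Suc n"] 4 \<open>L - (1/4) ^ n \<le> d m\<close> d_le[OF h]])
    qed
    finally show ?thesis using i by (simp add: par)
  qed
  have \<Delta>1: "(\<integral>\<^sup>+x. ennreal (norm (\<Delta> n x)) \<partial>M) \<le> ennreal ((measure M (space M) + 8) * (1/2) ^ n)" for n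
  proof -
    \<comment> \<open>The inequality a <= 2^(-n) + 2^n a^2 passes from L^2 to L^1 and keeps both
      terms summable.\<close>
    have pw: "norm (\<Delta> n x) \<le> (1/2) ^ n + 2 ^ n * (norm (\<Delta> n x))\<^sup>2" for x
    proof (cases "norm (\<Delta> n x) \<le> (1/2) ^ n")
      case False
      have "1 * norm (\<Delta> n x) \<le> (2 ^ n * norm (\<Delta> n x)) * norm (\<Delta> n x)"
        using False by (intro mult_right_mono) (auto simp: power_one_over field_simps)
      then show ?thesis by (simp add: power2_eq_square mult.assoc add_increasing)
    qed (simp add: add_increasing2)
    have "(\<integral>\<^sup>+x. ennreal (norm (\<Delta> n x)) \<partial>M) \<le> (\<integral>\<^sup>+x. ennreal ((1/2) ^ n + 2 ^ n * (norm (\<Delta> n x))\<^sup>2) \<partial>M)"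
      by (intro nn_integral_mono ennreal_leI pw)
    also have "\<dots> = ennreal (\<integral>x. (1/2) ^ n + 2 ^ n * (norm (\<Delta> n x))\<^sup>2 \<partial>M)"
      using \<Delta>2[of n] by (intro nn_integral_eq_integral) auto
    also have "(\<integral>x. (1/2) ^ n + 2 ^ n * (norm (\<Delta> n x))\<^sup>2 \<partial>M) = (1/2) ^ n * measure M (space M) + 2 ^ n * (\<integral>x. (norm (\<Delta> n x))\<^sup>2 \<partial>M)"
      using \<Delta>2[of n] by (subst Bochner_Integration.integral_add) auto
    also have "\<dots> \<le> (1/2) ^ n * measure M (space M) + 2 ^ n * (8 * (1/4) ^ n)"
      using \<Delta>2[of n] by (intro add_left_mono mult_left_mono) auto
    also have "(2::real) ^ n * (8 * (1/4) ^ n) = 8 * (1/2) ^ n"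
      by (simp flip: power_mult_distrib)
    also have "(1/2) ^ n * measure M (space M) + 8 * (1/2) ^ n = (measure M (space M) + 8) * (1/2) ^ n"
      by (simp add: algebra_simps)
    finally show ?thesis by (simp add: ennreal_leI)
  qed
  have "(\<integral>\<^sup>+x. (\<Sum>n. ennreal (norm (\<Delta> n x))) \<partial>M) = (\<Sum>n. \<integral>\<^sup>+x. ennreal (norm (\<Delta> n x)) \<partial>M)"
    by (rule nn_integral_suminf) measurable
  also have "\<dots> \<le> (\<Sum>n. ennreal ((measure M (space M) + 8) * (1/2) ^ n))"
    by (intro suminf_le \<Delta>1) auto
  also have "\<dots> < \<infinity>"
  proof -
    have "summable (\<lambda>n. (measure M (space M) + 8) * (1/2::real) ^ n)"
      by (intro summable_mult summable_geometric) simp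
    then show ?thesis by (subst suminf_ennreal2) auto
  qed
  finally have "AE x in M. (\<Sum>n. ennreal (norm (\<Delta> n x))) \<noteq> \<infinity>"
    by (intro nn_integral_PInf_AE) auto
  then have "AE x in M. convergent (\<lambda>n. comb (N n) (c n) x)"
  proof eventually_elim
    case (elim x)
    have "summable (\<lambda>n. norm (\<Delta> n x))"
      using elim by (intro summable_suminf_not_top) auto
    then have "summable (\<lambda>n. \<Delta> n x)" by (rule summable_norm_cancel)
    then have "(\<lambda>n. \<Sum>i<n. \<Delta> i x) \<longlonglongrightarrow> (\<Sum>n. \<Delta> n x)" by (rule summable_LIMSEQ)
    moreover have "(\<Sum>i<n. \<Delta> i x) = comb (N n) (c n) x - comb (N 0) (c 0) x" for n
      unfolding \<Delta>_def by (rule sum_lessThan_telescope)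
    ultimately have "(\<lambda>n. comb (N n) (c n) x - comb (N 0) (c 0) x + comb (N 0) (c 0) x) \<longlonglongrightarrow> (\<Sum>n. \<Delta> n x) + comb (N 0) (c 0) x"
      by (intro tendsto_intros) simp
    then show ?case by (auto simp: convergent_def)
  qed
  then show ?thesis
    using that[of N c] tail_weights_mono[OF c K(1)] by (simp add: comb_def)
qed

section \<open>Test functions and integrals\<close>

text \<open>Translates the encoding of test functions by iterated directional derivatives into one
  space-time gradient field \<open>G\<close>, bounded and uniformly continuous because its support
  is compact. The weak formulation then has the integrand
  \<open>G (t, x) \<bullet> (1, v t x)\<close>.\<close>

lemma test_function_gradient:
  fixes \<phi> :: "real \<times> 'a::euclidean_space \<Rightarrow> real"
  assumes "\<phi> \<in> test_functions T"
  obtains G :: "real \<times> 'a \<Rightarrow> real \<times> 'a" and B R :: real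
  where "\<And>z. (\<phi> has_derivative (\<lambda>h. G z \<bullet> h)) (at z)" "continuous_on UNIV G"
    "uniformly_continuous_on UNIV G" "\<And>z. norm (G z) \<le> B" "\<And>z. R < norm z \<Longrightarrow> G z = 0"
    "\<And>t x. deriv (\<lambda>s. \<phi> (s, x)) t = fst (G (t, x))"
    "\<And>t x. gradient (\<lambda>y. \<phi> (t, y)) x = snd (G (t, x))"
    "\<And>t x. t \<le> 0 \<or> T \<le> t \<Longrightarrow> \<phi> (t, x) = 0"
proof -
  define K where "K = closure {z. \<phi> z \<noteq> 0}"
  have Ck: "Ck (Suc 0) \<phi>" and K: "compact K" "K \<subseteq> {0<..<T} \<times> UNIV"
    using assms by (auto simp: test_functions_def K_def)
  have out: "\<phi> w = 0" if "w \<notin> K" for w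
  proof (rule ccontr)
    assume "\<phi> w \<noteq> 0"
    then have "w \<in> {z. \<phi> z \<noteq> 0}" by simp
    then have "w \<in> K" unfolding K_def by (rule subsetD[OF closure_subset])
    with that show False by contradiction
  qed
  define G where "G z = (\<Sum>b\<in>Basis. frechet_derivative \<phi> (at z) b *\<^sub>R b)" for z
  have der: "(\<phi> has_derivative (\<lambda>h. G z \<bullet> h)) (at z)" for z
  proof -
    have d: "(\<phi> has_derivative frechet_derivative \<phi> (at z)) (at z)"
    proof -
      have "\<phi> differentiable (at z)" using Ck by (cases z) auto
      then show ?thesis unfolding frechet_derivative_works .
    qed
    then interpret linear "frechet_derivative \<phi> (at z)" by (rule has_derivative_linear)
    have "frechet_derivative \<phi> (at z) h = G z \<bullet> h" for h
    proof -
      have "frechet_derivative \<phi> (at z) h = frechet_derivative \<phi> (at z) (\<Sum>b\<in>Basis. (h \<bullet> b) *\<^sub>R b)"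
        by (simp add: euclidean_representation)
      also have "\<dots> = G z \<bullet> h"
        by (simp add: sum scale G_def inner_sum_left inner_sum_right inner_commute mult.commute)
      finally show ?thesis .
    qed
    then have "frechet_derivative \<phi> (at z) = (\<lambda>h. G z \<bullet> h)" by (rule ext)
    with d show ?thesis by simp
  qed
  have contG: "continuous_on UNIV G"
  proof -
    have "continuous_on UNIV (\<lambda>x. frechet_derivative \<phi> (at x) h)" for h using Ck by (cases h) auto
    then show ?thesis unfolding G_def by (intro continuous_intros)
  qed
  obtain R where "\<forall>z\<in>K. norm z \<le> R"
    using compact_imp_bounded[OF K(1)] unfolding bounded_iff by blast
  then have R: "K \<subseteq> cball 0 R" by auto
  have G0: "G z = 0" if "R < norm z" for z
  proof -
    have zK: "z \<in> - K" using R that by auto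
    have "((\<lambda>_. 0) has_derivative (\<lambda>h. G z \<bullet> h)) (at z)"
    proof (rule has_derivative_transform_within_open[OF der[of z], of "- K"])
      show "open (- K)" using compact_imp_closed[OF K(1)] by (rule open_Compl)
      show "\<phi> w = 0" if "w \<in> - K" for w
        using that by (intro out) simp
    qed (rule zK)
    then have "(\<lambda>h. G z \<bullet> h) = (\<lambda>h. 0)"
      by (rule has_derivative_unique) (rule has_derivative_const)
    then have "G z \<bullet> G z = 0" by metis
    then show ?thesis by simp
  qed
  have ucG: "uniformly_continuous_on UNIV G"
    unfolding uniformly_continuous_on_def
  proof (intro allI impI)
    fix e :: real assume e: "0 < e"
    have "uniformly_continuous_on (cball 0 (R + 1)) G"
      using contG by (intro compact_uniformly_continuous) (auto intro: continuous_on_subset)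
    then obtain d where d: "0 < d"
      "\<And>z z'. z \<in> cball 0 (R + 1) \<Longrightarrow> z' \<in> cball 0 (R + 1) \<Longrightarrow> dist z' z < d \<Longrightarrow> dist (G z') (G z) < e"
      unfolding uniformly_continuous_on_def using e by metis
    \<comment> \<open>Two points at distance below 1 either both lie in the ball of radius R + 1 or
      both lie where \<open>G\<close> vanishes.\<close>
    have "dist (G z') (G z) < e" if zz: "dist z' z < min d 1" for z z'
    proof (cases "norm z \<le> R + 1 \<and> norm z' \<le> R + 1")
      case True
      then show ?thesis using zz by (intro d(2)) auto
    next
      case False
      have "norm z' < norm z + 1" "norm z < norm z' + 1"
        using zz norm_triangle_ineq2[of z' z] norm_triangle_ineq2[of z z'] norm_minus_commute[of z z']
        by (auto simp: dist_norm)
      then have "R < norm z" "R < norm z'" using False by linarith+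
      then show ?thesis using e by (simp add: G0)
    qed
    then show "\<exists>d>0. \<forall>z\<in>UNIV. \<forall>z'\<in>UNIV. dist z' z < d \<longrightarrow> dist (G z') (G z) < e"
      using d(1) by (intro exI[of _ "min d 1"]) auto
  qed
  have "bounded (G ` cball 0 (R + 1))"
    using contG by (intro compact_imp_bounded compact_continuous_image) (auto intro: continuous_on_subset)
  then obtain B where B: "\<And>z. z \<in> cball 0 (R + 1) \<Longrightarrow> norm (G z) \<le> B"
    unfolding bounded_iff by blast
  have GB: "norm (G z) \<le> max B 0" for z
    using B[of z] G0[of z] by (cases "norm z \<le> R + 1") auto
  show ?thesis
  proof (rule that[OF der contG ucG GB G0])
    fix t :: real and x :: 'a
    have "((\<lambda>s. \<phi> (s, x)) has_derivative (\<lambda>h. G (t, x) \<bullet> (h, 0))) (at t)"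
      by (rule has_derivative_compose[OF _ der]) (auto intro!: derivative_eq_intros)
    then have "((\<lambda>s. \<phi> (s, x)) has_real_derivative fst (G (t, x))) (at t)"
      unfolding has_field_derivative_def by (simp add: inner_prod_def)
    then show "deriv (\<lambda>s. \<phi> (s, x)) t = fst (G (t, x))" by (rule DERIV_imp_deriv)
    have g: "((\<lambda>y. \<phi> (t, y)) has_derivative (\<lambda>h. h \<bullet> snd (G (t, x)))) (at x)"
    proof -
      have "((\<lambda>y. \<phi> (t, y)) has_derivative (\<lambda>h. G (t, x) \<bullet> (0, h))) (at x)"
        by (rule has_derivative_compose[OF _ der]) (auto intro!: derivative_eq_intros)
      then show ?thesis by (simp add: inner_prod_def inner_commute)
    qed
    show "gradient (\<lambda>y. \<phi> (t, y)) x = snd (G (t, x))"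
      unfolding gradient_def gderiv_def
    proof (rule the_equality)
      show "((\<lambda>y. \<phi> (t, y)) has_derivative (\<lambda>h. h \<bullet> snd (G (t, x)))) (at x)" by (rule g)
      fix g' assume "((\<lambda>y. \<phi> (t, y)) has_derivative (\<lambda>h. h \<bullet> g')) (at x)"
      then have "(\<lambda>h. h \<bullet> g') = (\<lambda>h. h \<bullet> snd (G (t, x)))" by (rule has_derivative_unique) (rule g)
      then have "(g' - snd (G (t, x))) \<bullet> g' = (g' - snd (G (t, x))) \<bullet> snd (G (t, x))" by metis
      then have "(g' - snd (G (t, x))) \<bullet> (g' - snd (G (t, x))) = 0" by (simp add: inner_diff_right)
      then show "g' = snd (G (t, x))" by simp
    qed
  next
    fix t :: real and x :: 'a assume t: "t \<le> 0 \<or> T \<le> t"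
    show "\<phi> (t, x) = 0"
      by (rule out) (use K(2) t in auto)
  qed
qed

lemma mean_value_inner:
  fixes \<phi> :: "'b::euclidean_space \<Rightarrow> real"
  assumes der: "\<And>z. (\<phi> has_derivative (\<lambda>h. G z \<bullet> h)) (at z)"
  obtains \<xi> where "\<phi> z' - \<phi> z = G \<xi> \<bullet> (z' - z)" "norm (\<xi> - z) \<le> norm (z' - z)"
proof -
  have "((\<lambda>s. \<phi> (z + s *\<^sub>R (z' - z))) has_derivative (\<lambda>h. G (z + s *\<^sub>R (z' - z)) \<bullet> (h *\<^sub>R (z' - z)))) (at s within {0..1})" for s
    by (rule has_derivative_compose[OF _ der]) (auto intro!: derivative_eq_intros)
  then obtain s where s: "s \<in> {0<..<1::real}"
    "\<phi> (z + 1 *\<^sub>R (z' - z)) - \<phi> (z + 0 *\<^sub>R (z' - z)) = G (z + s *\<^sub>R (z' - z)) \<bullet> ((1 - 0) *\<^sub>R (z' - z))"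
    using mvt_simple[of 0 1 "\<lambda>s. \<phi> (z + s *\<^sub>R (z' - z))" "\<lambda>s h. G (z + s *\<^sub>R (z' - z)) \<bullet> (h *\<^sub>R (z' - z))"] by auto
  show ?thesis
  proof
    show "\<phi> z' - \<phi> z = G (z + s *\<^sub>R (z' - z)) \<bullet> (z' - z)" using s(2) by simp
    show "norm ((z + s *\<^sub>R (z' - z)) - z) \<le> norm (z' - z)"
      using s(1) by (simp add: mult_left_le_one_le)
  qed
qed

text \<open>Continuity allows the second argument to be replaced by its discretisation; the
  resulting functions are measurable as countable case distinctions and converge pointwise.\<close>

lemma Caratheodory_borel_measurable_pair:
  fixes f :: "'t \<Rightarrow> 'a::euclidean_space \<Rightarrow> 'b::{second_countable_topology, metric_space}"
  assumes m: "\<And>x. (\<lambda>t. f t x) \<in> borel_measurable S"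
    and c: "\<And>t. t \<in> space S \<Longrightarrow> continuous_on UNIV (f t)"
  shows "(\<lambda>z. f (fst z) (snd z)) \<in> borel_measurable (S \<Otimes>\<^sub>M borel)"
proof -
  have "\<exists>(u :: nat \<Rightarrow> 'a) (h :: 'a \<Rightarrow> nat). h \<in> measurable borel (count_space UNIV) \<and>
      (\<forall>y. dist (u (h y)) y < 1 / real (Suc n))" for n
  proof -
    have "0 < 1 / real (Suc n)" by simp
    then show ?thesis by (rule ex_countable_approx) blast
  qed
  then obtain u :: "nat \<Rightarrow> nat \<Rightarrow> 'a" and h :: "nat \<Rightarrow> 'a \<Rightarrow> nat"
    where h: "\<And>n. h n \<in> measurable borel (count_space UNIV)"
      and u: "\<And>n y. dist (u n (h n y)) y < 1 / real (Suc n)"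
    by metis
  show ?thesis
  proof (rule borel_measurable_LIMSEQ_metric)
    fix n
    show "(\<lambda>z. f (fst z) (u n (h n (snd z)))) \<in> borel_measurable (S \<Otimes>\<^sub>M borel)"
    proof (rule measurable_compose_countable[where f = "\<lambda>i z. f (fst z) (u n i)"])
      show "(\<lambda>z. f (fst z) (u n i)) \<in> borel_measurable (S \<Otimes>\<^sub>M borel)" for i
        using measurable_compose[OF measurable_fst m] .
      show "(\<lambda>z. h n (snd z)) \<in> S \<Otimes>\<^sub>M borel \<rightarrow>\<^sub>M count_space UNIV"
        using measurable_compose[OF measurable_snd h] .
    qed
  next
    fix z assume "z \<in> space (S \<Otimes>\<^sub>M (borel :: 'a measure))"
    then have "isCont (f (fst z)) (snd z)"
      using c by (auto simp: space_pair_measure continuous_on_eq_continuous_at)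
    moreover have "(\<lambda>n. u n (h n (snd z))) \<longlonglongrightarrow> snd z"
    proof (rule metric_tendsto_imp_tendsto)
      show "(\<lambda>n. 1 / real (Suc n)) \<longlonglongrightarrow> 0" by (rule LIMSEQ_Suc[OF lim_1_over_n])
      show "\<forall>\<^sub>F n in sequentially. dist (u n (h n (snd z))) (snd z) \<le> dist (1 / real (Suc n)) 0"
        using u by (auto intro!: always_eventually less_imp_le)
    qed
    ultimately show "(\<lambda>n. f (fst z) (u n (h n (snd z)))) \<longlonglongrightarrow> f (fst z) (snd z)"
      by (rule isCont_tendsto_compose)
  qed
qed

text \<open>Meant for the Skorokhod copies: their starting points vary with \<open>n\<close> while
  the law stays fixed. The natural majorants of displacements therefore depend on \<open>n\<close>
  too, but their integrals are constant.\<close>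

lemma integral_generalized_dominated:
  fixes f g :: "nat \<Rightarrow> 'a \<Rightarrow> real"
  assumes "finite_measure M"
    and [measurable]: "\<And>n. f n \<in> borel_measurable M"
    and g: "\<And>n. integrable M (g n)" "integrable M h"
    and fg: "\<And>n. AE x in M. 0 \<le> f n x \<and> f n x \<le> g n x"
    and f_lim: "AE x in M. (\<lambda>n. f n x) \<longlonglongrightarrow> 0"
    and g_lim: "AE x in M. (\<lambda>n. g n x) \<longlonglongrightarrow> h x"
    and int_lim: "(\<lambda>n. \<integral>x. g n x \<partial>M) \<longlonglongrightarrow> (\<integral>x. h x \<partial>M)"
  shows "(\<lambda>n. \<integral>x. f n x \<partial>M) \<longlonglongrightarrow> 0"
proof -
  have [measurable]: "g n \<in> borel_measurable M" "h \<in> borel_measurable M" for n using g by auto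
  have fi: "integrable M (f n)" for n
    by (rule Bochner_Integration.integrable_bound[OF g(1)[of n]]) (use fg[of n] in auto)
  have fg': "AE x in M. \<forall>n. 0 \<le> f n x \<and> f n x \<le> g n x" using fg by (simp add: AE_all_countable)
  have h0: "AE x in M. 0 \<le> h x"
    using fg' g_lim by eventually_elim (rule LIMSEQ_le_const, auto intro: order_trans)
  have gf0: "AE x in M. 0 \<le> g n x - f n x" "AE x in M. 0 \<le> f n x" for n using fg[of n] by auto
  \<comment> \<open>Fatou's lemma applied to \<open>g n - f n \<ge> 0\<close>\<close>
  have "(\<integral>\<^sup>+x. ennreal (h x) \<partial>M) = (\<integral>\<^sup>+x. liminf (\<lambda>n. ennreal (g n x - f n x)) \<partial>M)"
  proof (rule nn_integral_cong_AE)
    show "AE x in M. ennreal (h x) = liminf (\<lambda>n. ennreal (g n x - f n x))"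
      using f_lim g_lim
    proof eventually_elim
      case (elim x)
      have "(\<lambda>n. ennreal (g n x - f n x)) \<longlonglongrightarrow> ennreal (h x - 0)"
        by (intro tendsto_ennrealI tendsto_diff elim)
      then show ?case by (simp add: lim_imp_Liminf)
    qed
  qed
  also have "\<dots> \<le> liminf (\<lambda>n. \<integral>\<^sup>+x. ennreal (g n x - f n x) \<partial>M)"
    by (rule nn_integral_liminf) measurable
  also have "\<dots> = liminf (\<lambda>n. ennreal ((\<integral>x. g n x \<partial>M) - (\<integral>x. f n x \<partial>M)))"
    using g(1) fi gf0 by (subst nn_integral_eq_integral) auto
  finally have le: "ennreal (\<integral>x. h x \<partial>M) \<le> liminf (\<lambda>n. ennreal ((\<integral>x. g n x \<partial>M) - (\<integral>x. f n x \<partial>M)))"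
    using g(2) h0 by (simp add: nn_integral_eq_integral)
  have f0: "0 \<le> (\<integral>x. f n x \<partial>M)" for n using gf0(2) by (rule integral_nonneg_AE)
  have gf: "(\<integral>x. f n x \<partial>M) \<le> (\<integral>x. g n x \<partial>M)" for n
    using fg[of n] by (intro integral_mono_AE fi g) auto
  show ?thesis
  proof (rule LIMSEQ_I)
    fix e :: real assume e: "0 < e"
    have h0': "0 \<le> (\<integral>x. h x \<partial>M)" using h0 by (rule integral_nonneg_AE)
    have ev1: "\<forall>\<^sub>F n in sequentially. (\<integral>x. h x \<partial>M) - e / 2 < (\<integral>x. g n x \<partial>M) - (\<integral>x. f n x \<partial>M)"
    proof (cases "(\<integral>x. h x \<partial>M) - e / 2 < 0")
      case True
      show ?thesis
      proof (intro always_eventually allI)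
        show "(\<integral>x. h x \<partial>M) - e / 2 < (\<integral>x. g n x \<partial>M) - (\<integral>x. f n x \<partial>M)" for n
          using gf[of n] True by linarith
      qed
    next
      case False
      then have "ennreal ((\<integral>x. h x \<partial>M) - e / 2) < ennreal (\<integral>x. h x \<partial>M)"
        using e by (intro ennreal_lessI) auto
      then have "ennreal ((\<integral>x. h x \<partial>M) - e / 2) < liminf (\<lambda>n. ennreal ((\<integral>x. g n x \<partial>M) - (\<integral>x. f n x \<partial>M)))"
        using le by (rule less_le_trans)
      from less_LiminfD[OF this] show ?thesis
        by eventually_elim (use False in \<open>simp add: ennreal_less_iff\<close>)
    qed
    have ev2: "\<forall>\<^sub>F n in sequentially. (\<integral>x. g n x \<partial>M) < (\<integral>x. h x \<partial>M) + e / 2"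
      using order_tendstoD(2)[OF int_lim, of "(\<integral>x. h x \<partial>M) + e / 2"] e by simp
    have "\<forall>\<^sub>F n in sequentially. norm ((\<integral>x. f n x \<partial>M) - 0) < e"
      using ev1 ev2 by eventually_elim (use f0 in \<open>simp add: abs_of_nonneg\<close>)
    then show "\<exists>no. \<forall>n\<ge>no. norm ((\<integral>x. f n x \<partial>M) - 0) < e"
      by (simp add: eventually_sequentially)
  qed
qed

section \<open>The Euler scheme\<close>

lemma ident_borel_measurable_lebesgue_on: "(\<lambda>x. x) \<in> borel_measurable (lebesgue_on A)"
  by (intro measurable_restrict_space1 measurable_completion) simp

locale continuity_inclusion =
  fixes p T :: real
    and V :: "real \<Rightarrow> 'a::euclidean_space measure \<Rightarrow> ('a \<Rightarrow> 'a) set"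
    and m :: "real \<Rightarrow> real" and \<mu>0 :: "'a measure"
  assumes p: "1 \<le> p" and T: "0 < T"
    and V_meas: "\<And>\<mu>. \<mu> \<in> Pp p \<Longrightarrow> mf_measurable T C0 dcc (\<lambda>t. V t \<mu>)"
    and V_cont: "AE t in lebesgue_on {0..T}. \<forall>\<mu>\<in>Pp p. mf_continuous_at (Pp p) (Wp p) dcc (V t) \<mu>"
    and V_ne: "\<And>t \<mu>. t \<in> {0..T} \<Longrightarrow> \<mu> \<in> Pp p \<Longrightarrow> V t \<mu> \<noteq> {}"
    and V_closed: "\<And>t \<mu>. t \<in> {0..T} \<Longrightarrow> \<mu> \<in> Pp p \<Longrightarrow> closedin C0_topology (V t \<mu>)"
    and V_convex: "\<And>t \<mu>. t \<in> {0..T} \<Longrightarrow> \<mu> \<in> Pp p \<Longrightarrow> convex_fields (V t \<mu>)"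
    and m: "L1_nonneg T m"
    and growth: "AE t in lebesgue_on {0..T}. \<forall>\<mu>\<in>Pp p. \<forall>v\<in>V t \<mu>. \<forall>x.
        norm (v x) \<le> m t * (1 + norm x + moment p \<mu>)"
    and equi: "\<And>\<K> K. compactin (Pp_topology p) \<K> \<Longrightarrow> compact K \<Longrightarrow>
      \<exists>l \<omega>. L1_nonneg T l \<and> modulus \<omega> \<and>
        (AE t in lebesgue_on {0..T}. \<forall>\<mu>\<in>\<K>. \<forall>v\<in>V t \<mu>. \<forall>x\<in>K. \<forall>y\<in>K.
          norm (v x - v y) \<le> l t * \<omega> (norm (x - y)))"
    and \<mu>0: "\<mu>0 \<in> Pp p"
begin

abbreviation S :: "real measure" where "S \<equiv> lebesgue_on {0..T}"

lemma space_S [simp]: "space S = {0..T}" by simp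

lemma finite_measure_S: "finite_measure S"
  by (rule finite_measure_lebesgue_on) simp

lemma prob_\<mu>0: "prob_space \<mu>0" and sets_\<mu>0 [measurable_cong]: "sets \<mu>0 = sets borel"
  and space_\<mu>0 [simp]: "space \<mu>0 = UNIV"
  using PpD[OF \<mu>0] by auto

sublocale S: finite_measure S by (rule finite_measure_S)
sublocale M0: prob_space \<mu>0 by (rule prob_\<mu>0)

lemma m_int: "integrable S m" and m_nonneg: "s \<in> {0..T} \<Longrightarrow> 0 \<le> m s"
  using m by (auto simp: L1_nonneg_def)

lemma m_measurable [measurable]: "m \<in> borel_measurable S"
  using m_int by (rule borel_measurable_integrable)

lemma measure_S_total: "measure S (space S) = T"
  using T by (simp add: measure_restrict_space)

section \<open>Selections and the uniform grid\<close>

text \<open>A total choice allows the recursion for \<open>X\<close> to be stated before its laws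
  are known to lie in \<open>Pp p\<close>; only there does \<open>vsel\<close> have the selected
  properties.\<close>

definition vsel :: "'a measure \<Rightarrow> real \<Rightarrow> 'a \<Rightarrow> 'a" where
  "vsel \<mu> = (SOME v. (\<forall>t\<in>{0..T}. v t \<in> V t \<mu>) \<and> (\<forall>x. (\<lambda>t. v t x) \<in> borel_measurable S))"

lemma vsel:
  assumes "\<mu> \<in> Pp p"
  shows "t \<in> {0..T} \<Longrightarrow> vsel \<mu> t \<in> V t \<mu>" "(\<lambda>t. vsel \<mu> t x) \<in> borel_measurable S"
proof -
  have "\<exists>v. (\<forall>t\<in>{0..T}. v t \<in> V t \<mu>) \<and> (\<forall>x. (\<lambda>t. v t x) \<in> borel_measurable S)"
  proof (rule Kuratowski_Ryll_Nardzewski_C0[OF V_meas[OF assms] V_ne[OF _ assms] V_closed[OF _ assms]])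
    fix v assume "\<And>t. t \<in> {0..T} \<Longrightarrow> v t \<in> V t \<mu>" "\<And>x. (\<lambda>t. v t x) \<in> borel_measurable S"
    then show ?thesis by (intro exI[of _ v]) auto
  qed
  from someI_ex[OF this]
  show "t \<in> {0..T} \<Longrightarrow> vsel \<mu> t \<in> V t \<mu>" "(\<lambda>t. vsel \<mu> t x) \<in> borel_measurable S"
    unfolding vsel_def by auto
qed

lemma V_C0:
  assumes "t \<in> {0..T}" "\<mu> \<in> Pp p" "v \<in> V t \<mu>"
  shows "continuous_on UNIV v"
proof -
  interpret C: Metric_space "C0 :: ('a \<Rightarrow> 'a) set" dcc by (rule Metric_space_C0_dcc)
  have "V t \<mu> \<subseteq> C0" using closedin_subset[OF V_closed[OF assms(1,2)]] by (simp add: C.topspace_mtopology)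
  then show ?thesis using assms(3) by (auto simp: C0_def)
qed

text \<open>Grid number \<open>n\<close> has \<open>Suc n\<close> cells of length T / (n+1),
  numbered from 0. The end point T falls into the extra cell \<open>Suc n\<close>, which meets [0,T]
  only in T.\<close>

definition cell :: "nat \<Rightarrow> real \<Rightarrow> nat" where
  "cell n s = nat \<lfloor>s * real (Suc n) / T\<rfloor>"

definition grid :: "nat \<Rightarrow> nat \<Rightarrow> real" where
  "grid n k = real k * T / real (Suc n)"

lemma cell_less_iff: "0 \<le> s \<Longrightarrow> cell n s < k \<longleftrightarrow> s < grid n k"
proof -
  assume s: "0 \<le> s"
  have "cell n s < k \<longleftrightarrow> \<lfloor>s * real (Suc n) / T\<rfloor> < int k"
    using s T unfolding cell_def by (subst nat_less_iff) auto
  also have "\<dots> \<longleftrightarrow> s * real (Suc n) / T < real k" by (simp add: floor_less_iff)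
  also have "\<dots> \<longleftrightarrow> s < grid n k" using T unfolding grid_def by (simp add: field_simps)
  finally show ?thesis .
qed

lemma grid_cell: 
  assumes "0 \<le> s"
  shows "grid n (cell n s) \<le> s" "s < grid n (Suc (cell n s))"
  using cell_less_iff[OF assms, of n "cell n s"] cell_less_iff[OF assms, of n "Suc (cell n s)"] by auto

lemma grid_Suc: "grid n (Suc k) = grid n k + T / real (Suc n)"
  by (simp add: grid_def add_divide_distrib distrib_right)

lemma grid_0 [simp]: "grid n 0 = 0" and grid_last [simp]: "grid n (Suc n) = T"
  by (auto simp: grid_def)

lemma grid_nonneg [simp]: "0 \<le> grid n k"
  using T by (simp add: grid_def)

lemma cell_grid [simp]: "cell n (grid n k) = k"
  using T by (simp add: cell_def grid_def)

lemma cell_measurable [measurable]: "cell n \<in> measurable S (count_space UNIV)"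
proof -
  have "(\<lambda>s. nat \<lfloor>s * real (Suc n) / T\<rfloor>) \<in> measurable borel (count_space UNIV)" by measurable
  from measurable_compose[OF ident_borel_measurable_lebesgue_on this] show ?thesis
    by (simp add: cell_def[abs_def])
qed

lemma AE_S_less_T: "AE s in S. s < T"
proof -
  have "AE s in S. s \<notin> {T}"
  proof (rule AE_not_in)
    have "{T} \<in> null_sets lebesgue" by simp
    then show "{T} \<in> null_sets S"
      using T by (subst null_sets_restrict_space) auto
  qed
  then show ?thesis using AE_space by eventually_elim auto
qed

section \<open>Euler maps and their growth\<close>

text \<open>The position is frozen on a cell, the time argument of the velocity is not. From
  \<open>k = Suc n\<close> on, the cells meet [0,T] in null sets and the map no longer changes, so
  \<open>k\<close> needs no upper bound.\<close>

primrec X :: "nat \<Rightarrow> nat \<Rightarrow> 'a \<Rightarrow> 'a" where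
  "X n 0 = (\<lambda>x. x)"
| "X n (Suc k) = (\<lambda>x. X n k x +
     (\<integral>s. of_bool (cell n s = k) *\<^sub>R vsel (distr \<mu>0 borel (X n k)) s (X n k x) \<partial>S))"

declare X.simps(2) [simp del]

definition law :: "nat \<Rightarrow> nat \<Rightarrow> 'a measure" where "law n k = distr \<mu>0 borel (X n k)"

text \<open>\<open>D\<close> is the L^p norm of 1 + |x| under the initial measure, the factor by
  which growth bounds become moment bounds. \<open>Mi\<close> is the primitive of the growth
  function: the clock in which displacements are measured. \<open>MT\<close> is its total.\<close>

definition D :: real where "D = (\<integral>x. (1 + norm x) powr p \<partial>\<mu>0) powr (1 / p)"
definition Mi :: "real \<Rightarrow> real" where "Mi t = (\<integral>s. of_bool (s < t) * m s \<partial>S)"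
definition MT :: real where "MT = (\<integral>s. m s \<partial>S)"

lemma of_bool_measurable [measurable]: "(\<lambda>s. of_bool (s < t) :: real) \<in> borel_measurable S"
proof -
  have "(\<lambda>s. of_bool (s < t) :: real) \<in> borel_measurable borel" unfolding of_bool_def by measurable
  from measurable_compose[OF ident_borel_measurable_lebesgue_on this] show ?thesis .
qed

lemma Mi_int: "integrable S (\<lambda>s. of_bool (s < t) * m s)"
proof (rule Bochner_Integration.integrable_bound[OF m_int])
  show "(\<lambda>s. of_bool (s < t) * m s) \<in> borel_measurable S"
    by (intro borel_measurable_times of_bool_measurable m_measurable)
qed (auto simp: of_bool_def)

lemma Mi_mono: "s \<le> t \<Longrightarrow> Mi s \<le> Mi t"
  unfolding Mi_def using Mi_int m_nonneg by (intro integral_mono) (auto simp: of_bool_def)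

lemma Mi_0: "Mi 0 = 0"
proof -
  have "Mi 0 = (\<integral>s. 0 \<partial>S)" unfolding Mi_def
    by (intro Bochner_Integration.integral_cong) (auto simp: of_bool_def)
  then show ?thesis by simp
qed

lemma Mi_nonneg: "0 \<le> Mi t"
  unfolding Mi_def by (intro integral_nonneg_AE) (use AE_space m_nonneg in \<open>auto simp: of_bool_def\<close>)

lemma Mi_le_MT: "Mi t \<le> MT"
  unfolding Mi_def MT_def using m_nonneg by (intro integral_mono Mi_int m_int) (auto simp: of_bool_def)

lemma MT_nonneg: "0 \<le> MT" using Mi_nonneg[of 0] Mi_le_MT[of 0] by linarith

lemma Mi_isCont: "isCont Mi t"
  unfolding continuous_at_sequentially
proof (intro allI impI)
  fix u assume u: "u \<longlonglongrightarrow> t"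
  have "AE s in S. s \<notin> {t}"
  proof (cases "t \<in> {0..T}")
    case True
    have "{t} \<in> null_sets lebesgue" by simp
    then have "{t} \<in> null_sets S" using True by (subst null_sets_restrict_space) auto
    then show ?thesis by (rule AE_not_in)
  next
    case False
    from AE_space show ?thesis by eventually_elim (use False in auto)
  qed
  then have lim: "AE s in S. (\<lambda>j. of_bool (s < u j) * m s) \<longlonglongrightarrow> of_bool (s < t) * m s"
  proof eventually_elim
    case (elim s)
    have "\<forall>\<^sub>F j in sequentially. of_bool (s < u j) * m s = of_bool (s < t) * m s"
    proof (cases "s < t")
      case True
      from order_tendstoD(1)[OF u this] show ?thesis by eventually_elim (use True in simp)
    next
      case False
      then have "t < s" using elim by simp
      from order_tendstoD(2)[OF u this] show ?thesis by eventually_elim (use False in simp)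
    qed
    then show ?case by (rule tendsto_eventually)
  qed
  have "(\<lambda>j. Mi (u j)) \<longlonglongrightarrow> Mi t"
    unfolding Mi_def
  proof (rule integral_dominated_convergence[where w = m])
    show "AE s in S. norm (of_bool (s < u j) * m s) \<le> m s" for j
      using AE_space by eventually_elim (use m_nonneg in \<open>auto simp: of_bool_def\<close>)
  qed (use m_int lim in auto)
  then show "(Mi \<circ> u) \<longlonglongrightarrow> Mi t" by (simp add: o_def)
qed

text \<open>As \<open>m\<close> is only integrable, the mass of a cell is not proportional to its
  length. Uniform continuity of \<open>Mi\<close> on [0,T] still makes all cell masses small
  together with the mesh.\<close>

lemma Mi_increment_small:
  assumes "0 < e"
  shows "\<exists>N. (\<forall>n\<ge>N. \<forall>k\<le>n. Mi (grid n (Suc k)) - Mi (grid n k) < e) \<and> (\<forall>n\<ge>N. T / real (Suc n) < e)"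
proof -
  have "uniformly_continuous_on {0..T} Mi"
    using Mi_isCont by (intro compact_uniformly_continuous continuous_at_imp_continuous_on) auto
  then obtain d where d: "0 < d" "\<And>s t. s \<in> {0..T} \<Longrightarrow> t \<in> {0..T} \<Longrightarrow> dist t s < d \<Longrightarrow> dist (Mi t) (Mi s) < e"
    unfolding uniformly_continuous_on_def using assms by metis
  define d' where "d' = min d e"
  have d': "0 < d'" using d(1) assms by (simp add: d'_def)
  obtain N where N: "T / d' < real N" using reals_Archimedean2 by blast
  have small: "T / real (Suc n) < d'" if "N \<le> n" for n
  proof -
    have "T / d' < real (Suc n)" using N that by linarith
    then show ?thesis using d' by (simp add: field_simps)
  qed
  show ?thesis
  proof (intro exI[of _ N] conjI allI impI)
    fix n k assume n: "N \<le> n" and k: "k \<le> n"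
    have gT: "grid n j \<le> T" if "j \<le> Suc n" for j
    proof -
      have "grid n j \<le> grid n (Suc n)" unfolding grid_def
        using that T by (intro divide_right_mono mult_right_mono) auto
      then show ?thesis by simp
    qed
    have "dist (Mi (grid n (Suc k))) (Mi (grid n k)) < e"
      using small[OF n] k gT[of k] gT[of "Suc k"] T by (intro d(2)) (auto simp: dist_real_def grid_Suc d'_def simp del: of_nat_Suc)
    then show "Mi (grid n (Suc k)) - Mi (grid n k) < e" by (simp add: dist_real_def abs_less_iff)
  qed (use small in \<open>auto simp: d'_def\<close>)
qed

lemma one_norm_powr_int: "integrable \<mu>0 (\<lambda>x. (1 + norm x) powr p)"
proof (rule Bochner_Integration.integrable_bound)
  show "integrable \<mu>0 (\<lambda>x. 2 powr p * (1 + norm x powr p))"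
    using PpD(3)[OF \<mu>0] by (intro integrable_mult_right Bochner_Integration.integrable_add) auto
  show "AE x in \<mu>0. norm ((1 + norm x) powr p) \<le> norm (2 powr p * (1 + norm x powr p))"
  proof (rule AE_I2)
    fix x
    have "(1 + norm x) powr p \<le> (2 * max 1 (norm x)) powr p"
      using p by (intro powr_mono2) (auto simp: max_def)
    also have "\<dots> = 2 powr p * max 1 (norm x) powr p" by (rule powr_mult)
    also have "max 1 (norm x) powr p \<le> 1 + norm x powr p" by (auto simp: max_def)
    finally show "norm ((1 + norm x) powr p) \<le> norm (2 powr p * (1 + norm x powr p))"
      by (simp add: mult_left_mono)
  qed
qed measurable

lemma D_ge_1: "1 \<le> D"
proof -
  have "(\<integral>x. 1 \<partial>\<mu>0) \<le> (\<integral>x. (1 + norm x) powr p \<partial>\<mu>0)"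
    using p by (intro integral_mono one_norm_powr_int) (auto intro: ge_one_powr_ge_zero)
  then have "1 \<le> (\<integral>x. (1 + norm x) powr p \<partial>\<mu>0)" using M0.prob_space by simp
  then show ?thesis unfolding D_def using p by (intro ge_one_powr_ge_zero) auto
qed

lemma one_norm_int: "integrable \<mu>0 (\<lambda>x. 1 + norm x)"
proof (rule Bochner_Integration.integrable_bound[OF one_norm_powr_int])
  show "AE x in \<mu>0. norm (1 + norm x) \<le> norm ((1 + norm x) powr p)"
    using p powr_mono[of 1 p "1 + norm x" for x] by (intro AE_I2) auto
qed measurable

text \<open>The L^p norm of C (1 + |x|) under \<mu>0 is C D.\<close>

lemma image_Pp:
  assumes c: "f \<in> borel_measurable \<mu>0" and C: "\<And>x. norm (f x) \<le> C * (1 + norm x)" and C0: "0 \<le> C"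
  shows "distr \<mu>0 borel f \<in> Pp p" "moment p (distr \<mu>0 borel f) \<le> C * D"
proof -
  have b: "norm (f x) powr p \<le> C powr p * (1 + norm x) powr p" for x
  proof -
    have "norm (f x) powr p \<le> (C * (1 + norm x)) powr p" using C p by (intro powr_mono2) auto
    also have "\<dots> = C powr p * (1 + norm x) powr p" by (rule powr_mult)
    finally show ?thesis .
  qed
  have i: "integrable \<mu>0 (\<lambda>x. norm (f x) powr p)"
    by (rule Bochner_Integration.integrable_bound[OF integrable_mult_right[OF one_norm_powr_int, of "C powr p"]])
       (use c b in auto)
  show "distr \<mu>0 borel f \<in> Pp p"
    using c i unfolding Pp_def by (auto simp: integrable_distr_eq intro: M0.prob_space_distr)
  have "(\<integral>x. norm x powr p \<partial>distr \<mu>0 borel f) = (\<integral>x. norm (f x) powr p \<partial>\<mu>0)"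
    using c by (subst integral_distr) auto
  also have "\<dots> \<le> (\<integral>x. C powr p * (1 + norm x) powr p \<partial>\<mu>0)"
    using b by (intro integral_mono i integrable_mult_right one_norm_powr_int)
  also have "\<dots> = C powr p * (\<integral>x. (1 + norm x) powr p \<partial>\<mu>0)" by simp
  finally have "moment p (distr \<mu>0 borel f) \<le> (C powr p * (\<integral>x. (1 + norm x) powr p \<partial>\<mu>0)) powr (1 / p)"
    unfolding moment_def using p by (intro powr_mono2) auto
  also have "\<dots> = (C powr p) powr (1 / p) * D" unfolding D_def by (rule powr_mult)
  also have "(C powr p) powr (1 / p) = C" using p C0 by (simp add: powr_powr)
  finally show "moment p (distr \<mu>0 borel f) \<le> C * D" .
qed

lemma vsel_growth:
  assumes "\<mu> \<in> Pp p"
  shows "AE s in S. \<forall>y. norm (vsel \<mu> s y) \<le> m s * (1 + norm y + moment p \<mu>)"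
  using growth AE_space by eventually_elim (use vsel(1)[OF assms] assms in auto)

lemma vsel_cont: "\<mu> \<in> Pp p \<Longrightarrow> s \<in> {0..T} \<Longrightarrow> continuous_on UNIV (vsel \<mu> s)"
  using V_C0 vsel(1) by auto

text \<open>A discrete Gronwall factor. In the rate 1 + D, the 1 comes from the growth in the
  position and \<open>D\<close> from the growth in the moment of the law.\<close>

definition EE :: "nat \<Rightarrow> nat \<Rightarrow> real" where "EE n k = exp ((1 + D) * Mi (grid n k))"

lemma cell_indicator_int:
  fixes f :: "real \<Rightarrow> 'b::euclidean_space"
  assumes "integrable S f"
  shows "integrable S (\<lambda>s. of_bool (cell n s = k) *\<^sub>R f s)"
proof (rule Bochner_Integration.integrable_bound[OF assms])
  have [measurable]: "f \<in> borel_measurable S" using assms by (rule borel_measurable_integrable)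
  have [measurable]: "(\<lambda>s. of_bool (cell n s = k) :: real) \<in> borel_measurable S"
    unfolding of_bool_def by measurable
  show "(\<lambda>s. of_bool (cell n s = k) *\<^sub>R f s) \<in> borel_measurable S" by measurable
qed (auto simp: of_bool_def)

lemma cell_mass: "(\<integral>s. of_bool (cell n s = k) * m s \<partial>S) = Mi (grid n (Suc k)) - Mi (grid n k)"
proof -
  have "Mi (grid n (Suc k)) - Mi (grid n k) = (\<integral>s. of_bool (s < grid n (Suc k)) * m s - of_bool (s < grid n k) * m s \<partial>S)"
    unfolding Mi_def by (intro Bochner_Integration.integral_diff[symmetric] Mi_int)
  also have "\<dots> = (\<integral>s. of_bool (cell n s = k) * m s \<partial>S)"
  proof (rule Bochner_Integration.integral_cong[OF refl])
    fix s assume "s \<in> space S"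
    then have s: "0 \<le> s" by simp
    show "of_bool (s < grid n (Suc k)) * m s - of_bool (s < grid n k) * m s = of_bool (cell n s = k) * m s"
      unfolding cell_less_iff[OF s, symmetric] by (auto simp: of_bool_def)
  qed
  finally show ?thesis by simp
qed

text \<open>The step of a joint induction. The bound at level \<open>k\<close> places the law in
  \<open>Pp p\<close>, so the selection obeys the growth condition there; the displacement is then
  at most EE (1 + D)(1 + |x|) times the mass \<open>a\<close> of the cell, and 1 + (1 + D) a <=
  exp((1 + D) a) closes the induction. Continuity passes on by dominated convergence.\<close>

lemma Euler_step:
  assumes c: "continuous_on UNIV (X n k)" and b: "\<And>x. 1 + norm (X n k x) \<le> EE n k * (1 + norm x)"
  shows "law n k \<in> Pp p" "moment p (law n k) \<le> EE n k * D"
    "integrable S (\<lambda>s. vsel (law n k) s (X n k x))"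
    "AE s in S. \<forall>x. norm (vsel (law n k) s (X n k x)) \<le> m s * (EE n k * (1 + D) * (1 + norm x))"
    "norm (X n (Suc k) x - X n k x) \<le> EE n k * (1 + D) * (1 + norm x) * (Mi (grid n (Suc k)) - Mi (grid n k))"
    "continuous_on UNIV (X n (Suc k))"
    "1 + norm (X n (Suc k) x) \<le> EE n (Suc k) * (1 + norm x)"
proof -
  have E1: "1 \<le> EE n k" unfolding EE_def using D_ge_1 Mi_nonneg by (simp add: one_le_exp_iff)
  have Xm: "X n k \<in> borel_measurable \<mu>0"
    using borel_measurable_continuous_onI[OF c] by (simp cong: measurable_cong_sets add: sets_\<mu>0)
  have b': "norm (X n k x) \<le> EE n k * (1 + norm x)" for x using b[of x] by linarith
  show P: "law n k \<in> Pp p" and mom: "moment p (law n k) \<le> EE n k * D"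
    unfolding law_def using image_Pp[OF Xm b'] E1 by auto
  have w: "AE s in S. \<forall>x. norm (vsel (law n k) s (X n k x)) \<le> m s * (EE n k * (1 + D) * (1 + norm x))"
    using vsel_growth[OF P] AE_space
  proof eventually_elim
    case (elim s)
    show ?case
    proof
      fix x
      have "1 + norm (X n k x) + moment p (law n k) \<le> EE n k * (1 + norm x) + EE n k * D"
        using b[of x] mom by linarith
      also have "\<dots> \<le> EE n k * (1 + norm x) + EE n k * D * (1 + norm x)"
      proof -
        have "EE n k * D * 1 \<le> EE n k * D * (1 + norm x)"
          using E1 D_ge_1 by (intro mult_left_mono) auto
        then show ?thesis by simp
      qed
      also have "\<dots> = EE n k * (1 + D) * (1 + norm x)" by (simp add: algebra_simps)
      finally have "m s * (1 + norm (X n k x) + moment p (law n k)) \<le> m s * (EE n k * (1 + D) * (1 + norm x))"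
        using m_nonneg[of s] elim(2) by (intro mult_left_mono) auto
      then show "norm (vsel (law n k) s (X n k x)) \<le> m s * (EE n k * (1 + D) * (1 + norm x))"
        using elim(1) order_trans by blast
    qed
  qed
  then show "AE s in S. \<forall>x. norm (vsel (law n k) s (X n k x)) \<le> m s * (EE n k * (1 + D) * (1 + norm x))" .
  have int: "integrable S (\<lambda>s. vsel (law n k) s (X n k x))" for x
  proof (rule Bochner_Integration.integrable_bound[OF integrable_mult_left[OF m_int, of "EE n k * (1 + D) * (1 + norm x)"]])
    show "(\<lambda>s. vsel (law n k) s (X n k x)) \<in> borel_measurable S" by (rule vsel(2)[OF P])
    show "AE s in S. norm (vsel (law n k) s (X n k x)) \<le> norm (m s * (EE n k * (1 + D) * (1 + norm x)))"
      using w by eventually_elim (auto intro: order_trans[OF _ abs_ge_self])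
  qed
  then show "integrable S (\<lambda>s. vsel (law n k) s (X n k x))" .
  have XS: "X n (Suc k) x = X n k x + (\<integral>s. of_bool (cell n s = k) *\<^sub>R vsel (law n k) s (X n k x) \<partial>S)" for x
    by (simp add: law_def X.simps(2))
  have cm: "integrable S (\<lambda>s. of_bool (cell n s = k) * m s)"
    using cell_indicator_int[OF m_int, of n k] by simp
  have inc: "norm (X n (Suc k) x - X n k x) \<le> EE n k * (1 + D) * (1 + norm x) * (Mi (grid n (Suc k)) - Mi (grid n k))" for x
  proof -
    have "norm (X n (Suc k) x - X n k x) = norm (\<integral>s. of_bool (cell n s = k) *\<^sub>R vsel (law n k) s (X n k x) \<partial>S)"
      unfolding XS by simp
    also have "\<dots> \<le> (\<integral>s. EE n k * (1 + D) * (1 + norm x) * (of_bool (cell n s = k) * m s) \<partial>S)"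
    proof (rule norm_integral_le)
      show "integrable S (\<lambda>s. of_bool (cell n s = k) *\<^sub>R vsel (law n k) s (X n k x))"
        by (rule cell_indicator_int[OF int])
      show "integrable S (\<lambda>s. EE n k * (1 + D) * (1 + norm x) * (of_bool (cell n s = k) * m s))"
        by (intro integrable_mult_right cm)
      show "AE s in S. norm (of_bool (cell n s = k) *\<^sub>R vsel (law n k) s (X n k x))
          \<le> EE n k * (1 + D) * (1 + norm x) * (of_bool (cell n s = k) * m s)"
        using w by eventually_elim (auto simp: of_bool_def mult_ac)
    qed
    also have "\<dots> = EE n k * (1 + D) * (1 + norm x) * (Mi (grid n (Suc k)) - Mi (grid n k))"
      by (simp add: cell_mass)
    finally show ?thesis .
  qed
  then show "norm (X n (Suc k) x - X n k x) \<le> EE n k * (1 + D) * (1 + norm x) * (Mi (grid n (Suc k)) - Mi (grid n k))" .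
  show "continuous_on UNIV (X n (Suc k))"
  proof (rule continuous_at_imp_continuous_on, rule ballI)
    fix x
    have "isCont (\<lambda>x. \<integral>s. of_bool (cell n s = k) *\<^sub>R vsel (law n k) s (X n k x) \<partial>S) x"
      unfolding continuous_at_sequentially
    proof (intro allI impI)
      fix u assume u: "u \<longlonglongrightarrow> x"
      have "Bseq u" using u by (intro convergent_imp_Bseq) (auto simp: convergent_def)
      then obtain R where R: "\<And>j. norm (u j) \<le> R" by (auto simp: Bseq_def)
      have "(\<lambda>j. \<integral>s. of_bool (cell n s = k) *\<^sub>R vsel (law n k) s (X n k (u j)) \<partial>S)
        \<longlonglongrightarrow> (\<integral>s. of_bool (cell n s = k) *\<^sub>R vsel (law n k) s (X n k x) \<partial>S)"
      proof (rule integral_dominated_convergence[where w = "\<lambda>s. m s * (EE n k * (1 + D) * (1 + R))"])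
        show "integrable S (\<lambda>s. m s * (EE n k * (1 + D) * (1 + R)))" by (intro integrable_mult_left m_int)
        show "AE s in S. (\<lambda>j. of_bool (cell n s = k) *\<^sub>R vsel (law n k) s (X n k (u j)))
          \<longlonglongrightarrow> of_bool (cell n s = k) *\<^sub>R vsel (law n k) s (X n k x)"
          using AE_space
        proof eventually_elim
          case (elim s)
          have "isCont (vsel (law n k) s) (X n k x)" "isCont (X n k) x"
            using vsel_cont[OF P, of s] elim c by (auto simp: continuous_on_eq_continuous_at)
          from isCont_tendsto_compose[OF this(1) isCont_tendsto_compose[OF this(2) u]]
          show ?case by (intro tendsto_scaleR tendsto_const)
        qed
        show "AE s in S. norm (of_bool (cell n s = k) *\<^sub>R vsel (law n k) s (X n k (u j)))
            \<le> m s * (EE n k * (1 + D) * (1 + R))" for j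
          using w AE_space
        proof eventually_elim
          case (elim s)
          have "norm (vsel (law n k) s (X n k (u j))) \<le> m s * (EE n k * (1 + D) * (1 + norm (u j)))"
            using elim(1) by blast
          also have "\<dots> \<le> m s * (EE n k * (1 + D) * (1 + R))"
            using m_nonneg[of s] elim(2) R[of j] E1 D_ge_1 by (intro mult_left_mono add_left_mono) auto
          finally have f: "norm (vsel (law n k) s (X n k (u j))) \<le> m s * (EE n k * (1 + D) * (1 + R))" .
          then show ?case using order_trans[OF norm_ge_zero f] by (auto simp: of_bool_def)
        qed
      qed (auto intro!: borel_measurable_integrable cell_indicator_int int)
      then show "((\<lambda>x. \<integral>s. of_bool (cell n s = k) *\<^sub>R vsel (law n k) s (X n k x) \<partial>S) \<circ> u)
        \<longlonglongrightarrow> (\<integral>s. of_bool (cell n s = k) *\<^sub>R vsel (law n k) s (X n k x) \<partial>S)" by (simp add: o_def)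
    qed
    then show "isCont (X n (Suc k)) x"
      unfolding XS[abs_def] using c by (intro continuous_intros) (auto simp: continuous_on_eq_continuous_at)
  qed
  show "1 + norm (X n (Suc k) x) \<le> EE n (Suc k) * (1 + norm x)"
  proof -
    define a where "a = Mi (grid n (Suc k)) - Mi (grid n k)"
    have "norm (X n (Suc k) x) \<le> norm (X n k x) + norm (X n (Suc k) x - X n k x)"
      using norm_triangle_ineq[of "X n k x" "X n (Suc k) x - X n k x"] by simp
    then have "1 + norm (X n (Suc k) x) \<le> EE n k * (1 + norm x) + EE n k * (1 + D) * (1 + norm x) * a"
      using b[of x] inc[of x] by (simp add: a_def)
    also have "\<dots> = EE n k * (1 + norm x) * (1 + (1 + D) * a)" by (simp add: algebra_simps)
    also have "\<dots> \<le> EE n k * (1 + norm x) * exp ((1 + D) * a)"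
      using E1 by (intro mult_left_mono exp_ge_add_one_self) auto
    also have "\<dots> = EE n (Suc k) * (1 + norm x)"
      unfolding EE_def a_def by (simp add: algebra_simps flip: exp_add)
    finally show ?thesis .
  qed
qed

lemma Euler_invariant: "continuous_on UNIV (X n k) \<and> (\<forall>x. 1 + norm (X n k x) \<le> EE n k * (1 + norm x))"
proof (induction k)
  case 0
  then show ?case by (simp add: EE_def Mi_0)
next
  case (Suc k)
  then show ?case using Euler_step(6,7)[of n k] by blast
qed

lemmas X_cont = Euler_invariant[THEN conjunct1]
lemmas X_invariant = Euler_invariant[THEN conjunct2, rule_format]
lemmas law_Pp = Euler_step(1)[OF X_cont X_invariant]

text \<open>Uniform in the grid and the cell, it dominates both the growth factor
  \<open>EE n k\<close> and the speed factor \<open>EE n k * (1 + D)\<close>.\<close>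

definition CC :: real where "CC = exp ((1 + D) * MT) * (1 + D)"

lemma CC_ge_1: "1 \<le> CC"
proof -
  have "1 * 1 \<le> exp ((1 + D) * MT) * (1 + D)"
    using D_ge_1 MT_nonneg by (intro mult_mono) auto
  then show ?thesis by (simp add: CC_def)
qed

lemma EE_bounds: "1 \<le> EE n k" "EE n k \<le> exp ((1 + D) * MT)" "EE n k * (1 + D) \<le> CC" "EE n k \<le> CC"
proof -
  show 1: "1 \<le> EE n k" unfolding EE_def using D_ge_1 Mi_nonneg by (simp add: one_le_exp_iff)
  show 2: "EE n k \<le> exp ((1 + D) * MT)"
    unfolding EE_def using D_ge_1 Mi_le_MT by (simp add: mult_left_mono)
  then show 3: "EE n k * (1 + D) \<le> CC" unfolding CC_def using D_ge_1 by (intro mult_right_mono) auto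
  have "EE n k * 1 \<le> EE n k * (1 + D)" using 1 D_ge_1 by (intro mult_left_mono) auto
  then show "EE n k \<le> CC" using 3 by linarith
qed

lemma X_measurable [measurable]: "X n k \<in> borel_measurable borel"
  using X_cont by (rule borel_measurable_continuous_onI)

lemma X_measurable' [measurable]: "X n k \<in> borel_measurable \<mu>0"
  by measurable

lemma X_bound: "norm (X n k x) \<le> CC * (1 + norm x)"
proof -
  have "1 + norm (X n k x) \<le> EE n k * (1 + norm x)" by (rule X_invariant)
  also have "\<dots> \<le> CC * (1 + norm x)" using EE_bounds by (intro mult_right_mono) auto
  finally show ?thesis by linarith
qed

text \<open>One-step displacements telescope in the clock \<open>Mi\<close>. The modulus obtained is
  the same for all grids and therefore survives in the limit.\<close>

lemma X_increment: "j \<le> k \<Longrightarrow> norm (X n k x - X n j x) \<le> CC * (1 + norm x) * (Mi (grid n k) - Mi (grid n j))"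
proof (induction k)
  case 0
  then show ?case by simp
next
  case (Suc k)
  show ?case
  proof (cases "j = Suc k")
    case False
    then have j: "j \<le> k" using Suc.prems by simp
    have mono: "Mi (grid n k) \<le> Mi (grid n (Suc k))" using T by (intro Mi_mono) (simp add: grid_Suc del: of_nat_Suc)
    have "norm (X n (Suc k) x - X n k x) \<le> EE n k * (1 + D) * (1 + norm x) * (Mi (grid n (Suc k)) - Mi (grid n k))"
      by (rule Euler_step(5)[OF X_cont X_invariant])
    also have "\<dots> \<le> CC * (1 + norm x) * (Mi (grid n (Suc k)) - Mi (grid n k))"
      using EE_bounds(3)[of n k] mono by (intro mult_right_mono) auto
    finally have "norm (X n (Suc k) x - X n k x) \<le> CC * (1 + norm x) * (Mi (grid n (Suc k)) - Mi (grid n k))" .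
    moreover have "norm (X n (Suc k) x - X n j x) \<le> norm (X n (Suc k) x - X n k x) + norm (X n k x - X n j x)"
      using norm_triangle_ineq[of "X n (Suc k) x - X n k x" "X n k x - X n j x"] by simp
    ultimately show ?thesis using Suc.IH[OF j] by (simp add: algebra_simps)
  qed simp
qed

section \<open>Velocities of the scheme\<close>

definition vn :: "nat \<Rightarrow> real \<Rightarrow> 'a \<Rightarrow> 'a" where "vn n s = vsel (law n (cell n s)) s"

lemma vn_in: "s \<in> {0..T} \<Longrightarrow> vn n s \<in> V s (law n (cell n s))"
  unfolding vn_def by (rule vsel(1)[OF law_Pp])

lemma vn_cont: "s \<in> {0..T} \<Longrightarrow> continuous_on UNIV (vn n s)"
  unfolding vn_def by (rule vsel_cont[OF law_Pp])

lemma vn_measurable: "(\<lambda>s. vn n s y) \<in> borel_measurable S"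
  unfolding vn_def by (rule measurable_compose_countable[OF vsel(2)[OF law_Pp] cell_measurable])

lemma vn_measurable_pair: "(\<lambda>z. vn n (fst z) (snd z)) \<in> borel_measurable (S \<Otimes>\<^sub>M borel)"
  by (rule Caratheodory_borel_measurable_pair[OF vn_measurable vn_cont]) simp

text \<open>The laws of all schemes form a countable family, so one null set of times serves all
  \<open>n\<close> and all positions.\<close>

lemma vn_bound: "AE s in S. \<forall>n y. norm (vn n s y) \<le> m s * (CC * (1 + norm y))"
proof -
  have "AE s in S. \<forall>n k y. norm (vsel (law n k) s y) \<le> m s * (1 + norm y + moment p (law n k))"
    unfolding AE_all_countable by (intro allI vsel_growth law_Pp)
  then show ?thesis using AE_space
  proof eventually_elim
    case (elim s)
    show ?case
    proof (intro allI)
      fix n and y :: 'a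
      define k where "k = cell n s"
      have "moment p (law n k) \<le> EE n k * D" by (rule Euler_step(2)[OF X_cont X_invariant])
      then have "1 + norm y + moment p (law n k) \<le> EE n k * (1 + norm y) + EE n k * D * (1 + norm y)"
      proof -
        have 1: "1 * (1 + norm y) \<le> EE n k * (1 + norm y)" using EE_bounds by (intro mult_right_mono) auto
        have 2: "EE n k * D * 1 \<le> EE n k * D * (1 + norm y)"
          using EE_bounds(1)[of n k] D_ge_1 by (intro mult_left_mono) auto
        have "moment p (law n k) \<le> EE n k * D * (1 + norm y)"
          using order_trans[OF \<open>moment p (law n k) \<le> EE n k * D\<close>] 2 by simp
        from add_mono[OF 1 this] show ?thesis by simp
      qed
      also have "\<dots> = EE n k * (1 + D) * (1 + norm y)" by (simp add: algebra_simps)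
      also have "\<dots> \<le> CC * (1 + norm y)" using EE_bounds by (intro mult_right_mono) auto
      finally have "m s * (1 + norm y + moment p (law n k)) \<le> m s * (CC * (1 + norm y))"
        using m_nonneg[of s] elim(2) by (intro mult_left_mono) auto
      moreover have "norm (vn n s y) \<le> m s * (1 + norm y + moment p (law n k))"
        using elim(1) unfolding vn_def k_def by blast
      ultimately show "norm (vn n s y) \<le> m s * (CC * (1 + norm y))" by linarith
    qed
  qed
qed

text \<open>The growth constant along the scheme, from 1 + |X| <= (1 + CC)(1 + |x|).\<close>

definition KK :: real where "KK = CC * (1 + CC)"

lemma KK_nonneg: "0 \<le> KK" using CC_ge_1 by (simp add: KK_def)

lemma vn_X_bound: "AE s in S. \<forall>n x. norm (vn n s (X n (cell n s) x)) \<le> m s * (KK * (1 + norm x))"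
  using vn_bound AE_space
proof eventually_elim
  case (elim s)
  show ?case
  proof (intro allI)
    fix n and x :: 'a
    have "norm (vn n s (X n (cell n s) x)) \<le> m s * (CC * (1 + norm (X n (cell n s) x)))"
      using elim(1) by blast
    also have "\<dots> \<le> m s * (CC * ((1 + CC) * (1 + norm x)))"
    proof (intro mult_left_mono)
      have "1 + norm (X n (cell n s) x) \<le> 1 + CC * (1 + norm x)" using X_bound by simp
      also have "\<dots> \<le> (1 + CC) * (1 + norm x)" by (simp add: algebra_simps)
      finally show "1 + norm (X n (cell n s) x) \<le> (1 + CC) * (1 + norm x)" .
    qed (use CC_ge_1 m_nonneg elim(2) in auto)
    finally show "norm (vn n s (X n (cell n s) x)) \<le> m s * (KK * (1 + norm x))"
      by (simp add: KK_def mult.assoc)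
  qed
qed

lemma ident_measurable_fst: "(\<lambda>z. fst z) \<in> borel_measurable (S \<Otimes>\<^sub>M N)"
  using measurable_compose[OF measurable_fst ident_borel_measurable_lebesgue_on] .

lemma Xc_measurable_pair: "(\<lambda>z. X n (cell n (fst z)) (snd z)) \<in> borel_measurable (S \<Otimes>\<^sub>M borel)"
proof (rule measurable_compose_countable[where f = "\<lambda>k z. X n k (snd z)"])
  show "(\<lambda>z. X n k (snd z)) \<in> borel_measurable (S \<Otimes>\<^sub>M borel)" for k
    using measurable_compose[OF measurable_snd X_measurable] .
  show "(\<lambda>z. cell n (fst z)) \<in> S \<Otimes>\<^sub>M borel \<rightarrow>\<^sub>M count_space UNIV"
    using measurable_compose[OF measurable_fst cell_measurable] .
qed

lemma vX_measurable_pair: "(\<lambda>z. vn n (fst z) (X n (cell n (fst z)) (snd z))) \<in> borel_measurable (S \<Otimes>\<^sub>M borel)"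
  using measurable_compose[OF measurable_Pair[OF measurable_fst Xc_measurable_pair] vn_measurable_pair] by simp

lemma vX_measurable: "(\<lambda>s. vn n s (X n (cell n s) x)) \<in> borel_measurable S"
  using measurable_compose[OF measurable_Pair2'[of x borel S] vX_measurable_pair] by simp

lemma vX_int: "integrable S (\<lambda>s. vn n s (X n (cell n s) x))"
proof (rule Bochner_Integration.integrable_bound[OF integrable_mult_left[OF m_int, of "KK * (1 + norm x)"]])
  show "AE s in S. norm (vn n s (X n (cell n s) x)) \<le> norm (m s * (KK * (1 + norm x)))"
    using vn_X_bound by eventually_elim (auto intro: order_trans[OF _ abs_ge_self])
qed (rule vX_measurable)

lemma cell_measure:
  assumes "k \<le> n"
  shows "(\<integral>s. of_bool (cell n s = k) \<partial>S) = T / real (Suc n)"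
proof -
  have gT: "grid n (Suc k) \<le> T"
  proof -
    have "grid n (Suc k) \<le> grid n (Suc n)" unfolding grid_def
      using assms T by (intro divide_right_mono mult_right_mono) auto
    then show ?thesis by simp
  qed
  have sub: "{grid n k..<grid n (Suc k)} \<subseteq> {0..T}" using gT by (auto intro: order_trans[OF grid_nonneg])
  have eq: "of_bool (cell n s = k) = (indicator {grid n k..<grid n (Suc k)} s :: real)" if "s \<in> space S" for s
  proof -
    have s: "0 \<le> s" using that by simp
    show ?thesis using cell_less_iff[OF s, of n k] cell_less_iff[OF s, of n "Suc k"]
      by (auto simp: indicator_def of_bool_def less_Suc_eq)
  qed
  have "(\<integral>s. of_bool (cell n s = k) \<partial>S) = (\<integral>s. indicat_real {grid n k..<grid n (Suc k)} s \<partial>S)"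
    by (intro Bochner_Integration.integral_cong refl eq)
  also have "\<dots> = measure S ({grid n k..<grid n (Suc k)} \<inter> space S)" by simp
  also have "{grid n k..<grid n (Suc k)} \<inter> space S = {grid n k..<grid n (Suc k)}" using sub by auto
  also have "measure S {grid n k..<grid n (Suc k)} = measure lebesgue {grid n k..<grid n (Suc k)}"
    using sub by (intro measure_restrict_space) auto
  also have "\<dots> = T / real (Suc n)" using T by (simp add: grid_Suc)
  finally show ?thesis .
qed

section \<open>The approximate weak equation along the scheme\<close>

lemma norm_pair_le: "norm (a, b) \<le> norm a + norm b"
  by (simp add: norm_Pair sqrt_sum_squares_le_sum)

text \<open>Telescoping of a test function along the Euler polygon, by the mean value theorem on each cell.\<close>

lemma telescoped_Euler:
  fixes \<phi> :: "real \<times> 'a \<Rightarrow> real"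
  assumes der: "\<And>z. (\<phi> has_derivative (\<lambda>h. G z \<bullet> h)) (at z)"
    and \<phi>0: "\<And>t x. t \<le> 0 \<or> T \<le> t \<Longrightarrow> \<phi> (t, x) = 0"
  shows "\<exists>\<xi>. integrable S (\<lambda>s. G (\<xi> (cell n s)) \<bullet> (1, vn n s (X n (cell n s) x))) \<and>
    (\<integral>s. G (\<xi> (cell n s)) \<bullet> (1, vn n s (X n (cell n s) x)) \<partial>S) = 0 \<and>
    (\<forall>k. norm (\<xi> k - (grid n k, X n k x)) \<le> T / real (Suc n) + CC * (1 + norm x) * (Mi (grid n (Suc k)) - Mi (grid n k)))"
proof -
  define z where "z k = (grid n k, X n k x)" for k
  define b where "b s = vn n s (X n (cell n s) x)" for s
  define h where "h = T / real (Suc n)"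
  have h0: "0 < h" using T by (simp add: h_def)
  \<comment> \<open>The intermediate point depends on the cell alone, so \<open>G\<close> at this
    point is constant over the cell and can be moved into the integral defining the increment of
    \<open>X\<close>.\<close>
  have "\<exists>\<xi>. \<phi> (z (Suc k)) - \<phi> (z k) = G \<xi> \<bullet> (z (Suc k) - z k) \<and> norm (\<xi> - z k) \<le> norm (z (Suc k) - z k)" for k
    by (rule mean_value_inner[OF der, of "z (Suc k)" "z k"]) auto
  then obtain \<xi> where \<xi>1: "\<And>k. \<phi> (z (Suc k)) - \<phi> (z k) = G (\<xi> k) \<bullet> (z (Suc k) - z k)"
    and \<xi>2: "\<And>k. norm (\<xi> k - z k) \<le> norm (z (Suc k) - z k)" by metis
  have bi: "integrable S b" unfolding b_def by (rule vX_int)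
  have Gi: "integrable S (\<lambda>s. g \<bullet> (1, b s))" for g :: "real \<times> 'a"
  proof -
    have "integrable S (\<lambda>s. fst g + snd g \<bullet> b s)"
      by (intro Bochner_Integration.integrable_add integrable_inner_right bi) simp
    then show ?thesis by (cases g) simp
  qed
  define F where "F s k = of_bool (cell n s = k) * (G (\<xi> k) \<bullet> (1, b s))" for s k
  have Fi: "integrable S (\<lambda>s. F s k)" for k
    unfolding F_def using cell_indicator_int[OF Gi, of n k "G (\<xi> k)"] by simp
  have step: "\<phi> (z (Suc k)) - \<phi> (z k) = (\<integral>s. F s k \<partial>S)" if k: "k \<le> n" for k
  proof -
    have "X n (Suc k) x - X n k x = (\<integral>s. of_bool (cell n s = k) *\<^sub>R vsel (law n k) s (X n k x) \<partial>S)"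
      by (simp add: law_def X.simps(2))
    also have "\<dots> = (\<integral>s. of_bool (cell n s = k) *\<^sub>R b s \<partial>S)"
      by (intro Bochner_Integration.integral_cong) (auto simp: b_def vn_def of_bool_def)
    finally have dX: "X n (Suc k) x - X n k x = (\<integral>s. of_bool (cell n s = k) *\<^sub>R b s \<partial>S)" .
    have ci: "integrable S (\<lambda>s. of_bool (cell n s = k) *\<^sub>R b s)" by (rule cell_indicator_int[OF bi])
    have oi: "integrable S (\<lambda>s. of_bool (cell n s = k) :: real)"
      using cell_indicator_int[of "\<lambda>_. 1 :: real" n k] by simp
    have "(\<integral>s. F s k \<partial>S) = (\<integral>s. fst (G (\<xi> k)) * of_bool (cell n s = k) + snd (G (\<xi> k)) \<bullet> (of_bool (cell n s = k) *\<^sub>R b s) \<partial>S)"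
      by (intro Bochner_Integration.integral_cong) (auto simp: F_def of_bool_def inner_prod_def)
    also have "\<dots> = fst (G (\<xi> k)) * (\<integral>s. of_bool (cell n s = k) \<partial>S) + snd (G (\<xi> k)) \<bullet> (\<integral>s. of_bool (cell n s = k) *\<^sub>R b s \<partial>S)"
    proof -
      have i1: "integrable S (\<lambda>s. fst (G (\<xi> k)) * of_bool (cell n s = k))" by (intro integrable_mult_right oi)
      have i2: "integrable S (\<lambda>s. snd (G (\<xi> k)) \<bullet> (of_bool (cell n s = k) *\<^sub>R b s))" by (intro integrable_inner_right ci)
      have "(\<integral>s. snd (G (\<xi> k)) \<bullet> (of_bool (cell n s = k) *\<^sub>R b s) \<partial>S) = snd (G (\<xi> k)) \<bullet> (\<integral>s. of_bool (cell n s = k) *\<^sub>R b s \<partial>S)"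
        using ci by (intro integral_inner_right) simp
      then show ?thesis unfolding Bochner_Integration.integral_add[OF i1 i2] by simp
    qed
    also have "\<dots> = G (\<xi> k) \<bullet> (z (Suc k) - z k)"
      unfolding dX[symmetric] cell_measure[OF k] z_def by (simp add: inner_prod_def grid_Suc del: of_nat_Suc)
    finally show ?thesis using \<xi>1 by simp
  qed
  have "(\<Sum>k<Suc n. \<integral>s. F s k \<partial>S) = (\<Sum>k<Suc n. \<phi> (z (Suc k)) - \<phi> (z k))"
    using step by (intro sum.cong) auto
  also have "\<dots> = \<phi> (z (Suc n)) - \<phi> (z 0)" by (rule sum_lessThan_telescope)
  also have "\<dots> = 0" by (simp add: z_def \<phi>0)
  finally have sum0: "(\<integral>s. (\<Sum>k<Suc n. F s k) \<partial>S) = 0"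
    using Fi by (subst Bochner_Integration.integral_sum) auto
  \<comment> \<open>The sum runs over the cells 0 to n; the end point T lies in cell
    \<open>Suc n\<close>, so the identity holds only almost everywhere.\<close>
  have ae: "AE s in S. (\<Sum>k<Suc n. F s k) = G (\<xi> (cell n s)) \<bullet> (1, b s)"
    using AE_S_less_T AE_space
  proof eventually_elim
    case (elim s)
    then have c: "cell n s < Suc n" using cell_less_iff[of s n "Suc n"] by simp
    have "(\<Sum>k<Suc n. F s k) = (\<Sum>k\<in>{cell n s}. F s k)"
      using c by (intro sum.mono_neutral_right) (auto simp: F_def)
    then show ?case by (simp add: F_def)
  qed
  have meas: "(\<lambda>s. G (\<xi> (cell n s)) \<bullet> (1, b s)) \<in> borel_measurable S"
  proof (rule measurable_compose_countable[where f = "\<lambda>k s. G (\<xi> k) \<bullet> (1, b s)"])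
    show "(\<lambda>s. G (\<xi> k) \<bullet> (1, b s)) \<in> borel_measurable S" for k by (rule borel_measurable_integrable[OF Gi])
  qed measurable
  have sum_int: "integrable S (\<lambda>s. \<Sum>k<Suc n. F s k)" using Fi by (intro Bochner_Integration.integrable_sum) auto
  show ?thesis
  proof (intro exI[of _ \<xi>] conjI allI)
    show "integrable S (\<lambda>s. G (\<xi> (cell n s)) \<bullet> (1, vn n s (X n (cell n s) x)))"
      unfolding b_def[symmetric] by (rule integrable_cong_AE_imp[OF sum_int meas]) (use ae in \<open>auto simp: eq_commute\<close>)
    have "(\<integral>s. G (\<xi> (cell n s)) \<bullet> (1, b s) \<partial>S) = (\<integral>s. (\<Sum>k<Suc n. F s k) \<partial>S)"
      by (rule integral_cong_AE[OF meas borel_measurable_integrable[OF sum_int]]) (use ae in \<open>auto simp: eq_commute\<close>)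
    then show "(\<integral>s. G (\<xi> (cell n s)) \<bullet> (1, vn n s (X n (cell n s) x)) \<partial>S) = 0"
      unfolding b_def[symmetric] sum0 .
    show "norm (\<xi> k - (grid n k, X n k x)) \<le> T / real (Suc n) + CC * (1 + norm x) * (Mi (grid n (Suc k)) - Mi (grid n k))" for k
    proof -
      have "norm (\<xi> k - z k) \<le> norm (z (Suc k) - z k)" by (rule \<xi>2)
      also have "z (Suc k) - z k = (h, X n (Suc k) x - X n k x)"
        by (simp add: z_def grid_Suc h_def del: of_nat_Suc)
      also have "norm \<dots> \<le> norm h + norm (X n (Suc k) x - X n k x)" by (rule norm_pair_le)
      also have "\<dots> \<le> h + CC * (1 + norm x) * (Mi (grid n (Suc k)) - Mi (grid n k))"
        using X_increment[of k "Suc k" n x] h0 by simp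
      finally show ?thesis by (simp add: z_def h_def del: of_nat_Suc)
    qed
  qed
qed

lemma Euler_integrand_bound:
  fixes G :: "real \<times> 'a \<Rightarrow> real \<times> 'a"
  assumes GB: "\<And>z. norm (G z) \<le> B"
  shows "AE s in S. \<forall>n x. \<bar>G (s, X n (cell n s) x) \<bullet> (1, vn n s (X n (cell n s) x))\<bar> \<le> B * (1 + m s * (KK * (1 + norm x)))"
  using vn_X_bound
proof eventually_elim
  case (elim s)
  show ?case
  proof (intro allI)
    fix n and x :: 'a
    have B0: "0 \<le> B" using order_trans[OF norm_ge_zero GB] .
    have "\<bar>G (s, X n (cell n s) x) \<bullet> (1, vn n s (X n (cell n s) x))\<bar>
      \<le> norm (G (s, X n (cell n s) x)) * norm (1 :: real, vn n s (X n (cell n s) x))"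
      by (rule Cauchy_Schwarz_ineq2)
    also have "\<dots> \<le> B * (1 + m s * (KK * (1 + norm x)))"
    proof (rule mult_mono[OF GB])
      show "norm (1 :: real, vn n s (X n (cell n s) x)) \<le> 1 + m s * (KK * (1 + norm x))"
        using norm_pair_le[of "1::real" "vn n s (X n (cell n s) x)"] elim[rule_format, of n x] by simp
    qed (use B0 in auto)
    finally show "\<bar>G (s, X n (cell n s) x) \<bullet> (1, vn n s (X n (cell n s) x))\<bar> \<le> B * (1 + m s * (KK * (1 + norm x)))" .
  qed
qed

lemma Euler_integrand_measurable_pair:
  fixes G :: "real \<times> 'a \<Rightarrow> real \<times> 'a"
  assumes contG: "continuous_on UNIV G"
  shows "(\<lambda>z. G (fst z, X n (cell n (fst z)) (snd z)) \<bullet> (1, vn n (fst z) (X n (cell n (fst z)) (snd z)))) \<in> borel_measurable (S \<Otimes>\<^sub>M borel)"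
proof -
  have "G \<in> borel_measurable borel" using contG by (rule borel_measurable_continuous_onI)
  from measurable_compose[OF borel_measurable_Pair[OF ident_measurable_fst Xc_measurable_pair] this]
  show ?thesis
    by (intro borel_measurable_inner borel_measurable_Pair vX_measurable_pair) auto
qed

lemma Euler_integrand_measurable:
  fixes G :: "real \<times> 'a \<Rightarrow> real \<times> 'a"
  assumes contG: "continuous_on UNIV G"
  shows "(\<lambda>s. G (s, X n (cell n s) x) \<bullet> (1, vn n s (X n (cell n s) x))) \<in> borel_measurable S"
  using measurable_compose[OF measurable_Pair2'[of x borel S] Euler_integrand_measurable_pair[OF contG, of n]] by simp

lemma bound_int: "integrable S (\<lambda>s. B * (1 + m s * c))"
  by (intro integrable_mult_right Bochner_Integration.integrable_add integrable_mult_left m_int S.integrable_const)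

lemma bound_integral: "(\<integral>s. B * (1 + m s * c) \<partial>S) = B * (T + MT * c)"
proof -
  have "(\<integral>s. 1 + m s * c \<partial>S) = (\<integral>s. 1 \<partial>S) + (\<integral>s. m s * c \<partial>S)"
    by (intro Bochner_Integration.integral_add integrable_mult_left m_int S.integrable_const)
  also have "(\<integral>s. 1 \<partial>S) = T" using measure_S_total by simp
  finally show ?thesis by (simp add: MT_def)
qed

lemma Euler_integrand_int:
  fixes G :: "real \<times> 'a \<Rightarrow> real \<times> 'a"
  assumes contG: "continuous_on UNIV G" and GB: "\<And>z. norm (G z) \<le> B"
  shows "integrable S (\<lambda>s. G (s, X n (cell n s) x) \<bullet> (1, vn n s (X n (cell n s) x)))"
proof (rule Bochner_Integration.integrable_bound[OF bound_int[of B "KK * (1 + norm x)"] Euler_integrand_measurable[OF contG]])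
  show "AE s in S. norm (G (s, X n (cell n s) x) \<bullet> (1, vn n s (X n (cell n s) x))) \<le> norm (B * (1 + m s * (KK * (1 + norm x))))"
    using Euler_integrand_bound[of G, OF GB] by eventually_elim (auto intro: order_trans[OF _ abs_ge_self])
qed

text \<open>The integral with \<open>G\<close> at the intermediate points is exactly 0. Moving these
  points to (s, X) costs the modulus of continuity of \<open>G\<close>, integrated against 1 +
  |velocity|, and the points come together as the mesh shrinks.\<close>

lemma Euler_weak_error:
  fixes \<phi> :: "real \<times> 'a \<Rightarrow> real"
  assumes der: "\<And>z. (\<phi> has_derivative (\<lambda>h. G z \<bullet> h)) (at z)"
    and \<phi>0: "\<And>t x. t \<le> 0 \<or> T \<le> t \<Longrightarrow> \<phi> (t, x) = 0"
    and contG: "continuous_on UNIV G" and ucG: "uniformly_continuous_on UNIV G" and GB: "\<And>z. norm (G z) \<le> B"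
  shows "(\<lambda>n. \<integral>s. G (s, X n (cell n s) x) \<bullet> (1, vn n s (X n (cell n s) x)) \<partial>S) \<longlonglongrightarrow> 0"
proof (rule LIMSEQ_I)
  fix r :: real assume r: "0 < r"
  define c where "c = KK * (1 + norm x)"
  have c0: "0 \<le> c" using KK_nonneg by (simp add: c_def)
  define Q where "Q = T + MT * c"
  have Q0: "0 < Q" using T MT_nonneg c0 by (simp add: Q_def add_pos_nonneg)
  \<comment> \<open>\<open>Q\<close> is the integral of the bound 1 + m c on |(1, velocity)|, so an
    oscillation \<eta> of \<open>G\<close> contributes at most \<eta> Q = r/2.\<close>
  define \<eta> where "\<eta> = r / (2 * Q)"
  have \<eta>: "0 < \<eta>" "\<eta> * Q < r" using r Q0 by (simp_all add: \<eta>_def)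
  obtain \<delta> where \<delta>: "0 < \<delta>" "\<And>z z'. dist z' z < \<delta> \<Longrightarrow> dist (G z') (G z) < \<eta>"
    using ucG \<eta>(1) unfolding uniformly_continuous_on_def by (metis UNIV_I)
  define C where "C = CC * (1 + norm x)"
  have C0: "0 \<le> C" using CC_ge_1 by (simp add: C_def)
  \<comment> \<open>Budget: the time offset inside the cell is below \<open>e\<close>, and the
    intermediate point lies within e + C e of the left grid point, together e (2 + C) =
    \<delta>.\<close>
  define e where "e = \<delta> / (2 + C)"
  have e: "0 < e" "e * (2 + C) = \<delta>" using \<delta>(1) C0 by (simp_all add: e_def)
  from Mi_increment_small[OF e(1)]
  obtain N where "(\<forall>n\<ge>N. \<forall>k\<le>n. Mi (grid n (Suc k)) - Mi (grid n k) < e) \<and> (\<forall>n\<ge>N. T / real (Suc n) < e)" ..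
  then have N: "\<And>n k. N \<le> n \<Longrightarrow> k \<le> n \<Longrightarrow> Mi (grid n (Suc k)) - Mi (grid n k) < e" "\<And>n. N \<le> n \<Longrightarrow> T / real (Suc n) < e"
    by auto
  have "norm ((\<integral>s. G (s, X n (cell n s) x) \<bullet> (1, vn n s (X n (cell n s) x)) \<partial>S) - 0) < r" if n: "N \<le> n" for n
  proof -
    from telescoped_Euler[of \<phi> G n x, OF der \<phi>0]
    obtain \<xi> where \<xi>: "integrable S (\<lambda>s. G (\<xi> (cell n s)) \<bullet> (1, vn n s (X n (cell n s) x))) \<and>
      (\<integral>s. G (\<xi> (cell n s)) \<bullet> (1, vn n s (X n (cell n s) x)) \<partial>S) = 0 \<and>
      (\<forall>k. norm (\<xi> k - (grid n k, X n k x)) \<le> T / real (Suc n) + CC * (1 + norm x) * (Mi (grid n (Suc k)) - Mi (grid n k)))" ..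
    note \<xi>i = \<xi>[THEN conjunct1] and \<xi>0 = \<xi>[THEN conjunct2, THEN conjunct1] and \<xi>d' = \<xi>[THEN conjunct2, THEN conjunct2]
    note \<xi>d = \<xi>d'[rule_format]
    note Gi = Euler_integrand_int[OF contG GB, of n x]
    have eqJ: "(\<integral>s. G (s, X n (cell n s) x) \<bullet> (1, vn n s (X n (cell n s) x)) \<partial>S)
      = (\<integral>s. G (s, X n (cell n s) x) \<bullet> (1, vn n s (X n (cell n s) x)) - G (\<xi> (cell n s)) \<bullet> (1, vn n s (X n (cell n s) x)) \<partial>S)"
      using \<xi>0 by (simp add: Bochner_Integration.integral_diff[OF Gi \<xi>i])
    have "norm (\<integral>s. G (s, X n (cell n s) x) \<bullet> (1, vn n s (X n (cell n s) x)) \<partial>S) \<le> (\<integral>s. \<eta> * (1 + m s * c) \<partial>S)"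
      unfolding eqJ
    proof (rule norm_integral_le[OF Bochner_Integration.integrable_diff[OF Gi \<xi>i] bound_int])
      show "AE s in S. norm (G (s, X n (cell n s) x) \<bullet> (1, vn n s (X n (cell n s) x)) - G (\<xi> (cell n s)) \<bullet> (1, vn n s (X n (cell n s) x)))
        \<le> \<eta> * (1 + m s * c)"
        using vn_X_bound AE_S_less_T AE_space
      proof eventually_elim
        case (elim s)
        define k where "k = cell n s"
        have s0: "0 \<le> s" using elim(3) by simp
        have k: "k \<le> n" using cell_less_iff[OF s0, of n "Suc n"] elim(2) by (simp add: k_def)
        have g: "grid n k \<le> s" "s < grid n (Suc k)" unfolding k_def by (rule grid_cell[OF s0])+
        have "norm ((s, X n k x) - (grid n k, X n k x)) < e"
          using g N(2)[OF n] by (simp add: grid_Suc del: of_nat_Suc)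
        moreover have "norm (\<xi> k - (grid n k, X n k x)) < e + C * e"
        proof -
          have "C * (Mi (grid n (Suc k)) - Mi (grid n k)) \<le> C * e"
            using N(1)[OF n k] C0 by (intro mult_left_mono) auto
          then show ?thesis using \<xi>d[of k] N(2)[OF n] unfolding C_def[symmetric] by linarith
        qed
        ultimately have "norm ((s, X n k x) - \<xi> k) < e + (e + C * e)"
          using norm_triangle_ineq4[of "(s, X n k x) - (grid n k, X n k x)" "\<xi> k - (grid n k, X n k x)"]
          by (simp only: diff_diff_eq2 diff_add_cancel)
        also have "\<dots> = \<delta>" using e(2) by (simp add: algebra_simps)
        finally have "dist (G (s, X n k x)) (G (\<xi> k)) < \<eta>" by (intro \<delta>(2)) (simp add: dist_norm)
        then have GG: "norm (G (s, X n k x) - G (\<xi> k)) \<le> \<eta>" by (simp add: dist_norm)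
        have "norm (G (s, X n k x) \<bullet> (1, vn n s (X n k x)) - G (\<xi> k) \<bullet> (1, vn n s (X n k x)))
          = \<bar>(G (s, X n k x) - G (\<xi> k)) \<bullet> (1, vn n s (X n k x))\<bar>" by (simp add: inner_diff_left)
        also have "\<dots> \<le> norm (G (s, X n k x) - G (\<xi> k)) * norm (1 :: real, vn n s (X n k x))"
          by (rule Cauchy_Schwarz_ineq2)
        also have "\<dots> \<le> \<eta> * (1 + m s * c)"
        proof (rule mult_mono[OF GG])
          show "norm (1 :: real, vn n s (X n k x)) \<le> 1 + m s * c"
            using norm_pair_le[of "1::real" "vn n s (X n k x)"] elim(1)[rule_format, of n x] by (simp add: k_def c_def)
        qed (use \<eta> in auto)
        finally show ?case unfolding k_def .
      qed
    qed
    also have "\<dots> = \<eta> * Q" by (simp only: bound_integral Q_def)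
    also have "\<dots> < r" by (rule \<eta>(2))
    finally show ?thesis by simp
  qed
  then show "\<exists>no. \<forall>n\<ge>no. norm ((\<integral>s. G (s, X n (cell n s) x) \<bullet> (1, vn n s (X n (cell n s) x)) \<partial>S) - 0) < r" by blast
qed

text \<open>Averages the pathwise statement over the starting point: Fubini's theorem makes the time
  integral for fixed \<open>x\<close> the inner one, and a multiple of a constant plus |x| dominates
  it.\<close>

lemma Euler_weak_limit:
  fixes \<phi> :: "real \<times> 'a \<Rightarrow> real"
  assumes der: "\<And>z. (\<phi> has_derivative (\<lambda>h. G z \<bullet> h)) (at z)"
    and \<phi>0: "\<And>t x. t \<le> 0 \<or> T \<le> t \<Longrightarrow> \<phi> (t, x) = 0"
    and contG: "continuous_on UNIV G" and ucG: "uniformly_continuous_on UNIV G" and GB: "\<And>z. norm (G z) \<le> B"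
  shows "(\<lambda>n. \<integral>s. (\<integral>y. G (s, y) \<bullet> (1, vn n s y) \<partial>law n (cell n s)) \<partial>S) \<longlonglongrightarrow> 0"
proof -
  interpret P: pair_sigma_finite S \<mu>0 ..
  define F where "F n s x = G (s, X n (cell n s) x) \<bullet> (1, vn n s (X n (cell n s) x))" for n s x
  have sets: "sets (S \<Otimes>\<^sub>M \<mu>0) = sets (S \<Otimes>\<^sub>M borel)" by (intro sets_pair_measure_cong sets_\<mu>0 refl)
  have Fm: "(\<lambda>z. F n (fst z) (snd z)) \<in> borel_measurable (S \<Otimes>\<^sub>M \<mu>0)" for n
    using Euler_integrand_measurable_pair[OF contG, of n] measurable_cong_sets[OF sets refl]
    unfolding F_def by blast
  have B0: "0 \<le> B" using order_trans[OF norm_ge_zero GB] .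
  have Fb: "AE s in S. \<forall>n x. \<bar>F n s x\<bar> \<le> B * (1 + m s * (KK * (1 + norm x)))"
    unfolding F_def by (rule Euler_integrand_bound[of G, OF GB])
  have mx: "integrable \<mu>0 (\<lambda>x. B * (1 + c * (KK * (1 + norm x))))" for c
    by (intro integrable_mult_right Bochner_Integration.integrable_add M0.integrable_const one_norm_int)
  have Fx_meas: "F n s \<in> borel_measurable \<mu>0" if "s \<in> space S" for n s
    using measurable_compose[OF measurable_Pair1'[OF that] Fm] by simp
  have Fx: "AE s in S. \<forall>n. integrable \<mu>0 (F n s)"
    using Fb AE_space
  proof eventually_elim
    case (elim s)
    show ?case
    proof
      fix n
      show "integrable \<mu>0 (F n s)"
      proof (rule Bochner_Integration.integrable_bound[OF mx[of "m s"] Fx_meas[OF elim(2)]])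
        show "AE x in \<mu>0. norm (F n s x) \<le> norm (B * (1 + m s * (KK * (1 + norm x))))"
          using elim(1) by (intro AE_I2) (auto intro: order_trans[OF _ abs_ge_self])
      qed
    qed
  qed
  define E where "E = (\<integral>x. 1 + norm x \<partial>\<mu>0)"
  have mx_int: "(\<integral>x. B * (1 + c * (KK * (1 + norm x))) \<partial>\<mu>0) = B * (1 + c * (KK * E))" for c
  proof -
    have "(\<integral>x. 1 + c * (KK * (1 + norm x)) \<partial>\<mu>0) = (\<integral>x. 1 \<partial>\<mu>0) + (\<integral>x. c * (KK * (1 + norm x)) \<partial>\<mu>0)"
      by (intro Bochner_Integration.integral_add M0.integrable_const integrable_mult_right one_norm_int)
    also have "(\<integral>x. (1::real) \<partial>\<mu>0) = 1" using M0.prob_space by simp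
    finally show ?thesis by (simp add: E_def)
  qed
  have Fint: "integrable (S \<Otimes>\<^sub>M \<mu>0) (\<lambda>z. F n (fst z) (snd z))" for n
  proof (rule P.Fubini_integrable[OF Fm])
    show "AE s in S. integrable \<mu>0 (\<lambda>x. F n (fst (s, x)) (snd (s, x)))"
      using Fx by eventually_elim simp
    show "integrable S (\<lambda>s. \<integral>x. norm (F n (fst (s, x)) (snd (s, x))) \<partial>\<mu>0)"
    proof (rule Bochner_Integration.integrable_bound[OF bound_int[of B "KK * E"]])
      show "(\<lambda>s. \<integral>x. norm (F n (fst (s, x)) (snd (s, x))) \<partial>\<mu>0) \<in> borel_measurable S"
        using Fm by (intro M0.borel_measurable_lebesgue_integral) (simp add: split_beta')
      show "AE s in S. norm (\<integral>x. norm (F n (fst (s, x)) (snd (s, x))) \<partial>\<mu>0) \<le> norm (B * (1 + m s * (KK * E)))"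
        using Fb Fx
      proof eventually_elim
        case (elim s)
        have "norm (\<integral>x. norm (F n s x) \<partial>\<mu>0) \<le> (\<integral>x. B * (1 + m s * (KK * (1 + norm x))) \<partial>\<mu>0)"
          using elim by (intro norm_integral_le mx) auto
        also have "\<dots> = B * (1 + m s * (KK * E))" by (rule mx_int)
        finally show ?case by (auto intro: order_trans[OF _ abs_ge_self])
      qed
    qed
  qed
  have swap: "(\<integral>s. (\<integral>y. G (s, y) \<bullet> (1, vn n s y) \<partial>law n (cell n s)) \<partial>S) = (\<integral>x. (\<integral>s. F n s x \<partial>S) \<partial>\<mu>0)" for n
  proof -
    have "(\<integral>s. (\<integral>y. G (s, y) \<bullet> (1, vn n s y) \<partial>law n (cell n s)) \<partial>S) = (\<integral>s. (\<integral>x. F n s x \<partial>\<mu>0) \<partial>S)"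
    proof (rule Bochner_Integration.integral_cong[OF refl])
      fix s assume s: "s \<in> space S"
      have "continuous_on UNIV (\<lambda>y. G (s, y) \<bullet> (1, vn n s y))"
        using s vn_cont[of s n] by (intro continuous_intros continuous_on_compose2[OF contG]) auto
      then have "(\<lambda>y. G (s, y) \<bullet> (1, vn n s y)) \<in> borel_measurable borel"
        by (rule borel_measurable_continuous_onI)
      then show "(\<integral>y. G (s, y) \<bullet> (1, vn n s y) \<partial>law n (cell n s)) = (\<integral>x. F n s x \<partial>\<mu>0)"
        unfolding law_def F_def by (subst integral_distr) auto
    qed
    also have "\<dots> = (\<integral>x. (\<integral>s. F n s x \<partial>S) \<partial>\<mu>0)"
      using P.Fubini_integral[of "F n"] Fint[of n] by (simp add: split_beta')
    finally show ?thesis .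
  qed
  have "(\<lambda>n. \<integral>x. (\<integral>s. F n s x \<partial>S) \<partial>\<mu>0) \<longlonglongrightarrow> (\<integral>x. 0 \<partial>\<mu>0)"
  proof (rule integral_dominated_convergence[where w = "\<lambda>x. B * (T + MT * (KK * (1 + norm x)))"])
    show "integrable \<mu>0 (\<lambda>x. B * (T + MT * (KK * (1 + norm x))))"
      by (intro integrable_mult_right Bochner_Integration.integrable_add M0.integrable_const one_norm_int)
    show "(\<lambda>x. \<integral>s. F n s x \<partial>S) \<in> borel_measurable \<mu>0" for n
      using borel_measurable_integrable[OF P.integrable_snd[OF Fint[of n, unfolded split_beta'[symmetric]]]]
      by simp
    show "AE x in \<mu>0. (\<lambda>n. \<integral>s. F n s x \<partial>S) \<longlonglongrightarrow> 0"
      unfolding F_def by (intro AE_I2 Euler_weak_error[OF der \<phi>0 contG ucG GB])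
    show "AE x in \<mu>0. norm (\<integral>s. F n s x \<partial>S) \<le> B * (T + MT * (KK * (1 + norm x)))" for n
    proof (rule AE_I2)
      fix x
      have "norm (\<integral>s. F n s x \<partial>S) \<le> (\<integral>s. B * (1 + m s * (KK * (1 + norm x))) \<partial>S)"
      proof (rule norm_integral_le[OF _ bound_int])
        show "integrable S (\<lambda>s. F n s x)" unfolding F_def by (rule Euler_integrand_int[OF contG GB])
        show "AE s in S. norm (F n s x) \<le> B * (1 + m s * (KK * (1 + norm x)))"
          using Fb by eventually_elim auto
      qed
      then show "norm (\<integral>s. F n s x \<partial>S) \<le> B * (T + MT * (KK * (1 + norm x)))" unfolding bound_integral .
    qed
  qed simp
  then show ?thesis unfolding swap by simp
qed

end

section \<open>The limit curve\<close>

text \<open>Squashing is invertible away from the values 1 and -1. Being bounded infinitely often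
  keeps the squashed limit away from them.\<close>

lemma convergent_of_squashed:
  fixes a :: "nat \<Rightarrow> real"
  assumes conv: "convergent (\<lambda>n. a n / (1 + \<bar>a n\<bar>))"
    and freq: "\<exists>\<^sub>F n in sequentially. \<bar>a n\<bar> \<le> K"
  shows "convergent a"
proof -
  define s where "s n = a n / (1 + \<bar>a n\<bar>)" for n
  obtain L where L: "s \<longlonglongrightarrow> L" using conv by (auto simp: convergent_def s_def[abs_def])
  have K0: "0 \<le> K" using frequently_ex[OF freq] by auto
  have abs_s: "\<bar>s n\<bar> = 1 - 1 / (1 + \<bar>a n\<bar>)" for n
    unfolding s_def by (simp add: abs_divide field_simps)
  have "\<bar>L\<bar> \<le> 1 - 1 / (1 + K)"
  proof (rule ccontr)
    assume "\<not> \<bar>L\<bar> \<le> 1 - 1 / (1 + K)"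
    then have "1 - 1 / (1 + K) < \<bar>L\<bar>" by simp
    from order_tendstoD(1)[OF tendsto_rabs[OF L] this]
    have "\<forall>\<^sub>F n in sequentially. \<not> \<bar>a n\<bar> \<le> K"
    proof eventually_elim
      case (elim n)
      show ?case
      proof
        assume "\<bar>a n\<bar> \<le> K"
        then have "1 / (1 + K) \<le> 1 / (1 + \<bar>a n\<bar>)" by (intro divide_left_mono) auto
        then show False using elim abs_s[of n] by linarith
      qed
    qed
    then show False using freq by (simp add: frequently_def)
  qed
  moreover have "0 < 1 / (1 + K)" using K0 by simp
  ultimately have L1: "1 - \<bar>L\<bar> \<noteq> 0" by linarith
  have "a n = s n / (1 - \<bar>s n\<bar>)" for n
    unfolding abs_s unfolding s_def by (simp add: field_simps)
  then have "a = (\<lambda>n. s n / (1 - \<bar>s n\<bar>))" by (rule ext)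
  moreover have "(\<lambda>n. s n / (1 - \<bar>s n\<bar>)) \<longlonglongrightarrow> L / (1 - \<bar>L\<bar>)"
    by (intro tendsto_divide L tendsto_diff tendsto_const tendsto_rabs L1)
  ultimately show ?thesis by (auto simp: convergent_def)
qed

lemma liminf_finite_imp_frequently_bounded:
  fixes a :: "nat \<Rightarrow> real"
  assumes "liminf (\<lambda>n. ennreal (a n)) \<noteq> \<infinity>"
  shows "\<exists>K. \<exists>\<^sub>F n in sequentially. a n \<le> K"
proof (rule ccontr)
  assume neg: "\<not> ?thesis"
  have "ennreal (real k) \<le> liminf (\<lambda>n. ennreal (a n))" for k
  proof (rule Liminf_bounded)
    have "\<not> (\<exists>\<^sub>F n in sequentially. a n \<le> real k)" using neg by blast
    then have "\<forall>\<^sub>F n in sequentially. \<not> a n \<le> real k" by (simp add: frequently_def)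
    then show "\<forall>\<^sub>F n in sequentially. ennreal (real k) \<le> ennreal (a n)"
      by eventually_elim (auto intro: ennreal_leI)
  qed
  then have "(SUP k::nat. of_nat k :: ennreal) \<le> liminf (\<lambda>n. ennreal (a n))"
    by (intro SUP_least) (simp add: ennreal_of_nat_eq_real_of_nat)
  then have "liminf (\<lambda>n. ennreal (a n)) = \<infinity>"
    by (simp add: ennreal_SUP_of_nat_eq_top top_unique)
  then show False using assms by simp
qed

text \<open>The vectors are split into coordinates, represented as real random sequences and put
  together again. The common first-moment bound depends only on the laws, passes to the copies and
  prevents escape to infinity.\<close>

theorem Skorokhod_random_vectors:
  fixes Z :: "nat \<Rightarrow> nat \<Rightarrow> 'x \<Rightarrow> 'a::euclidean_space"
  assumes M: "prob_space M" and Zm[measurable]: "\<And>n j. Z n j \<in> borel_measurable M"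
    and bound: "\<And>n j. (\<integral>\<^sup>+x. ennreal (norm (Z n j x)) \<partial>M) \<le> ennreal C"
  shows "\<exists>r (\<Omega> :: real measure) Y. strict_mono r \<and> prob_space \<Omega> \<and> (\<forall>n j. Y n j \<in> borel_measurable \<Omega>) \<and>
    (\<forall>n. distr \<Omega> (Pi\<^sub>M UNIV (\<lambda>_. borel)) (\<lambda>\<omega> j. Y n j \<omega>) = distr M (Pi\<^sub>M UNIV (\<lambda>_. borel)) (\<lambda>x j. Z (r n) j x)) \<and>
    (AE \<omega> in \<Omega>. \<forall>j. convergent (\<lambda>n. Y n j \<omega>))"
proof -
  define d where "d = DIM('a)"
  obtain e :: "nat \<Rightarrow> 'a" where e: "bij_betw e {0..<d} Basis"
    using ex_bij_betw_nat_finite[of "Basis :: 'a set"] by (auto simp: d_def)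
  \<comment> \<open>\<open>Zs\<close> flattens the vectors into one sequence of coordinates, and
    \<open>H j\<close> rebuilds the j-th vector from it; the copies \<open>Y\<close> are defined
    through \<open>H\<close>.\<close>
  define H where "H j y = (\<Sum>l=0..<d. y (prod_encode (j, l)) *\<^sub>R e l)" for j and y :: "nat \<Rightarrow> real"
  define Zs where "Zs n i x = Z n (fst (prod_decode i)) x \<bullet> e (snd (prod_decode i))" for n i x
  have HZ: "H j (\<lambda>i. Zs n i x) = Z n j x" for j n x
  proof -
    have "H j (\<lambda>i. Zs n i x) = (\<Sum>l=0..<d. (Z n j x \<bullet> e l) *\<^sub>R e l)" by (simp add: H_def Zs_def)
    also have "\<dots> = (\<Sum>b\<in>Basis. (Z n j x \<bullet> b) *\<^sub>R b)" by (rule sum.reindex_bij_betw[OF e])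
    also have "\<dots> = Z n j x" by (rule euclidean_representation)
    finally show ?thesis .
  qed
  have eB: "e l \<in> Basis" if "l \<in> {0..<d}" for l
    using bij_betw_imp_surj_on[OF e] that by (metis image_eqI)
  have Hcoord: "H j y \<bullet> e l = y (prod_encode (j, l))" if l: "l \<in> {0..<d}" for j y l
  proof -
    have "H j y \<bullet> e l = (\<Sum>l'=0..<d. y (prod_encode (j, l')) * (e l' \<bullet> e l))" by (simp add: H_def inner_sum_left)
    also have "\<dots> = (\<Sum>l'\<in>{l}. y (prod_encode (j, l')) * (e l' \<bullet> e l))"
    proof (rule sum.mono_neutral_right)
      show "\<forall>l'\<in>{0..<d} - {l}. y (prod_encode (j, l')) * (e l' \<bullet> e l) = 0"
      proof
        fix l' assume "l' \<in> {0..<d} - {l}"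
        then have "e l' \<noteq> e l" "e l' \<in> Basis" "e l \<in> Basis"
          using inj_onD[OF bij_betw_imp_inj_on[OF e], of l' l] eB l by auto
        then show "y (prod_encode (j, l')) * (e l' \<bullet> e l) = 0" by (simp add: inner_Basis)
      qed
    qed (use l in auto)
    also have "\<dots> = y (prod_encode (j, l))" using eB[OF l] by (simp add: inner_Basis)
    finally show ?thesis .
  qed
  have Hm: "(\<lambda>y. H j y) \<in> borel_measurable (Pi\<^sub>M UNIV (\<lambda>_. borel))" for j
    unfolding H_def by (intro borel_measurable_sum borel_measurable_scaleR measurable_component_singleton borel_measurable_const) auto
  have HHm: "(\<lambda>y j. H j y) \<in> measurable (Pi\<^sub>M UNIV (\<lambda>_. borel)) (Pi\<^sub>M UNIV (\<lambda>_. borel))"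
    by (rule measurable_PiM_single') (use Hm in auto)
  have Zsm: "Zs n i \<in> borel_measurable M" for n i
    unfolding Zs_def[abs_def] by (intro borel_measurable_inner Zm borel_measurable_const)
  have Zsm': "(\<lambda>x i. Zs n i x) \<in> measurable M (Pi\<^sub>M UNIV (\<lambda>_. borel))" for n
    by (rule measurable_PiM_single') (use Zsm in auto)
  show ?thesis
  proof (rule Skorokhod_random_sequences[OF M Zsm])
    fix r :: "nat \<Rightarrow> nat" and \<Omega> :: "real measure" and Ys
    assume r: "strict_mono r" and \<Omega>: "prob_space \<Omega>" and Ysm: "\<And>n j. Ys n j \<in> borel_measurable \<Omega>"
      and Ysd: "\<And>n. distr \<Omega> (Pi\<^sub>M UNIV (\<lambda>_. borel)) (\<lambda>\<omega> j. Ys n j \<omega>) = distr M (Pi\<^sub>M UNIV (\<lambda>_. borel)) (\<lambda>\<omega> j. Zs (r n) j \<omega>)"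
      and Ysc: "AE \<omega> in \<Omega>. \<forall>j. convergent (\<lambda>n. Ys n j \<omega> / (1 + \<bar>Ys n j \<omega>\<bar>))"
    have Ysm': "(\<lambda>\<omega> i. Ys n i \<omega>) \<in> measurable \<Omega> (Pi\<^sub>M UNIV (\<lambda>_. borel))" for n
      by (rule measurable_PiM_single') (use Ysm in auto)
    define Y where "Y n j \<omega> = H j (\<lambda>i. Ys n i \<omega>)" for n j \<omega>
    have Ym: "Y n j \<in> borel_measurable \<Omega>" for n j
      unfolding Y_def[abs_def] by (rule measurable_compose[OF Ysm' Hm])
    have law: "distr \<Omega> (Pi\<^sub>M UNIV (\<lambda>_. borel)) (\<lambda>\<omega> j. Y n j \<omega>) = distr M (Pi\<^sub>M UNIV (\<lambda>_. borel)) (\<lambda>x j. Z (r n) j x)" for n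
    proof -
      have "distr \<Omega> (Pi\<^sub>M UNIV (\<lambda>_. borel)) (\<lambda>\<omega> j. Y n j \<omega>)
        = distr (distr \<Omega> (Pi\<^sub>M UNIV (\<lambda>_. borel)) (\<lambda>\<omega> j. Ys n j \<omega>)) (Pi\<^sub>M UNIV (\<lambda>_. borel)) (\<lambda>y j. H j y)"
        by (subst distr_distr[OF HHm Ysm']) (simp add: o_def Y_def)
      also have "\<dots> = distr M (Pi\<^sub>M UNIV (\<lambda>_. borel)) (\<lambda>x j. Z (r n) j x)"
        unfolding Ysd by (subst distr_distr[OF HHm Zsm']) (simp add: o_def HZ)
      finally show ?thesis .
    qed
    have norm_int: "(\<integral>\<^sup>+\<omega>. ennreal (norm (Y n j \<omega>)) \<partial>\<Omega>) \<le> ennreal C" for n j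
    proof -
      have Hn: "(\<lambda>y. ennreal (norm (H j y))) \<in> borel_measurable (Pi\<^sub>M UNIV (\<lambda>_. borel))"
        by (rule measurable_compose[OF Hm]) simp
      have "(\<integral>\<^sup>+\<omega>. ennreal (norm (Y n j \<omega>)) \<partial>\<Omega>)
        = (\<integral>\<^sup>+y. ennreal (norm (H j y)) \<partial>distr \<Omega> (Pi\<^sub>M UNIV (\<lambda>_. borel)) (\<lambda>\<omega> j. Ys n j \<omega>))"
        unfolding Y_def by (rule nn_integral_distr[OF Ysm', symmetric]) (use Hn in simp)
      also have "\<dots> = (\<integral>\<^sup>+x. ennreal (norm (Z (r n) j x)) \<partial>M)"
        unfolding Ysd by (subst nn_integral_distr[OF Zsm']) (use Hn in \<open>simp_all add: HZ\<close>)
      also have "\<dots> \<le> ennreal C" by (rule bound)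
      finally show ?thesis .
    qed
    \<comment> \<open>By Fatou's lemma the lower limit of the norms is integrable, hence finite
      almost surely, so each copy is bounded along some subsequence. Together with convergence of
      the squashed coordinates this suffices.\<close>
    have "AE \<omega> in \<Omega>. \<forall>j. \<exists>K. \<exists>\<^sub>F n in sequentially. norm (Y n j \<omega>) \<le> K"
      unfolding AE_all_countable
    proof
      fix j
      have nm: "(\<lambda>\<omega>. ennreal (norm (Y n j \<omega>))) \<in> borel_measurable \<Omega>" for n
        by (rule measurable_compose[OF Ym]) simp
      have "(\<integral>\<^sup>+\<omega>. liminf (\<lambda>n. ennreal (norm (Y n j \<omega>))) \<partial>\<Omega>) \<le> liminf (\<lambda>n. \<integral>\<^sup>+\<omega>. ennreal (norm (Y n j \<omega>)) \<partial>\<Omega>)"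
        by (rule nn_integral_liminf[OF nm])
      also have "\<dots> \<le> limsup (\<lambda>n. \<integral>\<^sup>+\<omega>. ennreal (norm (Y n j \<omega>)) \<partial>\<Omega>)"
        by (rule Liminf_le_Limsup) simp
      also have "\<dots> \<le> ennreal C" by (rule Limsup_bounded) (simp add: norm_int)
      also have "\<dots> < \<infinity>" by simp
      finally have "AE \<omega> in \<Omega>. liminf (\<lambda>n. ennreal (norm (Y n j \<omega>))) \<noteq> \<infinity>"
        by (intro nn_integral_PInf_AE borel_measurable_liminf nm) simp
      then show "AE \<omega> in \<Omega>. \<exists>K. \<exists>\<^sub>F n in sequentially. norm (Y n j \<omega>) \<le> K"
        by eventually_elim (rule liminf_finite_imp_frequently_bounded)
    qed
    then have conv: "AE \<omega> in \<Omega>. \<forall>j. convergent (\<lambda>n. Y n j \<omega>)"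
      using Ysc
    proof eventually_elim
      case (elim \<omega>)
      show ?case
      proof
        fix j
        obtain K where K: "\<exists>\<^sub>F n in sequentially. norm (Y n j \<omega>) \<le> K" using elim(1) by blast
        have "\<exists>L. (\<lambda>n. Ys n (prod_encode (j, l)) \<omega>) \<longlonglongrightarrow> L" if l: "l \<in> {0..<d}" for l
        proof -
          have le: "\<bar>Ys n (prod_encode (j, l)) \<omega>\<bar> \<le> norm (Y n j \<omega>)" for n
          proof -
            have "Ys n (prod_encode (j, l)) \<omega> = Y n j \<omega> \<bullet> e l" unfolding Y_def Hcoord[OF l] ..
            moreover have "e l \<in> Basis" using eB[OF l] .
            ultimately show ?thesis by (simp add: Basis_le_norm)
          qed
          have "\<exists>\<^sub>F n in sequentially. \<bar>Ys n (prod_encode (j, l)) \<omega>\<bar> \<le> K"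
            by (rule frequently_elim1[OF K]) (rule order_trans[OF le])
          from convergent_of_squashed[OF _ this] show ?thesis
            using elim(2) by (auto simp: convergent_def)
        qed
        then obtain L where L: "\<And>l. l \<in> {0..<d} \<Longrightarrow> (\<lambda>n. Ys n (prod_encode (j, l)) \<omega>) \<longlonglongrightarrow> L l" by metis
        have "(\<lambda>n. Y n j \<omega>) \<longlonglongrightarrow> (\<Sum>l=0..<d. L l *\<^sub>R e l)"
          unfolding Y_def H_def by (intro tendsto_sum tendsto_scaleR L tendsto_const)
        then show "convergent (\<lambda>n. Y n j \<omega>)" by (auto simp: convergent_def)
      qed
    qed
    show ?thesis
      by (intro exI[of _ r] exI[of _ \<Omega>] exI[of _ Y] conjI allI r \<Omega> Ym law conv)
  qed
qed

lemma distr_AE_limit: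
  fixes Y :: "nat \<Rightarrow> 'x \<Rightarrow> 'a::metric_space"
  assumes "prob_space M" and [measurable]: "\<And>n. Y n \<in> borel_measurable M" "L \<in> borel_measurable M"
    and lim: "AE \<omega> in M. (\<lambda>n. Y n \<omega>) \<longlonglongrightarrow> L \<omega>"
    and law: "\<And>n. distr M borel (Y n) = \<mu>"
  shows "distr M borel L = \<mu>"
proof -
  interpret M: prob_space M by fact
  have \<mu>: "prob_space \<mu>" "sets \<mu> = sets borel"
    using M.prob_space_distr[of "Y 0" borel] law[of 0] by (auto intro: arg_cong[OF law, THEN subst])
  show ?thesis
  proof (rule measure_eqI_lipschitz)
    show "finite_measure (distr M borel L)" by (intro prob_space.finite_measure M.prob_space_distr) simp
    show "finite_measure \<mu>" using \<mu>(1) by (rule prob_space.finite_measure)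
    fix f :: "'a \<Rightarrow> real" assume "\<exists>C. C-lipschitz_on UNIV f" and f01: "\<And>x. 0 \<le> f x \<and> f x \<le> 1"
    then obtain C where C: "C-lipschitz_on UNIV f" by blast
    have cont: "continuous_on UNIV f" using lipschitz_on_continuous_on[OF C] .
    have fm[measurable]: "f \<in> borel_measurable borel" using cont by (rule borel_measurable_continuous_onI)
    have "(\<lambda>n. \<integral>\<omega>. f (Y n \<omega>) \<partial>M) \<longlonglongrightarrow> (\<integral>\<omega>. f (L \<omega>) \<partial>M)"
    proof (rule integral_dominated_convergence[where w = "\<lambda>_. 1"])
      show "AE \<omega> in M. (\<lambda>n. f (Y n \<omega>)) \<longlonglongrightarrow> f (L \<omega>)"
        using lim
      proof eventually_elim
        case (elim \<omega>)
        have "isCont f (L \<omega>)" using cont by (simp add: continuous_on_eq_continuous_at)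
        then show ?case using elim by (rule isCont_tendsto_compose)
      qed
    qed (use f01 in auto)
    moreover have "(\<integral>\<omega>. f (Y n \<omega>) \<partial>M) = (\<integral>x. f x \<partial>\<mu>)" for n
      unfolding law[of n, symmetric] by (rule integral_distr[symmetric]) auto
    ultimately have "(\<integral>x. f x \<partial>\<mu>) = (\<integral>\<omega>. f (L \<omega>) \<partial>M)"
      by (simp add: LIMSEQ_const_iff)
    also have "\<dots> = (\<integral>x. f x \<partial>distr M borel L)" by (rule integral_distr[symmetric]) auto
    finally show "(\<integral>x. f x \<partial>distr M borel L) = (\<integral>x. f x \<partial>\<mu>)" ..
  qed (use \<mu> in auto)
qed

lemma add_powr_le:
  fixes a b p :: real
  assumes "0 \<le> p" "0 \<le> a" "0 \<le> b"
  shows "(a + b) powr p \<le> 2 powr p * (a powr p + b powr p)"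
proof -
  have "(a + b) powr p \<le> (2 * max a b) powr p" using assms by (intro powr_mono2) (auto simp: max_def)
  also have "\<dots> = 2 powr p * max a b powr p" by (rule powr_mult)
  also have "max a b powr p \<le> a powr p + b powr p" by (auto simp: max_def)
  finally show ?thesis by (simp add: mult_left_mono)
qed

lemma Cauchy_dominated:
  fixes a :: "nat \<Rightarrow> 'a::real_normed_vector" and b :: "nat \<Rightarrow> real"
  assumes b: "Cauchy b" and le: "\<And>i j. norm (a i - a j) \<le> C * \<bar>b i - b j\<bar>" and C: "0 \<le> C"
  shows "Cauchy a"
proof (rule metric_CauchyI)
  fix e :: real assume e: "0 < e"
  then have "0 < e / (C + 1)" using C by simp
  from metric_CauchyD[OF b this] obtain M where M: "\<forall>m\<ge>M. \<forall>n\<ge>M. dist (b m) (b n) < e / (C + 1)" ..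
  have "dist (a m) (a n) < e" if "M \<le> m" "M \<le> n" for m n
  proof -
    have "\<bar>b m - b n\<bar> < e / (C + 1)" using M that by (simp add: dist_real_def)
    then have "(C + 1) * \<bar>b m - b n\<bar> < e" using C by (simp add: field_simps)
    moreover have "C * \<bar>b m - b n\<bar> \<le> (C + 1) * \<bar>b m - b n\<bar>" by (intro mult_right_mono) auto
    ultimately show ?thesis using le[of m n] by (simp add: dist_norm)
  qed
  then show "\<exists>M. \<forall>m\<ge>M. \<forall>n\<ge>M. dist (a m) (a n) < e" by blast
qed

lemma borel_measurable_pred_le:
  fixes f g :: "'a \<Rightarrow> real"
  assumes [measurable]: "f \<in> borel_measurable M" "g \<in> borel_measurable M"
  shows "Measurable.pred M (\<lambda>x. f x \<le> g x)"
  by measurable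

context continuity_inclusion begin

section \<open>Positions at all times\<close>

text \<open>Enumerates the points of all grids: an index codes (k, n) and stands for the k-th point
  of grid \<open>n\<close>, with \<open>min\<close> clipping \<open>k\<close> so that the time stays
  in [0,T]. \<open>idx n t\<close> is the index of the last point of grid \<open>n\<close> not after
  \<open>t\<close>, and \<open>tau n t\<close> is that point.\<close>

definition q :: "nat \<Rightarrow> real" where
  "q i = grid (snd (prod_decode i)) (min (fst (prod_decode i)) (Suc (snd (prod_decode i))))"

definition idx :: "nat \<Rightarrow> real \<Rightarrow> nat" where "idx n t = prod_encode (cell n t, n)"

definition tau :: "nat \<Rightarrow> real \<Rightarrow> real" where "tau n t = grid n (cell n t)"

lemma grid_le_T: "k \<le> Suc n \<Longrightarrow> grid n k \<le> T"
proof -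
  assume "k \<le> Suc n"
  then have "grid n k \<le> grid n (Suc n)" unfolding grid_def
    using T by (intro divide_right_mono mult_right_mono) auto
  then show ?thesis by simp
qed

lemma q_in: "q i \<in> {0..T}"
  unfolding q_def using grid_le_T by simp

lemma cell_le: "t \<in> {0..T} \<Longrightarrow> cell n t \<le> Suc n"
proof -
  assume t: "t \<in> {0..T}"
  have "grid n (Suc (Suc n)) = T + T / real (Suc n)" by (subst grid_Suc) (simp only: grid_last)
  moreover have "0 < T / real (Suc n)" using T by simp
  ultimately have "t < grid n (Suc (Suc n))" using t by (simp del: of_nat_Suc)
  then show ?thesis using cell_less_iff[of t n "Suc (Suc n)"] t by simp
qed

lemma q_idx: "t \<in> {0..T} \<Longrightarrow> q (idx n t) = tau n t"
  using cell_le[of t n] by (simp add: q_def idx_def tau_def min_def)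

lemma cell_tau: "cell n (tau n t) = cell n t"
  by (simp add: tau_def)

lemma tau_close: "t \<in> {0..T} \<Longrightarrow> \<bar>tau n t - t\<bar> \<le> T / real (Suc n)"
  using grid_cell[of t n] by (simp add: tau_def grid_Suc del: of_nat_Suc)

lemma mesh_tendsto_0: "(\<lambda>n. T / real (Suc n)) \<longlonglongrightarrow> 0"
  using tendsto_mult_right_zero[OF LIMSEQ_Suc[OF lim_1_over_n], of T] by simp

lemma tau_tendsto:
  assumes r: "strict_mono r" and u: "\<And>n. u n \<in> {0..T}" "u \<longlonglongrightarrow> t"
  shows "(\<lambda>n. tau (r n) (u n)) \<longlonglongrightarrow> t"
proof -
  have "(\<lambda>n. tau (r n) (u n) - u n) \<longlonglongrightarrow> 0"
  proof (rule Lim_null_comparison)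
    show "\<forall>\<^sub>F n in sequentially. norm (tau (r n) (u n) - u n) \<le> T / real (Suc (r n))"
      using tau_close[OF u(1)] by (intro always_eventually) simp
    show "(\<lambda>n. T / real (Suc (r n))) \<longlonglongrightarrow> 0"
      using LIMSEQ_subseq_LIMSEQ[OF mesh_tendsto_0 r] by (simp add: o_def)
  qed
  from tendsto_add[OF this u(2)] show ?thesis by simp
qed

lemma X_path: "norm (X n (cell n s) x - X n (cell n t) x) \<le> CC * (1 + norm x) * \<bar>Mi (tau n s) - Mi (tau n t)\<bar>"
proof -
  have *: "norm (X n k x - X n j x) \<le> CC * (1 + norm x) * \<bar>Mi (grid n k) - Mi (grid n j)\<bar>" if "j \<le> k" for j k
  proof -
    have "0 \<le> CC * (1 + norm x)" using CC_ge_1 by simp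
    then have "CC * (1 + norm x) * (Mi (grid n k) - Mi (grid n j)) \<le> CC * (1 + norm x) * \<bar>Mi (grid n k) - Mi (grid n j)\<bar>"
      by (intro mult_left_mono) auto
    then show ?thesis using X_increment[OF that, of n x] by linarith
  qed
  show ?thesis
    using *[of "cell n t" "cell n s"] *[of "cell n s" "cell n t"] linear[of "cell n s" "cell n t"]
    by (auto simp: tau_def norm_minus_commute abs_minus_commute)
qed

lemma idx_measurable: "idx n \<in> measurable S (count_space UNIV)"
  using measurable_compose[OF cell_measurable, of "\<lambda>k. prod_encode (k, n)" "count_space UNIV"]
  by (simp add: idx_def[abs_def])

text \<open>Growth and modulus of continuity, both expressed through the starting point, are
  properties of the law of a whole sequence and pass to the copies. They first bound the almost sure
  limits at grid times, then extend these limits continuously in the clock \<open>Mi\<close> to all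
  times. The joint values on one probability space provide the couplings.\<close>

theorem limit_curve:
  "\<exists>r (\<Omega> :: real measure) (YY :: nat \<Rightarrow> real \<Rightarrow> real \<Rightarrow> 'a) (W :: real \<Rightarrow> real \<Rightarrow> 'a).
    strict_mono r \<and> prob_space \<Omega> \<and> (\<forall>n t. YY n t \<in> borel_measurable \<Omega>) \<and>
    (\<forall>n. \<forall>t\<in>{0..T}. distr \<Omega> borel (YY n t) = law (r n) (cell (r n) t)) \<and>
    (\<lambda>z. W (fst z) (snd z)) \<in> borel_measurable (S \<Otimes>\<^sub>M \<Omega>) \<and> (\<forall>t. W t \<in> borel_measurable \<Omega>) \<and>
    (\<forall>u t. (\<forall>n. u n \<in> {0..T}) \<longrightarrow> t \<in> {0..T} \<longrightarrow> u \<longlonglongrightarrow> t \<longrightarrow>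
      (AE \<omega> in \<Omega>. (\<lambda>n. YY n (u n) \<omega>) \<longlonglongrightarrow> W t \<omega>)) \<and>
    (\<forall>u t. (\<forall>n. u n \<in> {0..T}) \<longrightarrow> t \<in> {0..T} \<longrightarrow> u \<longlonglongrightarrow> t \<longrightarrow>
      (\<lambda>n. Wp p (distr \<Omega> borel (W t)) (law (r n) (cell (r n) (u n)))) \<longlonglongrightarrow> 0) \<and>
    (\<forall>t\<in>{0..T}. distr \<Omega> borel (W t) \<in> Pp p) \<and>
    (\<forall>s\<in>{0..T}. \<forall>t\<in>{0..T}. Wp p (distr \<Omega> borel (W s)) (distr \<Omega> borel (W t)) \<le> CC * D * \<bar>Mi t - Mi s\<bar>) \<and>
    distr \<Omega> borel (W 0) = \<mu>0"
proof -
  \<comment> \<open>Each scheme is sampled at the points of all grids, so the same countable set of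
    times serves every \<open>n\<close>.\<close>
  define Z where "Z n j = X n (cell n (q j))" for n j
  have Zm: "Z n j \<in> borel_measurable \<mu>0" for n j unfolding Z_def by (rule X_measurable')
  have Zbound: "(\<integral>\<^sup>+x. ennreal (norm (Z n j x)) \<partial>\<mu>0) \<le> ennreal (\<integral>x. CC * (1 + norm x) \<partial>\<mu>0)" for n j
  proof -
    have "(\<integral>\<^sup>+x. ennreal (norm (Z n j x)) \<partial>\<mu>0) \<le> (\<integral>\<^sup>+x. ennreal (CC * (1 + norm x)) \<partial>\<mu>0)"
      unfolding Z_def by (intro nn_integral_mono ennreal_leI X_bound)
    also have "\<dots> = ennreal (\<integral>x. CC * (1 + norm x) \<partial>\<mu>0)"
      using CC_ge_1 by (intro nn_integral_eq_integral integrable_mult_right one_norm_int) auto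
    finally show ?thesis .
  qed
  define Q where "Q r \<Omega> Y \<longleftrightarrow> strict_mono r \<and> prob_space \<Omega> \<and> (\<forall>n j. Y n j \<in> borel_measurable \<Omega>) \<and>
    (\<forall>n. distr \<Omega> (Pi\<^sub>M UNIV (\<lambda>_. borel)) (\<lambda>\<omega> j. Y n j \<omega>) = distr \<mu>0 (Pi\<^sub>M UNIV (\<lambda>_. borel)) (\<lambda>x j. Z (r n) j x)) \<and>
    (AE \<omega> in \<Omega>. \<forall>j. convergent (\<lambda>n. Y n j \<omega>))" for r and \<Omega> :: "real measure" and Y :: "nat \<Rightarrow> nat \<Rightarrow> real \<Rightarrow> 'a"
  have "\<exists>r \<Omega> Y. Q r \<Omega> Y"
    unfolding Q_def by (rule Skorokhod_random_vectors[OF prob_\<mu>0 Zm Zbound])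
  then obtain r \<Omega> Y where "Q r \<Omega> Y" by blast
  note Q = this[unfolded Q_def]
  note r = Q[THEN conjunct1] and \<Omega> = Q[THEN conjunct2, THEN conjunct1]
    and Ym = Q[THEN conjunct2, THEN conjunct2, THEN conjunct1]
    and law_seq = Q[THEN conjunct2, THEN conjunct2, THEN conjunct2, THEN conjunct1]
    and conv = Q[THEN conjunct2, THEN conjunct2, THEN conjunct2, THEN conjunct2]
  interpret \<Omega>: prob_space \<Omega> by (rule \<Omega>)
  have Ym[measurable]: "Y n j \<in> borel_measurable \<Omega>" for n j using Ym by simp
  have Ym': "(\<lambda>\<omega> j. Y n j \<omega>) \<in> measurable \<Omega> (Pi\<^sub>M UNIV (\<lambda>_. borel))" for n
    by (rule measurable_PiM_single') (use Ym in auto)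
  have Zm': "(\<lambda>x j. Z n j x) \<in> measurable \<mu>0 (Pi\<^sub>M UNIV (\<lambda>_. borel))" for n
    by (rule measurable_PiM_single') (use Zm in auto)
  \<comment> \<open>A pathwise fact about the scheme is an event of the sequence space of full
    probability, and the copies have the same law on that space.\<close>
  have transfer: "AE \<omega> in \<Omega>. P (\<lambda>j. Y n j \<omega>)"
    if P: "Measurable.pred (Pi\<^sub>M UNIV (\<lambda>_. borel)) P" and Z: "\<And>x. P (\<lambda>j. Z (r n) j x)" for P n
  proof -
    have Ps: "{y \<in> space (Pi\<^sub>M UNIV (\<lambda>_. borel :: 'a measure)). P y} \<in> sets (Pi\<^sub>M UNIV (\<lambda>_. borel))"
      using P by (simp add: pred_def)
    have "AE y in distr \<mu>0 (Pi\<^sub>M UNIV (\<lambda>_. borel)) (\<lambda>x j. Z (r n) j x). P y"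
      using Z by (subst AE_distr_iff[OF Zm' Ps]) simp
    then show ?thesis
      unfolding law_seq[rule_format, symmetric] by (subst (asm) AE_distr_iff[OF Ym' Ps])
  qed
  have law_Y: "distr \<Omega> borel (Y n j) = law (r n) (cell (r n) (q j))" for n j
  proof -
    have c: "(\<lambda>y. y j) \<in> borel_measurable (Pi\<^sub>M UNIV (\<lambda>_. borel :: 'a measure))" by (rule measurable_component_singleton) simp
    have "distr \<Omega> borel (Y n j) = distr (distr \<Omega> (Pi\<^sub>M UNIV (\<lambda>_. borel)) (\<lambda>\<omega> j. Y n j \<omega>)) borel (\<lambda>y. y j)"
      by (subst distr_distr[OF c Ym']) (simp add: o_def)
    also have "\<dots> = distr \<mu>0 borel (Z (r n) j)"
      unfolding law_seq[rule_format] by (subst distr_distr[OF c Zm']) (simp add: o_def)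
    finally show ?thesis by (simp add: Z_def law_def)
  qed
  \<comment> \<open>The index of time 0: this coordinate is the starting point, so it has law \<mu>0
    for every \<open>n\<close> and can control all other coordinates.\<close>
  define j0 where "j0 = prod_encode (0, 0)"
  have q0: "q j0 = 0" by (simp add: q_def j0_def)
  have cell0: "cell n 0 = 0" for n by (simp add: cell_def)
  have Z0: "Z n j0 x = x" for n x by (simp add: Z_def q0 cell0)
  have law_Y0: "distr \<Omega> borel (Y n j0) = \<mu>0" for n
  proof -
    have "law (r n) 0 = distr \<mu>0 borel (\<lambda>x. x)" by (simp add: law_def)
    also have "\<dots> = \<mu>0" by (rule distr_id2) (simp add: sets_\<mu>0)
    finally show ?thesis by (simp add: law_Y q0 cell0)
  qed
  have comp: "(\<lambda>y. y j) \<in> borel_measurable (Pi\<^sub>M UNIV (\<lambda>_. borel :: 'a measure))" for j :: nat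
    by (rule measurable_component_singleton) simp
  have norm_m: "(\<lambda>y. norm (y j)) \<in> borel_measurable (Pi\<^sub>M UNIV (\<lambda>_. borel :: 'a measure))" for j :: nat
    by (rule measurable_compose[OF comp]) simp
  have b1: "AE \<omega> in \<Omega>. \<forall>n j. norm (Y n j \<omega>) \<le> CC * (1 + norm (Y n j0 \<omega>))"
    unfolding AE_all_countable
  proof (intro allI)
    fix n j
    show "AE \<omega> in \<Omega>. norm (Y n j \<omega>) \<le> CC * (1 + norm (Y n j0 \<omega>))"
    proof (rule transfer[of "\<lambda>y. norm (y j) \<le> CC * (1 + norm (y j0))"])
      show "Measurable.pred (Pi\<^sub>M UNIV (\<lambda>_. borel)) (\<lambda>y :: nat \<Rightarrow> 'a. norm (y j) \<le> CC * (1 + norm (y j0)))"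
        by (intro borel_measurable_pred_le norm_m borel_measurable_times borel_measurable_add borel_measurable_const)
      show "norm (Z (r n) j x) \<le> CC * (1 + norm (Z (r n) j0 x))" for x
        unfolding Z0 unfolding Z_def by (rule X_bound)
    qed
  qed
  have b2: "AE \<omega> in \<Omega>. \<forall>n i j. norm (Y n i \<omega> - Y n j \<omega>) \<le> CC * (1 + norm (Y n j0 \<omega>)) * \<bar>Mi (tau (r n) (q i)) - Mi (tau (r n) (q j))\<bar>"
    unfolding AE_all_countable
  proof (intro allI)
    fix n i j
    define c where "c = \<bar>Mi (tau (r n) (q i)) - Mi (tau (r n) (q j))\<bar>"
    have "AE \<omega> in \<Omega>. norm (Y n i \<omega> - Y n j \<omega>) \<le> CC * (1 + norm (Y n j0 \<omega>)) * c"
    proof (rule transfer[of "\<lambda>y. norm (y i - y j) \<le> CC * (1 + norm (y j0)) * c"])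
      have "(\<lambda>y :: nat \<Rightarrow> 'a. norm (y i - y j)) \<in> borel_measurable (Pi\<^sub>M UNIV (\<lambda>_. borel))"
        by (rule measurable_compose[OF borel_measurable_diff[OF comp comp]]) simp
      then show "Measurable.pred (Pi\<^sub>M UNIV (\<lambda>_. borel)) (\<lambda>y :: nat \<Rightarrow> 'a. norm (y i - y j) \<le> CC * (1 + norm (y j0)) * c)"
        by (intro borel_measurable_pred_le norm_m borel_measurable_times borel_measurable_add borel_measurable_const)
      show "norm (Z (r n) i x - Z (r n) j x) \<le> CC * (1 + norm (Z (r n) j0 x)) * c" for x
        unfolding Z0 c_def unfolding Z_def by (rule X_path)
    qed
    then show "AE \<omega> in \<Omega>. norm (Y n i \<omega> - Y n j \<omega>) \<le> CC * (1 + norm (Y n j0 \<omega>)) * \<bar>Mi (tau (r n) (q i)) - Mi (tau (r n) (q j))\<bar>"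
      by (simp add: c_def)
  qed
  define YL where "YL j \<omega> = lim (\<lambda>n. Y n j \<omega>)" for j \<omega>
  \<comment> \<open>The limit is taken along the last points before \<open>t\<close> of finer and
    finer grids. It exists for good \<omega> because \<open>YL\<close> is Lipschitz in the clock
    \<open>Mi\<close>.\<close>
  define W where "W t \<omega> = lim (\<lambda>k. YL (idx k t) \<omega>)" for t \<omega>
  define good where "good \<omega> \<longleftrightarrow> (\<forall>j. (\<lambda>n. Y n j \<omega>) \<longlonglongrightarrow> YL j \<omega>) \<and>
    (\<forall>n j. norm (Y n j \<omega>) \<le> CC * (1 + norm (Y n j0 \<omega>))) \<and>
    (\<forall>n i j. norm (Y n i \<omega> - Y n j \<omega>) \<le> CC * (1 + norm (Y n j0 \<omega>)) * \<bar>Mi (tau (r n) (q i)) - Mi (tau (r n) (q j))\<bar>)" for \<omega>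
  have good: "AE \<omega> in \<Omega>. good \<omega>"
    using conv b1 b2
  proof eventually_elim
    case (elim \<omega>)
    have "(\<lambda>n. Y n j \<omega>) \<longlonglongrightarrow> YL j \<omega>" for j
      unfolding YL_def using elim(1) by (simp add: convergent_LIMSEQ_iff)
    then show ?case using elim(2,3) unfolding good_def by blast
  qed
  have Mi_tendsto: "(\<lambda>n. Mi (u n)) \<longlonglongrightarrow> Mi t" if "u \<longlonglongrightarrow> t" for u t
    using isCont_tendsto_compose[OF Mi_isCont that] .
  define c where "c \<omega> = CC * (1 + norm (YL j0 \<omega>))" for \<omega>
  have c0: "0 \<le> c \<omega>" for \<omega> using CC_ge_1 by (simp add: c_def)
  have c_lim: "(\<lambda>n. CC * (1 + norm (Y n j0 \<omega>))) \<longlonglongrightarrow> c \<omega>" if "good \<omega>" for \<omega>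
    unfolding c_def using that by (intro tendsto_intros) (simp add: good_def)
  have YL_le: "norm (YL j \<omega>) \<le> c \<omega>" if "good \<omega>" for j \<omega>
  proof (rule tendsto_le[OF _ c_lim[OF that]])
    show "(\<lambda>n. norm (Y n j \<omega>)) \<longlonglongrightarrow> norm (YL j \<omega>)" using that by (intro tendsto_norm) (simp add: good_def)
    show "\<forall>\<^sub>F n in sequentially. norm (Y n j \<omega>) \<le> CC * (1 + norm (Y n j0 \<omega>))"
      using that by (intro always_eventually) (simp add: good_def)
  qed simp
  have YL_diff: "norm (YL i \<omega> - YL j \<omega>) \<le> c \<omega> * \<bar>Mi (q i) - Mi (q j)\<bar>" if "good \<omega>" for i j \<omega>
  proof (rule tendsto_le)
    show "(\<lambda>n. norm (Y n i \<omega> - Y n j \<omega>)) \<longlonglongrightarrow> norm (YL i \<omega> - YL j \<omega>)"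
      using that by (intro tendsto_norm tendsto_diff) (simp_all add: good_def)
    show "(\<lambda>n. CC * (1 + norm (Y n j0 \<omega>)) * \<bar>Mi (tau (r n) (q i)) - Mi (tau (r n) (q j))\<bar>) \<longlonglongrightarrow> c \<omega> * \<bar>Mi (q i) - Mi (q j)\<bar>"
      by (intro tendsto_mult c_lim[OF that] tendsto_rabs tendsto_diff Mi_tendsto tau_tendsto[OF r] q_in tendsto_const)
    show "\<forall>\<^sub>F n in sequentially. norm (Y n i \<omega> - Y n j \<omega>) \<le> CC * (1 + norm (Y n j0 \<omega>)) * \<bar>Mi (tau (r n) (q i)) - Mi (tau (r n) (q j))\<bar>"
      using that by (intro always_eventually) (simp add: good_def)
  qed simp
  have Mi_tau: "(\<lambda>k. Mi (q (idx k t))) \<longlonglongrightarrow> Mi t" if t: "t \<in> {0..T}" for t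
  proof -
    have "(\<lambda>k. tau (id k) ((\<lambda>_. t) k)) \<longlonglongrightarrow> t"
      by (rule tau_tendsto) (use t in \<open>auto simp: strict_mono_def\<close>)
    then show ?thesis unfolding q_idx[OF t] id_apply by (rule Mi_tendsto)
  qed
  have W_lim: "(\<lambda>k. YL (idx k t) \<omega>) \<longlonglongrightarrow> W t \<omega>" if g: "good \<omega>" and t: "t \<in> {0..T}" for t \<omega>
  proof -
    have "Cauchy (\<lambda>k. Mi (q (idx k t)))" using Mi_tau[OF t] by (rule LIMSEQ_imp_Cauchy)
    then have "Cauchy (\<lambda>k. YL (idx k t) \<omega>)" by (rule Cauchy_dominated) (rule YL_diff[OF g], rule c0)
    then have "convergent (\<lambda>k. YL (idx k t) \<omega>)" by (rule Cauchy_convergent)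
    then show ?thesis unfolding W_def by (simp add: convergent_LIMSEQ_iff)
  qed
  have W_YL: "norm (W t \<omega> - YL j \<omega>) \<le> c \<omega> * \<bar>Mi t - Mi (q j)\<bar>" if g: "good \<omega>" and t: "t \<in> {0..T}" for t j \<omega>
  proof (rule tendsto_le)
    show "(\<lambda>k. norm (YL (idx k t) \<omega> - YL j \<omega>)) \<longlonglongrightarrow> norm (W t \<omega> - YL j \<omega>)"
      by (intro tendsto_norm tendsto_diff W_lim g t tendsto_const)
    show "(\<lambda>k. c \<omega> * \<bar>Mi (q (idx k t)) - Mi (q j)\<bar>) \<longlonglongrightarrow> c \<omega> * \<bar>Mi t - Mi (q j)\<bar>"
      by (intro tendsto_mult tendsto_rabs tendsto_diff tendsto_const Mi_tau t)
    show "\<forall>\<^sub>F k in sequentially. norm (YL (idx k t) \<omega> - YL j \<omega>) \<le> c \<omega> * \<bar>Mi (q (idx k t)) - Mi (q j)\<bar>"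
      by (intro always_eventually allI YL_diff g)
  qed simp
  have W_le: "norm (W t \<omega>) \<le> c \<omega>" if g: "good \<omega>" and t: "t \<in> {0..T}" for t \<omega>
  proof (rule tendsto_le)
    show "(\<lambda>k. norm (YL (idx k t) \<omega>)) \<longlonglongrightarrow> norm (W t \<omega>)" by (intro tendsto_norm W_lim g t)
    show "(\<lambda>k. c \<omega>) \<longlonglongrightarrow> c \<omega>" by simp
    show "\<forall>\<^sub>F k in sequentially. norm (YL (idx k t) \<omega>) \<le> c \<omega>" by (intro always_eventually allI YL_le g)
  qed simp
  have W_diff: "norm (W s \<omega> - W t \<omega>) \<le> c \<omega> * \<bar>Mi t - Mi s\<bar>" if g: "good \<omega>" and s: "s \<in> {0..T}" and t: "t \<in> {0..T}" for s t \<omega>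
  proof (rule tendsto_le)
    show "(\<lambda>k. norm (W s \<omega> - YL (idx k t) \<omega>)) \<longlonglongrightarrow> norm (W s \<omega> - W t \<omega>)"
      by (intro tendsto_norm tendsto_diff W_lim g t tendsto_const)
    have "(\<lambda>k. c \<omega> * \<bar>Mi s - Mi (q (idx k t))\<bar>) \<longlonglongrightarrow> c \<omega> * \<bar>Mi s - Mi t\<bar>"
      by (intro tendsto_mult tendsto_rabs tendsto_diff tendsto_const Mi_tau t)
    then show "(\<lambda>k. c \<omega> * \<bar>Mi s - Mi (q (idx k t))\<bar>) \<longlonglongrightarrow> c \<omega> * \<bar>Mi t - Mi s\<bar>"
      by (simp only: abs_minus_commute)
    show "\<forall>\<^sub>F k in sequentially. norm (W s \<omega> - YL (idx k t) \<omega>) \<le> c \<omega> * \<bar>Mi s - Mi (q (idx k t))\<bar>"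
      by (intro always_eventually allI W_YL g s)
  qed simp
  have W0: "W 0 \<omega> = YL j0 \<omega>" if g: "good \<omega>" for \<omega>
    using W_YL[OF g, of 0 j0] T by (simp add: q0)
  have YLm[measurable]: "YL j \<in> borel_measurable \<Omega>" for j
    unfolding YL_def[abs_def] by (rule borel_measurable_lim_metric) simp
  have Wm[measurable]: "W t \<in> borel_measurable \<Omega>" for t
    unfolding W_def[abs_def] by (rule borel_measurable_lim_metric) simp
  have Wm2: "(\<lambda>z. W (fst z) (snd z)) \<in> borel_measurable (S \<Otimes>\<^sub>M \<Omega>)"
    unfolding W_def
  proof (rule borel_measurable_lim_metric)
    fix k
    show "(\<lambda>z. YL (idx k (fst z)) (snd z)) \<in> borel_measurable (S \<Otimes>\<^sub>M \<Omega>)"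
    proof (rule measurable_compose_countable[where f = "\<lambda>i z. YL i (snd z)"])
      show "(\<lambda>z. YL i (snd z)) \<in> borel_measurable (S \<Otimes>\<^sub>M \<Omega>)" for i
        by (rule measurable_compose[OF measurable_snd YLm])
      show "(\<lambda>z. idx k (fst z)) \<in> S \<Otimes>\<^sub>M \<Omega> \<rightarrow>\<^sub>M count_space UNIV"
        by (rule measurable_compose[OF measurable_fst idx_measurable])
    qed
  qed
  have law_YL0: "distr \<Omega> borel (YL j0) = \<mu>0"
  proof (rule distr_AE_limit[where Y = "\<lambda>n. Y n j0", OF \<Omega> Ym YLm _ law_Y0])
    show "AE \<omega> in \<Omega>. (\<lambda>n. Y n j0 \<omega>) \<longlonglongrightarrow> YL j0 \<omega>"
      using good by eventually_elim (simp add: good_def)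
  qed
  define YY where "YY n t = Y n (idx (r n) t)" for n t
  have YYm[measurable]: "YY n t \<in> borel_measurable \<Omega>" for n t unfolding YY_def by (rule Ym)
  have law_YY: "distr \<Omega> borel (YY n t) = law (r n) (cell (r n) t)" if "t \<in> {0..T}" for n t
    unfolding YY_def law_Y q_idx[OF that] cell_tau ..
  have lim_YY: "(\<lambda>n. YY n (u n) \<omega>) \<longlonglongrightarrow> W t \<omega>"
    if u: "\<And>n. u n \<in> {0..T}" "u \<longlonglongrightarrow> t" and t: "t \<in> {0..T}" and g: "good \<omega>" for u t \<omega>
  proof (rule LIMSEQ_I)
    fix e :: real assume e: "0 < e"
    have "(\<lambda>k. c \<omega> * \<bar>Mi t - Mi (q (idx k t))\<bar>) \<longlonglongrightarrow> c \<omega> * \<bar>Mi t - Mi t\<bar>"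
      by (intro tendsto_mult tendsto_rabs tendsto_diff tendsto_const Mi_tau t)
    then have "\<forall>\<^sub>F k in sequentially. c \<omega> * \<bar>Mi t - Mi (q (idx k t))\<bar> < e / 3"
      by (rule order_tendstoD(2)) (use e in simp)
    then obtain k where k: "c \<omega> * \<bar>Mi t - Mi (q (idx k t))\<bar> < e / 3"
      using eventually_happens'[OF sequentially_bot] by blast
    \<comment> \<open>A fixed grid time close to \<open>t\<close> in the clock carries the
      comparison: from \<open>YY n (u n)\<close> to \<open>Y n j\<close>, on to \<open>YL j\<close>
      and to \<open>W t\<close>, each step below e/3.\<close>
    define j where "j = idx k t"
    have "(\<lambda>n. CC * (1 + norm (Y n j0 \<omega>)) * \<bar>Mi (tau (r n) (u n)) - Mi (tau (r n) (q j))\<bar>) \<longlonglongrightarrow> c \<omega> * \<bar>Mi t - Mi (q j)\<bar>"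
      by (intro tendsto_mult c_lim[OF g] tendsto_rabs tendsto_diff Mi_tendsto tau_tendsto[OF r] q_in u tendsto_const)
    then have ev1: "\<forall>\<^sub>F n in sequentially. CC * (1 + norm (Y n j0 \<omega>)) * \<bar>Mi (tau (r n) (u n)) - Mi (tau (r n) (q j))\<bar> < e / 3"
      by (rule order_tendstoD(2)) (use k in \<open>simp add: j_def\<close>)
    have "(\<lambda>n. norm (Y n j \<omega> - YL j \<omega>)) \<longlonglongrightarrow> norm (YL j \<omega> - YL j \<omega>)"
      using g by (intro tendsto_norm tendsto_diff tendsto_const) (simp add: good_def)
    then have ev2: "\<forall>\<^sub>F n in sequentially. norm (Y n j \<omega> - YL j \<omega>) < e / 3"
      by (rule order_tendstoD(2)) (use e in simp)
    have "\<forall>\<^sub>F n in sequentially. norm (YY n (u n) \<omega> - W t \<omega>) < e"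
      using ev1 ev2
    proof eventually_elim
      case (elim n)
      \<comment> \<open>The modulus bound for the copies uses the sampled times \<open>q\<close>; at
        the index of \<open>u n\<close> this is already a point of grid \<open>r n\<close>, so
        rounding it again changes nothing.\<close>
      have tt: "tau (r n) (tau (r n) (u n)) = tau (r n) (u n)" unfolding tau_def[of "r n" "tau (r n) (u n)"] cell_tau by (simp add: tau_def)
      have "norm (YY n (u n) \<omega> - Y n j \<omega>) \<le> CC * (1 + norm (Y n j0 \<omega>)) * \<bar>Mi (tau (r n) (u n)) - Mi (tau (r n) (q j))\<bar>"
      proof -
        have "norm (Y n (idx (r n) (u n)) \<omega> - Y n j \<omega>)
          \<le> CC * (1 + norm (Y n j0 \<omega>)) * \<bar>Mi (tau (r n) (q (idx (r n) (u n)))) - Mi (tau (r n) (q j))\<bar>"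
          using g unfolding good_def by blast
        then show ?thesis unfolding YY_def q_idx[OF u(1)] tt .
      qed
      moreover have "norm (W t \<omega> - YL j \<omega>) < e / 3" using W_YL[OF g t, of j] k by (simp add: j_def)
      moreover have "norm (YY n (u n) \<omega> - W t \<omega>) \<le> norm (YY n (u n) \<omega> - Y n j \<omega>) + norm (Y n j \<omega> - YL j \<omega>) + norm (W t \<omega> - YL j \<omega>)"
      proof -
        have "norm (YY n (u n) \<omega> - W t \<omega>) = norm ((YY n (u n) \<omega> - Y n j \<omega>) + (Y n j \<omega> - YL j \<omega>) - (W t \<omega> - YL j \<omega>))" by simp
        then show ?thesis
          using norm_triangle_ineq4[of "(YY n (u n) \<omega> - Y n j \<omega>) + (Y n j \<omega> - YL j \<omega>)" "W t \<omega> - YL j \<omega>"]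
            norm_triangle_ineq[of "YY n (u n) \<omega> - Y n j \<omega>" "Y n j \<omega> - YL j \<omega>"] by linarith
      qed
      ultimately show ?case using elim by linarith
    qed
    then show "\<exists>no. \<forall>n\<ge>no. norm (YY n (u n) \<omega> - W t \<omega>) < e" by (simp add: eventually_sequentially)
  qed
  have int_YL0: "integrable \<Omega> (\<lambda>\<omega>. (1 + norm (YL j0 \<omega>)) powr p)"
    and eq_YL0: "(\<integral>\<omega>. (1 + norm (YL j0 \<omega>)) powr p \<partial>\<Omega>) = (\<integral>x. (1 + norm x) powr p \<partial>\<mu>0)"
  proof -
    have h: "(\<lambda>x :: 'a. (1 + norm x) powr p) \<in> borel_measurable borel" by simp
    show "integrable \<Omega> (\<lambda>\<omega>. (1 + norm (YL j0 \<omega>)) powr p)"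
      using one_norm_powr_int unfolding law_YL0[symmetric] integrable_distr_eq[OF YLm h] .
    show "(\<integral>\<omega>. (1 + norm (YL j0 \<omega>)) powr p \<partial>\<Omega>) = (\<integral>x. (1 + norm x) powr p \<partial>\<mu>0)"
      unfolding law_YL0[symmetric] by (rule integral_distr[OF YLm h, symmetric])
  qed
  have int_Y0: "integrable \<Omega> (\<lambda>\<omega>. (1 + norm (Y n j0 \<omega>)) powr p)"
    and eq_Y0: "(\<integral>\<omega>. (1 + norm (Y n j0 \<omega>)) powr p \<partial>\<Omega>) = (\<integral>x. (1 + norm x) powr p \<partial>\<mu>0)" for n
  proof -
    have h: "(\<lambda>x :: 'a. (1 + norm x) powr p) \<in> borel_measurable borel" by simp
    show "integrable \<Omega> (\<lambda>\<omega>. (1 + norm (Y n j0 \<omega>)) powr p)"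
      using one_norm_powr_int unfolding law_Y0[of n, symmetric] integrable_distr_eq[OF Ym h] .
    show "(\<integral>\<omega>. (1 + norm (Y n j0 \<omega>)) powr p \<partial>\<Omega>) = (\<integral>x. (1 + norm x) powr p \<partial>\<mu>0)"
      unfolding law_Y0[of n, symmetric] by (rule integral_distr[OF Ym h, symmetric])
  qed
  define I where "I = (\<integral>x. (1 + norm x) powr p \<partial>\<mu>0)"
  have c_powr: "c \<omega> powr p = CC powr p * (1 + norm (YL j0 \<omega>)) powr p" for \<omega>
    unfolding c_def by (rule powr_mult)
  have W_Pp: "distr \<Omega> borel (W t) \<in> Pp p" if t: "t \<in> {0..T}" for t
  proof -
    have "integrable \<Omega> (\<lambda>\<omega>. norm (W t \<omega>) powr p)"
    proof (rule Bochner_Integration.integrable_bound[OF integrable_mult_right[OF int_YL0, of "CC powr p"]])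
      show "AE \<omega> in \<Omega>. norm (norm (W t \<omega>) powr p) \<le> norm (CC powr p * (1 + norm (YL j0 \<omega>)) powr p)"
        using good
      proof eventually_elim
        case (elim \<omega>)
        have "norm (W t \<omega>) powr p \<le> c \<omega> powr p" using W_le[OF elim t] p by (intro powr_mono2) auto
        then show ?case unfolding c_powr by simp
      qed
    qed measurable
    then show ?thesis
      unfolding Pp_def using integrable_distr_eq[OF Wm, of "\<lambda>x. norm x powr p" t] \<Omega>.prob_space_distr[OF Wm] by simp
  qed
  have W_Wp: "Wp p (distr \<Omega> borel (W s)) (distr \<Omega> borel (W t)) \<le> CC * D * \<bar>Mi t - Mi s\<bar>"
    if s: "s \<in> {0..T}" and t: "t \<in> {0..T}" for s t
  proof (rule Wp_distr_le[OF \<Omega> p Wm Wm])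
    show "0 \<le> CC * D * \<bar>Mi t - Mi s\<bar>" using CC_ge_1 D_ge_1 by simp
    define b where "b = \<bar>Mi t - Mi s\<bar>"
    have "(\<integral>\<^sup>+\<omega>. ennreal (norm (W s \<omega> - W t \<omega>) powr p) \<partial>\<Omega>)
      \<le> (\<integral>\<^sup>+\<omega>. ennreal ((CC * b) powr p * (1 + norm (YL j0 \<omega>)) powr p) \<partial>\<Omega>)"
    proof (rule nn_integral_mono_AE)
      show "AE \<omega> in \<Omega>. ennreal (norm (W s \<omega> - W t \<omega>) powr p) \<le> ennreal ((CC * b) powr p * (1 + norm (YL j0 \<omega>)) powr p)"
        using good
      proof eventually_elim
        case (elim \<omega>)
        have "norm (W s \<omega> - W t \<omega>) \<le> CC * b * (1 + norm (YL j0 \<omega>))"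
          using W_diff[OF elim s t] by (simp add: c_def b_def mult_ac)
        then have "norm (W s \<omega> - W t \<omega>) powr p \<le> (CC * b * (1 + norm (YL j0 \<omega>))) powr p" using p by (intro powr_mono2) auto
        also have "\<dots> = (CC * b) powr p * (1 + norm (YL j0 \<omega>)) powr p" by (rule powr_mult)
        finally show ?case by (rule ennreal_leI)
      qed
    qed
    also have "\<dots> = ennreal (\<integral>\<omega>. (CC * b) powr p * (1 + norm (YL j0 \<omega>)) powr p \<partial>\<Omega>)"
      by (intro nn_integral_eq_integral integrable_mult_right int_YL0) simp
    also have "(\<integral>\<omega>. (CC * b) powr p * (1 + norm (YL j0 \<omega>)) powr p \<partial>\<Omega>) = (CC * b) powr p * I"
      by (simp add: eq_YL0 I_def)
    \<comment> \<open>Hence the random Lipschitz constant \<open>c\<close> has L^p norm CC D, the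
      constant in the estimate of \<open>Wp\<close>.\<close>
    also have "I = D powr p"
    proof -
      have "0 \<le> I" unfolding I_def by (intro integral_nonneg_AE) simp
      then show ?thesis unfolding D_def I_def[symmetric] using p by (simp add: powr_powr)
    qed
    also have "(CC * b) powr p * D powr p = (CC * D * b) powr p" by (simp add: powr_mult mult_ac)
    finally show "(\<integral>\<^sup>+\<omega>. ennreal (norm (W s \<omega> - W t \<omega>) powr p) \<partial>\<Omega>) \<le> ennreal ((CC * D * \<bar>Mi t - Mi s\<bar>) powr p)"
      by (simp add: b_def)
  qed
  have Wp_lim: "(\<lambda>n. Wp p (distr \<Omega> borel (W t)) (law (r n) (cell (r n) (u n)))) \<longlonglongrightarrow> 0"
    if u: "\<And>n. u n \<in> {0..T}" "u \<longlonglongrightarrow> t" and t: "t \<in> {0..T}" for u t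
  proof -
    define f where "f n \<omega> = norm (W t \<omega> - YY n (u n) \<omega>) powr p" for n \<omega>
    define K where "K = 2 powr p * CC powr p"
    \<comment> \<open>From |W t| <= CC (1 + |YL j0|) and |YY n| <= CC (1 + |Y n j0|). It varies with
      \<open>n\<close>, but both starting points have law \<mu>0, so its integral is always K (I +
      I).\<close>
    define g where "g n \<omega> = K * ((1 + norm (YL j0 \<omega>)) powr p + (1 + norm (Y n j0 \<omega>)) powr p)" for n \<omega>
    define h where "h \<omega> = K * ((1 + norm (YL j0 \<omega>)) powr p + (1 + norm (YL j0 \<omega>)) powr p)" for \<omega>
    have gi: "integrable \<Omega> (g n)" for n
      unfolding g_def[abs_def] by (intro integrable_mult_right Bochner_Integration.integrable_add int_YL0 int_Y0)
    have hi: "integrable \<Omega> h"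
      unfolding h_def[abs_def] by (intro integrable_mult_right Bochner_Integration.integrable_add int_YL0)
    have g_int: "(\<integral>\<omega>. g n \<omega> \<partial>\<Omega>) = K * (I + I)" for n
      unfolding g_def by (simp add: Bochner_Integration.integral_add[OF int_YL0 int_Y0] eq_YL0 eq_Y0 I_def)
    have h_int: "(\<integral>\<omega>. h \<omega> \<partial>\<Omega>) = K * (I + I)"
      unfolding h_def by (simp add: Bochner_Integration.integral_add[OF int_YL0 int_YL0] eq_YL0 I_def)
    have fm: "f n \<in> borel_measurable \<Omega>" for n unfolding f_def[abs_def] by measurable
    have fg: "AE \<omega> in \<Omega>. 0 \<le> f n \<omega> \<and> f n \<omega> \<le> g n \<omega>" for n
      using good
    proof eventually_elim
      case (elim \<omega>)
      define a b where "a = CC * (1 + norm (YL j0 \<omega>))" and "b = CC * (1 + norm (Y n j0 \<omega>))"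
      have ab: "0 \<le> a" "0 \<le> b" using CC_ge_1 by (auto simp: a_def b_def)
      have "norm (W t \<omega> - YY n (u n) \<omega>) \<le> norm (W t \<omega>) + norm (YY n (u n) \<omega>)" by (rule norm_triangle_ineq4)
      also have "\<dots> \<le> a + b"
        using W_le[OF elim t] elim unfolding good_def YY_def a_def b_def c_def by (intro add_mono) auto
      finally have "f n \<omega> \<le> (a + b) powr p" unfolding f_def using p by (intro powr_mono2) auto
      also have "\<dots> \<le> 2 powr p * (a powr p + b powr p)" using p ab by (intro add_powr_le) auto
      also have "\<dots> = g n \<omega>" unfolding a_def b_def g_def K_def powr_mult by (simp add: algebra_simps)
      finally show ?case by (simp add: f_def)
    qed
    have flim: "AE \<omega> in \<Omega>. (\<lambda>n. f n \<omega>) \<longlonglongrightarrow> 0"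
      using good
    proof eventually_elim
      case (elim \<omega>)
      have "(\<lambda>n. norm (W t \<omega> - YY n (u n) \<omega>)) \<longlonglongrightarrow> norm (W t \<omega> - W t \<omega>)"
        by (intro tendsto_norm tendsto_diff tendsto_const lim_YY u t elim)
      then have "(\<lambda>n. norm (W t \<omega> - YY n (u n) \<omega>) powr p) \<longlonglongrightarrow> 0 powr p"
        using p by (intro tendsto_powr' tendsto_const) auto
      then show ?case unfolding f_def using p by simp
    qed
    have glim: "AE \<omega> in \<Omega>. (\<lambda>n. g n \<omega>) \<longlonglongrightarrow> h \<omega>"
      using good
    proof eventually_elim
      case (elim \<omega>)
      have Y0: "(\<lambda>n. Y n j0 \<omega>) \<longlonglongrightarrow> YL j0 \<omega>" using elim by (simp add: good_def)
      show ?case unfolding g_def h_def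
        by (intro tendsto_mult tendsto_add tendsto_powr tendsto_const tendsto_norm Y0)
           (use norm_ge_zero[of "YL j0 \<omega>"] in linarith)
    qed
    have "(\<lambda>n. \<integral>\<omega>. f n \<omega> \<partial>\<Omega>) \<longlonglongrightarrow> 0"
      by (rule integral_generalized_dominated[OF prob_space.finite_measure[OF \<Omega>] fm gi hi fg flim glim])
         (simp add: g_int h_int)
    then have lim: "(\<lambda>n. (\<integral>\<omega>. f n \<omega> \<partial>\<Omega>) powr (1 / p)) \<longlonglongrightarrow> 0"
    proof -
      assume F: "(\<lambda>n. \<integral>\<omega>. f n \<omega> \<partial>\<Omega>) \<longlonglongrightarrow> 0"
      have "0 \<le> (\<integral>\<omega>. f n \<omega> \<partial>\<Omega>)" for n by (intro integral_nonneg_AE) (simp add: f_def)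
      then have "(\<lambda>n. (\<integral>\<omega>. f n \<omega> \<partial>\<Omega>) powr (1 / p)) \<longlonglongrightarrow> 0 powr (1 / p)"
        using p F by (intro tendsto_powr' tendsto_const) auto
      then show ?thesis using p by simp
    qed
    have fi: "integrable \<Omega> (f n)" for n
    proof (rule Bochner_Integration.integrable_bound[OF gi[of n] fm])
      show "AE \<omega> in \<Omega>. norm (f n \<omega>) \<le> norm (g n \<omega>)"
        using fg[of n] by eventually_elim simp
    qed
    have bound: "Wp p (distr \<Omega> borel (W t)) (law (r n) (cell (r n) (u n))) \<le> (\<integral>\<omega>. f n \<omega> \<partial>\<Omega>) powr (1 / p)" for n
      unfolding law_YY[OF u(1), symmetric]
    proof (rule Wp_distr_le[OF \<Omega> p Wm YYm])
      have f0: "0 \<le> (\<integral>\<omega>. f n \<omega> \<partial>\<Omega>)" by (intro integral_nonneg_AE) (simp add: f_def)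
      have "(\<integral>\<^sup>+\<omega>. ennreal (f n \<omega>) \<partial>\<Omega>) = ennreal (\<integral>\<omega>. f n \<omega> \<partial>\<Omega>)"
        by (intro nn_integral_eq_integral fi) (simp add: f_def)
      also have "(\<integral>\<omega>. f n \<omega> \<partial>\<Omega>) = ((\<integral>\<omega>. f n \<omega> \<partial>\<Omega>) powr (1 / p)) powr p"
        using f0 p by (simp add: powr_powr)
      finally show "(\<integral>\<^sup>+\<omega>. ennreal (norm (W t \<omega> - YY n (u n) \<omega>) powr p) \<partial>\<Omega>)
        \<le> ennreal (((\<integral>\<omega>. f n \<omega> \<partial>\<Omega>) powr (1 / p)) powr p)" by (simp add: f_def)
    qed simp
    show ?thesis
    proof (rule tendsto_sandwich[OF _ _ tendsto_const lim])
      show "\<forall>\<^sub>F n in sequentially. 0 \<le> Wp p (distr \<Omega> borel (W t)) (law (r n) (cell (r n) (u n)))"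
        by (intro always_eventually allI Wp_nonneg)
      show "\<forall>\<^sub>F n in sequentially. Wp p (distr \<Omega> borel (W t)) (law (r n) (cell (r n) (u n))) \<le> (\<integral>\<omega>. f n \<omega> \<partial>\<Omega>) powr (1 / p)"
        by (intro always_eventually allI bound)
    qed
  qed
  have W0_law: "distr \<Omega> borel (W 0) = \<mu>0"
  proof -
    have "distr \<Omega> borel (W 0) = distr \<Omega> borel (YL j0)"
      by (rule distr_cong_AE) (use good in \<open>auto elim!: eventually_mono simp: W0\<close>)
    then show ?thesis by (simp add: law_YL0)
  qed
  have lim_YY_AE: "AE \<omega> in \<Omega>. (\<lambda>n. YY n (u n) \<omega>) \<longlonglongrightarrow> W t \<omega>"
    if "\<forall>n. u n \<in> {0..T}" "t \<in> {0..T}" "u \<longlonglongrightarrow> t" for u t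
    using good by eventually_elim (rule lim_YY, use that in auto)
  show ?thesis
    by (intro exI[of _ r] exI[of _ \<Omega>] exI[of _ YY] exI[of _ W] conjI allI impI ballI r \<Omega> YYm law_YY Wm2 Wm
        lim_YY_AE Wp_lim W_Pp W_Wp W0_law) auto
qed

end

section \<open>The limit velocity\<close>

lemma integrable_lebesgue_on_indicator:
  fixes f :: "real \<Rightarrow> real"
  shows "integrable (lebesgue_on {a..b}) f \<longleftrightarrow> integrable lebesgue (\<lambda>x. indicator {a..b} x *\<^sub>R f x)"
  by (rule integrable_restrict_space) simp

text \<open>Records the outcome of \<open>limit_curve\<close> with the convergences taken at a fixed
  time, the form in which the velocities are studied.\<close>

locale Euler_limit = continuity_inclusion p T V m \<mu>0
  for p T :: real and V :: "real \<Rightarrow> 'a::euclidean_space measure \<Rightarrow> ('a \<Rightarrow> 'a) set"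
    and m :: "real \<Rightarrow> real" and \<mu>0 :: "'a measure" +
  fixes r :: "nat \<Rightarrow> nat" and \<Omega> :: "real measure"
    and YY :: "nat \<Rightarrow> real \<Rightarrow> real \<Rightarrow> 'a" and W :: "real \<Rightarrow> real \<Rightarrow> 'a"
  assumes r: "strict_mono r" and \<Omega>: "prob_space \<Omega>" and YY_measurable: "\<And>n t. YY n t \<in> borel_measurable \<Omega>"
    and law_YY: "\<And>n t. t \<in> {0..T} \<Longrightarrow> distr \<Omega> borel (YY n t) = law (r n) (cell (r n) t)"
    and W_measurable_pair: "(\<lambda>z. W (fst z) (snd z)) \<in> borel_measurable (S \<Otimes>\<^sub>M \<Omega>)"
    and W_measurable: "\<And>t. W t \<in> borel_measurable \<Omega>"
    and YY_tendsto: "\<And>t. t \<in> {0..T} \<Longrightarrow> AE \<omega> in \<Omega>. (\<lambda>n. YY n t \<omega>) \<longlonglongrightarrow> W t \<omega>"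
    and Wp_tendsto: "\<And>t. t \<in> {0..T} \<Longrightarrow> (\<lambda>n. Wp p (distr \<Omega> borel (W t)) (law (r n) (cell (r n) t))) \<longlonglongrightarrow> 0"
    and W_Pp: "\<And>t. t \<in> {0..T} \<Longrightarrow> distr \<Omega> borel (W t) \<in> Pp p"
    and W_Wp: "\<And>s t. s \<in> {0..T} \<Longrightarrow> t \<in> {0..T} \<Longrightarrow>
      Wp p (distr \<Omega> borel (W s)) (distr \<Omega> borel (W t)) \<le> CC * D * \<bar>Mi t - Mi s\<bar>"
    and W_0: "distr \<Omega> borel (W 0) = \<mu>0"
begin

sublocale O: prob_space \<Omega> by (rule \<Omega>)

definition \<mu> :: "real \<Rightarrow> 'a measure" where "\<mu> t = distr \<Omega> borel (W t)"

text \<open>The velocities along the subsequence chosen by the representation, so that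
  \<open>w n\<close> is the velocity belonging to \<open>YY n\<close>.\<close>

definition w :: "nat \<Rightarrow> real \<Rightarrow> 'a \<Rightarrow> 'a" where "w n = vn (r n)"

section \<open>Regularity of the limit curve\<close>

lemma Mi_diff:
  assumes "0 \<le> s" "s \<le> t" "t \<le> T"
  shows "Mi t - Mi s = (\<integral>x. m x \<partial>lebesgue_on {s..t})"
proof -
  define f where "f x = of_bool (x < t) * m x - of_bool (x < s) * m x" for x
  have fi: "integrable S f" unfolding f_def[abs_def] by (intro Bochner_Integration.integrable_diff Mi_int)
  have mi: "integrable (lebesgue_on {s..t}) m" by (rule integrable_subinterval[OF m_int]) (use assms in auto)
  have "Mi t - Mi s = (\<integral>x. f x \<partial>S)"
    unfolding Mi_def f_def by (intro Bochner_Integration.integral_diff[symmetric] Mi_int)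
  also have "\<dots> = (\<integral>x. indicator {0..T} x *\<^sub>R f x \<partial>lebesgue)" by (rule integral_restrict_space) simp
  also have "\<dots> = (\<integral>x. indicator {s..t} x *\<^sub>R m x \<partial>lebesgue)"
  proof (rule integral_cong_AE)
    show "(\<lambda>x. indicator {0..T} x *\<^sub>R f x) \<in> borel_measurable lebesgue"
      using fi unfolding integrable_lebesgue_on_indicator by (rule borel_measurable_integrable)
    show "(\<lambda>x. indicator {s..t} x *\<^sub>R m x) \<in> borel_measurable lebesgue"
      using mi unfolding integrable_lebesgue_on_indicator by (rule borel_measurable_integrable)
    have "{t} \<in> null_sets lebesgue" by simp
    from AE_not_in[OF this] show "AE x in lebesgue. indicator {0..T} x *\<^sub>R f x = indicator {s..t} x *\<^sub>R m x"
      by eventually_elim (use assms in \<open>auto simp: f_def indicator_def of_bool_def\<close>)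
  qed
  also have "\<dots> = (\<integral>x. m x \<partial>lebesgue_on {s..t})" by (rule integral_restrict_space[symmetric]) simp
  finally show ?thesis .
qed

text \<open>Increments of the clock are integrals of \<open>m\<close>, so CC D m serves as the
  integrable bound on the speed.\<close>

lemma curve_AC: "\<mu> \<in> AC_curves T p"
proof -
  have L1: "L1_nonneg T (\<lambda>s. CC * D * m s)"
    unfolding L1_nonneg_def using m_int m_nonneg CC_ge_1 D_ge_1 by simp
  have bound: "Wp p (\<mu> s) (\<mu> t) \<le> (\<integral>x. CC * D * m x \<partial>lebesgue_on {s..t})"
    if st: "0 \<le> s \<and> s \<le> t \<and> t \<le> T" for s t
  proof -
    have "Wp p (\<mu> s) (\<mu> t) \<le> CC * D * \<bar>Mi t - Mi s\<bar>" unfolding \<mu>_def using st by (intro W_Wp) auto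
    also have "\<bar>Mi t - Mi s\<bar> = Mi t - Mi s" using Mi_mono[of s t] st by simp
    also have "\<dots> = (\<integral>x. m x \<partial>lebesgue_on {s..t})" using st by (intro Mi_diff) auto
    finally show ?thesis by simp
  qed
  show ?thesis
    unfolding AC_curves_def mem_Collect_eq
  proof (intro conjI exI[of _ "\<lambda>s. CC * D * m s"] allI impI ballI L1 bound)
    show "\<mu> t \<in> Pp p" if "t \<in> {0..T}" for t unfolding \<mu>_def using that by (rule W_Pp)
  qed auto
qed

text \<open>Makes the equicontinuity hypothesis, which is local on compact sets of measures,
  available along the whole limit curve.\<close>

lemma curve_compact: "compactin (Pp_topology p) (\<mu> ` {0..T})"
proof -
  interpret P: Metric_space "Pp p :: 'a measure set" "Wp p" by (rule Metric_space_Pp_Wp[OF p])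
  show ?thesis
  proof (rule image_compactin)
    show "compactin (top_of_set {0..T}) {0..T}" by (simp add: compactin_subtopology)
    show "continuous_map (top_of_set {0..T}) (Pp_topology p) \<mu>"
      unfolding P.continuous_map_to_metric
    proof (intro ballI allI impI)
      fix t and e :: real assume "t \<in> topspace (top_of_set {0..T})" and e: "0 < e"
      then have t: "t \<in> {0..T}" by simp
      have "(\<lambda>s. CC * D * \<bar>Mi s - Mi t\<bar>) \<midarrow>t\<rightarrow> CC * D * \<bar>Mi t - Mi t\<bar>"
        using Mi_isCont[of t] unfolding isCont_def
        by (intro tendsto_mult tendsto_rabs tendsto_diff tendsto_const)
      then have "\<forall>\<^sub>F s in at t. CC * D * \<bar>Mi s - Mi t\<bar> < e"
        by (rule order_tendstoD(2)) (use e in simp)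
      then obtain d where d: "0 < d" "\<And>s. s \<noteq> t \<Longrightarrow> dist s t < d \<Longrightarrow> CC * D * \<bar>Mi s - Mi t\<bar> < e"
        unfolding eventually_at by auto
      show "\<exists>U. openin (top_of_set {0..T}) U \<and> t \<in> U \<and> (\<forall>s\<in>U. \<mu> s \<in> P.mball (\<mu> t) e)"
      proof (intro exI[of _ "{0..T} \<inter> ball t d"] conjI ballI)
        show "openin (top_of_set {0..T}) ({0..T} \<inter> ball t d)" by (rule openin_open_Int) simp
        show "t \<in> {0..T} \<inter> ball t d" using t d by simp
        fix s assume s: "s \<in> {0..T} \<inter> ball t d"
        have "CC * D * \<bar>Mi s - Mi t\<bar> < e"
        proof (cases "s = t")
          case False
          then show ?thesis using d(2)[of s] s by (simp add: dist_commute)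
        qed (use e in simp)
        then have "Wp p (\<mu> t) (\<mu> s) < e" using W_Wp[of t s] t s unfolding \<mu>_def by simp
        then show "\<mu> s \<in> P.mball (\<mu> t) e" using W_Pp t s by (simp add: P.mball_def \<mu>_def)
      qed
    qed
  qed
qed

section \<open>Distance of the velocities from V along the limit curve\<close>

lemma w_bound: "AE s in S. \<forall>n y. norm (w n s y) \<le> m s * (CC * (1 + norm y))"
  using vn_bound by eventually_elim (simp add: w_def)

text \<open>For fixed \<open>s\<close> the laws of the schemes converge to the limit law in
  \<open>Wp\<close>, and the first half of \<open>mf_continuous_at\<close> carries this over to the
  sets of velocities.\<close>

lemma w_near_V: "AE s in S. \<forall>k. \<forall>e>0. \<exists>N. \<forall>n\<ge>N. \<exists>z\<in>V s (\<mu> s). \<forall>x. norm x \<le> real k \<longrightarrow> norm (w n s x - z x) \<le> e"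
  using V_cont AE_space
proof eventually_elim
  case (elim s)
  then have s: "s \<in> {0..T}" by simp
  have \<mu>s: "\<mu> s \<in> Pp p" unfolding \<mu>_def by (rule W_Pp[OF s])
  have cont: "mf_continuous_at (Pp p) (Wp p) dcc (V s) (\<mu> s)" using elim(1) \<mu>s by blast
  show ?case
  proof (intro allI impI)
    fix k :: nat and e :: real assume e: "0 < e"
    define e' where "e' = min 1 e"
    \<comment> \<open>\<open>e'\<close> respects the truncation at 1 in \<open>dcc\<close>, and the
      factor 1/2 turns the non-strict bound of the continuity condition into the strict one of
      \<open>dcc_ball_le\<close>.\<close>
    define \<epsilon> where "\<epsilon> = (1/2) ^ Suc k * e' / 2"
    have \<epsilon>: "0 < \<epsilon>" "\<epsilon> < (1/2) ^ Suc k * e'" using e by (simp_all add: \<epsilon>_def e'_def)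
    from cont[unfolded mf_continuous_at_def, THEN conjunct1, rule_format, OF \<epsilon>(1)]
    obtain \<delta> where \<delta>: "0 < \<delta>" "\<forall>x'\<in>Pp p. Wp p (\<mu> s) x' \<le> \<delta> \<longrightarrow> (\<forall>y\<in>V s x'. \<exists>y'\<in>V s (\<mu> s). dcc y y' \<le> \<epsilon>)" by blast
    have "\<forall>\<^sub>F n in sequentially. Wp p (\<mu> s) (law (r n) (cell (r n) s)) < \<delta>"
      unfolding \<mu>_def by (rule order_tendstoD(2)[OF Wp_tendsto[OF s] \<delta>(1)])
    then obtain N where N: "\<forall>n\<ge>N. Wp p (\<mu> s) (law (r n) (cell (r n) s)) < \<delta>" unfolding eventually_sequentially ..
    show "\<exists>N. \<forall>n\<ge>N. \<exists>z\<in>V s (\<mu> s). \<forall>x. norm x \<le> real k \<longrightarrow> norm (w n s x - z x) \<le> e"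
    proof (intro exI[of _ N] allI impI)
      fix n assume "N \<le> n"
      then have "Wp p (\<mu> s) (law (r n) (cell (r n) s)) \<le> \<delta>" using N by (simp add: less_imp_le)
      moreover have "w n s \<in> V s (law (r n) (cell (r n) s))" unfolding w_def by (rule vn_in[OF s])
      ultimately obtain z where z: "z \<in> V s (\<mu> s)" "dcc (w n s) z \<le> \<epsilon>" using \<delta>(2) law_Pp by blast
      have "norm (w n s x - z x) \<le> e" if "norm x \<le> real k" for x
      proof -
        have "norm (w n s x - z x) \<le> e'"
          by (rule dcc_ball_le[of _ _ k]) (use z(2) \<epsilon>(2) that in \<open>auto simp: e'_def\<close>)
        then show ?thesis by (simp add: e'_def)
      qed
      then show "\<exists>z\<in>V s (\<mu> s). \<forall>x. norm x \<le> real k \<longrightarrow> norm (w n s x - z x) \<le> e" using z(1) by blast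
    qed
  qed
qed

text \<open>At a fixed time \<open>l s\<close> is just a number, so \<open>l s\<close> times the
  modulus tends to 0 with the distance; the admissible \<open>d\<close> depends on
  \<open>s\<close>.\<close>

lemma V_equicontinuous: "AE s in S. \<forall>k :: nat. \<forall>e>0. \<exists>d>0. \<forall>z\<in>V s (\<mu> s). \<forall>x y.
    norm x \<le> real k \<longrightarrow> norm y \<le> real k \<longrightarrow> norm (x - y) < d \<longrightarrow> norm (z x - z y) \<le> e"
  unfolding AE_all_countable
proof
  fix k :: nat
  obtain l \<omega> where l: "L1_nonneg T l" and \<omega>: "modulus \<omega>"
    and lw: "AE t in S. \<forall>\<nu>\<in>\<mu> ` {0..T}. \<forall>v\<in>V t \<nu>. \<forall>x\<in>cball 0 (real k). \<forall>y\<in>cball 0 (real k). norm (v x - v y) \<le> l t * \<omega> (norm (x - y))"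
    using equi[OF curve_compact compact_cball[of 0 "real k"]] by blast
  show "AE s in S. \<forall>e>0. \<exists>d>0. \<forall>z\<in>V s (\<mu> s). \<forall>x y.
    norm x \<le> real k \<longrightarrow> norm y \<le> real k \<longrightarrow> norm (x - y) < d \<longrightarrow> norm (z x - z y) \<le> e"
    using lw AE_space
  proof eventually_elim
    case (elim s)
    then have s: "s \<in> {0..T}" by simp
    have l0: "0 \<le> l s" using l s by (simp add: L1_nonneg_def)
    show ?case
    proof (intro allI impI)
      fix e :: real assume e: "0 < e"
      have cont: "continuous_on {0..} \<omega>" and \<omega>0: "\<omega> 0 = 0" using \<omega> by (auto simp: modulus_def)
      \<comment> \<open>The summand 1 avoids dividing by 0 when \<open>l s\<close> vanishes.\<close>
      have "0 < e / (l s + 1)" using e l0 by simp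
      then have "\<exists>d>0. \<forall>a\<in>{0..}. dist a 0 < d \<longrightarrow> dist (\<omega> a) (\<omega> 0) < e / (l s + 1)"
        using cont[unfolded continuous_on_iff, THEN bspec[of _ _ 0]] by simp
      then obtain d where d0: "0 < d" and d': "\<forall>a\<in>{0..}. dist a 0 < d \<longrightarrow> dist (\<omega> a) (\<omega> 0) < e / (l s + 1)" by blast
      have d: "\<bar>\<omega> a\<bar> < e / (l s + 1)" if "0 \<le> a" "a < d" for a
        using d'[THEN bspec[of _ _ a]] that by (simp add: dist_real_def \<omega>0)
      show "\<exists>d>0. \<forall>z\<in>V s (\<mu> s). \<forall>x y. norm x \<le> real k \<longrightarrow> norm y \<le> real k \<longrightarrow> norm (x - y) < d \<longrightarrow> norm (z x - z y) \<le> e"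
      proof (intro exI[of _ d] conjI d0 ballI allI impI)
        fix z and x y :: 'a assume z: "z \<in> V s (\<mu> s)" and x: "norm x \<le> real k" and y: "norm y \<le> real k" and xy: "norm (x - y) < d"
        have "norm (z x - z y) \<le> l s * \<omega> (norm (x - y))" using elim(1) s z x y by simp
        also have "\<dots> \<le> l s * (e / (l s + 1))"
          using d[OF norm_ge_zero xy] l0 by (intro mult_left_mono) auto
        also have "\<dots> \<le> e" using l0 e by (simp add: field_simps)
        finally show "norm (z x - z y) \<le> e" .
      qed
    qed
  qed
qed

text \<open>\<open>convex_fields\<close> concerns two fields; the induction renormalises partial
  sums. Fields with weight 0 are exempt from membership, because tail weights meet such fields
  before the approximation sets in.\<close>

lemma convex_fields_sum:
  fixes z :: "nat \<Rightarrow> 'a \<Rightarrow> 'a" and c :: "nat \<Rightarrow> real"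
  assumes conv: "convex_fields A" and A: "\<And>k. k < N \<Longrightarrow> c k \<noteq> 0 \<Longrightarrow> z k \<in> A"
    and c: "\<And>k. k < N \<Longrightarrow> 0 \<le> c k" "(\<Sum>k<N. c k) = (1::real)"
  shows "(\<lambda>x. \<Sum>k<N. c k *\<^sub>R z k x) \<in> A"
proof -
  have gen: "(\<lambda>x. \<Sum>k<N. (c k / (\<Sum>k<N. c k)) *\<^sub>R z k x) \<in> A"
    if "\<And>k. k < N \<Longrightarrow> c k \<noteq> 0 \<Longrightarrow> z k \<in> A" "\<And>k. k < N \<Longrightarrow> 0 \<le> c k" "0 < (\<Sum>k<N. c k)" for N :: nat
    using that
  proof (induction N)
    case (Suc N)
    define s where "s = (\<Sum>k<N. c k)"
    have s0: "0 \<le> s" unfolding s_def using Suc.prems(2) by (intro sum_nonneg) auto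
    have cN: "0 \<le> c N" using Suc.prems(2) by simp
    have IH: "(\<lambda>x. \<Sum>k<N. (c k / s) *\<^sub>R z k x) \<in> A" if "0 < s"
      unfolding s_def using Suc.prems(1,2) that unfolding s_def by (intro Suc.IH) auto
    show ?case
    proof -
      have t: "0 < s + c N" using Suc.prems(3) by (simp add: s_def)
      have eq: "(\<Sum>k<Suc N. (c k / (\<Sum>k<Suc N. c k)) *\<^sub>R z k x)
        = (s / (s + c N)) *\<^sub>R (\<Sum>k<N. (c k / s) *\<^sub>R z k x) + (c N / (s + c N)) *\<^sub>R z N x" if "0 < s" for x
        using that t by (simp add: s_def[symmetric] scaleR_sum_right)
      consider "s = 0" | "c N = 0" "0 < s" | "0 < s" "0 < c N" using s0 cN by linarith
      then show "(\<lambda>x. \<Sum>k<Suc N. (c k / (\<Sum>k<Suc N. c k)) *\<^sub>R z k x) \<in> A"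
      proof cases
        case 1
        then have "c k = 0" if "k < N" for k
          using that Suc.prems(2) sum_nonneg_eq_0_iff[of "{..<N}" c] unfolding s_def by auto
        then have "(\<lambda>x. \<Sum>k<Suc N. (c k / (\<Sum>k<Suc N. c k)) *\<^sub>R z k x) = z N"
          using 1 t by (intro ext) (simp add: s_def[symmetric])
        then show ?thesis using Suc.prems(1)[of N] 1 t by simp
      next
        case 2
        then show ?thesis using IH by (simp add: s_def[symmetric])
      next
        case 3
        have "s / (s + c N) + c N / (s + c N) = 1" using t by (simp add: add_divide_distrib[symmetric])
        then show ?thesis
          unfolding eq[OF 3(1)] using conv[unfolded convex_fields_def, rule_format, of "\<lambda>x. \<Sum>k<N. (c k / s) *\<^sub>R z k x" "z N" "s / (s + c N)" "c N / (s + c N)"]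
            IH 3 t Suc.prems(1)[of N] by simp
      qed
    qed
  qed simp
  have "(\<lambda>x. \<Sum>k<N. (c k / (\<Sum>k<N. c k)) *\<^sub>R z k x) \<in> A"
    by (rule gen) (use A c in auto)
  then show ?thesis by (simp add: c(2))
qed

text \<open>The approximants of the single velocities, combined with the same weights, stay in the
  set by convexity. Weights supported beyond \<open>N0\<close> see only velocities that are already
  close.\<close>

lemma w_combination_near_V:
  assumes s: "s \<in> {0..T}"
    and near: "\<forall>n\<ge>N0. \<exists>z\<in>V s (\<mu> s). \<forall>x. norm x \<le> real k \<longrightarrow> norm (w n s x - z x) \<le> e"
    and c: "tail_weights n N c" and n: "N0 \<le> n"
  shows "\<exists>z\<in>V s (\<mu> s). \<forall>x. norm x \<le> real k \<longrightarrow> norm ((\<Sum>i<N. c i *\<^sub>R w i s x) - z x) \<le> e"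
proof -
  have "\<forall>i. \<exists>z. N0 \<le> i \<longrightarrow> z \<in> V s (\<mu> s) \<and> (\<forall>x. norm x \<le> real k \<longrightarrow> norm (w i s x - z x) \<le> e)"
    using near by blast
  then obtain z where z: "\<And>i. N0 \<le> i \<Longrightarrow> z i \<in> V s (\<mu> s)"
    "\<And>i x. N0 \<le> i \<Longrightarrow> norm x \<le> real k \<Longrightarrow> norm (w i s x - z i x) \<le> e" by metis
  have c0: "c i = 0" if "i < N0" for i using c n that by (simp add: tail_weights_def)
  have conv: "convex_fields (V s (\<mu> s))" unfolding \<mu>_def by (rule V_convex[OF s W_Pp[OF s]])
  have mem: "(\<lambda>x. \<Sum>i<N. c i *\<^sub>R z i x) \<in> V s (\<mu> s)"
  proof (rule convex_fields_sum[OF conv])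
    show "z i \<in> V s (\<mu> s)" if "c i \<noteq> 0" for i using that c0[of i] z(1)[of i] by (cases "i < N0") auto
    show "0 \<le> c i" for i using c by (simp add: tail_weights_def)
    show "(\<Sum>i<N. c i) = 1" using c by (simp add: tail_weights_def)
  qed
  have close: "norm ((\<Sum>i<N. c i *\<^sub>R w i s x) - (\<Sum>i<N. c i *\<^sub>R z i x)) \<le> e" if x: "norm x \<le> real k" for x
  proof -
    have "(\<Sum>i<N. c i *\<^sub>R w i s x) - (\<Sum>i<N. c i *\<^sub>R z i x) = (\<Sum>i<N. c i *\<^sub>R (w i s x - z i x))"
      by (simp add: sum_subtractf scaleR_diff_right)
    also have "norm \<dots> \<le> e"
      using tail_weights_mono[OF c n] by (rule norm_weighted_sum_le) (rule z(2)[OF _ x])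
    finally show ?thesis .
  qed
  show ?thesis
    by (rule bexI[OF _ mem], intro allI impI) (rule close)
qed

text \<open>The velocities inherit equicontinuity from nearby elements of the set at the limit law,
  up to an error that vanishes as n grows. Three errors of e/4 occur.\<close>

lemma w_asymptotically_equicontinuous:
  "AE s in S. \<forall>u y. u \<longlonglongrightarrow> y \<longrightarrow> (\<lambda>n. w n s (u n) - w n s y) \<longlonglongrightarrow> 0"
  using w_near_V V_equicontinuous
proof eventually_elim
  case (elim s)
  show ?case
  proof (intro allI impI LIMSEQ_I)
    fix u :: "nat \<Rightarrow> 'a" and y and e :: real assume u: "u \<longlonglongrightarrow> y" and e: "0 < e"
    have "Bseq u" using u by (intro convergent_imp_Bseq) (auto simp: convergent_def)
    then obtain R where R: "\<And>n. norm (u n) \<le> R" by (auto simp: Bseq_def)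
    obtain k :: nat where k: "max R (norm y) \<le> real k" using real_arch_simple by blast
    have uk: "norm (u n) \<le> real k" for n using R[of n] k by simp
    have yk: "norm y \<le> real k" using k by simp
    have e4: "0 < e / 4" using e by simp
    from elim(1)[rule_format, OF e4, of k] obtain N where
      N: "\<forall>n\<ge>N. \<exists>z\<in>V s (\<mu> s). \<forall>x. norm x \<le> real k \<longrightarrow> norm (w n s x - z x) \<le> e / 4" ..
    from elim(2)[rule_format, OF e4, of k] obtain d where
      d: "0 < d" "\<forall>z\<in>V s (\<mu> s). \<forall>x y. norm x \<le> real k \<longrightarrow> norm y \<le> real k \<longrightarrow> norm (x - y) < d \<longrightarrow> norm (z x - z y) \<le> e / 4"
      by blast
    obtain N' where N': "\<forall>n\<ge>N'. norm (u n - y) < d" using LIMSEQ_D[OF u d(1)] ..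
    have "norm (w n s (u n) - w n s y - 0) < e" if n: "max N N' \<le> n" for n
    proof -
      obtain z where z: "z \<in> V s (\<mu> s)" "\<forall>x. norm x \<le> real k \<longrightarrow> norm (w n s x - z x) \<le> e / 4"
        using N n by auto
      have "norm (w n s (u n) - z (u n)) \<le> e / 4" "norm (w n s y - z y) \<le> e / 4" "norm (z (u n) - z y) \<le> e / 4"
        using z d(2) uk yk N' n by auto
      moreover have "norm (w n s (u n) - w n s y) = norm ((w n s (u n) - z (u n)) + (z (u n) - z y) - (w n s y - z y))" by simp
      moreover have "norm ((w n s (u n) - z (u n)) + (z (u n) - z y) - (w n s y - z y))
        \<le> norm (w n s (u n) - z (u n)) + norm (z (u n) - z y) + norm (w n s y - z y)"
        using norm_triangle_ineq4[of "(w n s (u n) - z (u n)) + (z (u n) - z y)" "w n s y - z y"]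
          norm_triangle_ineq[of "w n s (u n) - z (u n)" "z (u n) - z y"] by linarith
      ultimately show ?thesis using e unfolding diff_zero by linarith
    qed
    then show "\<exists>no. \<forall>n\<ge>no. norm (w n s (u n) - w n s y - 0) < e" by blast
  qed
qed

section \<open>The weak formulation along the limit curve\<close>

text \<open>A class containing the velocities \<open>w n\<close>, their tail combinations and the
  limit velocity, all under one growth bound, so that one dominated convergence argument serves
  them.\<close>

definition admissible :: "(real \<Rightarrow> 'a \<Rightarrow> 'a) \<Rightarrow> bool" where
  "admissible b \<longleftrightarrow> (\<lambda>z. b (fst z) (snd z)) \<in> borel_measurable (S \<Otimes>\<^sub>M borel) \<and>
    (AE s in S. \<forall>y. norm (b s y) \<le> m s * (CC * (1 + norm y)))"

lemma w_admissible: "admissible (w n)"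
  unfolding admissible_def w_def
  by (intro conjI vn_measurable_pair) (use vn_bound in \<open>eventually_elim, blast\<close>)

lemma combination_admissible:
  assumes c: "tail_weights n N c"
  shows "admissible (\<lambda>s y. \<Sum>k<N. c k *\<^sub>R w k s y)"
  unfolding admissible_def
proof
  show "(\<lambda>z. \<Sum>k<N. c k *\<^sub>R w k (fst z) (snd z)) \<in> borel_measurable (S \<Otimes>\<^sub>M borel)"
    using w_admissible unfolding admissible_def by (intro borel_measurable_sum borel_measurable_scaleR borel_measurable_const) blast
  show "AE s in S. \<forall>y. norm (\<Sum>k<N. c k *\<^sub>R w k s y) \<le> m s * (CC * (1 + norm y))"
    using w_bound by eventually_elim (intro allI norm_weighted_sum_le[OF c], blast)
qed

lemma W_pair_measurable': "(\<lambda>z. (fst z, W (fst z) (snd z))) \<in> measurable (S \<Otimes>\<^sub>M \<Omega>) (S \<Otimes>\<^sub>M borel)"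
  by (intro measurable_Pair measurable_fst W_measurable_pair)

text \<open>The time integrand of the weak formulation along the limit curve. Every velocity is
  tested at the same positions \<open>W\<close>, which makes the expression compatible with convex
  combinations.\<close>

definition A :: "(real \<times> 'a \<Rightarrow> real \<times> 'a) \<Rightarrow> (real \<Rightarrow> 'a \<Rightarrow> 'a) \<Rightarrow> real \<Rightarrow> real" where
  "A G b s = (\<integral>\<omega>. G (s, W s \<omega>) \<bullet> (1, b s (W s \<omega>)) \<partial>\<Omega>)"

context
  fixes G :: "real \<times> 'a \<Rightarrow> real \<times> 'a" and B R :: real
  assumes contG: "continuous_on UNIV G" and GB: "\<And>z. norm (G z) \<le> B" and GR: "\<And>z. R < norm z \<Longrightarrow> G z = 0"
begin

text \<open>As \<open>G\<close> vanishes outside a ball, only positions of norm at most |R| count;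
  this majorant is integrable in time and independent of position and velocity. The absolute value
  is there because the sign of \<open>R\<close> is unknown.\<close>

definition \<beta> :: "real \<Rightarrow> real" where "\<beta> s = B * (1 + m s * (CC * (1 + \<bar>R\<bar>)))"

lemma \<beta>_int: "integrable S \<beta>"
  unfolding \<beta>_def[abs_def] by (rule bound_int)

lemma integrand_le:
  assumes "s \<in> {0..T}" "\<forall>y. norm (v y) \<le> m s * (CC * (1 + norm y))"
  shows "\<bar>G (s, y) \<bullet> (1, v y)\<bar> \<le> \<beta> s"
proof -
  have B0: "0 \<le> B" using order_trans[OF norm_ge_zero GB] .
  have m0: "0 \<le> m s" using m_nonneg[OF assms(1)] .
  show ?thesis
  proof (cases "R < norm (s, y)")
    case True
    then show ?thesis using GR[OF True] B0 m0 CC_ge_1 by (simp add: \<beta>_def)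
  next
    case False
    then have yR: "norm y \<le> \<bar>R\<bar>" using norm_snd_le[of y s] by simp
    have "\<bar>G (s, y) \<bullet> (1, v y)\<bar> \<le> norm (G (s, y)) * norm (1 :: real, v y)" by (rule Cauchy_Schwarz_ineq2)
    also have "\<dots> \<le> B * (1 + m s * (CC * (1 + \<bar>R\<bar>)))"
    proof (rule mult_mono[OF GB _ B0])
      have "norm (1 :: real, v y) \<le> 1 + norm (v y)" using norm_pair_le[of "1::real" "v y"] by simp
      also have "norm (v y) \<le> m s * (CC * (1 + norm y))" using assms(2) by blast
      also have "\<dots> \<le> m s * (CC * (1 + \<bar>R\<bar>))" using yR m0 CC_ge_1 by (intro mult_left_mono) auto
      finally show "norm (1 :: real, v y) \<le> 1 + m s * (CC * (1 + \<bar>R\<bar>))" by simp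
    qed simp
    finally show ?thesis by (simp add: \<beta>_def)
  qed
qed

lemma integrand_measurable_pair:
  assumes "admissible b"
  shows "(\<lambda>z. G (fst z, W (fst z) (snd z)) \<bullet> (1, b (fst z) (W (fst z) (snd z)))) \<in> borel_measurable (S \<Otimes>\<^sub>M \<Omega>)"
proof -
  have b: "(\<lambda>z. b (fst z) (W (fst z) (snd z))) \<in> borel_measurable (S \<Otimes>\<^sub>M \<Omega>)"
    using measurable_compose[OF W_pair_measurable', of "\<lambda>z. b (fst z) (snd z)" borel] assms
    by (simp add: admissible_def)
  have "G \<in> borel_measurable borel" using contG by (rule borel_measurable_continuous_onI)
  from measurable_compose[OF borel_measurable_Pair[OF ident_measurable_fst W_measurable_pair] this]
  show ?thesis by (intro borel_measurable_inner borel_measurable_Pair b) auto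
qed

lemma integrand_measurable:
  assumes "admissible b" "s \<in> {0..T}"
  shows "(\<lambda>\<omega>. G (s, W s \<omega>) \<bullet> (1, b s (W s \<omega>))) \<in> borel_measurable \<Omega>"
  using measurable_compose[OF measurable_Pair1'[of s S \<Omega>] integrand_measurable_pair[OF assms(1)]] assms(2) by simp

lemma A_measurable: "admissible b \<Longrightarrow> A G b \<in> borel_measurable S"
  unfolding A_def[abs_def] using integrand_measurable_pair
  by (intro O.borel_measurable_lebesgue_integral) (simp add: split_beta')

lemma integrand_int:
  assumes "admissible b" "s \<in> {0..T}" "\<forall>y. norm (b s y) \<le> m s * (CC * (1 + norm y))"
  shows "integrable \<Omega> (\<lambda>\<omega>. G (s, W s \<omega>) \<bullet> (1, b s (W s \<omega>)))"
  by (rule O.integrable_const_bound[where B = "\<beta> s"])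
     (use integrand_measurable[OF assms(1,2)] integrand_le[OF assms(2,3)] in auto)

lemma A_bound:
  assumes "admissible b"
  shows "AE s in S. \<bar>A G b s\<bar> \<le> \<beta> s"
proof -
  have "AE s in S. \<forall>y. norm (b s y) \<le> m s * (CC * (1 + norm y))" using assms by (simp add: admissible_def)
  then show ?thesis using AE_space
  proof eventually_elim
    case (elim s)
    then have s: "s \<in> {0..T}" by simp
    have "norm (A G b s) \<le> (\<integral>\<omega>. \<beta> s \<partial>\<Omega>)"
      unfolding A_def
      by (rule norm_integral_le[OF integrand_int[OF assms s elim(1)] O.integrable_const])
         (use integrand_le[OF s elim(1)] in auto)
    then show ?case using O.prob_space by simp
  qed
qed

lemma A_int:
  assumes "admissible b"
  shows "integrable S (A G b)"
proof (rule Bochner_Integration.integrable_bound[OF \<beta>_int A_measurable[OF assms]])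
  show "AE s in S. norm (A G b s) \<le> norm (\<beta> s)" using A_bound[OF assms] by eventually_elim simp
qed

lemma A_tendsto:
  assumes bn: "\<And>n. admissible (b n)" and b: "admissible b'"
    and lim: "AE s in S. \<forall>y. (\<lambda>n. b n s y) \<longlonglongrightarrow> b' s y"
  shows "(\<lambda>n. \<integral>s. A G (b n) s \<partial>S) \<longlonglongrightarrow> (\<integral>s. A G b' s \<partial>S)"
proof (rule integral_dominated_convergence[where w = \<beta>])
  have bnd: "AE s in S. \<forall>n y. norm (b n s y) \<le> m s * (CC * (1 + norm y))"
    unfolding AE_all_countable[of "\<lambda>n s. \<forall>y. norm (b n s y) \<le> m s * (CC * (1 + norm y))"]
    using bn by (simp add: admissible_def)
  show "AE s in S. (\<lambda>n. A G (b n) s) \<longlonglongrightarrow> A G b' s"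
    using bnd lim AE_space
  proof eventually_elim
    case (elim s)
    then have s: "s \<in> {0..T}" by simp
    show ?case
      unfolding A_def
    proof (rule integral_dominated_convergence[where w = "\<lambda>_. \<beta> s"])
      show "AE \<omega> in \<Omega>. (\<lambda>n. G (s, W s \<omega>) \<bullet> (1, b n s (W s \<omega>))) \<longlonglongrightarrow> G (s, W s \<omega>) \<bullet> (1, b' s (W s \<omega>))"
        using elim(2) by (intro AE_I2 tendsto_inner tendsto_Pair tendsto_const) blast
      show "AE \<omega> in \<Omega>. norm (G (s, W s \<omega>) \<bullet> (1, b n s (W s \<omega>))) \<le> \<beta> s" for n
        using integrand_le[OF s elim(1)[THEN spec[of _ n]]] by (intro AE_I2) simp
    qed (use integrand_measurable[OF b s] integrand_measurable[OF bn s] in auto)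
  qed
  show "AE s in S. norm (A G (b n) s) \<le> \<beta> s" for n using A_bound[OF bn, of n] by simp
qed (use A_measurable[OF b] A_measurable[OF bn] \<beta>_int in auto)

text \<open>Because of the entry 1 in (1, v), the functional is affine and not linear in the
  velocity; it respects these combinations because the weights sum to 1.\<close>

lemma A_combination:
  assumes c: "tail_weights n N c"
  shows "(\<integral>s. A G (\<lambda>s y. \<Sum>k<N. c k *\<^sub>R w k s y) s \<partial>S) = (\<Sum>k<N. c k *\<^sub>R (\<integral>s. A G (w k) s \<partial>S))"
proof -
  have c1: "(\<Sum>k<N. c k) = 1" using c by (simp add: tail_weights_def)
  note adm = combination_admissible[OF c]
  have "(\<integral>s. A G (\<lambda>s y. \<Sum>k<N. c k *\<^sub>R w k s y) s \<partial>S) = (\<integral>s. (\<Sum>k<N. c k *\<^sub>R A G (w k) s) \<partial>S)"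
  proof (rule integral_cong_AE)
    show "A G (\<lambda>s y. \<Sum>k<N. c k *\<^sub>R w k s y) \<in> borel_measurable S" by (rule A_measurable[OF adm])
    show "(\<lambda>s. \<Sum>k<N. c k *\<^sub>R A G (w k) s) \<in> borel_measurable S"
      by (intro borel_measurable_sum borel_measurable_scaleR borel_measurable_const A_measurable w_admissible)
    show "AE s in S. A G (\<lambda>s y. \<Sum>k<N. c k *\<^sub>R w k s y) s = (\<Sum>k<N. c k *\<^sub>R A G (w k) s)"
      using w_bound AE_space
    proof eventually_elim
      case (elim s)
      then have s: "s \<in> {0..T}" by simp
      have i: "integrable \<Omega> (\<lambda>\<omega>. c k *\<^sub>R (G (s, W s \<omega>) \<bullet> (1, w k s (W s \<omega>))))" for k
        by (intro integrable_scaleR_right integrand_int[OF w_admissible s]) (use elim(1) in blast)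
      have e: "G z \<bullet> (1, \<Sum>k<N. c k *\<^sub>R v k) = (\<Sum>k<N. c k *\<^sub>R (G z \<bullet> (1, v k)))" for z and v :: "nat \<Rightarrow> 'a"
      proof -
        have "(\<Sum>k<N. c k *\<^sub>R (G z \<bullet> (1, v k))) = (\<Sum>k<N. c k * fst (G z) + c k * (snd (G z) \<bullet> v k))"
          by (simp add: inner_prod_def algebra_simps)
        also have "\<dots> = (\<Sum>k<N. c k) * fst (G z) + (\<Sum>k<N. c k * (snd (G z) \<bullet> v k))"
          by (simp add: sum.distrib sum_distrib_right)
        also have "\<dots> = G z \<bullet> (1, \<Sum>k<N. c k *\<^sub>R v k)" by (simp add: c1 inner_prod_def inner_sum_right)
        finally show ?thesis by simp
      qed
      have "A G (\<lambda>s y. \<Sum>k<N. c k *\<^sub>R w k s y) s = (\<integral>\<omega>. (\<Sum>k<N. c k *\<^sub>R (G (s, W s \<omega>) \<bullet> (1, w k s (W s \<omega>)))) \<partial>\<Omega>)"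
        unfolding A_def e ..
      also have "\<dots> = (\<Sum>k<N. \<integral>\<omega>. c k *\<^sub>R (G (s, W s \<omega>) \<bullet> (1, w k s (W s \<omega>))) \<partial>\<Omega>)"
        by (rule Bochner_Integration.integral_sum) (rule i)
      also have "\<dots> = (\<Sum>k<N. c k *\<^sub>R A G (w k) s)" unfolding A_def by simp
      finally show ?case .
    qed
  qed
  also have "\<dots> = (\<Sum>k<N. \<integral>s. c k *\<^sub>R A G (w k) s \<partial>S)"
    by (rule Bochner_Integration.integral_sum) (intro integrable_scaleR_right A_int w_admissible)
  finally show ?thesis by simp
qed

text \<open>Moves the velocities from the positions of their own schemes to the common positions
  \<open>W\<close>. The positions converge almost surely and the velocities are asymptotically
  equicontinuous, so the difference vanishes although the velocities themselves need not
  converge.\<close>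

lemma A_w_tendsto:
  assumes lim: "(\<lambda>n. \<integral>s. (\<integral>y. G (s, y) \<bullet> (1, vn n s y) \<partial>law n (cell n s)) \<partial>S) \<longlonglongrightarrow> 0"
  shows "(\<lambda>n. \<integral>s. A G (w n) s \<partial>S) \<longlonglongrightarrow> 0"
proof -
  define L where "L n s = (\<integral>y. G (s, y) \<bullet> (1, w n s y) \<partial>law (r n) (cell (r n) s))" for n s
  have L_lim: "(\<lambda>n. \<integral>s. L n s \<partial>S) \<longlonglongrightarrow> 0"
    using LIMSEQ_subseq_LIMSEQ[OF lim r] by (simp add: o_def L_def w_def)
  have gm: "(\<lambda>y. G (s, y) \<bullet> (1, w n s y)) \<in> borel_measurable borel" if s: "s \<in> {0..T}" for n s
  proof (rule borel_measurable_continuous_onI)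
    show "continuous_on UNIV (\<lambda>y. G (s, y) \<bullet> (1, w n s y))"
      unfolding w_def by (intro continuous_intros continuous_on_compose2[OF contG] vn_cont[OF s]) auto
  qed
  have L_YY: "L n s = (\<integral>\<omega>. G (s, YY n s \<omega>) \<bullet> (1, w n s (YY n s \<omega>)) \<partial>\<Omega>)" if s: "s \<in> {0..T}" for n s
    unfolding L_def law_YY[OF s, symmetric] by (rule integral_distr[OF YY_measurable gm[OF s]])
  have Lm: "L n \<in> borel_measurable S" for n
  proof -
    define f where "f s x = G (s, X (r n) (cell (r n) s) x) \<bullet> (1, vn (r n) s (X (r n) (cell (r n) s) x))" for s x
    have sets: "sets (S \<Otimes>\<^sub>M \<mu>0) = sets (S \<Otimes>\<^sub>M borel)" by (intro sets_pair_measure_cong sets_\<mu>0 refl)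
    have "(\<lambda>z. f (fst z) (snd z)) \<in> borel_measurable (S \<Otimes>\<^sub>M \<mu>0)"
      using Euler_integrand_measurable_pair[OF contG, of "r n"] measurable_cong_sets[OF sets refl] unfolding f_def by blast
    then have fm: "(\<lambda>s. \<integral>x. f s x \<partial>\<mu>0) \<in> borel_measurable S"
      by (intro M0.borel_measurable_lebesgue_integral) (simp add: split_beta')
    have eq: "L n s = (\<integral>x. f s x \<partial>\<mu>0)" if "s \<in> space S" for s
    proof -
      have s: "s \<in> {0..T}" using that by simp
      show ?thesis
        unfolding L_def law_def f_def using integral_distr[OF X_measurable' gm[OF s, of n], of "r n" "cell (r n) s"]
        by (simp add: w_def)
    qed
    show ?thesis using measurable_cong[of S "L n" "\<lambda>s. \<integral>x. f s x \<partial>\<mu>0" borel, OF eq] fm by blast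
  qed
  have L_bound: "AE s in S. \<forall>n. \<bar>L n s\<bar> \<le> \<beta> s"
    using w_bound AE_space
  proof eventually_elim
    case (elim s)
    then have s: "s \<in> {0..T}" by simp
    show ?case
    proof
      fix n
      have le: "\<bar>G (s, y) \<bullet> (1, w n s y)\<bar> \<le> \<beta> s" for y
        by (rule integrand_le[OF s]) (use elim(1) in blast)
      have "norm (L n s) \<le> (\<integral>\<omega>. \<beta> s \<partial>\<Omega>)"
        unfolding L_YY[OF s]
      proof (rule norm_integral_le[OF _ O.integrable_const])
        show "integrable \<Omega> (\<lambda>\<omega>. G (s, YY n s \<omega>) \<bullet> (1, w n s (YY n s \<omega>)))"
          by (rule O.integrable_const_bound[where B = "\<beta> s"])
             (use measurable_compose[OF YY_measurable gm[OF s]] le in auto)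
      qed (use le in auto)
      then show "\<bar>L n s\<bar> \<le> \<beta> s" using O.prob_space by simp
    qed
  qed
  have Li: "integrable S (L n)" for n
    by (rule Bochner_Integration.integrable_bound[OF \<beta>_int Lm])
       (use L_bound in \<open>eventually_elim, auto intro: order_trans[OF _ abs_ge_self]\<close>)
  have "(\<lambda>n. \<integral>s. L n s - A G (w n) s \<partial>S) \<longlonglongrightarrow> (\<integral>s. 0 \<partial>S)"
  proof (rule integral_dominated_convergence[where w = "\<lambda>s. 2 * \<beta> s"])
    show "integrable S (\<lambda>s. 2 * \<beta> s)" by (intro integrable_mult_right \<beta>_int)
    show "(\<lambda>s. L n s - A G (w n) s) \<in> borel_measurable S" for n
      by (intro borel_measurable_diff Lm A_measurable w_admissible)
    show "AE s in S. norm (L n s - A G (w n) s) \<le> 2 * \<beta> s" for n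
      using L_bound A_bound[OF w_admissible, of n]
    proof eventually_elim
      case (elim s)
      show ?case using elim(1)[THEN spec[of _ n]] elim(2) unfolding real_norm_def by linarith
    qed
    show "AE s in S. (\<lambda>n. L n s - A G (w n) s) \<longlonglongrightarrow> 0"
      using w_bound w_asymptotically_equicontinuous AE_space
    proof eventually_elim
      case (elim s)
      then have s: "s \<in> {0..T}" by simp
      have le: "\<bar>G (s, y) \<bullet> (1, w n s y)\<bar> \<le> \<beta> s" for n y
        by (rule integrand_le[OF s]) (use elim(1) in blast)
      have i1: "integrable \<Omega> (\<lambda>\<omega>. G (s, YY n s \<omega>) \<bullet> (1, w n s (YY n s \<omega>)))" for n
        by (rule O.integrable_const_bound[where B = "\<beta> s"])
           (use measurable_compose[OF YY_measurable gm[OF s]] le in auto)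
      have i2: "integrable \<Omega> (\<lambda>\<omega>. G (s, W s \<omega>) \<bullet> (1, w n s (W s \<omega>)))" for n
        by (rule integrand_int[OF w_admissible s]) (use elim(1) in blast)
      have "(\<lambda>n. \<integral>\<omega>. G (s, YY n s \<omega>) \<bullet> (1, w n s (YY n s \<omega>)) - G (s, W s \<omega>) \<bullet> (1, w n s (W s \<omega>)) \<partial>\<Omega>) \<longlonglongrightarrow> (\<integral>\<omega>. 0 \<partial>\<Omega>)"
      proof (rule integral_dominated_convergence[where w = "\<lambda>_. 2 * \<beta> s"])
        show "AE \<omega> in \<Omega>. norm (G (s, YY n s \<omega>) \<bullet> (1, w n s (YY n s \<omega>)) - G (s, W s \<omega>) \<bullet> (1, w n s (W s \<omega>))) \<le> 2 * \<beta> s" for n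
        proof (rule AE_I2)
          fix \<omega>
          show "norm (G (s, YY n s \<omega>) \<bullet> (1, w n s (YY n s \<omega>)) - G (s, W s \<omega>) \<bullet> (1, w n s (W s \<omega>))) \<le> 2 * \<beta> s"
            using le[of "YY n s \<omega>" n] le[of "W s \<omega>" n] unfolding real_norm_def by linarith
        qed
        show "AE \<omega> in \<Omega>. (\<lambda>n. G (s, YY n s \<omega>) \<bullet> (1, w n s (YY n s \<omega>)) - G (s, W s \<omega>) \<bullet> (1, w n s (W s \<omega>))) \<longlonglongrightarrow> 0"
          using YY_tendsto[OF s]
        proof eventually_elim
          case YY: (elim \<omega>)
          define y where "y = W s \<omega>"
          define u where "u n = YY n s \<omega>" for n
          have u: "u \<longlonglongrightarrow> y" using YY by (simp add: u_def[abs_def] y_def)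
          have dw: "(\<lambda>n. w n s (u n) - w n s y) \<longlonglongrightarrow> 0" using elim(2) u by blast
          have GG: "(\<lambda>n. G (s, u n) - G (s, y)) \<longlonglongrightarrow> 0"
          proof -
            have "isCont G (s, y)" using contG by (simp add: continuous_on_eq_continuous_at)
            then have "(\<lambda>n. G (s, u n)) \<longlonglongrightarrow> G (s, y)"
              by (rule isCont_tendsto_compose) (intro tendsto_Pair tendsto_const u)
            from tendsto_diff[OF this tendsto_const[of "G (s, y)"]] show ?thesis by simp
          qed
          have "(\<lambda>n. norm (G (s, u n) - G (s, y)) * (1 + m s * (CC * (1 + norm y))) + B * norm (w n s (u n) - w n s y)) \<longlonglongrightarrow> 0 * (1 + m s * (CC * (1 + norm y))) + B * 0"
            by (intro tendsto_add tendsto_mult tendsto_const tendsto_norm_zero GG dw)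
          then have lim0: "(\<lambda>n. norm (G (s, u n) - G (s, y)) * (1 + m s * (CC * (1 + norm y))) + B * norm (w n s (u n) - w n s y)) \<longlonglongrightarrow> 0" by simp
          have "(\<lambda>n. G (s, u n) \<bullet> (1, w n s (u n)) - G (s, y) \<bullet> (1, w n s y)) \<longlonglongrightarrow> 0"
          proof (rule Lim_null_comparison[OF _ lim0], intro always_eventually allI)
            fix n
            \<comment> \<open>The change of \<open>G\<close> is weighted by a velocity at the fixed
              point \<open>y\<close>, which the growth condition bounds; the change of velocity is
              weighted by the bounded \<open>G\<close>.\<close>
            have eq: "G (s, u n) \<bullet> (1, w n s (u n)) - G (s, y) \<bullet> (1, w n s y)
              = (G (s, u n) - G (s, y)) \<bullet> (1, w n s y) + G (s, u n) \<bullet> (0, w n s (u n) - w n s y)"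
              by (simp add: inner_prod_def inner_diff_left inner_diff_right)
            have a: "\<bar>(G (s, u n) - G (s, y)) \<bullet> (1, w n s y)\<bar> \<le> norm (G (s, u n) - G (s, y)) * (1 + m s * (CC * (1 + norm y)))"
            proof -
              have "norm (1 :: real, w n s y) \<le> 1 + norm (w n s y)" using norm_pair_le[of "1::real" "w n s y"] by simp
              also have "\<dots> \<le> 1 + m s * (CC * (1 + norm y))" using elim(1) by simp
              finally have "norm (G (s, u n) - G (s, y)) * norm (1 :: real, w n s y) \<le> norm (G (s, u n) - G (s, y)) * (1 + m s * (CC * (1 + norm y)))"
                by (rule mult_left_mono) simp
              then show ?thesis using Cauchy_Schwarz_ineq2[of "G (s, u n) - G (s, y)" "(1, w n s y)"] by linarith
            qed
            have b: "\<bar>G (s, u n) \<bullet> (0, w n s (u n) - w n s y)\<bar> \<le> B * norm (w n s (u n) - w n s y)"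
            proof -
              have "norm (G (s, u n)) * norm (0 :: real, w n s (u n) - w n s y) \<le> B * norm (w n s (u n) - w n s y)"
                by (intro mult_mono GB) (auto simp: norm_Pair intro: order_trans[OF norm_ge_zero GB])
              then show ?thesis using Cauchy_Schwarz_ineq2[of "G (s, u n)" "(0, w n s (u n) - w n s y)"] by linarith
            qed
            show "norm (G (s, u n) \<bullet> (1, w n s (u n)) - G (s, y) \<bullet> (1, w n s y))
              \<le> norm (G (s, u n) - G (s, y)) * (1 + m s * (CC * (1 + norm y))) + B * norm (w n s (u n) - w n s y)"
              unfolding eq real_norm_def using a b abs_triangle_ineq[of "(G (s, u n) - G (s, y)) \<bullet> (1, w n s y)" "G (s, u n) \<bullet> (0, w n s (u n) - w n s y)"] by linarith
          qed
          then show ?case by (simp add: u_def y_def)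
        qed
      qed (auto intro!: borel_measurable_integrable Bochner_Integration.integrable_diff i1 i2)
      then show ?case
        unfolding L_YY[OF s] A_def Bochner_Integration.integral_diff[OF i1 i2] by simp
    qed
  qed simp
  then have d: "(\<lambda>n. (\<integral>s. L n s \<partial>S) - (\<integral>s. A G (w n) s \<partial>S)) \<longlonglongrightarrow> 0"
    by (simp add: Bochner_Integration.integral_diff[OF Li A_int[OF w_admissible]])
  from tendsto_diff[OF L_lim d] show ?thesis by simp
qed

end

section \<open>Limits of velocity combinations\<close>

text \<open>The geometric law gives every index positive mass, so almost everywhere convergence on
  time times index yields convergence at every \<open>y j\<close> with a single sequence of weights.
  Dividing by \<open>1 + a s j\<close> makes the functions bounded; this factor does not depend on
  \<open>n\<close> and is restored after the limit.\<close>

lemma combinations_converge_on_dense: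
  fixes y :: "nat \<Rightarrow> 'a"
  shows "\<exists>c N. (\<forall>n. tail_weights n (N n) (c n)) \<and>
    (AE s in S. \<forall>j. convergent (\<lambda>n. \<Sum>k<N n. c n k *\<^sub>R w k s (y j)))"
proof -
  define P where "P = measure_pmf (geometric_pmf (1/2))"
  have Pp: "prob_space P" unfolding P_def by (rule measure_pmf.prob_space_axioms)
  interpret P: prob_space P by (rule Pp)
  interpret SP: pair_sigma_finite S P ..
  define a where "a s j = \<bar>m s\<bar> * (CC * (1 + norm (y j)))" for s j
  have a0: "0 \<le> a s j" for s j using CC_ge_1 by (simp add: a_def)
  \<comment> \<open>The case distinction replaces the velocity by 0 at the exceptional times where
    the growth bound fails, so the bound 1 holds everywhere.\<close>
  define h where "h n j s = (if norm (w n s (y j)) \<le> a s j then (1 / (1 + a s j)) *\<^sub>R w n s (y j) else 0)" for n j s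
  define f where "f n z = h n (snd z) (fst z)" for n and z :: "real \<times> nat"
  have hm: "h n j \<in> borel_measurable S" for n j
  proof -
    have [measurable]: "(\<lambda>s. w n s (y j)) \<in> borel_measurable S" unfolding w_def by (rule vn_measurable)
    have [measurable]: "(\<lambda>s. a s j) \<in> borel_measurable S" unfolding a_def by measurable
    show ?thesis unfolding h_def[abs_def] by measurable
  qed
  have fm: "f n \<in> borel_measurable (S \<Otimes>\<^sub>M P)" for n
    unfolding f_def[abs_def]
  proof (rule measurable_compose_countable[where f = "\<lambda>j z. h n j (fst z)"])
    show "(\<lambda>z. h n j (fst z)) \<in> borel_measurable (S \<Otimes>\<^sub>M P)" for j
      by (rule measurable_compose[OF measurable_fst hm])
    show "(\<lambda>z. snd z) \<in> S \<Otimes>\<^sub>M P \<rightarrow>\<^sub>M count_space UNIV"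
    proof -
      have "sets P = sets (count_space UNIV)" by (simp add: P_def)
      from measurable_cong_sets[OF refl this] show ?thesis using measurable_snd[of S P] by blast
    qed
  qed
  have fb: "norm (f n z) \<le> 1" for n z
  proof -
    have "norm (h n j s) \<le> 1" for j s
    proof (cases "norm (w n s (y j)) \<le> a s j")
      case True
      then have "norm (w n s (y j)) \<le> 1 + a s j" by simp
      then show ?thesis using True a0[of s j] by (simp add: h_def divide_le_eq_1)
    qed (simp add: h_def)
    then show ?thesis by (simp add: f_def)
  qed
  have fin: "finite_measure (S \<Otimes>\<^sub>M P)" by (rule finite_measure_pair_measure[OF P.finite_measure finite_measure_S])
  show ?thesis
  proof (rule tail_combinations_converge_AE[OF fin fm fb])
    fix c :: "nat \<Rightarrow> nat \<Rightarrow> real" and N :: "nat \<Rightarrow> nat"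
    assume c: "\<And>n. tail_weights n (N n) (c n)"
      and conv: "AE z in S \<Otimes>\<^sub>M P. convergent (\<lambda>n. \<Sum>k<N n. c n k *\<^sub>R f k z)"
    have "AE s in S. AE j in P. convergent (\<lambda>n. \<Sum>k<N n. c n k *\<^sub>R f k (s, j))"
      using SP.AE_pair[OF conv] by simp
    then have "AE s in S. \<forall>j. convergent (\<lambda>n. \<Sum>k<N n. c n k *\<^sub>R w k s (y j))"
      using w_bound AE_space
    proof eventually_elim
      case (elim s)
      then have s: "s \<in> {0..T}" by simp
      show ?case
      proof
        fix j
        have "j \<in> set_pmf (geometric_pmf (1/2))" by (simp add: set_pmf_geometric)
        then have "convergent (\<lambda>n. \<Sum>k<N n. c n k *\<^sub>R f k (s, j))"
          using elim(1) unfolding P_def AE_measure_pmf_iff by blast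
        then obtain L where L: "(\<lambda>n. \<Sum>k<N n. c n k *\<^sub>R f k (s, j)) \<longlonglongrightarrow> L" by (auto simp: convergent_def)
        have fw: "f k (s, j) = (1 / (1 + a s j)) *\<^sub>R w k s (y j)" for k
        proof -
          have "norm (w k s (y j)) \<le> a s j"
            using elim(2)[rule_format, of k "y j"] m_nonneg[OF s] by (simp add: a_def)
          then show ?thesis by (simp add: f_def h_def)
        qed
        have eq: "(\<Sum>k<N n. c n k *\<^sub>R w k s (y j)) = (1 + a s j) *\<^sub>R (\<Sum>k<N n. c n k *\<^sub>R f k (s, j))" for n
          unfolding fw scaleR_sum_right using a0[of s j] by (intro sum.cong refl) simp
        have "(\<lambda>n. \<Sum>k<N n. c n k *\<^sub>R w k s (y j)) \<longlonglongrightarrow> (1 + a s j) *\<^sub>R L"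
          unfolding eq by (intro tendsto_scaleR tendsto_const L)
        then show "convergent (\<lambda>n. \<Sum>k<N n. c n k *\<^sub>R w k s (y j))" by (auto simp: convergent_def)
      qed
    qed
    then show ?thesis using c by (intro exI[of _ c] exI[of _ N] conjI allI)
  qed
qed

text \<open>An Ascoli-type argument: convergence on a dense set and asymptotic equicontinuity give
  uniform Cauchy sequences on balls. The limit is approached by elements of the set, which is
  closed.\<close>

lemma combination_limit_in_V:
  fixes y :: "nat \<Rightarrow> 'a"
  assumes s: "s \<in> {0..T}" and y: "\<And>X. open X \<Longrightarrow> X \<noteq> {} \<Longrightarrow> \<exists>i. y i \<in> X"
    and c: "\<And>n. tail_weights n (N n) (c n)"
    and dense: "\<And>j. convergent (\<lambda>n. \<Sum>k<N n. c n k *\<^sub>R w k s (y j))"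
    and near: "\<forall>k. \<forall>e>0. \<exists>N. \<forall>n\<ge>N. \<exists>z\<in>V s (\<mu> s). \<forall>x. norm x \<le> real k \<longrightarrow> norm (w n s x - z x) \<le> e"
    and equic: "\<forall>k :: nat. \<forall>e>0. \<exists>d>0. \<forall>z\<in>V s (\<mu> s). \<forall>x y.
      norm x \<le> real k \<longrightarrow> norm y \<le> real k \<longrightarrow> norm (x - y) < d \<longrightarrow> norm (z x - z y) \<le> e"
  shows "\<exists>v\<in>V s (\<mu> s). \<forall>x. (\<lambda>n. \<Sum>k<N n. c n k *\<^sub>R w k s x) \<longlonglongrightarrow> v x"
proof -
  define u where "u n x = (\<Sum>k<N n. c n k *\<^sub>R w k s x)" for n x
  have \<mu>s: "\<mu> s \<in> Pp p" unfolding \<mu>_def by (rule W_Pp[OF s])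
  have near_u: "\<exists>N0. \<forall>n\<ge>N0. \<exists>z\<in>V s (\<mu> s). \<forall>x. norm x \<le> real k \<longrightarrow> norm (u n x - z x) \<le> e" if e: "0 < e" for k e
  proof -
    from near[rule_format, OF e, of k] obtain N0 where
      N0: "\<forall>n\<ge>N0. \<exists>z\<in>V s (\<mu> s). \<forall>x. norm x \<le> real k \<longrightarrow> norm (w n s x - z x) \<le> e" ..
    show ?thesis
      unfolding u_def by (intro exI[of _ N0] allI impI w_combination_near_V[OF s N0 c])
  qed
  have Cauchy: "uniformly_Cauchy_on (cball 0 (real k)) u" for k
    unfolding uniformly_Cauchy_on_def
  proof (intro allI impI)
    fix e :: real assume e: "0 < e"
    \<comment> \<open>Budget: each oscillation costs 3e/8 and is used twice, the values at
      \<open>y j\<close> differ by less than e/8; the total stays below 7e/8.\<close>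
    then have e8: "0 < e / 8" by simp
    \<comment> \<open>The radius is enlarged by 1 because the dense points close to the ball of
      radius \<open>k\<close> may lie slightly outside it; \<delta> <= 1 keeps them in the larger
      ball.\<close>
    from near_u[OF e8, of "Suc k"] obtain N0 where
      N0: "\<forall>n\<ge>N0. \<exists>z\<in>V s (\<mu> s). \<forall>x. norm x \<le> real (Suc k) \<longrightarrow> norm (u n x - z x) \<le> e / 8" ..
    from equic[rule_format, OF e8, of "Suc k"] obtain d where d0: "0 < d" and
      d: "\<forall>z\<in>V s (\<mu> s). \<forall>x y. norm x \<le> real (Suc k) \<longrightarrow> norm y \<le> real (Suc k) \<longrightarrow> norm (x - y) < d \<longrightarrow> norm (z x - z y) \<le> e / 8"
      by blast
    have osc: "norm (u n x - u n x') \<le> 3 * (e / 8)"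
      if n: "N0 \<le> n" and x: "norm x \<le> real (Suc k)" and x': "norm x' \<le> real (Suc k)" and xx: "norm (x - x') < d" for n x x'
    proof -
      from N0[rule_format, OF n] obtain z where z: "z \<in> V s (\<mu> s)" "\<forall>x. norm x \<le> real (Suc k) \<longrightarrow> norm (u n x - z x) \<le> e / 8" ..
      have b: "norm (u n x - z x) \<le> e / 8" "norm (u n x' - z x') \<le> e / 8" using z(2) x x' by blast+
      have b3: "norm (z x - z x') \<le> e / 8" using d[rule_format, OF z(1) x x' xx] .
      have "norm (u n x - u n x') = norm ((u n x - z x) + (z x - z x') - (u n x' - z x'))" by simp
      also have "\<dots> \<le> norm (u n x - z x) + norm (z x - z x') + norm (u n x' - z x')"
        using norm_triangle_ineq4[of "(u n x - z x) + (z x - z x')" "u n x' - z x'"]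
          norm_triangle_ineq[of "u n x - z x" "z x - z x'"] by linarith
      finally show ?thesis using b b3 by linarith
    qed
    define \<delta> where "\<delta> = min d 1"
    have \<delta>: "0 < \<delta>" "\<delta> \<le> d" "\<delta> \<le> 1" using d0 by (auto simp: \<delta>_def)
    have "cball 0 (real k) \<subseteq> (\<Union>j. ball (y j) \<delta>)"
    proof
      fix x :: 'a
      obtain j where "y j \<in> ball x \<delta>" using y[of "ball x \<delta>"] \<delta>(1) by auto
      then show "x \<in> (\<Union>j. ball (y j) \<delta>)" by (auto simp: dist_commute)
    qed
    then obtain J where J: "finite J" "cball 0 (real k) \<subseteq> (\<Union>j\<in>J. ball (y j) \<delta>)"
      using compactE_image[of "cball 0 (real k)" UNIV "\<lambda>j. ball (y j) \<delta>"] by auto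
    have "\<exists>M. \<forall>n\<ge>M. \<forall>n'\<ge>M. dist (u n (y j)) (u n' (y j)) < e / 8" for j
      using metric_CauchyD[OF convergent_Cauchy[OF dense[of j]] e8] unfolding u_def by blast
    then obtain M where M: "\<And>j. \<forall>n\<ge>M j. \<forall>n'\<ge>M j. dist (u n (y j)) (u n' (y j)) < e / 8" by metis
    define N1 where "N1 = max N0 (Max (insert 0 (M ` J)))"
    have N1: "N0 \<le> N1" "M j \<le> N1" if "j \<in> J" for j
      using that J(1) by (auto simp: N1_def intro: max.coboundedI2 Max_ge)
    show "\<exists>M. \<forall>x\<in>cball 0 (real k). \<forall>m\<ge>M. \<forall>n\<ge>M. dist (u m x) (u n x) < e"
    proof (intro exI[of _ N1] ballI allI impI)
      fix x n n' assume x: "x \<in> cball (0 :: 'a) (real k)" and n: "N1 \<le> n" and n': "N1 \<le> n'"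
      obtain j where j: "j \<in> J" "x \<in> ball (y j) \<delta>" using J(2) x by blast
      have xy: "norm (x - y j) < d" using j(2) \<delta>(2) by (simp add: dist_norm norm_minus_commute)
      have xk: "norm x \<le> real (Suc k)" using x by simp
      have yk: "norm (y j) \<le> real (Suc k)"
      proof -
        have "norm (y j) \<le> norm x + norm (y j - x)" using norm_triangle_ineq[of x "y j - x"] by simp
        then show ?thesis using j(2) \<delta>(3) x by (simp add: dist_norm)
      qed
      have 1: "norm (u n x - u n (y j)) \<le> 3 * (e / 8)" "norm (u n' x - u n' (y j)) \<le> 3 * (e / 8)"
        using osc[OF _ xk yk xy] N1(1)[OF j(1)] n n' by auto
      have 2: "norm (u n (y j) - u n' (y j)) < e / 8"
        using M[of j] N1(2)[OF j(1)] n n' by (simp add: dist_norm)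
      have "dist (u n x) (u n' x) = norm ((u n x - u n (y j)) + (u n (y j) - u n' (y j)) - (u n' x - u n' (y j)))"
        by (simp add: dist_norm)
      also have "\<dots> \<le> norm (u n x - u n (y j)) + norm (u n (y j) - u n' (y j)) + norm (u n' x - u n' (y j))"
        using norm_triangle_ineq4[of "(u n x - u n (y j)) + (u n (y j) - u n' (y j))" "u n' x - u n' (y j)"]
          norm_triangle_ineq[of "u n x - u n (y j)" "u n (y j) - u n' (y j)"] by linarith
      finally show "dist (u n x) (u n' x) < e" using 1 2 e by linarith
    qed
  qed
  define v where "v x = lim (\<lambda>n. u n x)" for x
  have unif: "uniform_limit (cball 0 (real k)) u v sequentially" for k
    using Cauchy_uniformly_convergent[OF Cauchy[of k]] unfolding v_def[abs_def] uniformly_convergent_uniform_limit_iff .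
  have uC: "u n \<in> C0" for n
    unfolding C0_def mem_Collect_eq u_def[abs_def] w_def
    by (intro continuous_on_sum continuous_on_scaleR continuous_on_const vn_cont[OF s])
  have vC: "v \<in> C0" by (rule C0_uniform_limit[OF uC unif])
  have lim: "(\<lambda>n. u n x) \<longlonglongrightarrow> v x" for x
  proof -
    obtain k :: nat where "norm x \<le> real k" using real_arch_simple by blast
    then have "x \<in> cball 0 (real k)" by simp
    from tendsto_uniform_limitI[OF unif this] show ?thesis .
  qed
  interpret C: Metric_space "C0 :: ('a \<Rightarrow> 'a) set" dcc by (rule Metric_space_C0_dcc)
  have Vcl: "closedin C0_topology (V s (\<mu> s))" by (rule V_closed[OF s \<mu>s])
  have "v \<in> V s (\<mu> s)"
  proof (rule ccontr)
    assume "v \<notin> V s (\<mu> s)"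
    then have "v \<in> C0 - V s (\<mu> s)" using vC by simp
    moreover have "openin C0_topology (C0 - V s (\<mu> s))" using Vcl by (simp add: closedin_def C.topspace_mtopology)
    ultimately obtain \<rho> where \<rho>: "0 < \<rho>" "C.mball v \<rho> \<subseteq> C0 - V s (\<mu> s)" by (auto simp: C.openin_mtopology)
    obtain k where k: "(1/2) ^ k < \<rho> / 2" using ex_half_power_less[of "\<rho>/2"] \<rho> by auto
    have \<rho>8: "0 < \<rho> / 8" using \<rho> by simp
    from near_u[OF \<rho>8, of k] obtain N0 where
      N0: "\<forall>n\<ge>N0. \<exists>z\<in>V s (\<mu> s). \<forall>x. norm x \<le> real k \<longrightarrow> norm (u n x - z x) \<le> \<rho> / 8" ..
    from uniform_limitD[OF unif[of k] \<rho>8] obtain N1 where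
      N1: "\<forall>n\<ge>N1. \<forall>x\<in>cball 0 (real k). dist (u n x) (v x) < \<rho> / 8" unfolding eventually_sequentially ..
    define n where "n = max N0 N1"
    have "N0 \<le> n" "N1 \<le> n" by (auto simp: n_def)
    from N0[rule_format, OF this(1)] obtain z where z: "z \<in> V s (\<mu> s)" "\<forall>x. norm x \<le> real k \<longrightarrow> norm (u n x - z x) \<le> \<rho> / 8" ..
    have "norm (v x - z x) \<le> \<rho> / 4" if x: "norm x \<le> real k" for x
    proof -
      have "norm (u n x - v x) < \<rho> / 8" using N1[rule_format, OF \<open>N1 \<le> n\<close>, of x] x by (simp add: dist_norm)
      moreover have "norm (u n x - z x) \<le> \<rho> / 8" using z(2) x by blast
      moreover have "norm (v x - z x) \<le> norm (u n x - z x) + norm (u n x - v x)"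
        using norm_triangle_ineq4[of "u n x - z x" "u n x - v x"] by simp
      ultimately show ?thesis by linarith
    qed
    then have "dcc v z \<le> \<rho> / 4 + (1/2) ^ k" using \<rho> by (intro dcc_le) auto
    also have "\<dots> < \<rho>" using k \<rho>(1) by linarith
    finally have "dcc v z < \<rho>" .
    moreover have "z \<in> C0" using closedin_subset[OF Vcl] z(1) by (auto simp: C.topspace_mtopology)
    ultimately have "z \<in> C.mball v \<rho>" using vC by (simp add: C.mball_def)
    then show False using \<rho>(2) z(1) by auto
  qed
  then show ?thesis using lim unfolding u_def by (intro bexI[of _ v] allI)
qed

theorem limit_velocity:
  "\<exists>c N v. (\<forall>n. tail_weights n (N n) (c n)) \<and> (\<forall>s\<in>{0..T}. v s \<in> C0) \<and>
    (\<forall>x. (\<lambda>s. v s x) \<in> borel_measurable S) \<and> (AE s in S. v s \<in> V s (\<mu> s)) \<and>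
    (AE s in S. \<forall>x. (\<lambda>n. \<Sum>k<N n. c n k *\<^sub>R w k s x) \<longlonglongrightarrow> v s x)"
proof -
  obtain y :: "nat \<Rightarrow> 'a" where y: "\<And>X. open X \<Longrightarrow> X \<noteq> {} \<Longrightarrow> \<exists>i. y i \<in> X"
    using ex_dense_sequence by blast
  obtain c N where c: "\<forall>n. tail_weights n (N n) (c n)"
    and conv: "AE s in S. \<forall>j. convergent (\<lambda>n. \<Sum>k<N n. c n k *\<^sub>R w k s (y j))"
    using combinations_converge_on_dense[of y] by blast
  define good where "good s \<longleftrightarrow> (\<exists>v\<in>V s (\<mu> s). \<forall>x. (\<lambda>n. \<Sum>k<N n. c n k *\<^sub>R w k s x) \<longlonglongrightarrow> v x)" for s
  have "AE s in S. good s"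
    using conv w_near_V V_equicontinuous AE_space
  proof eventually_elim
    case (elim s)
    show ?case unfolding good_def
    proof (rule combination_limit_in_V[OF _ y])
      show "s \<in> {0..T}" using elim(4) by simp
      show "tail_weights n (N n) (c n)" for n using c by blast
      show "convergent (\<lambda>n. \<Sum>k<N n. c n k *\<^sub>R w k s (y j))" for j using elim(1) by blast
    qed (use elim(2,3) in auto)
  qed
  then obtain Z where Z: "Z \<in> null_sets S" "{s\<in>space S. \<not> good s} \<subseteq> Z"
    unfolding eventually_ae_filter by blast
  \<comment> \<open>The value 0 on the null set makes every \<open>v s\<close> continuous, not just
    almost every one: measurability into the space of fields is a statement about all times.\<close>
  define v where "v s = (\<lambda>x. if s \<in> Z then 0 else lim (\<lambda>n. \<Sum>k<N n. c n k *\<^sub>R w k s x))" for s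
  have vV: "v s \<in> V s (\<mu> s) \<and> (\<forall>x. (\<lambda>n. \<Sum>k<N n. c n k *\<^sub>R w k s x) \<longlonglongrightarrow> v s x)" if s: "s \<in> space S" "s \<notin> Z" for s
  proof -
    have "good s" using Z(2) s by blast
    then obtain v' where v': "v' \<in> V s (\<mu> s)" "\<And>x. (\<lambda>n. \<Sum>k<N n. c n k *\<^sub>R w k s x) \<longlonglongrightarrow> v' x"
      unfolding good_def by blast
    have "v s = v'" using s(2) limI[OF v'(2)] by (simp add: v_def fun_eq_iff)
    then show ?thesis using v' by simp
  qed
  have vC0: "v s \<in> C0" if s: "s \<in> {0..T}" for s
  proof (cases "s \<in> Z")
    case True
    then show ?thesis by (simp add: v_def C0_def)
  next
    case False
    have "\<mu> s \<in> Pp p" unfolding \<mu>_def by (rule W_Pp[OF s])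
    then show ?thesis using V_C0[OF s] vV[of s] s False by (simp add: C0_def)
  qed
  have vm: "(\<lambda>s. v s x) \<in> borel_measurable S" for x
    unfolding v_def
  proof (rule measurable_If_set)
    show "Z \<inter> space S \<in> sets S" using Z(1) by auto
    show "(\<lambda>s. lim (\<lambda>n. \<Sum>k<N n. c n k *\<^sub>R w k s x)) \<in> borel_measurable S"
      unfolding w_def
      by (intro borel_measurable_lim_metric borel_measurable_sum borel_measurable_scaleR borel_measurable_const vn_measurable)
  qed simp
  have ae: "AE s in S. v s \<in> V s (\<mu> s) \<and> (\<forall>x. (\<lambda>n. \<Sum>k<N n. c n k *\<^sub>R w k s x) \<longlonglongrightarrow> v s x)"
    using AE_not_in[OF Z(1)] AE_space by eventually_elim (rule vV)
  show ?thesis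
  proof (intro exI[of _ c] exI[of _ N] exI[of _ v] conjI c allI vm ballI vC0)
    show "AE s in S. v s \<in> V s (\<mu> s)" using ae by eventually_elim blast
    show "AE s in S. \<forall>x. (\<lambda>n. \<Sum>k<N n. c n k *\<^sub>R w k s x) \<longlonglongrightarrow> v s x" using ae by eventually_elim blast
  qed
qed

section \<open>The weak equation for the limit\<close>

text \<open>The combined weak integrals have two limits: 0, inherited from the schemes, and the weak
  integral of the limit velocity, by dominated convergence. Their equality is the continuity
  equation.\<close>

theorem curve_solves: "solves_continuity_inclusion T V \<mu>"
proof -
  obtain c N v where c: "\<forall>n. tail_weights n (N n) (c n)" and vC0: "\<forall>s\<in>{0..T}. v s \<in> C0"
    and vm: "\<forall>x. (\<lambda>s. v s x) \<in> borel_measurable S" and vV: "AE s in S. v s \<in> V s (\<mu> s)"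
    and lim: "AE s in S. \<forall>x. (\<lambda>n. \<Sum>k<N n. c n k *\<^sub>R w k s x) \<longlonglongrightarrow> v s x"
    using limit_velocity by blast
  have vcont: "continuous_on UNIV (v s)" if "s \<in> {0..T}" for s using vC0 that by (simp add: C0_def)
  have v_adm: "admissible v"
    unfolding admissible_def
  proof
    show "(\<lambda>z. v (fst z) (snd z)) \<in> borel_measurable (S \<Otimes>\<^sub>M borel)"
      by (rule Caratheodory_borel_measurable_pair) (use vm vcont in auto)
    show "AE s in S. \<forall>y. norm (v s y) \<le> m s * (CC * (1 + norm y))"
      using lim w_bound
    proof eventually_elim
      case (elim s)
      show ?case
      proof
        fix y
        have lim_y: "(\<lambda>n. norm (\<Sum>k<N n. c n k *\<^sub>R w k s y)) \<longlonglongrightarrow> norm (v s y)"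
          using elim(1) by (intro tendsto_norm) blast
        have "norm (\<Sum>k<N n. c n k *\<^sub>R w k s y) \<le> m s * (CC * (1 + norm y))" for n
          by (rule norm_weighted_sum_le[OF c[rule_format]]) (use elim(2) in blast)
        then show "norm (v s y) \<le> m s * (CC * (1 + norm y))"
          by (intro LIMSEQ_le_const2[OF lim_y]) blast
      qed
    qed
  qed
  have "solves_continuity_eq T v \<mu>"
    unfolding solves_continuity_eq_def
  proof
    fix \<phi> :: "real \<times> 'a \<Rightarrow> real" assume "\<phi> \<in> test_functions T"
    then show "has_bochner_integral S (\<lambda>t. \<integral>x. deriv (\<lambda>s. \<phi> (s, x)) t + gradient (\<lambda>y. \<phi> (t, y)) x \<bullet> v t x \<partial>\<mu> t) 0"
    proof (rule test_function_gradient)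
      fix G :: "real \<times> 'a \<Rightarrow> real \<times> 'a" and B R :: real
      assume der: "\<And>z. (\<phi> has_derivative (\<lambda>h. G z \<bullet> h)) (at z)" and contG: "continuous_on UNIV G"
        and ucG: "uniformly_continuous_on UNIV G" and GB: "\<And>z. norm (G z) \<le> B" and GR: "\<And>z. R < norm z \<Longrightarrow> G z = 0"
        and Gt: "\<And>t x. deriv (\<lambda>s. \<phi> (s, x)) t = fst (G (t, x))"
        and Gx: "\<And>t x. gradient (\<lambda>y. \<phi> (t, y)) x = snd (G (t, x))"
        and \<phi>0: "\<And>t x. t \<le> 0 \<or> T \<le> t \<Longrightarrow> \<phi> (t, x) = 0"
      have Aw: "(\<lambda>n. \<integral>s. A G (w n) s \<partial>S) \<longlonglongrightarrow> 0"
        by (rule A_w_tendsto[OF contG GB GR Euler_weak_limit[OF der \<phi>0 contG ucG GB]])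
      \<comment> \<open>Tail weights preserve a limit of the sequence they average.\<close>
      have comb0: "(\<lambda>n. \<Sum>k<N n. c n k *\<^sub>R (\<integral>s. A G (w k) s \<partial>S)) \<longlonglongrightarrow> 0"
      proof (rule LIMSEQ_I)
        fix e :: real assume e: "0 < e"
        then have "0 < e / 2" by simp
        from LIMSEQ_D[OF Aw this] obtain M where M: "\<forall>n\<ge>M. norm ((\<integral>s. A G (w n) s \<partial>S) - 0) < e / 2" ..
        have "norm ((\<Sum>k<N n. c n k *\<^sub>R (\<integral>s. A G (w k) s \<partial>S)) - 0) < e" if n: "M \<le> n" for n
        proof -
          have "norm (\<Sum>k<N n. c n k *\<^sub>R (\<integral>s. A G (w k) s \<partial>S)) \<le> e / 2"
          proof (rule norm_weighted_sum_le[OF c[rule_format]])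
            show "norm (\<integral>s. A G (w k) s \<partial>S) \<le> e / 2" if "n \<le> k" for k
              using M[rule_format, of k] n that by simp
          qed
          then show ?thesis using e by simp
        qed
        then show "\<exists>M. \<forall>n\<ge>M. norm ((\<Sum>k<N n. c n k *\<^sub>R (\<integral>s. A G (w k) s \<partial>S)) - 0) < e" by blast
      qed
      have "(\<lambda>n. \<integral>s. A G (\<lambda>s y. \<Sum>k<N n. c n k *\<^sub>R w k s y) s \<partial>S) \<longlonglongrightarrow> (\<integral>s. A G v s \<partial>S)"
        by (rule A_tendsto[OF contG GB GR combination_admissible[OF c[rule_format]] v_adm lim])
      moreover have "(\<integral>s. A G (\<lambda>s y. \<Sum>k<N n. c n k *\<^sub>R w k s y) s \<partial>S) = (\<Sum>k<N n. c n k *\<^sub>R (\<integral>s. A G (w k) s \<partial>S))" for n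
        by (rule A_combination[OF contG GB GR c[rule_format]])
      ultimately have "(\<lambda>n. \<Sum>k<N n. c n k *\<^sub>R (\<integral>s. A G (w k) s \<partial>S)) \<longlonglongrightarrow> (\<integral>s. A G v s \<partial>S)" by simp
      then have A0: "(\<integral>s. A G v s \<partial>S) = 0" using comb0 by (rule LIMSEQ_unique)
      have "has_bochner_integral S (A G v) 0"
        using A_int[OF contG GB GR v_adm] A0 by (simp add: has_bochner_integral_iff)
      moreover have "(\<integral>x. deriv (\<lambda>s. \<phi> (s, x)) t + gradient (\<lambda>y. \<phi> (t, y)) x \<bullet> v t x \<partial>\<mu> t) = A G v t" if "t \<in> space S" for t
      proof -
        have t: "t \<in> {0..T}" using that by simp
        have "continuous_on UNIV (\<lambda>y. G (t, y) \<bullet> (1, v t y))"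
          by (intro continuous_intros continuous_on_compose2[OF contG] vcont[OF t]) auto
        then have gm: "(\<lambda>y. G (t, y) \<bullet> (1, v t y)) \<in> borel_measurable borel" by (rule borel_measurable_continuous_onI)
        have "(\<integral>x. deriv (\<lambda>s. \<phi> (s, x)) t + gradient (\<lambda>y. \<phi> (t, y)) x \<bullet> v t x \<partial>\<mu> t) = (\<integral>x. G (t, x) \<bullet> (1, v t x) \<partial>\<mu> t)"
          unfolding Gt Gx by (simp add: inner_prod_def)
        also have "\<dots> = A G v t"
          unfolding \<mu>_def A_def by (rule integral_distr[OF W_measurable gm])
        finally show ?thesis .
      qed
      ultimately show ?thesis by (subst has_bochner_integral_cong[OF refl _ refl]) auto
    qed
  qed
  moreover have "v \<in> measurable S (sigma C0 {U. openin C0_topology U})"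
    by (rule measurable_into_C0) (use vC0 vm in auto)
  ultimately show ?thesis
    unfolding solves_continuity_inclusion_def using vV by blast
qed

end

context continuity_inclusion begin

theorem existence: "\<exists>\<mu>\<in>AC_curves T p. solves_continuity_inclusion T V \<mu> \<and> \<mu> 0 = \<mu>0"
proof -
  define Q where "Q r \<Omega> YY W \<longleftrightarrow> Euler_limit p T V m \<mu>0 r \<Omega> YY W"
    for r and \<Omega> :: "real measure" and YY :: "nat \<Rightarrow> real \<Rightarrow> real \<Rightarrow> 'a" and W
  have "\<exists>r \<Omega> YY W. Q r \<Omega> YY W"
    using limit_curve
  proof (elim exE conjE)
    fix r and \<Omega> :: "real measure" and YY :: "nat \<Rightarrow> real \<Rightarrow> real \<Rightarrow> 'a" and W
    assume *: "strict_mono r" "prob_space \<Omega>" "\<forall>n t. YY n t \<in> borel_measurable \<Omega>"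
      "\<forall>n. \<forall>t\<in>{0..T}. distr \<Omega> borel (YY n t) = law (r n) (cell (r n) t)"
      "(\<lambda>z. W (fst z) (snd z)) \<in> borel_measurable (S \<Otimes>\<^sub>M \<Omega>)" "\<forall>t. W t \<in> borel_measurable \<Omega>"
      "\<forall>u t. (\<forall>n. u n \<in> {0..T}) \<longrightarrow> t \<in> {0..T} \<longrightarrow> u \<longlonglongrightarrow> t \<longrightarrow>
        (AE \<omega> in \<Omega>. (\<lambda>n. YY n (u n) \<omega>) \<longlonglongrightarrow> W t \<omega>)"
      "\<forall>u t. (\<forall>n. u n \<in> {0..T}) \<longrightarrow> t \<in> {0..T} \<longrightarrow> u \<longlonglongrightarrow> t \<longrightarrow>
        (\<lambda>n. Wp p (distr \<Omega> borel (W t)) (law (r n) (cell (r n) (u n)))) \<longlonglongrightarrow> 0"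
      "\<forall>t\<in>{0..T}. distr \<Omega> borel (W t) \<in> Pp p"
      "\<forall>s\<in>{0..T}. \<forall>t\<in>{0..T}. Wp p (distr \<Omega> borel (W s)) (distr \<Omega> borel (W t)) \<le> CC * D * \<bar>Mi t - Mi s\<bar>"
      "distr \<Omega> borel (W 0) = \<mu>0"
    have "Euler_limit p T V m \<mu>0 r \<Omega> YY W"
    proof (intro Euler_limit.intro continuity_inclusion_axioms Euler_limit_axioms.intro)
      show "AE \<omega> in \<Omega>. (\<lambda>n. YY n t \<omega>) \<longlonglongrightarrow> W t \<omega>" if "t \<in> {0..T}" for t
        using *(7)[rule_format, of "\<lambda>_. t" t] that by simp
      show "(\<lambda>n. Wp p (distr \<Omega> borel (W t)) (law (r n) (cell (r n) t))) \<longlonglongrightarrow> 0" if "t \<in> {0..T}" for t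
        using *(8)[rule_format, of "\<lambda>_. t" t] that by simp
    qed (use * in blast)+
    then show ?thesis unfolding Q_def by blast
  qed
  then obtain r \<Omega> YY W where "Q r \<Omega> YY W" by blast
  then interpret L: Euler_limit p T V m \<mu>0 r \<Omega> YY W unfolding Q_def .
  show ?thesis
    by (intro bexI[of _ L.\<mu>] conjI L.curve_solves L.curve_AC) (simp add: L.\<mu>_def L.W_0)
qed

end

theorem theorem3p2:
  fixes p T :: real
    and V :: "real \<Rightarrow> (real ^ 'd) measure \<Rightarrow> (real ^ 'd \<Rightarrow> real ^ 'd) set"
  assumes "1 \<le> p" and "0 < T"
    and "Caratheodory T (Pp p) (Wp p) C0 dcc V"
    and "\<forall>t\<in>{0..T}. \<forall>\<mu>\<in>Pp p. V t \<mu> \<noteq> {} \<and> closedin C0_topology (V t \<mu>) \<and> convex_fields (V t \<mu>)"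
    and "\<exists>m. L1_nonneg T m \<and>
      (AE t in lebesgue_on {0..T}. \<forall>\<mu>\<in>Pp p. \<forall>v\<in>V t \<mu>. \<forall>x.
        norm (v x) \<le> m t * (1 + norm x + moment p \<mu>))"
    and "\<forall>\<K> K. compactin (Pp_topology p) \<K> \<and> compact K \<longrightarrow>
      (\<exists>l \<omega>. L1_nonneg T l \<and> modulus \<omega> \<and>
        (AE t in lebesgue_on {0..T}. \<forall>\<mu>\<in>\<K>. \<forall>v\<in>V t \<mu>. \<forall>x\<in>K. \<forall>y\<in>K.
          norm (v x - v y) \<le> l t * \<omega> (norm (x - y))))"
    and "\<forall>\<K>. compactin (Pp_topology p) \<K> \<longrightarrow>
      (\<exists>L \<omega>. L1_nonneg T L \<and> modulus \<omega> \<and>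
        (AE t in lebesgue_on {0..T}. \<forall>\<mu>\<in>\<K>. \<forall>\<nu>\<in>\<K>. \<forall>v\<in>V t \<mu>. \<exists>w\<in>V t \<nu>.
          dcc v w \<le> L t * \<omega> (Wp p \<mu> \<nu>)))"
  shows "\<forall>\<mu>0\<in>Pp p. \<exists>\<mu>\<in>AC_curves T p. solves_continuity_inclusion T V \<mu> \<and> \<mu> 0 = \<mu>0"
proof
  fix \<mu>0 :: "(real ^ 'd) measure" assume \<mu>0: "\<mu>0 \<in> Pp p"
  obtain m where m: "L1_nonneg T m"
    "AE t in lebesgue_on {0..T}. \<forall>\<mu>\<in>Pp p. \<forall>v\<in>V t \<mu>. \<forall>x. norm (v x) \<le> m t * (1 + norm x + moment p \<mu>)"
    using assms(5) by blast
  have "continuity_inclusion p T V m \<mu>0"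
  proof
    show "mf_measurable T C0 dcc (\<lambda>t. V t \<mu>)" if "\<mu> \<in> Pp p" for \<mu>
      using assms(3) that by (simp add: Caratheodory_def)
    show "AE t in lebesgue_on {0..T}. \<forall>\<mu>\<in>Pp p. mf_continuous_at (Pp p) (Wp p) dcc (V t) \<mu>"
      using assms(3) by (simp add: Caratheodory_def)
    show "\<exists>l \<omega>. L1_nonneg T l \<and> modulus \<omega> \<and>
        (AE t in lebesgue_on {0..T}. \<forall>\<mu>\<in>\<K>. \<forall>v\<in>V t \<mu>. \<forall>x\<in>K. \<forall>y\<in>K.
          norm (v x - v y) \<le> l t * \<omega> (norm (x - y)))"
      if "compactin (Pp_topology p) \<K>" "compact K" for \<K> K
      using assms(6) that by simp
  qed (use assms(1,2,4) m \<mu>0 in auto)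
  then interpret continuity_inclusion p T V m \<mu>0 .
  show "\<exists>\<mu>\<in>AC_curves T p. solves_continuity_inclusion T V \<mu> \<and> \<mu> 0 = \<mu>0" by (rule existence)
qed

end
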